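(* Let $k\ge1$ be an integer, $E\ge0$, $\theta\in[0,2\pi)$, and let $\hat\rho\in\mathcal S^E$ be a (target) state whose quadrature distribution $p_{\hat\rho,\theta}$ has $k$ distinct real zeros $x_1,\dots,x_k$. For $\eta>0$ let $\hat W_\eta$ be the spectral projector of $\hat q_\theta$ onto the union of windows $\bigcup_{i=1}^k[x_i-\frac\eta2,x_i+\frac\eta2]$, and let $$w_\eta:=\inf_{\hat\sigma\in\mathcal S_{k-1}^E}\operatorname{Tr}(\hat\sigma\hat W_\eta).$$ Then there exists $\eta>0$ such that $w_\eta>0$ (soundness) and $\operatorname{Tr}(\hat\rho\hat W_\eta)<w_\eta$ (completeness). Moreover, the violation of the threshold by a measured state $\hat\tau\in\mathcal S_k^E$ lower bounds its trace distance to all states in $\mathcal S_{k-1}^E$: $$w_\eta-\operatorname{Tr}(\hat\tau\hat W_\eta)\le\inf_{\hat\sigma\in\mathcal S_{k-1}^E}D(\hat\tau,\hat\sigma),$$ where $D$ denotes the trace distance.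
   Context: Setting: $\mathcal H=L^2(\mathbb R)$ (one bosonic mode), with position and momentum operators $\hat x,\hat p$ satisfying $[\hat x,\hat p]=i$, annihilation operator $\hat a=(\hat x+i\hat p)/\sqrt2$, number operator $\hat n=\hat a^\dagger\hat a$, and Fock basis $\{|n\rangle\}_{n\ge0}$ of eigenvectors of $\hat n$. States are density operators on $\mathcal H$; a pure state is identified with its rank-one projector $|\psi\rangle\langle\psi|$. For $\theta\in[0,2\pi)$ the quadrature operator is $\hat q_\theta=e^{-i\theta\hat n}\hat x e^{i\theta\hat n}=\hat x\cos\theta+\hat p\sin\theta$. For a state $\hat\rho$, $p_{\hat\rho,\theta}$ is the probability density of the outcome of measuring $\hat q_\theta$ on $\hat\rho$; for the energy-bounded states considered here, it denotes the continuous representative of this density. Trace distance: $D(\hat\rho,\hat\sigma)=\frac12\|\hat\rho-\hat\sigma\|_1$. Stellar rank: for a pure state $|\psi\rangle=\sum_n\psi_n|n\rangle$, $r^\star(\psi)\in\mathbb N_0\cup\{\infty\}$ is the number of zeros in $\mathbb C$, counted with multiplicity, of the entire function $F^\star_\psi(\alpha)=\sum_n\psi_n\alpha^n/\sqrt{n!}$. For a mixed state $\hat\rho$, $r^\star(\hat\rho)=\inf\sup_i r^\star(\psi_i)$, where the infimum is over all decompositions $\hat\rho=\sum_i p_i|\psi_i\rangle\langle\psi_i|$ of $\hat\rho$ as a statistical mixture of pure states (no energy constraint is placed on the $\psi_i$ here). Energy-bounded sets: for a set $S$ of states, $\mathrm{cch}(S)$ is its closed convex hull in trace norm. For $E\ge0$,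 $\mathcal S^E=\mathrm{cch}\{|\psi\rangle\langle\psi| : \|\psi\|=1,\ \langle\psi|\hat n|\psi\rangle\le E\}$. For $r\in\mathbb N_0=\{0,1,2,\dots\}$, $\mathcal S_r^E=\{\hat\rho\in\mathcal S^E : r^\star(\hat\rho)\le r\}$, i.e. the intersection of $\mathcal S^E$ with the set of states of stellar rank at most $r$. *)

theory Defs
  imports "HOL-Complex_Analysis.Complex_Analysis" "HOL-Probability.Probability"
begin

section \<open>The Hilbert space of square-integrable functions on the real line\<close>

definition sq_integrable :: "(real \<Rightarrow> complex) \<Rightarrow> bool" where
  "sq_integrable f \<longleftrightarrow>
     f \<in> borel_measurable lborel \<and> integrable lborel (\<lambda>x. (cmod (f x))\<^sup>2)"

definition ae_equal :: "(real \<Rightarrow> complex) \<Rightarrow> (real \<Rightarrow> complex) \<Rightarrow> bool" where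
  "ae_equal f g \<longleftrightarrow> sq_integrable f \<and> sq_integrable g \<and> (AE x in lborel. f x = g x)"

lemma sq_integrable_zero: "sq_integrable (\<lambda>x. 0)"
  by (simp add: sq_integrable_def)

lemma sq_integrable_scale:
  assumes "sq_integrable f"
  shows "sq_integrable (\<lambda>x. c * f x)"
  using assms by (auto simp: sq_integrable_def norm_mult power_mult_distrib)

lemma sq_integrable_add:
  assumes "sq_integrable f" "sq_integrable g"
  shows "sq_integrable (\<lambda>x. f x + g x)"
proof -
  have m [measurable]: "f \<in> borel_measurable borel" "g \<in> borel_measurable borel"
    using assms by (auto simp: sq_integrable_def)
  have "integrable lborel (\<lambda>x. (cmod (f x + g x))\<^sup>2)"
  proof (rule Bochner_Integration.integrable_bound)
    show "integrable lborel (\<lambda>x. 2 * (cmod (f x))\<^sup>2 + 2 * (cmod (g x))\<^sup>2)"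
      using assms by (auto simp: sq_integrable_def)
    have "(cmod (a + b))\<^sup>2 \<le> 2 * (cmod a)\<^sup>2 + 2 * (cmod b)\<^sup>2" for a b
    proof -
      have "(cmod (a + b))\<^sup>2 \<le> (cmod a + cmod b)\<^sup>2"
        by (simp add: norm_triangle_ineq power_mono)
      also have "\<dots> \<le> 2 * (cmod a)\<^sup>2 + 2 * (cmod b)\<^sup>2"
        using sum_squares_bound[of "cmod a" "cmod b"] by (simp add: power2_sum)
      finally show ?thesis .
    qed
    then show "AE x in lborel. norm ((cmod (f x + g x))\<^sup>2)
        \<le> norm (2 * (cmod (f x))\<^sup>2 + 2 * (cmod (g x))\<^sup>2)"
      by auto
  qed measurable
  then show ?thesis by (simp add: sq_integrable_def)
qed

lemma measurable_cnj [measurable]: "cnj \<in> borel_measurable borel"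
  by (intro borel_measurable_continuous_onI continuous_intros)

lemma sq_integrable_cinner:
  assumes "sq_integrable f" "sq_integrable g"
  shows "integrable lborel (\<lambda>x. cnj (f x) * g x)"
proof (rule Bochner_Integration.integrable_bound)
  have m [measurable]: "f \<in> borel_measurable borel" "g \<in> borel_measurable borel"
    using assms by (auto simp: sq_integrable_def)
  show "integrable lborel (\<lambda>x. (cmod (f x))\<^sup>2 + (cmod (g x))\<^sup>2)"
    using assms by (auto simp: sq_integrable_def)
  show "(\<lambda>x. cnj (f x) * g x) \<in> borel_measurable lborel"
    by measurable
  have "cmod a * cmod b \<le> (cmod a)\<^sup>2 + (cmod b)\<^sup>2" for a b
    using sum_squares_bound[of "cmod a" "cmod b"]
      mult_nonneg_nonneg[OF norm_ge_zero[of a] norm_ge_zero[of b]] by linarith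
  then show "AE x in lborel. norm (cnj (f x) * g x) \<le> norm ((cmod (f x))\<^sup>2 + (cmod (g x))\<^sup>2)"
    by (auto simp: norm_mult)
qed

quotient_type l2r = "real \<Rightarrow> complex" / partial: ae_equal
  morphisms rep_l2r to_l2r
proof (rule part_equivpI)
  show "\<exists>f. ae_equal f f"
    using sq_integrable_zero by (auto simp: ae_equal_def)
  show "symp ae_equal"
    by (rule sympI) (auto simp: ae_equal_def elim: AE_mp)
  show "transp ae_equal"
  proof (rule transpI)
    fix f g h assume a: "ae_equal f g" "ae_equal g h"
    then have "AE x in lborel. f x = g x" "AE x in lborel. g x = h x"
      by (auto simp: ae_equal_def)
    then have "AE x in lborel. f x = h x" by eventually_elim simp
    with a show "ae_equal f h" by (simp add: ae_equal_def)
  qed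
qed

instantiation l2r :: ab_group_add
begin

lift_definition zero_l2r :: l2r is "\<lambda>x. 0"
  by (simp add: ae_equal_def sq_integrable_zero)

lift_definition plus_l2r :: "l2r \<Rightarrow> l2r \<Rightarrow> l2r" is "\<lambda>f g x. f x + g x"
  unfolding ae_equal_def by (auto intro: sq_integrable_add)

lift_definition uminus_l2r :: "l2r \<Rightarrow> l2r" is "\<lambda>f x. - f x"
  unfolding ae_equal_def using sq_integrable_scale[where c = "-1"] by auto

definition minus_l2r :: "l2r \<Rightarrow> l2r \<Rightarrow> l2r" where
  "minus_l2r f g = f + - g"

instance
proof
  fix a b c :: l2r
  show "a + b + c = a + (b + c)"
    by transfer (auto simp: ae_equal_def add.assoc intro!: sq_integrable_add)
  show "a + b = b + a"
    by transfer (auto simp: ae_equal_def add.commute intro!: sq_integrable_add)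
  show "0 + a = a"
    by transfer (auto simp: ae_equal_def)
  show "- a + a = 0"
    by transfer (auto simp: ae_equal_def sq_integrable_zero)
  show "a - b = a + - b"
    by (simp add: minus_l2r_def)
qed

end

lift_definition scaleC :: "complex \<Rightarrow> l2r \<Rightarrow> l2r" is "\<lambda>c f x. c * f x"
  unfolding ae_equal_def by (auto intro: sq_integrable_scale)

text \<open>The inner product is conjugate-linear in its first argument.\<close>

lift_definition cinner :: "l2r \<Rightarrow> l2r \<Rightarrow> complex" is
  "\<lambda>f g. LINT x|lborel. cnj (f x) * g x"
proof -
  fix f f' g g' assume a: "ae_equal f f'" "ae_equal g g'"
  then have [measurable]: "f \<in> borel_measurable borel" "g \<in> borel_measurable borel"
      "f' \<in> borel_measurable borel" "g' \<in> borel_measurable borel"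
    by (auto simp: ae_equal_def sq_integrable_def)
  have "AE x in lborel. f x = f' x" "AE x in lborel. g x = g' x"
    using a by (auto simp: ae_equal_def)
  then have "AE x in lborel. cnj (f x) * g x = cnj (f' x) * g' x"
    by eventually_elim simp
  then show "(LINT x|lborel. cnj (f x) * g x) = (LINT x|lborel. cnj (f' x) * g' x)"
    by (intro integral_cong_AE) measurable
qed

instantiation l2r :: real_vector
begin

definition scaleR_l2r :: "real \<Rightarrow> l2r \<Rightarrow> l2r" where
  "scaleR_l2r r = scaleC (complex_of_real r)"

instance
proof
  fix a b :: real and x y :: l2r
  show "a *\<^sub>R (x + y) = a *\<^sub>R x + a *\<^sub>R y"
    unfolding scaleR_l2r_def
    by transfer (simp add: ae_equal_def distrib_left sq_integrable_add sq_integrable_scale)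
  show "(a + b) *\<^sub>R x = a *\<^sub>R x + b *\<^sub>R x"
    unfolding scaleR_l2r_def
    by transfer (simp add: ae_equal_def distrib_right sq_integrable_add sq_integrable_scale)
  show "a *\<^sub>R b *\<^sub>R x = (a * b) *\<^sub>R x"
    unfolding scaleR_l2r_def
    by transfer (simp add: ae_equal_def mult.assoc sq_integrable_scale)
  show "1 *\<^sub>R x = x"
    unfolding scaleR_l2r_def by transfer (auto simp: ae_equal_def)
qed

end

lemma cinner_commute: "cinner x y = cnj (cinner y x)"
proof transfer
  fix f g :: "real \<Rightarrow> complex"
  have "(LINT x|lborel. cnj (f x) * g x) = (LINT x|lborel. cnj (cnj (g x) * f x))"
    by (simp only: complex_cnj_mult complex_cnj_cnj mult.commute)
  then show "(LINT x|lborel. cnj (f x) * g x) = cnj (LINT x|lborel. cnj (g x) * f x)"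
    by (simp only: Bochner_Integration.integral_cnj)
qed

lemma cinner_add_right: "cinner x (y + z) = cinner x y + cinner x z"
  by transfer (auto simp: ae_equal_def distrib_left sq_integrable_cinner)

lemma cinner_add_left: "cinner (x + y) z = cinner x z + cinner y z"
  by (metis cinner_commute cinner_add_right complex_cnj_add)

lemma cinner_scaleC_right: "cinner x (scaleC c y) = c * cinner x y"
  by transfer (simp add: mult.left_commute)

lemma cinner_scaleC_left: "cinner (scaleC c x) y = cnj c * cinner x y"
  by (metis cinner_commute cinner_scaleC_right complex_cnj_mult)

lemma cinner_self: "cinner x x = complex_of_real (Re (cinner x x))" "0 \<le> Re (cinner x x)"
proof -
  have "cinner x x \<in> \<real> \<and> 0 \<le> Re (cinner x x)"
  proof (transfer)
    fix f assume "ae_equal f f"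
    have "(LINT x|lborel. cnj (f x) * f x)
        = complex_of_real (LINT x|lborel. (cmod (f x))\<^sup>2)"
      by (simp only: mult.commute[of "cnj _"] integral_complex_of_real flip: complex_norm_square)
    then show "(LINT x|lborel. cnj (f x) * f x) \<in> \<real>
        \<and> 0 \<le> Re (LINT x|lborel. cnj (f x) * f x)"
      by simp
  qed
  then show "cinner x x = complex_of_real (Re (cinner x x))" "0 \<le> Re (cinner x x)"
    by (auto simp: of_real_Re)
qed

lemma cinner_self_eq_0: "Re (cinner x x) = 0 \<longleftrightarrow> x = 0"
proof transfer
  fix f assume "ae_equal f f"
  then have f: "sq_integrable f" and
      i: "integrable lborel (\<lambda>x. (cmod (f x))\<^sup>2)"
    by (auto simp: ae_equal_def sq_integrable_def)
  have "(LINT x|lborel. cnj (f x) * f x)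
      = complex_of_real (LINT x|lborel. (cmod (f x))\<^sup>2)"
    by (simp only: mult.commute[of "cnj _"] integral_complex_of_real flip: complex_norm_square)
  moreover have "(LINT x|lborel. (cmod (f x))\<^sup>2) = 0 \<longleftrightarrow> (AE x in lborel. f x = 0)"
    using integral_nonneg_eq_0_iff_AE[OF i] by simp
  ultimately show "Re (LINT x|lborel. cnj (f x) * f x) = 0 \<longleftrightarrow> ae_equal f (\<lambda>x. 0)"
    using f by (simp add: ae_equal_def sq_integrable_zero)
qed

instantiation l2r :: real_inner
begin

definition inner_l2r :: "l2r \<Rightarrow> l2r \<Rightarrow> real" where
  "inner_l2r x y = Re (cinner x y)"

definition norm_l2r :: "l2r \<Rightarrow> real" where
  "norm_l2r x = sqrt (inner x x)"

definition sgn_l2r :: "l2r \<Rightarrow> l2r" where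
  "sgn_l2r x = x /\<^sub>R norm x"

definition dist_l2r :: "l2r \<Rightarrow> l2r \<Rightarrow> real" where
  "dist_l2r x y = norm (x - y)"

definition uniformity_l2r :: "(l2r \<times> l2r) filter" where
  "uniformity_l2r = (INF e\<in>{0<..}. principal {(x, y). dist x y < e})"

definition open_l2r :: "l2r set \<Rightarrow> bool" where
  "open_l2r U \<longleftrightarrow> (\<forall>x\<in>U. eventually (\<lambda>(x', y). x' = x \<longrightarrow> y \<in> U) uniformity)"

instance
proof
  fix x y z :: l2r and r :: real and U :: "l2r set"
  show "dist x y = norm (x - y)" by (simp add: dist_l2r_def)
  show "sgn x = x /\<^sub>R norm x" by (simp add: sgn_l2r_def)
  show "uniformity = (INF e\<in>{0<..}. principal {(x :: l2r, y). dist x y < e})"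
    by (simp add: uniformity_l2r_def)
  show "open U \<longleftrightarrow> (\<forall>x\<in>U. eventually (\<lambda>(x', y). x' = x \<longrightarrow> y \<in> U) uniformity)"
    by (simp add: open_l2r_def)
  show "inner x y = inner y x"
    unfolding inner_l2r_def by (subst cinner_commute) simp
  show "inner (x + y) z = inner x z + inner y z"
    by (simp add: inner_l2r_def cinner_add_left)
  show "inner (r *\<^sub>R x) y = r * inner x y"
    by (simp add: inner_l2r_def scaleR_l2r_def cinner_scaleC_left)
  show "0 \<le> inner x x" by (simp add: inner_l2r_def cinner_self(2))
  show "inner x x = 0 \<longleftrightarrow> x = 0" by (simp add: inner_l2r_def cinner_self_eq_0)
  show "norm x = sqrt (inner x x)" by (simp add: norm_l2r_def)
qed

end

section \<open>Operators, trace and trace norm\<close>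

lemma scaleC_add_left: "scaleC (a + b) x = scaleC a x + scaleC b x"
  by transfer
    (simp add: ae_equal_def distrib_right sq_integrable_add sq_integrable_scale)

lemma scaleC_scaleC: "scaleC a (scaleC b x) = scaleC (a * b) x"
  by transfer (simp add: ae_equal_def mult.assoc sq_integrable_scale)

lemma norm_scaleC: "norm (scaleC c x) = cmod c * norm x"
proof -
  have "cinner (scaleC c x) (scaleC c x) = complex_of_real ((cmod c)\<^sup>2) * cinner x x"
    by (simp only: cinner_scaleC_left cinner_scaleC_right complex_norm_square mult.assoc
        mult.left_commute)
  then show ?thesis
    by (simp add: norm_l2r_def inner_l2r_def real_sqrt_mult)
qed

lemma cmod_cinner_le: "cmod (cinner x y) \<le> norm x * norm y"
proof -
  obtain u where u: "cmod u = 1" "u * cinner x y = complex_of_real (cmod (cinner x y))"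
  proof (cases "cinner x y = 0")
    case True
    then show ?thesis using that[of 1] by simp
  next
    case False
    have "cnj (sgn (cinner x y)) * cinner x y = complex_of_real (cmod (cinner x y))"
      using False complex_norm_square[of "cinner x y"]
      by (simp add: sgn_eq field_simps power2_eq_square)
    then show ?thesis using that[of "cnj (sgn (cinner x y))"] False by (simp add: norm_sgn)
  qed
  have "cmod (cinner x y) = inner x (scaleC u y)"
    by (simp add: inner_l2r_def cinner_scaleC_right u(2))
  also have "\<dots> \<le> norm x * norm (scaleC u y)"
    by (rule norm_cauchy_schwarz)
  finally show ?thesis by (simp add: norm_scaleC u(1))
qed

text \<open>
  Elements of this type are bounded but only real-linear; complex linearity is the predicate
  \<open>complex_linear\<close> below.
\<close>

type_synonym l2op = "l2r \<Rightarrow>\<^sub>L l2r"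

definition complex_linear :: "l2op \<Rightarrow> bool" where
  "complex_linear A \<longleftrightarrow> (\<forall>c \<psi>. A (scaleC c \<psi>) = scaleC c (A \<psi>))"

definition positive_op :: "l2op \<Rightarrow> bool" where
  "positive_op A \<longleftrightarrow>
     complex_linear A \<and> (\<forall>\<psi>. cinner \<psi> (A \<psi>) \<in> \<real> \<and> 0 \<le> Re (cinner \<psi> (A \<psi>)))"

text \<open>
  \<open>|A|\<close> is the positive square root of \<open>A\<^sup>\<dagger>A\<close>: since \<open>P\<close> is self-adjoint, the condition below
  is \<open>P\<^sup>2 = A\<^sup>\<dagger>A\<close> tested on vectors.
\<close>

definition abs_op :: "l2op \<Rightarrow> l2op" where
  "abs_op A = (THE P. positive_op P \<and>
     (\<forall>\<phi> \<psi>. cinner (P \<phi>) (P \<psi>) = cinner (A \<phi>) (A \<psi>)))"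

lift_definition rank_one_proj :: "l2r \<Rightarrow> l2op" is "\<lambda>\<psi> \<phi>. scaleC (cinner \<psi> \<phi>) \<psi>"
proof (rule bounded_linear_intro)
  fix \<psi> \<phi> \<xi> :: l2r and r :: real
  show "scaleC (cinner \<psi> (\<phi> + \<xi>)) \<psi> = scaleC (cinner \<psi> \<phi>) \<psi> + scaleC (cinner \<psi> \<xi>) \<psi>"
    by (simp add: cinner_add_right scaleC_add_left)
  show "scaleC (cinner \<psi> (r *\<^sub>R \<phi>)) \<psi> = r *\<^sub>R scaleC (cinner \<psi> \<phi>) \<psi>"
    by (simp add: scaleR_l2r_def cinner_scaleC_right scaleC_scaleC)
  show "norm (scaleC (cinner \<psi> \<phi>) \<psi>) \<le> norm \<phi> * (norm \<psi> * norm \<psi>)"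
    using mult_right_mono[OF cmod_cinner_le[of \<psi> \<phi>], of "norm \<psi>"]
    by (simp add: norm_scaleC mult_ac)
qed

section \<open>Position, momentum and the Fock basis\<close>

definition position_op :: "(real \<Rightarrow> complex) \<Rightarrow> real \<Rightarrow> complex" where
  "position_op f = (\<lambda>x. complex_of_real x * f x)"

definition momentum_op :: "(real \<Rightarrow> complex) \<Rightarrow> real \<Rightarrow> complex" where
  "momentum_op f = (\<lambda>x. - \<i> * vector_derivative f (at x))"

definition annihilation_op :: "(real \<Rightarrow> complex) \<Rightarrow> real \<Rightarrow> complex" where
  "annihilation_op f = (\<lambda>x. (position_op f x + \<i> * momentum_op f x) / complex_of_real (sqrt 2))"

definition creation_op :: "(real \<Rightarrow> complex) \<Rightarrow> real \<Rightarrow> complex" where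
  "creation_op f = (\<lambda>x. (position_op f x - \<i> * momentum_op f x) / complex_of_real (sqrt 2))"

definition number_op :: "(real \<Rightarrow> complex) \<Rightarrow> real \<Rightarrow> complex" where
  "number_op f = creation_op (annihilation_op f)"

primrec fock_fun :: "nat \<Rightarrow> real \<Rightarrow> complex" where
  "fock_fun 0 = (\<lambda>x. complex_of_real (pi powr (- 1 / 4) * exp (- x\<^sup>2 / 2)))"
| "fock_fun (Suc n) = (\<lambda>x. creation_op (fock_fun n) x / complex_of_real (sqrt (real (Suc n))))"

definition gauss_poly :: "complex poly \<Rightarrow> real \<Rightarrow> complex" where
  "gauss_poly p = (\<lambda>x. poly p (complex_of_real x) * complex_of_real (exp (- x\<^sup>2 / 2)))"

lemma vector_derivative_gauss_poly:
  "vector_derivative (gauss_poly p) (at x) = gauss_poly (pderiv p - [:0, 1:] * p) x"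
proof (rule vector_derivative_at)
  have g: "complex_of_real (exp (- x\<^sup>2 / 2)) = exp (- (complex_of_real x)\<^sup>2 / 2)" for x
    using exp_of_real[of "- x\<^sup>2 / 2", where ?'a = complex] by simp
  have e: "gauss_poly p = (\<lambda>x. (\<lambda>z. poly p z * exp (- z\<^sup>2 / 2)) (complex_of_real x))" for p
    by (simp only: gauss_poly_def g)
  have "((\<lambda>z. poly p z * exp (- z\<^sup>2 / 2)) has_field_derivative
      poly (pderiv p - [:0, 1:] * p) z * exp (- z\<^sup>2 / 2)) (at z)" for z :: complex
    by (auto intro!: derivative_eq_intros poly_DERIV simp: algebra_simps)
  from has_vector_derivative_real_field[OF this, of x]
  show "(gauss_poly p has_vector_derivative gauss_poly (pderiv p - [:0, 1:] * p) x) (at x)"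
    by (simp only: e)
qed

lemma gauss_poly_simps:
  "gauss_poly (smult c p) x = c * gauss_poly p x"
  "gauss_poly (p + q) x = gauss_poly p x + gauss_poly q x"
  "gauss_poly (p - q) x = gauss_poly p x - gauss_poly q x"
  "gauss_poly ([:0, c:] * p) x = c * complex_of_real x * gauss_poly p x"
  by (simp_all add: gauss_poly_def algebra_simps)

lemma annihilation_gauss_poly:
  "annihilation_op (gauss_poly p) = gauss_poly (smult (1 / complex_of_real (sqrt 2)) (pderiv p))"
  by (rule ext)
    (simp only: annihilation_op_def position_op_def momentum_op_def vector_derivative_gauss_poly
      gauss_poly_simps, simp add: algebra_simps)

lemma creation_gauss_poly:
  "creation_op (gauss_poly p)
    = gauss_poly (smult (1 / complex_of_real (sqrt 2)) ([:0, 2:] * p - pderiv p))"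
  by (rule ext)
    (simp only: creation_op_def position_op_def momentum_op_def vector_derivative_gauss_poly
      gauss_poly_simps, simp add: algebra_simps diff_divide_distrib)

lemma ex_fock_fun_gauss_poly: "\<exists>p. fock_fun n = gauss_poly p"
proof (induction n)
  case 0
  have "fock_fun 0 = gauss_poly [:complex_of_real (pi powr (- 1 / 4)):]"
    by (auto simp: gauss_poly_def)
  then show ?case by blast
next
  case (Suc n)
  then obtain p where p: "fock_fun n = gauss_poly p" by blast
  have "fock_fun (Suc n) = gauss_poly (smult (1 / complex_of_real (sqrt (real (Suc n))))
      (smult (1 / complex_of_real (sqrt 2)) ([:0, 2:] * p - pderiv p)))"
    by (rule ext, simp only: fock_fun.simps p creation_gauss_poly gauss_poly_simps) simp
  then show ?case by blast
qed

lemma sq_integrable_monomial_gauss: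
  "sq_integrable (\<lambda>x. complex_of_real (x ^ k * exp (- x\<^sup>2 / 2)))"
proof -
  have "integrable lborel (\<lambda>x :: real. sqrt pi * (normal_density 0 (1 / sqrt 2) x * (x - 0) ^ (2 * k)))"
    by (intro integrable_mult_right integrable_normal_moment) auto
  also have "(\<lambda>x :: real. sqrt pi * (normal_density 0 (1 / sqrt 2) x * (x - 0) ^ (2 * k)))
      = (\<lambda>x. (cmod (complex_of_real (x ^ k * exp (- x\<^sup>2 / 2))))\<^sup>2)"
  proof (rule ext)
    fix x :: real
    have n: "normal_density 0 (1 / sqrt 2) x = exp (- x\<^sup>2) / sqrt pi"
      by (simp add: normal_density_def power_divide)
    have e: "(exp (- x\<^sup>2 / 2))\<^sup>2 = exp (- x\<^sup>2)"
      using exp_double[of "- x\<^sup>2 / 2"] by simp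
    have "(cmod (complex_of_real (x ^ k * exp (- x\<^sup>2 / 2))))\<^sup>2 = (x ^ k)\<^sup>2 * (exp (- x\<^sup>2 / 2))\<^sup>2"
      by (simp only: norm_of_real power2_abs power_mult_distrib)
    also have "\<dots> = x ^ (2 * k) * exp (- x\<^sup>2)"
      by (simp only: e power_mult[symmetric] mult.commute[of k 2])
    finally show "sqrt pi * (normal_density 0 (1 / sqrt 2) x * (x - 0) ^ (2 * k))
        = (cmod (complex_of_real (x ^ k * exp (- x\<^sup>2 / 2))))\<^sup>2"
      by (simp add: n)
  qed
  finally show ?thesis by (simp add: sq_integrable_def)
qed

lemma sq_integrable_gauss_poly: "sq_integrable (gauss_poly p)"
proof -
  have "sq_integrable (\<lambda>x. complex_of_real (x ^ k) * gauss_poly p x)" for k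
  proof (induction p arbitrary: k)
    case 0
    then show ?case by (simp add: gauss_poly_def sq_integrable_zero)
  next
    case (pCons c p)
    have "(\<lambda>x. complex_of_real (x ^ k) * gauss_poly (pCons c p) x)
        = (\<lambda>x. c * complex_of_real (x ^ k * exp (- x\<^sup>2 / 2))
            + complex_of_real (x ^ Suc k) * gauss_poly p x)"
      by (auto simp: gauss_poly_def algebra_simps)
    moreover have "sq_integrable \<dots>"
      by (intro sq_integrable_add sq_integrable_scale sq_integrable_monomial_gauss pCons.IH)
    ultimately show ?case by (simp only:)
  qed
  from this[of 0] show ?thesis by simp
qed

lemma annihilation_creation_gauss_poly:
  "annihilation_op (creation_op (gauss_poly p)) x
    = creation_op (annihilation_op (gauss_poly p)) x + gauss_poly p x"
proof -
  define c where "c = 1 / complex_of_real (sqrt 2)"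
  have c: "c * c = 1 / 2"
    by (simp add: c_def flip: of_real_mult)
  have d: "pderiv ([:0, 2:] * p - pderiv p) = [:0, 2:] * pderiv p - pderiv (pderiv p) + smult 2 p"
    by (simp add: pderiv_diff pderiv_mult pderiv_pCons pderiv_smult algebra_simps)
  have "annihilation_op (creation_op (gauss_poly p)) x
      = c * c * gauss_poly (pderiv ([:0, 2:] * p - pderiv p)) x"
    by (simp only: annihilation_gauss_poly creation_gauss_poly gauss_poly_simps pderiv_smult
        mult.assoc flip: c_def)
  moreover have "creation_op (annihilation_op (gauss_poly p)) x
      = c * c * gauss_poly ([:0, 2:] * pderiv p - pderiv (pderiv p)) x"
    by (simp only: annihilation_gauss_poly creation_gauss_poly gauss_poly_simps pderiv_smult
        flip: c_def) (simp add: algebra_simps)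
  ultimately show ?thesis
    unfolding d c gauss_poly_simps by (simp add: ring_distribs)
qed

lemma annihilation_op_scale:
  "annihilation_op (\<lambda>x. gauss_poly p x / c) = (\<lambda>x. annihilation_op (gauss_poly p) x / c)"
proof -
  have e: "(\<lambda>x. gauss_poly p x / c) = gauss_poly (smult (1 / c) p)"
    by (simp add: gauss_poly_simps fun_eq_iff)
  show ?thesis
    unfolding e annihilation_gauss_poly
    by (rule ext) (simp add: gauss_poly_simps pderiv_smult)
qed

lemma creation_op_scale:
  "creation_op (\<lambda>x. c * gauss_poly p x) = (\<lambda>x. c * creation_op (gauss_poly p) x)"
proof -
  have e: "(\<lambda>x. c * gauss_poly p x) = gauss_poly (smult c p)"
    by (simp add: gauss_poly_simps fun_eq_iff)
  show ?thesis
    unfolding e creation_gauss_poly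
    by (rule ext, simp only: gauss_poly_simps pderiv_smult) (simp add: algebra_simps)
qed

lemma annihilation_fock_fun_0: "annihilation_op (fock_fun 0) = (\<lambda>x. 0)"
proof -
  have "fock_fun 0 = gauss_poly [:complex_of_real (pi powr (- 1 / 4)):]"
    by (auto simp: gauss_poly_def)
  then show ?thesis by (simp add: annihilation_gauss_poly pderiv_pCons) (simp add: gauss_poly_def)
qed

lemma number_op_fock_fun: "number_op (fock_fun n) = (\<lambda>x. of_nat n * fock_fun n x)"
proof (induction n)
  case 0
  have "creation_op (gauss_poly 0) = (\<lambda>x. 0)"
    by (simp add: creation_gauss_poly) (simp add: gauss_poly_def)
  moreover have "gauss_poly 0 = (\<lambda>x. 0)" by (simp add: gauss_poly_def)
  ultimately show ?case
    by (simp only: number_op_def annihilation_fock_fun_0) simp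
next
  case (Suc n)
  define s where "s = complex_of_real (sqrt (real (Suc n)))"
  have s: "s \<noteq> 0" "s * s = of_nat (Suc n)"
    by (simp_all add: s_def del: of_nat_Suc flip: of_real_mult)
  obtain p where p: "fock_fun n = gauss_poly p" using ex_fock_fun_gauss_poly by blast
  obtain q where q: "creation_op (gauss_poly p) = gauss_poly q"
    using creation_gauss_poly by blast
  have f: "fock_fun (Suc n) = (\<lambda>x. gauss_poly q x / s)"
    by (simp only: fock_fun.simps p q s_def)
  have "annihilation_op (gauss_poly q) x = s * s * gauss_poly p x" for x
    using annihilation_creation_gauss_poly[of p x] fun_cong[OF Suc.IH, of x]
    by (simp add: p q number_op_def s algebra_simps)
  then have "annihilation_op (fock_fun (Suc n)) = (\<lambda>x. s * gauss_poly p x)"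
    using s(1) by (simp add: f annihilation_op_scale del: fock_fun.simps)
  then have "number_op (fock_fun (Suc n)) = (\<lambda>x. s * gauss_poly q x)"
    by (simp add: number_op_def creation_op_scale q del: fock_fun.simps)
  then show ?case
    using s(1) by (simp add: f fun_eq_iff del: fock_fun.simps of_nat_Suc flip: s(2))
qed

lift_definition fock :: "nat \<Rightarrow> l2r" is fock_fun
proof -
  fix n
  obtain p where "fock_fun n = gauss_poly p" using ex_fock_fun_gauss_poly by blast
  then show "ae_equal (fock_fun n) (fock_fun n)"
    using sq_integrable_gauss_poly[of p] by (simp add: ae_equal_def)
qed

section \<open>Energy-bounded states\<close>

text \<open>
  The expectation of the number operator, through its eigenbasis (lemma \<open>number_op_fock_fun\<close>); it is
  \<open>\<infinity>\<close> outside the form domain.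
\<close>

definition mean_photon_number :: "l2r \<Rightarrow> ennreal" where
  "mean_photon_number \<psi> = (\<Sum>n. ennreal (real n * (cmod (cinner (fock n) \<psi>))\<^sup>2))"

definition op_trace :: "(l2r \<Rightarrow> l2r) \<Rightarrow> complex" where
  "op_trace A = (\<Sum>n. cinner (fock n) (A (fock n)))"

definition trace_class :: "l2op \<Rightarrow> bool" where
  "trace_class A \<longleftrightarrow>
     complex_linear A \<and> summable (\<lambda>n. cinner (fock n) (abs_op A (fock n)))"

definition trace_norm :: "l2op \<Rightarrow> real" where
  "trace_norm A = Re (op_trace (abs_op A))"

definition trace_distance :: "l2op \<Rightarrow> l2op \<Rightarrow> real" where
  "trace_distance \<rho> \<sigma> = trace_norm (\<rho> - \<sigma>) / 2"

definition closed_convex_hull :: "l2op set \<Rightarrow> l2op set" where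
  "closed_convex_hull S =
     {\<rho>. trace_class \<rho> \<and> (\<forall>\<epsilon>>0. \<exists>\<sigma>\<in>convex hull S. trace_norm (\<rho> - \<sigma>) < \<epsilon>)}"

definition energy_states :: "real \<Rightarrow> l2op set" where
  "energy_states E = closed_convex_hull
     {rank_one_proj \<psi> | \<psi>. norm \<psi> = 1 \<and> mean_photon_number \<psi> \<le> ennreal E}"

section \<open>Stellar rank\<close>

definition stellar_fun :: "l2r \<Rightarrow> complex \<Rightarrow> complex" where
  "stellar_fun \<psi> \<alpha> =
     (\<Sum>n. cinner (fock n) \<psi> * \<alpha> ^ n / complex_of_real (sqrt (fact n)))"

definition pure_stellar_rank :: "l2r \<Rightarrow> enat" where
  "pure_stellar_rank \<psi> =
     (let Z = {\<alpha>. stellar_fun \<psi> \<alpha> = 0}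
      in if finite Z then enat (\<Sum>\<alpha>\<in>Z. nat (zorder (stellar_fun \<psi>) \<alpha>)) else \<infinity>)"

text \<open>
  Mixtures are countable; a finite one is padded with terms of weight \<open>0\<close>, which the supremum
  ignores.
\<close>

definition is_mixture :: "l2op \<Rightarrow> (nat \<Rightarrow> real) \<Rightarrow> (nat \<Rightarrow> l2r) \<Rightarrow> bool" where
  "is_mixture \<rho> p \<psi> \<longleftrightarrow>
     (\<forall>i. 0 \<le> p i) \<and> p sums 1 \<and> (\<forall>i. norm (\<psi> i) = 1) \<and>
     (\<lambda>i. p i *\<^sub>R rank_one_proj (\<psi> i)) sums \<rho>"

definition stellar_rank :: "l2op \<Rightarrow> enat" where
  "stellar_rank \<rho> =
     Inf {(SUP i\<in>{i. 0 < p i}. pure_stellar_rank (\<psi> i)) | p \<psi>. is_mixture \<rho> p \<psi>}"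

definition stellar_states :: "nat \<Rightarrow> real \<Rightarrow> l2op set" where
  "stellar_states r E = {\<rho> \<in> energy_states E. stellar_rank \<rho> \<le> enat r}"

section \<open>Quadrature measurements\<close>

text \<open>\<open>rotation \<theta>\<close> is \<open>exp (\<i>\<theta>n)\<close> for the number operator \<open>n\<close>.\<close>

definition rotation :: "real \<Rightarrow> l2r \<Rightarrow> l2r" where
  "rotation \<theta> \<psi> = (\<Sum>n. scaleC (cis (\<theta> * real n) * cinner (fock n) \<psi>) (fock n))"

definition position_proj :: "real set \<Rightarrow> l2r \<Rightarrow> l2r" where
  "position_proj B \<psi> = to_l2r (\<lambda>x. indicator B x * rep_l2r \<psi> x)"

text \<open>
  The spectral measure of \<open>q\<^sub>\<theta> = e\<^bsup>-\<i>\<theta>n\<^esup> x e\<^bsup>\<i>\<theta>n\<^esup>\<close> is that of \<open>x\<close>, conjugated by the same unitary.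
  With \<open>a = (x + \<i>p)/\<surd>2\<close> this operator is \<open>x cos \<theta> - p sin \<theta>\<close>; the convention with \<open>+\<close> is
  obtained by replacing \<open>\<theta>\<close> with \<open>-\<theta>\<close>.
\<close>

definition quadrature_proj :: "real \<Rightarrow> real set \<Rightarrow> l2r \<Rightarrow> l2r" where
  "quadrature_proj \<theta> B \<psi> = rotation (- \<theta>) (position_proj B (rotation \<theta> \<psi>))"

definition quadrature_prob :: "l2op \<Rightarrow> real \<Rightarrow> real set \<Rightarrow> real" where
  "quadrature_prob \<rho> \<theta> B = Re (op_trace (\<lambda>\<psi>. \<rho> (quadrature_proj \<theta> B \<psi>)))"

definition quadrature_density :: "l2op \<Rightarrow> real \<Rightarrow> real \<Rightarrow> real" where
  "quadrature_density \<rho> \<theta> = (THE p. continuous_on UNIV p \<and> (\<forall>x. 0 \<le> p x) \<and>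
     integrable lborel p \<and>
     (\<forall>B\<in>sets borel. quadrature_prob \<rho> \<theta> B = (LINT x:B|lborel. p x)))"

definition windows :: "nat \<Rightarrow> (nat \<Rightarrow> real) \<Rightarrow> real \<Rightarrow> real set" where
  "windows k x \<eta> = (\<Union>i\<in>{1..k}. {x i - \<eta> / 2 .. x i + \<eta> / 2})"

definition threshold :: "nat \<Rightarrow> real \<Rightarrow> real \<Rightarrow> (nat \<Rightarrow> real) \<Rightarrow> real \<Rightarrow> real" where
  "threshold k E \<theta> x \<eta> =
     (INF \<sigma>\<in>stellar_states (k - 1) E. quadrature_prob \<sigma> \<theta> (windows k x \<eta>))"

end

(* Idea.  A state of stellar rank at most r has a stellar function P exp(a z^2 + b z) with deg P <= r
   and |2a| < 1 (Hadamard factorization, here via a Borel-Caratheodory bound), so every rotated wave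
   function is a polynomial of degree at most r times a Gaussian and has at most r real zeros.
   Stellar functions with at most r zeros are closed under locally uniform limits (Hurwitz) and
   energy-bounded unit vectors are compact, hence for pure states of rank at most k - 1 and energy at
   most 2E + 1 the densities at x_1, ..., x_k have a sum bounded below by some c > 0.  By Markov's
   inequality at least half of the weight of a mixture of energy at most E sits on such states, and the
   Hoelder continuity of H^1 wave functions gives w_eta >= const * eta for small eta.  The density of
   rho is continuous and vanishes at each x_i, so Tr(rho W_eta) = o(eta).
   The last claim is Tr((sigma - tau) W) = Tr((sigma - tau)(2W - 1)) / 2 <= |sigma - tau|_1 / 2,
   because both states have trace 1 and 2W - 1 is a contraction. *)

theory Submission
  imports Defs "HOL-Real_Asymp.Real_Asymp" "HOL-Computational_Algebra.Fundamental_Theorem_Algebra"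
begin

section \<open>Representatives of L^2 classes, complex sesquilinearity, completeness\<close>

section \<open>The Hilbert space\<close>

text \<open>The energy bound constrains a mixture only on average, so a single component need not
  lie in any compact set. The estimate for pure states is therefore made at the larger energy 2E + 1
  and summed with a weight that turns negative for components of higher energy. Energy enters in
  three more places. It makes a wave function continuous, so that its value at x_i has a meaning. It
  gains a factor 1/|\<alpha>| in the growth of the stellar function, which is what excludes |2a| =
  1. It stops a sequence of unit vectors from escaping to high Fock levels, so that a limit is not
  0. A function with at most k - 1 zeros may vanish at all but one of the points, so it is the sum
  over all k points that gets a lower bound. Everything is reduced to coefficients in the Fock
  basis: adjoints are assembled from coordinates, a state \<rho> is decomposed through its square
  root instead of its eigenvectors, and the trace norm of A is handled through the sums of |<V e_n,
  A e_n>| over contractions V, where e_n is the n-th Fock vector.\<close>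

lemma ae_equal_refl_iff: "ae_equal f f \<longleftrightarrow> sq_integrable f"
  by (auto simp: ae_equal_def)

lemma sq_integrable_rep: "sq_integrable (rep_l2r \<psi>)"
  using Quotient3_rep_reflp[OF Quotient3_l2r, of \<psi>] by (simp add: ae_equal_refl_iff)

lemma to_l2r_rep [simp]: "to_l2r (rep_l2r \<psi>) = \<psi>"
  by (rule Quotient3_abs_rep[OF Quotient3_l2r])

lemma to_l2r_eq_iff:
  "sq_integrable f \<Longrightarrow> sq_integrable g \<Longrightarrow> to_l2r f = to_l2r g \<longleftrightarrow> (AE x in lborel. f x = g x)"
  using Quotient3_rel[OF Quotient3_l2r, of f g] by (auto simp: ae_equal_refl_iff) (auto simp: ae_equal_def)

lemma rep_to_l2r: "sq_integrable f \<Longrightarrow> AE x in lborel. rep_l2r (to_l2r f) x = f x"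
  using to_l2r_eq_iff[OF sq_integrable_rep, of f "to_l2r f"] by simp

lemma cinner_to_l2r:
  "sq_integrable f \<Longrightarrow> sq_integrable g \<Longrightarrow> cinner (to_l2r f) (to_l2r g) = (LINT x|lborel. cnj (f x) * g x)"
  by (simp add: cinner.abs_eq ae_equal_refl_iff)

lemma plus_to_l2r:
  "sq_integrable f \<Longrightarrow> sq_integrable g \<Longrightarrow> to_l2r f + to_l2r g = to_l2r (\<lambda>x. f x + g x)"
  by (simp add: plus_l2r.abs_eq ae_equal_refl_iff)

lemma scaleC_to_l2r: "sq_integrable f \<Longrightarrow> scaleC c (to_l2r f) = to_l2r (\<lambda>x. c * f x)"
  by (simp add: scaleC.abs_eq ae_equal_refl_iff)

lemma sq_integrable_diff: "sq_integrable f \<Longrightarrow> sq_integrable g \<Longrightarrow> sq_integrable (\<lambda>x. f x - g x)"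
  using sq_integrable_add[OF _ sq_integrable_scale[of g "-1"], of f] by simp

lemma minus_to_l2r:
  "sq_integrable f \<Longrightarrow> sq_integrable g \<Longrightarrow> to_l2r f - to_l2r g = to_l2r (\<lambda>x. f x - g x)"
  using plus_to_l2r[OF _ sq_integrable_scale[of g "-1"], of f]
  by (simp add: minus_l2r_def uminus_l2r.abs_eq ae_equal_refl_iff)

lemma norm_sq_cinner: "cinner \<psi> \<psi> = complex_of_real ((norm \<psi>)\<^sup>2)"
proof -
  have "(norm \<psi>)\<^sup>2 = Re (cinner \<psi> \<psi>)"
    by (simp add: norm_l2r_def inner_l2r_def cinner_self(2))
  then show ?thesis using cinner_self(1)[of \<psi>] by simp
qed

lemma norm_to_l2r_sq:
  assumes "sq_integrable f"
  shows "(norm (to_l2r f))\<^sup>2 = (LINT x|lborel. (cmod (f x))\<^sup>2)"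
proof -
  have "complex_of_real ((norm (to_l2r f))\<^sup>2) = (LINT x|lborel. cnj (f x) * f x)"
    using assms by (simp only: cinner_to_l2r flip: norm_sq_cinner)
  also have "\<dots> = complex_of_real (LINT x|lborel. (cmod (f x))\<^sup>2)"
    by (simp only: mult.commute[of "cnj _"] integral_complex_of_real flip: complex_norm_square)
  finally show ?thesis by (simp only: of_real_eq_iff)
qed

lemma nn_integral_norm_to_l2r:
  assumes "sq_integrable f"
  shows "(\<integral>\<^sup>+x. ennreal ((cmod (f x))\<^sup>2) \<partial>lborel) = ennreal ((norm (to_l2r f))\<^sup>2)"
  using assms by (subst nn_integral_eq_integral) (auto simp: norm_to_l2r_sq sq_integrable_def)

lemma sq_integrable_nn:
  assumes "f \<in> borel_measurable lborel" "(\<integral>\<^sup>+x. ennreal ((cmod (f x))\<^sup>2) \<partial>lborel) < \<infinity>"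
  shows "sq_integrable f"
  unfolding sq_integrable_def using assms by (auto intro!: integrableI_bounded)

lemma scaleC_add_right: "scaleC c (x + y) = scaleC c x + scaleC c y"
  by transfer (simp add: ae_equal_def distrib_left sq_integrable_add sq_integrable_scale)

lemma scaleC_of_real: "scaleC (complex_of_real r) x = r *\<^sub>R x"
  by (simp add: scaleR_l2r_def)

lemma bounded_bilinear_cinner: "bounded_bilinear cinner"
proof
  show "\<exists>K. \<forall>a b. norm (cinner a b) \<le> norm a * norm b * K"
    by (rule exI[of _ 1]) (simp add: cmod_cinner_le)
qed (auto simp: cinner_add_left cinner_add_right cinner_scaleC_left cinner_scaleC_right
      scaleR_l2r_def scaleR_conv_of_real)

lemma bounded_bilinear_scaleC: "bounded_bilinear scaleC"
proof
  show "\<exists>K. \<forall>a b. norm (scaleC a b) \<le> norm a * norm b * K"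
    by (rule exI[of _ 1]) (simp add: norm_scaleC)
qed (auto simp: scaleC_add_left scaleC_add_right scaleR_l2r_def scaleR_conv_of_real scaleC_scaleC mult.commute)

interpretation cinner: bounded_bilinear cinner
  by (rule bounded_bilinear_cinner)

interpretation scaleC: bounded_bilinear scaleC
  by (rule bounded_bilinear_scaleC)

lemma scaleC_one [simp]: "scaleC 1 x = x"
  using scaleC_of_real[of 1 x] by simp

lemma cinner_eq_zero_commute: "cinner x y = 0 \<longleftrightarrow> cinner y x = 0"
  by (metis cinner_commute complex_cnj_zero)

lemma cinner_ext: "(\<And>\<phi>. cinner \<phi> x = cinner \<phi> y) \<Longrightarrow> x = y"
proof -
  assume "\<And>\<phi>. cinner \<phi> x = cinner \<phi> y"
  then have "cinner (x - y) (x - y) = 0"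
    by (simp add: cinner.diff_right)
  then show "x = y"
    by (simp add: norm_sq_cinner)
qed

text \<open>Riesz-Fischer: a rapidly converging subsequence converges almost everywhere, and Fatou's
  lemma turns the pointwise limit into an L^2 limit with the same rate.\<close>

lemma l2r_Cauchy_convergent:
  fixes X :: "nat \<Rightarrow> l2r"
  assumes "Cauchy X"
  shows "convergent X"
proof -
  have "\<exists>N. \<forall>m\<ge>N. \<forall>n\<ge>N. dist (X m) (X n) < (1/2) ^ k" for k
    using assms unfolding Cauchy_def by simp
  then obtain N where N: "\<And>k m n. m \<ge> N k \<Longrightarrow> n \<ge> N k \<Longrightarrow> dist (X m) (X n) < (1/2) ^ k"
    by metis
  \<comment> \<open>Summing all earlier thresholds puts \<open>r k\<close> above \<open>N m\<close>
    for every m \<le> k; the added k makes \<open>r\<close> strictly increasing.\<close>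
  define r where "r k = (\<Sum>i\<le>k. N i) + k" for k
  have r: "strict_mono r"
    by (rule strict_monoI_Suc) (simp add: r_def)
  have rN: "N k \<le> r m" if "k \<le> m" for k m
  proof -
    have "N k \<le> (\<Sum>i\<le>m. N i)"
      by (rule member_le_sum) (use that in auto)
    then show ?thesis by (simp add: r_def)
  qed
  define f where "f k = rep_l2r (X (r k))" for k
  have sqf: "sq_integrable (f k)" for k
    by (simp add: f_def sq_integrable_rep)
  have [measurable]: "f k \<in> borel_measurable lborel" for k
    using sqf by (auto simp: sq_integrable_def)
  have Xf: "X (r k) = to_l2r (f k)" for k
    by (simp add: f_def)
  have int: "(\<integral>\<^sup>+x. ennreal ((cmod (f m x - f n x))\<^sup>2) \<partial>lborel) \<le> ennreal ((1/4) ^ k)"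
    if "k \<le> m" "k \<le> n" for m n k
  proof -
    have "(\<integral>\<^sup>+x. ennreal ((cmod (f m x - f n x))\<^sup>2) \<partial>lborel) = ennreal ((dist (X (r m)) (X (r n)))\<^sup>2)"
      by (simp add: dist_norm Xf minus_to_l2r sqf nn_integral_norm_to_l2r sq_integrable_diff)
    also have "\<dots> \<le> ennreal (((1/2) ^ k)\<^sup>2)"
      using N[OF rN rN, OF that] by (intro ennreal_leI power_mono) auto
    also have "((1/2) ^ k)\<^sup>2 = (1/4 :: real) ^ k"
      by (simp add: power2_eq_square flip: power_mult_distrib)
    finally show ?thesis .
  qed
  \<comment> \<open>The squared increments have integral at most 4^-k. The weight 2^k leaves the
    convergent series of 2^-k and still forces increments of order 2^(-k/2) wherever
    \<open>S\<close> is finite.\<close>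
  define S where "S x = (\<Sum>k. ennreal (2 ^ k * (cmod (f (Suc k) x - f k x))\<^sup>2))" for x
  have [measurable]: "S \<in> borel_measurable lborel"
    unfolding S_def by measurable
  have "(\<integral>\<^sup>+x. S x \<partial>lborel) = (\<Sum>k. (\<integral>\<^sup>+x. ennreal (2 ^ k * (cmod (f (Suc k) x - f k x))\<^sup>2) \<partial>lborel))"
    unfolding S_def by (rule nn_integral_suminf) measurable
  also have "\<dots> \<le> (\<Sum>k. ennreal ((1/2) ^ k))"
  proof (intro suminf_le)
    fix k
    have "(\<integral>\<^sup>+x. ennreal (2 ^ k * (cmod (f (Suc k) x - f k x))\<^sup>2) \<partial>lborel)
      = ennreal (2 ^ k) * (\<integral>\<^sup>+x. ennreal ((cmod (f (Suc k) x - f k x))\<^sup>2) \<partial>lborel)"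
      by (subst nn_integral_cmult[symmetric]) (auto simp: ennreal_mult)
    also have "\<dots> \<le> ennreal (2 ^ k) * ennreal ((1/4) ^ k)"
      by (intro mult_left_mono int) auto
    also have "\<dots> = ennreal ((1/2) ^ k)"
      by (simp flip: ennreal_mult power_mult_distrib)
    finally show "(\<integral>\<^sup>+x. ennreal (2 ^ k * (cmod (f (Suc k) x - f k x))\<^sup>2) \<partial>lborel) \<le> ennreal ((1/2) ^ k)" .
  qed auto
  also have "\<dots> = ennreal (\<Sum>k. (1/2) ^ k)"
    by (rule suminf_ennreal2) (auto intro: summable_geometric)
  finally have "(\<integral>\<^sup>+x. S x \<partial>lborel) \<noteq> \<infinity>"
    by (auto simp: top_unique)
  then have "AE x in lborel. S x \<noteq> \<infinity>"
    by (intro nn_integral_noteq_infinite) auto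
  then have conv: "AE x in lborel. convergent (\<lambda>k. f k x)"
  proof eventually_elim
    fix x assume "S x \<noteq> \<infinity>"
    define C where "C = enn2real (S x)"
    have C: "S x = ennreal C" "C \<ge> 0"
      using \<open>S x \<noteq> \<infinity>\<close> by (simp_all add: C_def less_top)
    have b: "cmod (f (Suc k) x - f k x) \<le> sqrt C * (1 / sqrt 2) ^ k" for k
    proof -
      have "ennreal (2 ^ k * (cmod (f (Suc k) x - f k x))\<^sup>2) \<le> ennreal C"
        unfolding C(1)[symmetric] S_def
        using sum_le_suminf[of "\<lambda>k. ennreal (2 ^ k * (cmod (f (Suc k) x - f k x))\<^sup>2)" "{k}"]
        by (simp only: sum.insert sum.empty finite.intros summableI empty_iff not_False_eq_True add_0_right ennreal_zero_less_top simp_thms zero_le)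
      then have "2 ^ k * (cmod (f (Suc k) x - f k x))\<^sup>2 \<le> C"
        using C(2) by (simp only: ennreal_le_iff)
      then have "(cmod (f (Suc k) x - f k x))\<^sup>2 \<le> C * (1 / 2) ^ k"
        by (simp add: power_divide field_simps)
      then have "cmod (f (Suc k) x - f k x) \<le> sqrt (C * (1 / 2) ^ k)"
        by (rule real_le_rsqrt)
      also have "\<dots> = sqrt C * (1 / sqrt 2) ^ k"
        by (simp only: real_sqrt_mult real_sqrt_power real_sqrt_divide real_sqrt_one)
      finally show ?thesis .
    qed
    have "summable (\<lambda>k. f (Suc k) x - f k x)"
    proof (rule summable_comparison_test[OF _ summable_mult])
      show "\<exists>N. \<forall>n\<ge>N. norm (f (Suc n) x - f n x) \<le> sqrt C * (1 / sqrt 2) ^ n"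
        using b by auto
      show "summable (\<lambda>n. (1 / sqrt 2) ^ n)"
        by (intro summable_geometric) auto
    qed
    then have "convergent (\<lambda>n. f n x - f 0 x)"
      using sum_lessThan_telescope[of "\<lambda>k. f k x"] by (simp add: summable_iff_convergent)
    then show "convergent (\<lambda>k. f k x)"
      by (simp add: convergent_diff_const_right_iff)
  qed
  define g where "g x = lim (\<lambda>k. f k x)" for x
  have [measurable]: "g \<in> borel_measurable lborel"
    unfolding g_def by (rule borel_measurable_lim_metric) measurable
  have lim: "AE x in lborel. (\<lambda>k. f k x) \<longlonglongrightarrow> g x"
    using conv by eventually_elim (simp add: g_def convergent_LIMSEQ_iff)
  have gint: "(\<integral>\<^sup>+x. ennreal ((cmod (g x - f k x))\<^sup>2) \<partial>lborel) \<le> ennreal ((1/4) ^ k)" for k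
  proof -
    have "(\<integral>\<^sup>+x. ennreal ((cmod (g x - f k x))\<^sup>2) \<partial>lborel)
      = (\<integral>\<^sup>+x. liminf (\<lambda>m. ennreal ((cmod (f m x - f k x))\<^sup>2)) \<partial>lborel)"
    proof (rule nn_integral_cong_AE, use lim in eventually_elim)
      fix x assume "(\<lambda>k. f k x) \<longlonglongrightarrow> g x"
      then have "(\<lambda>m. ennreal ((cmod (f m x - f k x))\<^sup>2)) \<longlonglongrightarrow> ennreal ((cmod (g x - f k x))\<^sup>2)"
        by (intro tendsto_intros)
      then show "ennreal ((cmod (g x - f k x))\<^sup>2) = liminf (\<lambda>m. ennreal ((cmod (f m x - f k x))\<^sup>2))"
        by (rule lim_imp_Liminf[OF sequentially_bot, symmetric])
    qed
    also have "\<dots> \<le> liminf (\<lambda>m. \<integral>\<^sup>+x. ennreal ((cmod (f m x - f k x))\<^sup>2) \<partial>lborel)"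
      by (rule nn_integral_liminf) measurable
    also have "\<dots> \<le> ennreal ((1/4) ^ k)"
    proof (rule Liminf_le)
      show "\<forall>\<^sub>F m in sequentially. (\<integral>\<^sup>+x. ennreal ((cmod (f m x - f k x))\<^sup>2) \<partial>lborel) \<le> ennreal ((1/4) ^ k)"
        using eventually_ge_at_top[of k] by eventually_elim (auto intro: int)
    qed auto
    finally show ?thesis .
  qed
  have sqd: "sq_integrable (\<lambda>x. g x - f k x)" for k
    using gint[of k] by (intro sq_integrable_nn) (auto simp: less_top[symmetric] top_unique)
  have sqg: "sq_integrable g"
    using sq_integrable_add[OF sqd[of 0] sqf[of 0]] by simp
  have nb: "norm (X (r k) - to_l2r g) \<le> (1/2) ^ k" for k
  proof -
    have "ennreal ((norm (to_l2r g - X (r k)))\<^sup>2) \<le> ennreal ((1/4) ^ k)"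
      using gint[of k] by (simp add: Xf minus_to_l2r sqf sqg nn_integral_norm_to_l2r sqd)
    then have "(norm (to_l2r g - X (r k)))\<^sup>2 \<le> ((1/2) ^ k)\<^sup>2"
      by (simp add: ennreal_le_iff power2_eq_square flip: power_mult_distrib)
    then show ?thesis
      by (subst norm_minus_commute) (rule power2_le_imp_le, auto)
  qed
  have "(\<lambda>k. X (r k) - to_l2r g) \<longlonglongrightarrow> 0"
  proof (rule Lim_null_comparison)
    show "\<forall>\<^sub>F k in sequentially. norm (X (r k) - to_l2r g) \<le> (1/2) ^ k"
      using nb by simp
    show "(\<lambda>k. (1/2 :: real) ^ k) \<longlonglongrightarrow> 0"
      by (rule LIMSEQ_power_zero) auto
  qed
  then have "(X \<circ> r) \<longlonglongrightarrow> to_l2r g"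
    by (simp add: o_def LIM_zero_iff)
  then show ?thesis
    using Cauchy_converges_subseq[OF assms r] by (auto simp: convergent_def)
qed

instance l2r :: banach
  by standard (rule l2r_Cauchy_convergent)

section \<open>Polynomials times complex Gaussians and the ladder operators on them\<close>

section \<open>Gaussian wave functions\<close>

text \<open>A family that contains the Fock functions (s = 1, t = 0) as well as the wave functions
  of all states of finite stellar rank, and that is closed under d/dx and multiplication by
  x.\<close>

definition cgauss :: "complex \<Rightarrow> complex \<Rightarrow> complex poly \<Rightarrow> real \<Rightarrow> complex" where
  "cgauss s t p x = poly p (of_real x) * exp (- s * (of_real x)\<^sup>2 / 2 + t * of_real x)"

lemma gauss_poly_eq_cgauss: "gauss_poly p = cgauss 1 0 p"
proof
  fix x :: real
  have "complex_of_real (exp (- x\<^sup>2 / 2)) = exp (- (complex_of_real x)\<^sup>2 / 2)"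
    using exp_of_real[of "- x\<^sup>2 / 2", where ?'a = complex] by simp
  then show "gauss_poly p x = cgauss 1 0 p x"
    by (simp add: gauss_poly_def cgauss_def)
qed

lemma cgauss_simps:
  "cgauss s t 0 x = 0"
  "cgauss s t (smult c p) x = c * cgauss s t p x"
  "cgauss s t (p + q) x = cgauss s t p x + cgauss s t q x"
  "cgauss s t (p - q) x = cgauss s t p x - cgauss s t q x"
  "cgauss s t (pCons c p) x = c * cgauss s t 1 x + of_real x * cgauss s t p x"
  by (simp_all add: cgauss_def algebra_simps)

definition cgauss_deriv :: "complex \<Rightarrow> complex \<Rightarrow> complex poly \<Rightarrow> complex poly" where
  "cgauss_deriv s t p = pderiv p + [:t, - s:] * p"

lemma has_vector_derivative_cgauss:
  "(cgauss s t p has_vector_derivative cgauss s t (cgauss_deriv s t p) x) (at x)"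
proof -
  have "((\<lambda>z. poly p z * exp (- s * z\<^sup>2 / 2 + t * z)) has_field_derivative
      poly (cgauss_deriv s t p) z * exp (- s * z\<^sup>2 / 2 + t * z)) (at z)" for z :: complex
    by (auto intro!: derivative_eq_intros poly_DERIV simp: cgauss_deriv_def algebra_simps)
  from has_vector_derivative_real_field[OF this, of x]
  show ?thesis by (simp add: cgauss_def [abs_def])
qed

lemma continuous_on_cgauss: "continuous_on A (cgauss s t p)"
  unfolding cgauss_def[abs_def] by (intro continuous_intros continuous_on_poly) auto

lemma borel_measurable_cgauss [measurable]: "cgauss s t p \<in> borel_measurable borel"
  by (rule borel_measurable_continuous_onI[OF continuous_on_cgauss])

text \<open>Completing the square: half of the quadratic decay absorbs the linear term, at the price
  of the constant exp ((Re t)^2 / Re s), which is the same for every power k.\<close>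

lemma norm_cgauss_monomial_le:
  assumes "Re s > 0"
  shows "\<exists>C. \<forall>x k. cmod (of_real x ^ k * cgauss s t 1 x) \<le> C * \<bar>x\<bar> ^ k * exp (- Re s * x\<^sup>2 / 4)"
proof -
  have "cmod (of_real x ^ k * cgauss s t 1 x) \<le> exp ((Re t)\<^sup>2 / Re s) * \<bar>x\<bar> ^ k * exp (- Re s * x\<^sup>2 / 4)" for x k
  proof -
    have "0 \<le> (Re s * x / 2 - Re t)\<^sup>2 / Re s"
      using assms by simp
    also have "(Re s * x / 2 - Re t)\<^sup>2 / Re s = Re s * x\<^sup>2 / 4 - Re t * x + (Re t)\<^sup>2 / Re s"
      using assms by (simp add: power2_diff field_simps power2_eq_square)
    finally have "- Re s * x\<^sup>2 / 2 + Re t * x \<le> (Re t)\<^sup>2 / Re s + - Re s * x\<^sup>2 / 4"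
      by simp
    then have "exp (- Re s * x\<^sup>2 / 2 + Re t * x) \<le> exp ((Re t)\<^sup>2 / Re s) * exp (- Re s * x\<^sup>2 / 4)"
      by (simp flip: exp_add)
    moreover have "cmod (cgauss s t 1 x) = exp (- Re s * x\<^sup>2 / 2 + Re t * x)"
      by (simp add: cgauss_def flip: of_real_power)
    ultimately show ?thesis
      by (simp add: norm_mult norm_power mult.assoc mult.left_commute[of "exp _" "\<bar>x\<bar> ^ k"] mult_left_mono)
  qed
  then show ?thesis by blast
qed

lemma integrable_gauss_moment:
  assumes "\<sigma> > 0"
  shows "integrable lborel (\<lambda>x :: real. \<bar>x\<bar> ^ k * exp (- \<sigma> * x\<^sup>2 / 4))"
proof -
  define v where "v = sqrt (2 / \<sigma>)"
  have v: "v > 0" "v\<^sup>2 = 2 / \<sigma>" using assms by (simp_all add: v_def)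
  have "integrable lborel (\<lambda>x :: real. sqrt (2 * pi * v\<^sup>2) * (normal_density 0 v x * \<bar>x - 0\<bar> ^ k))"
    by (intro integrable_mult_right integrable_normal_moment_abs v)
  also have "(\<lambda>x :: real. sqrt (2 * pi * v\<^sup>2) * (normal_density 0 v x * \<bar>x - 0\<bar> ^ k))
      = (\<lambda>x. \<bar>x\<bar> ^ k * exp (- \<sigma> * x\<^sup>2 / 4))"
    using v assms by (auto simp: normal_density_def)
  finally show ?thesis .
qed

lemma integrable_cgauss:
  assumes "Re s > 0"
  shows "integrable lborel (cgauss s t p)"
proof -
  obtain C where C: "\<And>x k. cmod (of_real x ^ k * cgauss s t 1 x) \<le> C * \<bar>x\<bar> ^ k * exp (- Re s * x\<^sup>2 / 4)"
    using norm_cgauss_monomial_le[OF assms] by blast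
  have b: "integrable lborel (\<lambda>x. of_real x ^ k * cgauss s t 1 x)" for k
  proof (rule Bochner_Integration.integrable_bound)
    show "integrable lborel (\<lambda>x. C * (\<bar>x\<bar> ^ k * exp (- Re s * x\<^sup>2 / 4)))"
      by (intro integrable_mult_right integrable_gauss_moment assms)
    show "AE x in lborel. norm (of_real x ^ k * cgauss s t 1 x) \<le> norm (C * (\<bar>x\<bar> ^ k * exp (- Re s * x\<^sup>2 / 4)))"
      using order_trans[OF C abs_ge_self] by (auto simp: mult.assoc)
  qed measurable
  have "integrable lborel (\<lambda>x. of_real x ^ k * cgauss s t p x)" for k
  proof (induction p arbitrary: k)
    case (pCons c p)
    have "(\<lambda>x. of_real x ^ k * cgauss s t (pCons c p) x)
        = (\<lambda>x. c * (of_real x ^ k * cgauss s t 1 x) + of_real x ^ Suc k * cgauss s t p x)"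
      by (rule ext, subst cgauss_simps(5)) (simp add: algebra_simps)
    then show ?case
      using b[of k] pCons.IH[of "Suc k"] by (simp del: power_Suc)
  qed (simp add: cgauss_simps)
  from this[of 0] show ?thesis by simp
qed

lemma tendsto_cgauss:
  assumes "Re s > 0" "F = at_top \<or> F = at_bot"
  shows "(cgauss s t p \<longlongrightarrow> 0) F"
proof -
  obtain C where C: "\<And>x k. cmod (of_real x ^ k * cgauss s t 1 x) \<le> C * \<bar>x\<bar> ^ k * exp (- Re s * x\<^sup>2 / 4)"
    using norm_cgauss_monomial_le[OF assms(1)] by blast
  define \<sigma> where "\<sigma> = Re s"
  have \<sigma>: "\<sigma> > 0" using assms by (simp add: \<sigma>_def)
  have t: "((\<lambda>x. x ^ k * exp (- \<sigma> * x\<^sup>2 / 4)) \<longlongrightarrow> 0) at_top" for k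
    using \<sigma> by real_asymp
  have 1: "((\<lambda>x. \<bar>x\<bar> ^ k * exp (- \<sigma> * x\<^sup>2 / 4)) \<longlongrightarrow> 0) at_top" for k
    by (rule Lim_transform_eventually[OF t[of k]])
      (use eventually_ge_at_top[of 0] in \<open>eventually_elim, simp\<close>)
  have 2: "((\<lambda>x. \<bar>x\<bar> ^ k * exp (- \<sigma> * x\<^sup>2 / 4)) \<longlongrightarrow> 0) F" for k
    using assms(2) 1[of k] by (auto simp: filterlim_at_bot_mirror)
  have b: "((\<lambda>x. of_real x ^ k * cgauss s t 1 x) \<longlongrightarrow> 0) F" for k
  proof (rule Lim_null_comparison)
    show "\<forall>\<^sub>F x in F. norm (of_real x ^ k * cgauss s t 1 x) \<le> C * (\<bar>x\<bar> ^ k * exp (- \<sigma> * x\<^sup>2 / 4))"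
      using C by (simp add: \<sigma>_def mult.assoc)
    show "((\<lambda>x. C * (\<bar>x\<bar> ^ k * exp (- \<sigma> * x\<^sup>2 / 4))) \<longlongrightarrow> 0) F"
      by (rule tendsto_mult_right_zero[OF 2])
  qed
  have "((\<lambda>x. of_real x ^ k * cgauss s t p x) \<longlongrightarrow> 0) F" for k
  proof (induction p arbitrary: k)
    case (pCons c p)
    have "(\<lambda>x. of_real x ^ k * cgauss s t (pCons c p) x)
        = (\<lambda>x. c * (of_real x ^ k * cgauss s t 1 x) + of_real x ^ Suc k * cgauss s t p x)"
      by (rule ext, subst cgauss_simps(5)) (simp add: algebra_simps)
    then show ?case
      using tendsto_add_zero[OF tendsto_mult_right_zero[OF b[of k]] pCons.IH[of "Suc k"]]
      by (simp del: power_Suc)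
  qed (simp add: cgauss_simps)
  from this[of 0] show ?thesis by simp
qed

lemma integral_cgauss_deriv:
  assumes "Re s > 0"
  shows "(LINT x|lborel. cgauss s t (cgauss_deriv s t p) x) = 0"
proof -
  have "(LBINT x=-\<infinity>..\<infinity>. cgauss s t (cgauss_deriv s t p) x) = 0 - 0"
  proof (rule interval_integral_FTC_integrable[where F = "cgauss s t p"])
    show "set_integrable lborel (einterval (-\<infinity>) \<infinity>) (cgauss s t (cgauss_deriv s t p))"
      using integrable_cgauss[OF assms] by (simp add: set_integrable_def)
  qed (use tendsto_cgauss[OF assms] in \<open>auto simp: ereal_tendsto_simps intro!: has_vector_derivative_cgauss
        continuous_on_interior[OF continuous_on_cgauss[of UNIV]]\<close>)
  then show ?thesis
    by (simp add: interval_lebesgue_integral_def set_lebesgue_integral_def)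
qed

lemma cnj_poly: "cnj (poly p z) = poly (map_poly cnj p) (cnj z)"
  by (induction p) (auto simp: map_poly_pCons)

lemma cnj_cgauss_mult:
  "cnj (cgauss s t p x) * cgauss s' t' q x = cgauss (cnj s + s') (cnj t + t') (map_poly cnj p * q) x"
proof -
  have "cnj (exp (- s * (of_real x)\<^sup>2 / 2 + t * of_real x)) * exp (- s' * (of_real x)\<^sup>2 / 2 + t' * of_real x)
    = exp (- (cnj s + s') * (complex_of_real x)\<^sup>2 / 2 + (cnj t + t') * of_real x)"
    by (simp add: exp_cnj exp_add[symmetric] algebra_simps add_divide_distrib diff_divide_distrib)
  then show ?thesis
    by (simp only: cgauss_def complex_cnj_mult cnj_poly complex_cnj_complex_of_real poly_mult
        mult.assoc mult.left_commute[of "cnj (exp _)"])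
qed

lemma sq_integrable_cgauss:
  assumes "Re s > 0"
  shows "sq_integrable (cgauss s t p)"
proof -
  have "integrable lborel (\<lambda>x. Re (cgauss (cnj s + s) (cnj t + t) (map_poly cnj p * p) x))"
    using assms by (intro integrable_Re integrable_cgauss) simp
  also have "(\<lambda>x. Re (cgauss (cnj s + s) (cnj t + t) (map_poly cnj p * p) x)) = (\<lambda>x. (cmod (cgauss s t p x))\<^sup>2)"
    by (rule ext, simp add: cmod_power2 flip: cnj_cgauss_mult) (simp add: power2_eq_square)
  finally show ?thesis by (simp add: sq_integrable_def)
qed

definition gauss_vec :: "complex \<Rightarrow> complex \<Rightarrow> complex poly \<Rightarrow> l2r" where
  "gauss_vec s t p = to_l2r (cgauss s t p)"

text \<open>The annihilation operator (x + d/dx) / sqrt 2 acting on the polynomial factor while the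
  Gaussian is held fixed; \<open>raise_poly\<close> is the creation operator in the same
  sense.\<close>

definition lower_poly :: "complex \<Rightarrow> complex \<Rightarrow> complex poly \<Rightarrow> complex poly" where
  "lower_poly s t p = smult (1 / of_real (sqrt 2)) ([:0, 1:] * p + cgauss_deriv s t p)"

definition raise_poly :: "complex \<Rightarrow> complex \<Rightarrow> complex poly \<Rightarrow> complex poly" where
  "raise_poly s t p = smult (1 / of_real (sqrt 2)) ([:0, 1:] * p - cgauss_deriv s t p)"

lemma gauss_vec_smult: "Re s > 0 \<Longrightarrow> gauss_vec s t (smult c p) = scaleC c (gauss_vec s t p)"
  by (simp add: gauss_vec_def scaleC_to_l2r sq_integrable_cgauss cgauss_simps(2)[abs_def])

lemma gauss_vec_add: "Re s > 0 \<Longrightarrow> gauss_vec s t (p + q) = gauss_vec s t p + gauss_vec s t q"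
  by (simp add: gauss_vec_def plus_to_l2r sq_integrable_cgauss cgauss_simps(3)[abs_def])

lemma gauss_vec_diff: "Re s > 0 \<Longrightarrow> gauss_vec s t (p - q) = gauss_vec s t p - gauss_vec s t q"
  by (simp add: gauss_vec_def minus_to_l2r sq_integrable_cgauss cgauss_simps(4)[abs_def])

lemma cinner_gauss_vec:
  assumes "Re s > 0" "Re s' > 0"
  shows "cinner (gauss_vec s t p) (gauss_vec s' t' q) = (LINT x|lborel. cnj (cgauss s t p x) * cgauss s' t' q x)"
  by (simp add: gauss_vec_def cinner_to_l2r sq_integrable_cgauss assms)

text \<open>The conjugate of one function times the other is again a \<open>cgauss\<close>, with
  parameters cnj s + s' and cnj t + t'. Its derivative integrates to 0, so integration by parts
  leaves no boundary term.\<close>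

lemma cinner_gauss_vec_deriv:
  assumes "Re s > 0" "Re s' > 0"
  shows "cinner (gauss_vec s t (cgauss_deriv s t p)) (gauss_vec s' t' q)
    = - cinner (gauss_vec s t p) (gauss_vec s' t' (cgauss_deriv s' t' q))"
proof -
  let ?S = "cnj s + s'" and ?T = "cnj t + t'" and ?r = "map_poly cnj p * q"
  have "cgauss ?S ?T (cgauss_deriv ?S ?T ?r) x
    = cnj (cgauss s t (cgauss_deriv s t p) x) * cgauss s' t' q x
    + cnj (cgauss s t p x) * cgauss s' t' (cgauss_deriv s' t' q) x" for x
  proof (rule vector_derivative_unique_at)
    show "(cgauss ?S ?T ?r has_vector_derivative cgauss ?S ?T (cgauss_deriv ?S ?T ?r) x) (at x)"
      by (rule has_vector_derivative_cgauss)
    have "((\<lambda>x. cnj (cgauss s t p x) * cgauss s' t' q x) has_vector_derivative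
      cnj (cgauss s t p x) * cgauss s' t' (cgauss_deriv s' t' q) x
       + cnj (cgauss s t (cgauss_deriv s t p) x) * cgauss s' t' q x) (at x)"
      by (intro has_vector_derivative_mult has_vector_derivative_cnj has_vector_derivative_cgauss)
    then show "(cgauss ?S ?T ?r has_vector_derivative
        cnj (cgauss s t (cgauss_deriv s t p) x) * cgauss s' t' q x
      + cnj (cgauss s t p x) * cgauss s' t' (cgauss_deriv s' t' q) x) (at x)"
      by (simp add: cnj_cgauss_mult[abs_def] add.commute)
  qed
  moreover have "(LINT x|lborel. cgauss ?S ?T (cgauss_deriv ?S ?T ?r) x) = 0"
    by (rule integral_cgauss_deriv) (use assms in simp)
  moreover have "integrable lborel (\<lambda>x. cnj (cgauss s t p' x) * cgauss s' t' q' x)" for p' q'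
    by (intro sq_integrable_cinner sq_integrable_cgauss assms)
  ultimately show ?thesis
    using assms by (simp add: cinner_gauss_vec eq_neg_iff_add_eq_0)
qed

lemma cinner_gauss_vec_x:
  assumes "Re s > 0" "Re s' > 0"
  shows "cinner (gauss_vec s t ([:0, 1:] * p)) (gauss_vec s' t' q) = cinner (gauss_vec s t p) (gauss_vec s' t' ([:0, 1:] * q))"
  using assms by (simp add: cinner_gauss_vec) (simp add: cgauss_def algebra_simps)

text \<open>Multiplication by x is symmetric and d/dx antisymmetric, so raising and lowering are
  mutually adjoint. The two sides may carry different Gaussians: with (1, 0) on the left this gives
  recursions for the Fock coefficients of an arbitrary Gaussian vector.\<close>

lemma cinner_raise_poly:
  assumes "Re s > 0" "Re s' > 0"
  shows "cinner (gauss_vec s t (raise_poly s t p)) (gauss_vec s' t' q) = cinner (gauss_vec s t p) (gauss_vec s' t' (lower_poly s' t' q))"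
    and "cinner (gauss_vec s t (lower_poly s t p)) (gauss_vec s' t' q) = cinner (gauss_vec s t p) (gauss_vec s' t' (raise_poly s' t' q))"
  unfolding raise_poly_def lower_poly_def using assms
  by (simp_all only: gauss_vec_smult gauss_vec_add gauss_vec_diff cinner_scaleC_left cinner_scaleC_right
      cinner.diff_left cinner.diff_right cinner.add_left cinner.add_right cinner_gauss_vec_deriv cinner_gauss_vec_x)
    (simp_all add: algebra_simps)

section \<open>Hermite functions: ladder relations, orthonormality, completeness\<close>

section \<open>The Fock basis\<close>

lemma lower_poly_1_0: "lower_poly 1 0 p = smult (1 / of_real (sqrt 2)) (pderiv p)"
  unfolding lower_poly_def cgauss_deriv_def
  by (rule arg_cong[of _ _ "smult _"], rule poly_eqI) (simp add: coeff_pCons split: nat.splits)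

lemma raise_poly_1_0: "raise_poly 1 0 p = smult (1 / of_real (sqrt 2)) ([:0, 2:] * p - pderiv p)"
  unfolding raise_poly_def cgauss_deriv_def
  by (rule arg_cong[of _ _ "smult _"], rule poly_eqI) (simp add: coeff_pCons split: nat.splits)

lemma annihilation_op_lower_poly: "annihilation_op (gauss_poly p) = gauss_poly (lower_poly 1 0 p)"
  by (simp only: annihilation_gauss_poly lower_poly_1_0)

lemma creation_op_raise_poly: "creation_op (gauss_poly p) = gauss_poly (raise_poly 1 0 p)"
  by (simp only: creation_gauss_poly raise_poly_1_0)

text \<open>These are the L^2-normalized Hermite polynomials pi^(-1/4) H_n / sqrt (2^n n!),
  generated by H_(n+1) = 2 x H_n - H_n'.\<close>

primrec fock_poly :: "nat \<Rightarrow> complex poly" where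
  "fock_poly 0 = [:complex_of_real (pi powr (- 1 / 4)):]"
| "fock_poly (Suc n) = smult (1 / of_real (sqrt (real (Suc n)))) (raise_poly 1 0 (fock_poly n))"

lemma fock_fun_eq_gauss_poly: "fock_fun n = gauss_poly (fock_poly n)"
proof (induction n)
  case 0
  then show ?case by (auto simp: gauss_poly_def)
next
  case (Suc n)
  show ?case
    by (rule ext) (simp add: Suc.IH creation_op_raise_poly gauss_poly_simps del: of_nat_Suc)
qed

lemma fock_eq_gauss_vec: "fock n = gauss_vec 1 0 (fock_poly n)"
  by (simp add: fock.abs_eq gauss_vec_def fock_fun_eq_gauss_poly gauss_poly_eq_cgauss)

lemma sqrt_Suc_complex: "complex_of_real (sqrt (real (Suc n))) \<noteq> 0"
  "complex_of_real (sqrt (real (Suc n))) * complex_of_real (sqrt (real (Suc n))) = of_nat (Suc n)"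
  by (simp_all del: of_nat_Suc flip: of_real_mult)

lemma raise_fock_poly: "raise_poly 1 0 (fock_poly n) = smult (of_real (sqrt (real (Suc n)))) (fock_poly (Suc n))"
  using sqrt_Suc_complex(1)[of n] by (simp del: of_nat_Suc)

lemma degree_fock_poly: "degree (fock_poly n) = n \<and> fock_poly n \<noteq> 0"
proof (induction n)
  case (Suc n)
  have "raise_poly 1 0 (fock_poly n) = smult (1 / of_real (sqrt 2)) ([:0, 2:] * fock_poly n - pderiv (fock_poly n))"
    by (rule raise_poly_1_0)
  moreover have "degree ([:0, 2:] * fock_poly n) = Suc n"
    using Suc by (subst degree_mult_eq) auto
  moreover from this have "degree ([:0, 2:] * fock_poly n - pderiv (fock_poly n)) = Suc n"
    using Suc degree_pderiv[of "fock_poly n"]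
    by (subst diff_conv_add_uminus, subst degree_add_eq_left) auto
  ultimately show ?case
    using sqrt_Suc_complex(1)[of n] by (auto simp del: of_nat_Suc)
qed simp

lemma cinner_fock_lower:
  assumes "Re s > 0"
  shows "cinner (fock n) (gauss_vec s t (lower_poly s t p)) = of_real (sqrt (real (Suc n))) * cinner (fock (Suc n)) (gauss_vec s t p)"
  using cinner_raise_poly(1)[of 1 s 0 "fock_poly n" t p] assms
  by (simp only: raise_fock_poly gauss_vec_smult fock_eq_gauss_vec cinner_scaleC_left) simp

text \<open>The canonical commutation relation and the eigenvalue n of the number operator show that
  lowering after raising multiplies the n-th function by n + 1; the normalization of
  \<open>fock_poly (Suc n)\<close> takes away one factor sqrt (n + 1).\<close>

lemma lower_fock_poly:
  "gauss_vec 1 0 (lower_poly 1 0 (fock_poly 0)) = 0"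
  "gauss_vec 1 0 (lower_poly 1 0 (fock_poly (Suc n))) = scaleC (of_real (sqrt (real (Suc n)))) (fock n)"
proof -
  show "gauss_vec 1 0 (lower_poly 1 0 (fock_poly 0)) = 0"
    by (simp add: lower_poly_def cgauss_deriv_def gauss_vec_def cgauss_simps(1)[abs_def] zero_l2r.abs_eq)
  define s where "s = complex_of_real (sqrt (real (Suc n)))"
  have s: "s \<noteq> 0" "s * s = of_nat (Suc n)"
    using sqrt_Suc_complex[of n] by (simp_all add: s_def)
  have "gauss_poly (lower_poly 1 0 (raise_poly 1 0 (fock_poly n))) x = s * s * gauss_poly (fock_poly n) x" for x
    using annihilation_creation_gauss_poly[of "fock_poly n" x] fun_cong[OF number_op_fock_fun[of n], of x]
    by (simp add: number_op_def fock_fun_eq_gauss_poly annihilation_op_lower_poly creation_op_raise_poly s algebra_simps)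
  then have "gauss_poly (lower_poly 1 0 (raise_poly 1 0 (fock_poly n))) = gauss_poly (smult (s * s) (fock_poly n))"
    by (intro ext) (simp only: gauss_poly_simps)
  then have "gauss_vec 1 0 (lower_poly 1 0 (raise_poly 1 0 (fock_poly n))) = gauss_vec 1 0 (smult (s * s) (fock_poly n))"
    by (simp only: gauss_vec_def gauss_poly_eq_cgauss)
  moreover have "lower_poly 1 0 (smult c p) = smult c (lower_poly 1 0 p)" for c p
    by (simp add: lower_poly_1_0 pderiv_smult mult.commute)
  ultimately show "gauss_vec 1 0 (lower_poly 1 0 (fock_poly (Suc n))) = scaleC s (fock n)"
    using s(1) by (simp add: fock_eq_gauss_vec gauss_vec_smult scaleC_scaleC flip: s_def del: of_nat_Suc)
qed

lemma cinner_fock_raise: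
  assumes "Re s > 0"
  shows "cinner (fock 0) (gauss_vec s t (raise_poly s t p)) = 0"
    and "cinner (fock (Suc n)) (gauss_vec s t (raise_poly s t p)) = of_real (sqrt (real (Suc n))) * cinner (fock n) (gauss_vec s t p)"
  using cinner_raise_poly(2)[of 1 s 0 "fock_poly 0" t p] cinner_raise_poly(2)[of 1 s 0 "fock_poly (Suc n)" t p] assms
    fock_eq_gauss_vec[of 0] fock_eq_gauss_vec[of "Suc n"]
  by (simp_all add: lower_fock_poly cinner_scaleC_left cinner.zero_left del: fock_poly.simps of_nat_Suc)

text \<open>The ladder relation lowers both indices at once. What remains is the vacuum against
  raised vectors, which vanishes, and the norm of the vacuum, whose squared modulus is the normal
  density of variance 1/2.\<close>

lemma fock_orthonormal: "cinner (fock m) (fock n) = (if m = n then 1 else 0)"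
proof -
  have z: "cinner (fock 0) (fock (Suc n)) = 0" for n
    using cinner_fock_raise(1)[of 1 0 "fock_poly n"] sqrt_Suc_complex(1)[of n]
    by (simp add: raise_fock_poly gauss_vec_smult cinner_scaleC_right flip: fock_eq_gauss_vec del: of_nat_Suc fock_poly.simps)
  have s: "of_real (sqrt (real (Suc n))) * cinner (fock (Suc m)) (fock (Suc n)) = of_real (sqrt (real (Suc m))) * cinner (fock m) (fock n)" for m n
    using cinner_fock_raise(2)[of 1 m 0 "fock_poly n"]
    by (simp add: raise_fock_poly gauss_vec_smult cinner_scaleC_right flip: fock_eq_gauss_vec del: of_nat_Suc fock_poly.simps)
  have "cinner (fock 0) (fock 0) = 1"
  proof -
    have "cinner (fock 0) (fock 0) = (LINT x|lborel. cnj (fock_fun 0 x) * fock_fun 0 x)"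
      using sq_integrable_cgauss[of 1 0 "fock_poly 0"]
      by (simp add: fock.abs_eq cinner_to_l2r fock_fun_eq_gauss_poly gauss_poly_eq_cgauss del: fock_fun.simps)
    also have "(\<lambda>x. cnj (fock_fun 0 x) * fock_fun 0 x) = (\<lambda>x. complex_of_real (normal_density 0 (1 / sqrt 2) x))"
    proof
      fix x :: real
      have "normal_density 0 (1 / sqrt 2) x = exp (- x\<^sup>2) / sqrt pi"
        by (simp add: normal_density_def power_divide)
      moreover have "pi powr (- 1 / 4) * pi powr (- 1 / 4) = 1 / sqrt pi"
        by (simp add: powr_half_sqrt[symmetric] powr_minus_divide flip: powr_add)
      moreover have "exp (- x\<^sup>2 / 2) * exp (- x\<^sup>2 / 2) = exp (- x\<^sup>2)"
        by (simp flip: exp_add)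
      ultimately have "(pi powr (- 1 / 4) * exp (- x\<^sup>2 / 2)) * (pi powr (- 1 / 4) * exp (- x\<^sup>2 / 2)) = normal_density 0 (1 / sqrt 2) x"
        by (simp only: mult.assoc mult.left_commute[of "exp _" "pi powr _"])
          (simp only: mult.assoc[symmetric], simp)
      then show "cnj (fock_fun 0 x) * fock_fun 0 x = complex_of_real (normal_density 0 (1 / sqrt 2) x)"
        by (simp only: fock_fun.simps complex_cnj_complex_of_real flip: of_real_mult)
    qed
    also have "(LINT x|lborel. complex_of_real (normal_density 0 (1 / sqrt 2) x)) = 1"
      by (subst integral_complex_of_real) (simp add: integral_normal_density)
    finally show ?thesis .
  qed
  then show ?thesis
  proof (induction m arbitrary: n)
    case 0
    then show ?case using z by (cases n) auto
  next
    case (Suc m)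
    show ?case
    proof (cases n)
      case 0
      then show ?thesis using z[of m] cinner_eq_zero_commute[of "fock 0" "fock (Suc m)"] by simp
    next
      case (Suc k)
      then show ?thesis
        using s[of k m] Suc.IH[of k] Suc.prems sqrt_Suc_complex(1)[of k] by (auto split: if_splits simp del: of_nat_Suc)
    qed
  qed
qed

text \<open>The positive and negative parts of g have equal Fourier transforms and, at t = 0, equal
  mass m. If m > 0, division by m gives two probability densities with the same characteristic
  function, and Levy's uniqueness theorem identifies them; if m = 0, both parts vanish almost
  everywhere.\<close>

lemma fourier_zero_imp_AE_zero_real:
  fixes g :: "real \<Rightarrow> real"
  assumes g: "integrable lborel g"
    and F: "\<And>t. (LINT x|lborel. complex_of_real (g x) * iexp (t * x)) = 0"
  shows "AE x in lborel. g x = 0"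
proof -
  have [measurable]: "g \<in> borel_measurable borel"
    using g by auto
  define h where "h s x = max 0 (s * g x)" for s x :: real
  have [measurable]: "h s \<in> borel_measurable borel" for s
    unfolding h_def by measurable
  have h: "integrable lborel (h s)" for s
    unfolding h_def using g by (intro integrable_max) auto
  have hg: "g x = h 1 x - h (-1) x" for x
    by (simp add: h_def max_def)
  have hi: "integrable lborel (\<lambda>x. complex_of_real (h s x) * iexp (t * x))" for s t
    by (rule Bochner_Integration.integrable_bound[OF h[of s]]) (auto simp: norm_mult)
  have eq: "(LINT x|lborel. complex_of_real (h 1 x) * iexp (t * x)) = (LINT x|lborel. complex_of_real (h (-1) x) * iexp (t * x))" for t
    using F[of t] hi by (simp add: hg left_diff_distrib)
  define m where "m = (LINT x|lborel. h 1 x)"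
  have m: "(LINT x|lborel. h s x) = m" if "s = 1 \<or> s = -1" for s
    using eq[of 0] that by (auto simp: m_def) 
  have "m \<ge> 0"
    unfolding m_def by (intro integral_nonneg_AE) (auto simp: h_def)
  have hz: "AE x in lborel. h 1 x = h (-1) x"
  proof (cases "m = 0")
    case True
    have "AE x in lborel. h s x = 0" if "s = 1 \<or> s = -1" for s
      using integral_nonneg_eq_0_iff_AE[OF h[of s]] m[OF that] True by (auto simp: h_def)
    from this[of 1] this[of "-1"] show ?thesis
      by (auto elim: AE_mp)
  next
    case False
    define M where "M s = density lborel (\<lambda>x. ennreal (h s x / m))" for s
    have nn: "0 \<le> h s x / m" for s x
      using \<open>m \<ge> 0\<close> by (simp add: h_def)
    have rd: "real_distribution (M s)" if "s = 1 \<or> s = -1" for s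
    proof -
      have "emeasure (M s) (space (M s)) = (\<integral>\<^sup>+x. ennreal (h s x / m) \<partial>lborel)"
        by (simp add: M_def emeasure_density)
      also have "\<dots> = ennreal (LINT x|lborel. h s x / m)"
        using nn h by (intro nn_integral_eq_integral) auto
      also have "\<dots> = 1"
        using m[OF that] False by simp
      finally have "prob_space (M s)"
        by (rule prob_spaceI)
      then show ?thesis
        by (simp add: real_distribution_def real_distribution_axioms_def M_def)
    qed
    have "char (M s) t = (LINT x|lborel. complex_of_real (h s x) * iexp (t * x)) / of_real m" for s t
    proof -
      have "char (M s) t = (LINT x|lborel. (h s x / m) *\<^sub>R iexp (t * x))"
        unfolding char_def M_def using nn by (intro integral_density) auto
      also have "\<dots> = (LINT x|lborel. complex_of_real (h s x) * iexp (t * x) / of_real m)"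
        by (intro Bochner_Integration.integral_cong) (auto simp: scaleR_conv_of_real)
      finally show ?thesis by simp
    qed
    then have "char (M 1) = char (M (-1))"
      using eq by auto
    then have "M 1 = M (-1)"
      by (intro Levy_uniqueness rd) auto
    then have "AE x in lborel. ennreal (h 1 x / m) = ennreal (h (-1) x / m)"
      unfolding M_def by (intro sigma_finite_measure.density_unique[OF sigma_finite_lborel]) auto
    then show ?thesis
      by eventually_elim (use nn False in \<open>simp add: ennreal_inj\<close>)
  qed
  then show ?thesis
    by eventually_elim (simp add: hg)
qed

text \<open>Conjugating g conjugates and reflects its Fourier transform, so the transforms of Re g
  and Im g vanish too and the real case applies to each.\<close>

lemma fourier_zero_imp_AE_zero:
  fixes g :: "real \<Rightarrow> complex"
  assumes g: "integrable lborel g"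
    and F: "\<And>t. (LINT x|lborel. g x * iexp (t * x)) = 0"
  shows "AE x in lborel. g x = 0"
proof -
  have [measurable]: "g \<in> borel_measurable borel"
    using g by auto
  have F': "(LINT x|lborel. cnj (g x) * iexp (t * x)) = 0" for t
  proof -
    have "(LINT x|lborel. cnj (g x) * iexp (t * x)) = (LINT x|lborel. cnj (g x * iexp (- t * x)))"
      by (intro Bochner_Integration.integral_cong) (auto simp: exp_cnj)
    also have "\<dots> = 0"
      by (subst Bochner_Integration.integral_cnj) (simp only: F complex_cnj_zero)
    finally show ?thesis .
  qed
  have i1: "integrable lborel (\<lambda>x. g x * iexp (t * x))" for t
    by (rule Bochner_Integration.integrable_bound[OF g]) (auto simp: norm_mult)
  have i2: "integrable lborel (\<lambda>x. cnj (g x) * iexp (t * x))" for t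
    by (rule Bochner_Integration.integrable_bound[OF g]) (auto simp: norm_mult)
  have "AE x in lborel. Re (g x) = 0"
  proof (rule fourier_zero_imp_AE_zero_real)
    fix t
    have "(LINT x|lborel. complex_of_real (Re (g x)) * iexp (t * x))
      = (LINT x|lborel. (g x * iexp (t * x) + cnj (g x) * iexp (t * x)) / 2)"
      by (intro Bochner_Integration.integral_cong) (auto simp: complex_add_cnj simp flip: distrib_right)
    then show "(LINT x|lborel. complex_of_real (Re (g x)) * iexp (t * x)) = 0"
      using F[of t] F'[of t] i1[of t] i2[of t] by simp
  qed (use g in auto)
  moreover have "AE x in lborel. Im (g x) = 0"
  proof (rule fourier_zero_imp_AE_zero_real)
    fix t
    have im: "complex_of_real (Im z) * w = (z * w - cnj z * w) / (2 * \<i>)" for z w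
    proof -
      have "z * w - cnj z * w = (2 * \<i>) * (complex_of_real (Im z) * w)"
        by (simp add: complex_eq_iff algebra_simps)
      then show ?thesis by simp
    qed
    have "(LINT x|lborel. complex_of_real (Im (g x)) * iexp (t * x))
      = (LINT x|lborel. (g x * iexp (t * x) - cnj (g x) * iexp (t * x)) / (2 * \<i>))"
      by (intro Bochner_Integration.integral_cong) (simp_all only: im)
    then show "(LINT x|lborel. complex_of_real (Im (g x)) * iexp (t * x)) = 0"
      using F[of t] F'[of t] i1[of t] i2[of t] by simp
  qed (use g in auto)
  ultimately show ?thesis
    by eventually_elim (simp add: complex_eq_iff)
qed

text \<open>Since \<open>fock_poly n\<close> has degree exactly n, subtracting a multiple of it
  removes the leading term: the Fock functions span all polynomials times the standard
  Gaussian.\<close>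

lemma cinner_gauss_vec_eq_0:
  assumes "\<And>n. cinner (fock n) \<psi> = 0"
  shows "cinner (gauss_vec 1 0 p) \<psi> = 0"
proof -
  have "\<forall>p. degree p < n \<or> p = 0 \<longrightarrow> cinner (gauss_vec 1 0 p) \<psi> = 0" for n
  proof (induction n)
    case 0
    show ?case
      by (simp add: gauss_vec_def cgauss_simps(1)[abs_def] cinner.zero_left flip: zero_l2r.abs_eq)
  next
    case (Suc n)
    show ?case
    proof (intro allI impI)
      fix p :: "complex poly" assume p: "degree p < Suc n \<or> p = 0"
      define c where "c = coeff p n / coeff (fock_poly n) n"
      have l: "coeff (fock_poly n) n \<noteq> 0"
        using degree_fock_poly[of n] by (metis leading_coeff_neq_0)
      have "degree (p - smult c (fock_poly n)) \<le> n"
        using p degree_fock_poly[of n] by (intro degree_diff_le order_trans[OF degree_smult_le]) auto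
      moreover have "coeff (p - smult c (fock_poly n)) n = 0"
        using l by (simp add: c_def)
      ultimately have "degree (p - smult c (fock_poly n)) < n \<or> p - smult c (fock_poly n) = 0"
        by (metis leading_coeff_neq_0 le_neq_implies_less)
      with Suc.IH have "cinner (gauss_vec 1 0 (p - smult c (fock_poly n))) \<psi> = 0"
        by blast
      then show "cinner (gauss_vec 1 0 p) \<psi> = 0"
        using assms[of n]
        by (simp add: gauss_vec_diff gauss_vec_smult cinner.diff_left cinner_scaleC_left flip: fock_eq_gauss_vec)
    qed
  qed
  from this[of "Suc (degree p)"] show ?thesis by simp
qed

text \<open>All moments of g = exp (- x^2 / 2) f vanish. The exponential series of
  \<open>iexp (t * x)\<close> may be integrated against g term by term, so the Fourier transform of
  g is 0.\<close>

lemma fock_complete: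
  assumes "\<And>n. cinner (fock n) \<psi> = 0"
  shows "\<psi> = 0"
proof -
  define f where "f = rep_l2r \<psi>"
  have f: "sq_integrable f" "to_l2r f = \<psi>"
    by (simp_all add: f_def sq_integrable_rep)
  then have [measurable]: "f \<in> borel_measurable borel"
    by (auto simp: sq_integrable_def)
  define g where "g x = of_real (exp (- x\<^sup>2 / 2)) * f x" for x
  have [measurable]: "g \<in> borel_measurable borel"
    unfolding g_def by measurable
  have e: "integrable lborel (\<lambda>x. norm (cnj (cgauss 1 t p x) * f x))" for t p
    by (intro integrable_norm sq_integrable_cinner sq_integrable_cgauss f) simp
  have mom: "(LINT x|lborel. of_real x ^ n * g x) = 0" "integrable lborel (\<lambda>x. of_real x ^ n * g x)" for n
  proof -
    have c: "cnj (cgauss 1 0 (monom 1 n) x) * f x = of_real x ^ n * g x" for x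
      unfolding gauss_poly_eq_cgauss[symmetric] by (simp add: g_def poly_monom gauss_poly_def)
    have "cinner (gauss_vec 1 0 (monom 1 n)) \<psi> = 0"
      by (rule cinner_gauss_vec_eq_0[OF assms])
    then have "(LINT x|lborel. cnj (cgauss 1 0 (monom 1 n) x) * f x) = 0"
      using cinner_to_l2r[OF sq_integrable_cgauss[of 1 0 "monom 1 n"] f(1)] f(2) by (simp add: gauss_vec_def)
    then show "(LINT x|lborel. of_real x ^ n * g x) = 0"
      by (simp only: c)
    show "integrable lborel (\<lambda>x. of_real x ^ n * g x)"
      unfolding c[symmetric] by (intro sq_integrable_cinner sq_integrable_cgauss f) simp
  qed
  have "AE x in lborel. g x = 0"
  proof (rule fourier_zero_imp_AE_zero)
    show "integrable lborel g"
      using mom(2)[of 0] by simp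
    fix t :: real
    define s where "s N x = (\<Sum>n<N. (\<i> * of_real t) ^ n / fact n * (of_real x ^ n * g x))" for N x
    have sz: "(LINT x|lborel. s N x) = 0" for N
      unfolding s_def using mom by (subst Bochner_Integration.integral_sum) (auto intro!: integrable_mult_right)
    have seq: "s N x = g x * (\<Sum>n<N. (\<i> * of_real (t * x)) ^ n /\<^sub>R fact n)" for N x
      by (simp add: s_def sum_distrib_left scaleR_conv_of_real power_mult_distrib field_simps)
    \<comment> \<open>The partial sums of the exponential are at most exp |t x|, hence at most exp
      (t x) + exp (- t x). Each of these times exp (- x^2 / 2) is a Gaussian in L^2, so its product
      with f is integrable and dominates.\<close>
    have "(\<lambda>N. LINT x|lborel. s N x) \<longlonglongrightarrow> (LINT x|lborel. g x * iexp (t * x))"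
    proof (rule integral_dominated_convergence[where w = "\<lambda>x. norm (cnj (cgauss 1 (of_real t) 1 x) * f x) + norm (cnj (cgauss 1 (of_real (- t)) 1 x) * f x)"])
      show "integrable lborel (\<lambda>x. norm (cnj (cgauss 1 (of_real t) 1 x) * f x) + norm (cnj (cgauss 1 (of_real (- t)) 1 x) * f x))"
        by (intro Bochner_Integration.integrable_add e)
      show "AE x in lborel. (\<lambda>N. s N x) \<longlonglongrightarrow> g x * iexp (t * x)"
      proof (rule AE_I2)
        fix x
        have "(\<lambda>N. \<Sum>n<N. (\<i> * of_real (t * x)) ^ n /\<^sub>R fact n) \<longlonglongrightarrow> iexp (t * x)"
          using exp_converges[of "\<i> * complex_of_real (t * x)"] by (simp add: sums_def)
        then show "(\<lambda>N. s N x) \<longlonglongrightarrow> g x * iexp (t * x)"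
          unfolding seq by (intro tendsto_intros)
      qed
      show "AE x in lborel. norm (s N x) \<le> norm (cnj (cgauss 1 (of_real t) 1 x) * f x) + norm (cnj (cgauss 1 (of_real (- t)) 1 x) * f x)" for N
      proof (rule AE_I2)
        fix x
        have cg: "cmod (cgauss 1 (of_real r) 1 x) = exp (- x\<^sup>2 / 2) * exp (r * x)" for r
          by (simp add: cgauss_def flip: exp_add of_real_power)
        have "cmod (\<Sum>n<N. (\<i> * of_real (t * x)) ^ n /\<^sub>R fact n) \<le> (\<Sum>n<N. \<bar>t * x\<bar> ^ n /\<^sub>R fact n)"
          by (rule order_trans[OF norm_sum]) (simp add: norm_mult norm_power power_mult_distrib abs_mult)
        also have "\<dots> \<le> exp \<bar>t * x\<bar>"
          unfolding exp_def by (intro sum_le_suminf summable_exp_generic) auto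
        also have "\<dots> \<le> exp (t * x) + exp (- t * x)"
          by (auto simp: abs_if)
        finally have "cmod (s N x) \<le> cmod (g x) * (exp (t * x) + exp (- t * x))"
          unfolding seq norm_mult by (intro mult_left_mono) auto
        also have "\<dots> = norm (cnj (cgauss 1 (of_real t) 1 x) * f x) + norm (cnj (cgauss 1 (of_real (- t)) 1 x) * f x)"
          by (simp only: complex_mod_cnj norm_mult cg g_def norm_of_real abs_exp_cancel) (simp add: algebra_simps)
        finally show "norm (s N x) \<le> norm (cnj (cgauss 1 (of_real t) 1 x) * f x) + norm (cnj (cgauss 1 (of_real (- t)) 1 x) * f x)" .
      qed
    qed (auto simp: s_def)
    then show "(LINT x|lborel. g x * iexp (t * x)) = 0"
      by (simp add: sz LIMSEQ_const_iff)
  qed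
  then have "AE x in lborel. f x = 0"
    by eventually_elim (simp add: g_def)
  then have "to_l2r f = to_l2r (\<lambda>x. 0)"
    by (subst to_l2r_eq_iff) (auto simp: f sq_integrable_zero)
  then show ?thesis
    using f by (simp add: zero_l2r.abs_eq)
qed

lemma fock_ext: "(\<And>n. cinner (fock n) x = cinner (fock n) y) \<Longrightarrow> x = y"
  using fock_complete[of "x - y"] by (simp add: cinner.diff_right)

lemma norm_sum_fock:
  assumes "finite A"
  shows "(norm (\<Sum>n\<in>A. scaleC (a n) (fock n)))\<^sup>2 = (\<Sum>n\<in>A. (cmod (a n))\<^sup>2)"
proof -
  define S where "S = (\<Sum>n\<in>A. scaleC (a n) (fock n))"
  have c: "cinner (fock m) S = a m" if "m \<in> A" for m
  proof -
    have "cinner (fock m) S = (\<Sum>n\<in>A. if m = n then a n else 0)"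
      unfolding S_def cinner.sum_right cinner_scaleC_right fock_orthonormal by (intro sum.cong) auto
    then show ?thesis
      using assms that by simp
  qed
  have "complex_of_real ((norm S)\<^sup>2) = cinner S S"
    by (simp only: norm_sq_cinner)
  also have "\<dots> = (\<Sum>m\<in>A. cnj (a m) * cinner (fock m) S)"
    unfolding S_def by (subst cinner.sum_left) (simp only: cinner_scaleC_left)
  also have "\<dots> = (\<Sum>m\<in>A. cnj (a m) * a m)"
    using c by (intro sum.cong) auto
  also have "\<dots> = complex_of_real (\<Sum>n\<in>A. (cmod (a n))\<^sup>2)"
    by (simp only: of_real_sum complex_norm_square mult.commute[of "cnj _"])
  finally show ?thesis
    by (simp only: of_real_eq_iff S_def)
qed

lemma summable_fock:
  assumes "summable (\<lambda>n. (cmod (a n))\<^sup>2)"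
  shows "summable (\<lambda>n. scaleC (a n) (fock n))"
  unfolding summable_Cauchy
proof (intro allI impI)
  fix e :: real assume "e > 0"
  then have "e\<^sup>2 > 0" by simp
  then obtain N where N: "\<And>m n. m \<ge> N \<Longrightarrow> norm (\<Sum>n\<in>{m..<n}. (cmod (a n))\<^sup>2) < e\<^sup>2"
    using assms unfolding summable_Cauchy by blast
  have "norm (\<Sum>n\<in>{m..<n}. scaleC (a n) (fock n)) < e" if "m \<ge> N" for m n
  proof -
    have "(norm (\<Sum>n\<in>{m..<n}. scaleC (a n) (fock n)))\<^sup>2 < e\<^sup>2"
      using N[OF that, of n] by (subst norm_sum_fock) (auto simp: sum_nonneg)
    then show ?thesis
      using \<open>e > 0\<close> by (simp add: power2_less_imp_less)
  qed
  then show "\<exists>N. \<forall>m\<ge>N. \<forall>n. norm (\<Sum>n\<in>{m..<n}. scaleC (a n) (fock n)) < e"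
    by blast
qed

lemma cinner_fock_sums:
  assumes "(\<lambda>n. scaleC (a n) (fock n)) sums \<psi>"
  shows "cinner (fock m) \<psi> = a m"
proof -
  have "(\<lambda>n. cinner (fock m) (scaleC (a n) (fock n))) sums cinner (fock m) \<psi>"
    by (rule bounded_linear.sums[OF cinner.bounded_linear_right assms])
  moreover have "(\<lambda>n. cinner (fock m) (scaleC (a n) (fock n))) sums a m"
    using sums_single[of m a] by (simp add: cinner_scaleC_right fock_orthonormal if_distrib eq_commute[of m] cong: if_cong)
  ultimately show ?thesis
    by (rule sums_unique2)
qed

lemma bessel_fock: "(\<Sum>n<N. (cmod (cinner (fock n) \<psi>))\<^sup>2) \<le> (norm \<psi>)\<^sup>2"
proof -
  define \<phi> where "\<phi> = (\<Sum>n<N. scaleC (cinner (fock n) \<psi>) (fock n))"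
  have n\<phi>: "(norm \<phi>)\<^sup>2 = (\<Sum>n<N. (cmod (cinner (fock n) \<psi>))\<^sup>2)"
    unfolding \<phi>_def by (rule norm_sum_fock) simp
  have "cinner \<phi> \<psi> = complex_of_real ((norm \<phi>)\<^sup>2)"
    unfolding n\<phi> unfolding \<phi>_def
    by (simp only: cinner.sum_left cinner_scaleC_left of_real_sum complex_norm_square mult.commute[of "cnj _"])
  then have "(norm \<phi>)\<^sup>2 \<le> norm \<phi> * norm \<psi>"
    using cmod_cinner_le[of \<phi> \<psi>] by (simp add: norm_power)
  then have "norm \<phi> \<le> norm \<psi>"
    by (cases "norm \<phi> = 0") (auto simp: power2_eq_square)
  then show ?thesis
    by (simp flip: n\<phi> add: power_mono)
qed

lemma summable_fock_coeff: "summable (\<lambda>n. (cmod (cinner (fock n) \<psi>))\<^sup>2)"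
  by (rule summableI_nonneg_bounded[OF _ bessel_fock]) simp

lemma fock_expansion: "(\<lambda>n. scaleC (cinner (fock n) \<psi>) (fock n)) sums \<psi>"
proof -
  obtain \<phi> where \<phi>: "(\<lambda>n. scaleC (cinner (fock n) \<psi>) (fock n)) sums \<phi>"
    using summable_fock[OF summable_fock_coeff] by (auto simp: summable_def)
  have "\<phi> = \<psi>"
    by (rule fock_ext) (rule cinner_fock_sums[OF \<phi>])
  with \<phi> show ?thesis by simp
qed

lemma parseval: "(\<lambda>n. cnj (cinner (fock n) \<phi>) * cinner (fock n) \<psi>) sums cinner \<phi> \<psi>"
proof -
  have "(\<lambda>n. cinner (scaleC (cinner (fock n) \<phi>) (fock n)) \<psi>) sums cinner \<phi> \<psi>"
    by (rule bounded_linear.sums[OF cinner.bounded_linear_left fock_expansion])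
  then show ?thesis
    by (simp add: cinner_scaleC_left)
qed

lemma parseval_norm: "(\<lambda>n. (cmod (cinner (fock n) \<psi>))\<^sup>2) sums (norm \<psi>)\<^sup>2"
proof -
  have "(\<lambda>n. complex_of_real ((cmod (cinner (fock n) \<psi>))\<^sup>2)) sums complex_of_real ((norm \<psi>)\<^sup>2)"
    using parseval[of \<psi> \<psi>] by (simp only: norm_sq_cinner complex_norm_square mult.commute[of "cnj _"])
  then show ?thesis
    by (simp only: sums_of_real_iff)
qed

lemma ex_l2r_fock_coeff:
  assumes "summable (\<lambda>n. (cmod (a n))\<^sup>2)"
  obtains \<psi> where "\<And>n. cinner (fock n) \<psi> = a n"
  using summable_fock[OF assms] cinner_fock_sums by (meson summable_def)

section \<open>Quadratic forms of positive operators; adjoints\<close>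

section \<open>Bounded operators\<close>

lemma complex_linearD: "complex_linear A \<Longrightarrow> A (scaleC c \<psi>) = scaleC c (A \<psi>)"
  by (simp add: complex_linear_def)

lemma positive_opD:
  assumes "positive_op A"
  shows "complex_linear A" "0 \<le> Re (cinner \<psi> (A \<psi>))" "Im (cinner \<psi> (A \<psi>)) = 0"
    "cinner \<psi> (A \<psi>) = of_real (Re (cinner \<psi> (A \<psi>)))"
  using assms by (auto simp: positive_op_def complex_is_Real_iff complex_eq_iff)

lemma positive_opI:
  assumes "complex_linear A" "\<And>\<psi>. \<exists>r\<ge>0. cinner \<psi> (A \<psi>) = complex_of_real r"
  shows "positive_op A"
  unfolding positive_op_def
proof (intro conjI allI)
  fix \<psi>
  obtain r where "r \<ge> 0" "cinner \<psi> (A \<psi>) = complex_of_real r"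
    using assms(2) by blast
  then show "cinner \<psi> (A \<psi>) \<in> \<real>" "0 \<le> Re (cinner \<psi> (A \<psi>))"
    by simp_all
qed (rule assms(1))

text \<open>Polarization: the form is real at \<phi> + \<psi> and at \<phi> + i \<psi>. The first
  gives equality of the imaginary parts, the second of the real parts.\<close>

lemma positive_op_hermitian:
  assumes "positive_op A"
  shows "cinner \<phi> (A \<psi>) = cinner (A \<phi>) \<psi>"
proof -
  note [simp] = cinner_add_left cinner_add_right cinner_scaleC_left cinner_scaleC_right
    blinfun.add_right complex_linearD[OF positive_opD(1)[OF assms]]
  have d: "Im (cinner \<zeta> (A \<zeta>)) = 0" for \<zeta>
    by (rule positive_opD(3)[OF assms])
  have 1: "Im (cinner \<phi> (A \<psi>)) + Im (cinner \<psi> (A \<phi>)) = 0"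
    using d[of "\<phi> + \<psi>"] d[of \<phi>] d[of \<psi>] by simp
  have 2: "Re (cinner \<phi> (A \<psi>)) - Re (cinner \<psi> (A \<phi>)) = 0"
    using d[of "\<phi> + scaleC \<i> \<psi>"] d[of \<phi>] d[of \<psi>] by simp
  have "cinner \<phi> (A \<psi>) = cnj (cinner \<psi> (A \<phi>))"
    using 1 2 by (simp add: complex_eq_iff)
  then show ?thesis
    by (simp flip: cinner_commute)
qed

text \<open>With z = <\<phi>, A \<psi>>, the form at \<phi> - s (cnj z) \<psi> is a nonnegative
  quadratic polynomial in the real number s. Its value at s = 1 / b gives the bound; for b = 0 a
  large s forces z = 0.\<close>

lemma positive_op_cauchy_schwarz:
  assumes "positive_op A"
  shows "(cmod (cinner \<phi> (A \<psi>)))\<^sup>2 \<le> Re (cinner \<phi> (A \<phi>)) * Re (cinner \<psi> (A \<psi>))"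
proof -
  define z where "z = cinner \<phi> (A \<psi>)"
  define a where "a = Re (cinner \<phi> (A \<phi>))"
  define b where "b = Re (cinner \<psi> (A \<psi>))"
  have a: "cinner \<phi> (A \<phi>) = of_real a" and b: "cinner \<psi> (A \<psi>) = of_real b" and ab: "a \<ge> 0" "b \<ge> 0"
    using positive_opD[OF assms] by (auto simp: a_def b_def)
  have z': "cinner \<psi> (A \<phi>) = cnj z"
    unfolding z_def by (subst cinner_commute) (simp add: positive_op_hermitian[OF assms])
  have q: "0 \<le> a - 2 * s * (cmod z)\<^sup>2 + s\<^sup>2 * (cmod z)\<^sup>2 * b" for s :: real
  proof -
    define c where "c = complex_of_real (- s) * cnj z"
    have "0 \<le> Re (cinner (\<phi> + scaleC c \<psi>) (A (\<phi> + scaleC c \<psi>)))"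
      by (rule positive_opD(2)[OF assms])
    also have "cinner (\<phi> + scaleC c \<psi>) (A (\<phi> + scaleC c \<psi>)) = of_real a + c * z + cnj (c * z) + (c * cnj c) * of_real b"
      by (simp add: cinner_add_left cinner_add_right cinner_scaleC_left cinner_scaleC_right blinfun.add_right
          complex_linearD[OF positive_opD(1)[OF assms]] a b z' algebra_simps flip: z_def)
    also have "c * z = of_real (- s * (cmod z)\<^sup>2)"
      by (simp only: c_def of_real_mult complex_norm_square mult.assoc mult.commute[of z])
    also have "c * cnj c = of_real (s\<^sup>2 * (cmod z)\<^sup>2)"
      by (simp only: complex_norm_square[symmetric] c_def norm_mult norm_of_real complex_mod_cnj power_mult_distrib power2_abs power2_minus)
    finally show ?thesis
      by (simp add: algebra_simps)
  qed
  have "(cmod z)\<^sup>2 \<le> a * b"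
  proof (cases "b = 0")
    case True
    have "z = 0"
    proof (rule ccontr)
      assume "z \<noteq> 0"
      then show False
        using q[of "(a + 1) / (2 * (cmod z)\<^sup>2)"] True by simp
    qed
    then show ?thesis using True by simp
  next
    case False
    then have "b > 0" using ab by simp
    then show ?thesis
      using q[of "1 / b"] by (simp add: field_simps power2_eq_square)
  qed
  then show ?thesis
    by (simp add: z_def a_def b_def)
qed

text \<open>Cauchy-Schwarz for the form, applied to A \<psi> and \<psi>, bounds |A \<psi>|^4 by K^2
  |A \<psi>|^2 |\<psi>|^2.\<close>

lemma positive_op_norm_le:
  assumes A: "positive_op A" and K: "\<And>\<psi>. Re (cinner \<psi> (A \<psi>)) \<le> K * (norm \<psi>)\<^sup>2" and "K \<ge> 0"
  shows "norm (A \<psi>) \<le> K * norm \<psi>"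
proof (cases "A \<psi> = 0")
  case False
  have "((norm (A \<psi>))\<^sup>2)\<^sup>2 = (cmod (cinner (A \<psi>) (A \<psi>)))\<^sup>2"
    by (simp only: norm_sq_cinner norm_of_real power2_abs)
  also have "\<dots> \<le> Re (cinner (A \<psi>) (A (A \<psi>))) * Re (cinner \<psi> (A \<psi>))"
    by (rule positive_op_cauchy_schwarz[OF A])
  also have "\<dots> \<le> (K * (norm (A \<psi>))\<^sup>2) * (K * (norm \<psi>)\<^sup>2)"
    by (intro mult_mono K positive_opD[OF A]) (use assms(3) in auto)
  also have "\<dots> = (norm (A \<psi>))\<^sup>2 * (K * norm \<psi>)\<^sup>2"
    by (simp add: power_mult_distrib power2_eq_square)
  finally have "(norm (A \<psi>))\<^sup>2 \<le> (K * norm \<psi>)\<^sup>2"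
    using False by (simp add: power2_eq_square)
  then show ?thesis
    by (rule power2_le_imp_le) (simp add: assms(3))
qed (use assms(3) in simp)

lemma positive_op_eq_0:
  assumes "positive_op A" "Re (cinner \<psi> (A \<psi>)) = 0"
  shows "A \<psi> = 0"
  using positive_op_cauchy_schwarz[OF assms(1), of "A \<psi>" \<psi>] assms(2) by (simp add: norm_sq_cinner)

lemma cinner_op_le_norm:
  fixes A :: l2op
  shows "Re (cinner \<psi> (A \<psi>)) \<le> norm A * (norm \<psi>)\<^sup>2"
proof -
  have "Re (cinner \<psi> (A \<psi>)) \<le> norm \<psi> * norm (A \<psi>)"
    using complex_Re_le_cmod cmod_cinner_le order_trans by blast
  also have "\<dots> \<le> norm \<psi> * (norm A * norm \<psi>)"
    by (intro mult_left_mono norm_blinfun) simp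
  finally show ?thesis by (simp add: power2_eq_square mult_ac)
qed

lemma complex_linear_compose: "complex_linear A \<Longrightarrow> complex_linear B \<Longrightarrow> complex_linear (A o\<^sub>L B)"
  by (simp add: complex_linear_def)

lemma complex_linear_id: "complex_linear id_blinfun"
  by (simp add: complex_linear_def)

lemma complex_linear_add: "complex_linear A \<Longrightarrow> complex_linear B \<Longrightarrow> complex_linear (A + B)"
  by (simp add: complex_linear_def blinfun.add_left scaleC_add_right)

lemma complex_linear_diff: "complex_linear A \<Longrightarrow> complex_linear B \<Longrightarrow> complex_linear (A - B)"
  by (simp add: complex_linear_def blinfun.diff_left scaleC.diff_right)

lemma complex_linear_scaleR: "complex_linear A \<Longrightarrow> complex_linear (r *\<^sub>R A)"
proof -
  assume A: "complex_linear A"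
  have "scaleC (of_real r) (scaleC c (A \<psi>)) = scaleC c (scaleC (of_real r) (A \<psi>))" for c \<psi>
    by (simp only: scaleC_scaleC mult.commute)
  then show ?thesis
    by (simp only: complex_linear_def blinfun.scaleR_left complex_linearD[OF A] scaleC_of_real simp_thms)
qed

lemma complex_linear_zero: "complex_linear 0"
  by (simp add: complex_linear_def scaleC.zero_right)

lemma complex_linear_limit:
  assumes "\<And>n. complex_linear (Y n)" "Y \<longlonglongrightarrow> A"
  shows "complex_linear A"
  unfolding complex_linear_def
proof (intro allI)
  fix c \<psi>
  have "(\<lambda>n. Y n (scaleC c \<psi>)) \<longlonglongrightarrow> A (scaleC c \<psi>)"
    by (intro tendsto_intros assms)
  moreover have "(\<lambda>n. scaleC c (Y n \<psi>)) \<longlonglongrightarrow> scaleC c (A \<psi>)"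
    by (intro scaleC.tendsto tendsto_intros assms)
  ultimately show "A (scaleC c \<psi>) = scaleC c (A \<psi>)"
    using assms(1) by (simp add: complex_linearD LIMSEQ_unique)
qed

lemma ex_complex_linear_op:
  assumes "\<And>x y. f (x + y) = f x + f y" "\<And>c x. f (scaleC c x) = scaleC c (f x)" "\<And>x. norm (f x) \<le> norm x * K"
  obtains F :: l2op where "complex_linear F" "\<And>x. F x = f x"
proof -
  have "bounded_linear f"
    by (rule bounded_linear_intro[where K = K]) (use assms in \<open>auto simp flip: scaleC_of_real\<close>)
  then have "\<And>x. Blinfun f x = f x"
    by (simp add: bounded_linear_Blinfun_apply)
  then show ?thesis
    using that[of "Blinfun f"] assms(2) by (simp add: complex_linear_def)
qed

text \<open>The vector A' \<phi> is assembled from its Fock coefficients <A e_n, \<phi>>. They are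
  square-summable: if \<zeta> is the finite Fock sum with these very coefficients, then |\<zeta>|^2
  = <A \<zeta>, \<phi>> \<le> |A| |\<zeta>| |\<phi>|.\<close>

lemma ex_adjoint:
  assumes A: "complex_linear A"
  obtains A' :: l2op where "complex_linear A'" "\<And>\<phi> \<psi>. cinner \<phi> (A \<psi>) = cinner (A' \<phi>) \<psi>"
proof -
  have "\<exists>\<xi>. \<forall>n. cinner (fock n) \<xi> = cinner (A (fock n)) \<phi>" for \<phi>
  proof -
    have "(\<Sum>n<N. (cmod (cinner (A (fock n)) \<phi>))\<^sup>2) \<le> (norm A * norm \<phi>)\<^sup>2" for N
    proof -
      define a where "a n = cinner (A (fock n)) \<phi>" for n
      define \<zeta> where "\<zeta> = (\<Sum>n<N. scaleC (a n) (fock n))"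
      have n: "(norm \<zeta>)\<^sup>2 = (\<Sum>n<N. (cmod (a n))\<^sup>2)"
        unfolding \<zeta>_def by (rule norm_sum_fock) simp
      have "cinner (A \<zeta>) \<phi> = (\<Sum>n<N. cnj (a n) * a n)"
        by (simp add: \<zeta>_def blinfun.sum_right cinner.sum_left complex_linearD[OF A] cinner_scaleC_left a_def)
      also have "\<dots> = complex_of_real ((norm \<zeta>)\<^sup>2)"
        unfolding n by (simp only: of_real_sum complex_norm_square mult.commute[of "cnj _"])
      finally have "(norm \<zeta>)\<^sup>2 = cmod (cinner (A \<zeta>) \<phi>)"
        by (simp add: norm_power)
      also have "\<dots> \<le> norm (A \<zeta>) * norm \<phi>"
        by (rule cmod_cinner_le)
      also have "\<dots> \<le> (norm A * norm \<zeta>) * norm \<phi>"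
        by (intro mult_right_mono norm_blinfun) simp
      finally have "norm \<zeta> \<le> norm A * norm \<phi>"
        by (cases "norm \<zeta> = 0") (auto simp: power2_eq_square)
      then have "(norm \<zeta>)\<^sup>2 \<le> (norm A * norm \<phi>)\<^sup>2"
        by (intro power_mono) auto
      then show ?thesis
        by (simp only: n a_def)
    qed
    then have "summable (\<lambda>n. (cmod (cinner (A (fock n)) \<phi>))\<^sup>2)"
      by (intro summableI_nonneg_bounded) auto
    then show ?thesis
      by (rule ex_l2r_fock_coeff) blast
  qed
  then obtain f where f: "\<And>\<phi> n. cinner (fock n) (f \<phi>) = cinner (A (fock n)) \<phi>"
    by metis
  have adj: "cinner \<psi> (f \<phi>) = cinner (A \<psi>) \<phi>" for \<phi> \<psi>
  proof (rule sums_unique2)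
    show "(\<lambda>n. cnj (cinner (fock n) \<psi>) * cinner (fock n) (f \<phi>)) sums cinner \<psi> (f \<phi>)"
      by (rule parseval)
    have "(\<lambda>n. cinner (A (scaleC (cinner (fock n) \<psi>) (fock n))) \<phi>) sums cinner (A \<psi>) \<phi>"
      by (intro bounded_linear.sums[OF cinner.bounded_linear_left] bounded_linear.sums[OF blinfun.bounded_linear_right] fock_expansion)
    then show "(\<lambda>n. cnj (cinner (fock n) \<psi>) * cinner (fock n) (f \<phi>)) sums cinner (A \<psi>) \<phi>"
      by (simp add: complex_linearD[OF A] cinner_scaleC_left f)
  qed
  obtain A' :: l2op where "complex_linear A'" "\<And>x. A' x = f x"
  proof (rule ex_complex_linear_op[of f "norm A"])
    show "f (x + y) = f x + f y" for x y
      by (rule cinner_ext) (simp add: adj cinner_add_right)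
    show "f (scaleC c x) = scaleC c (f x)" for c x
      by (rule cinner_ext) (simp add: adj cinner_scaleC_right)
    show "norm (f x) \<le> norm x * norm A" for x
    proof -
      have "(norm (f x))\<^sup>2 = cmod (cinner (f x) (f x))"
        by (simp add: norm_sq_cinner norm_power)
      also have "\<dots> \<le> norm (A (f x)) * norm x"
        unfolding adj by (rule cmod_cinner_le)
      also have "\<dots> \<le> (norm A * norm (f x)) * norm x"
        by (intro mult_right_mono norm_blinfun) simp
      finally show ?thesis
        by (cases "norm (f x) = 0") (auto simp: power2_eq_square mult_ac)
    qed
  qed blast
  then show ?thesis
    using that[of A'] adj by (metis cinner_commute)
qed

lemma adjoint_contraction:
  assumes adj: "\<And>\<phi> \<psi>. cinner \<phi> (A \<psi>) = cinner (A' \<phi>) \<psi>" and A: "\<And>\<psi>. norm (A \<psi>) \<le> norm \<psi>"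
  shows "norm (A' \<phi>) \<le> norm \<phi>"
proof -
  have "(norm (A' \<phi>))\<^sup>2 = cmod (cinner (A' \<phi>) (A' \<phi>))"
    by (simp add: norm_sq_cinner norm_power)
  also have "\<dots> \<le> norm \<phi> * norm (A (A' \<phi>))"
    unfolding adj[symmetric] by (rule cmod_cinner_le)
  also have "\<dots> \<le> norm \<phi> * norm (A' \<phi>)"
    by (intro mult_left_mono A) simp
  finally show ?thesis
    by (cases "norm (A' \<phi>) = 0") (auto simp: power2_eq_square)
qed

section \<open>Existence and uniqueness of positive square roots\<close>

section \<open>Square roots and absolute values\<close>

text \<open>With \<open>X = 1 - C\<close>, the iteration \<open>Y \<mapsto> (X + Y\<^sup>2) / 2\<close> converges to \<open>1 - \<surd>C\<close>; its increments
  are dominated by those of the scalar iteration \<open>y \<mapsto> (1 + y\<^sup>2) / 2\<close> started at \<open>0\<close>.\<close>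

primrec sqrt_iter :: "l2op \<Rightarrow> nat \<Rightarrow> l2op" where
  "sqrt_iter X 0 = 0"
| "sqrt_iter X (Suc n) = (1 / 2) *\<^sub>R (X + (sqrt_iter X n o\<^sub>L sqrt_iter X n))"

primrec scalar_sqrt_iter :: "nat \<Rightarrow> real" where
  "scalar_sqrt_iter 0 = 0"
| "scalar_sqrt_iter (Suc n) = (1 + scalar_sqrt_iter n ^ 2) / 2"

lemma scalar_sqrt_iter_bounds: "0 \<le> scalar_sqrt_iter n \<and> scalar_sqrt_iter n \<le> 1"
proof (induction n)
  case (Suc n)
  then have "scalar_sqrt_iter n ^ 2 \<le> 1"
    by (simp add: power_le_one)
  then show ?case by simp
qed simp

lemma norm_sqrt_iter_le:
  assumes "norm X \<le> 1"
  shows "norm (sqrt_iter X n) \<le> scalar_sqrt_iter n"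
proof (induction n)
  case (Suc n)
  have "norm (sqrt_iter X n o\<^sub>L sqrt_iter X n) \<le> scalar_sqrt_iter n * scalar_sqrt_iter n"
    using Suc scalar_sqrt_iter_bounds[of n] by (intro order_trans[OF norm_blinfun_compose] mult_mono) auto
  then have "norm (X + (sqrt_iter X n o\<^sub>L sqrt_iter X n)) \<le> 1 + scalar_sqrt_iter n * scalar_sqrt_iter n"
    using norm_triangle_ineq[of X "sqrt_iter X n o\<^sub>L sqrt_iter X n"] assms by linarith
  then show ?case
    by (simp add: power2_eq_square)
qed simp

lemma norm_sqrt_iter_Suc_diff_le:
  assumes "norm X \<le> 1"
  shows "norm (sqrt_iter X (Suc n) - sqrt_iter X n) \<le> scalar_sqrt_iter (Suc n) - scalar_sqrt_iter n"
proof (induction n)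
  case 0
  then show ?case using assms by simp
next
  case (Suc n)
  let ?Y = "sqrt_iter X" and ?y = "scalar_sqrt_iter"
  define a where "a = ?Y (Suc n)"
  define b where "b = ?Y n"
  have ca: "?Y (Suc (Suc n)) = (1/2) *\<^sub>R (X + (a o\<^sub>L a))"
    unfolding a_def by (rule sqrt_iter.simps(2))
  have ab: "a = (1/2) *\<^sub>R (X + (b o\<^sub>L b))"
    unfolding a_def b_def by (rule sqrt_iter.simps(2))
  have "?Y (Suc (Suc n)) - a = (1/2) *\<^sub>R (X + (a o\<^sub>L a)) - (1/2) *\<^sub>R (X + (b o\<^sub>L b))"
    by (simp only: ca ab[symmetric])
  \<comment> \<open>The splitting a a - b b = a (a - b) + (a - b) b is valid for noncommuting
    factors. The scalar iteration satisfies the same identity, which closes the induction.\<close>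
  also have "\<dots> = (1/2) *\<^sub>R ((a o\<^sub>L (a - b)) + ((a - b) o\<^sub>L b))"
    by (rule blinfun_eqI)
      (simp add: blinfun.diff_left blinfun.add_left blinfun.scaleR_left blinfun.diff_right algebra_simps)
  finally have "norm (?Y (Suc (Suc n)) - ?Y (Suc n))
     = (1/2) * norm ((?Y (Suc n) o\<^sub>L (?Y (Suc n) - ?Y n)) + ((?Y (Suc n) - ?Y n) o\<^sub>L ?Y n))"
    by (simp only: a_def b_def norm_scaleR)
  also have "\<dots> \<le> (1/2) * (?y (Suc n) * (?y (Suc n) - ?y n) + (?y (Suc n) - ?y n) * ?y n)"
  proof (intro mult_left_mono norm_triangle_le add_mono)
    show "norm (?Y (Suc n) o\<^sub>L (?Y (Suc n) - ?Y n)) \<le> ?y (Suc n) * (?y (Suc n) - ?y n)"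
      using Suc norm_sqrt_iter_le[OF assms, of "Suc n"] order_trans[OF norm_ge_zero Suc] scalar_sqrt_iter_bounds[of "Suc n"]
      by (intro order_trans[OF norm_blinfun_compose] mult_mono) auto
    show "norm ((?Y (Suc n) - ?Y n) o\<^sub>L ?Y n) \<le> (?y (Suc n) - ?y n) * ?y n"
      using Suc norm_sqrt_iter_le[OF assms, of n] order_trans[OF norm_ge_zero Suc]
      by (intro order_trans[OF norm_blinfun_compose] mult_mono) auto
  qed simp
  also have "\<dots> = ?y (Suc (Suc n)) - ?y (Suc n)"
    by (simp only: scalar_sqrt_iter.simps(2)[of "Suc n"] scalar_sqrt_iter.simps(2)[of n]) (simp add: field_simps power2_eq_square)
  finally show ?case .
qed

lemma convergent_sqrt_iter:
  assumes "norm X \<le> 1"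
  shows "convergent (sqrt_iter X)"
proof -
  let ?Y = "sqrt_iter X" and ?y = "scalar_sqrt_iter"
  have mono: "incseq ?y"
    using order_trans[OF norm_ge_zero norm_sqrt_iter_Suc_diff_le[OF assms]] by (intro incseq_SucI) simp
  obtain L where "?y \<longlonglongrightarrow> L"
    using incseq_convergent[OF mono, of 1] scalar_sqrt_iter_bounds by blast
  then have "convergent ?y"
    by (auto simp: convergent_def)
  then have "summable (\<lambda>n. ?y (Suc n) - ?y n)"
    by (auto simp: convergent_def simp del: scalar_sqrt_iter.simps intro: telescope_summable)
  then have "summable (\<lambda>n. ?Y (Suc n) - ?Y n)"
    by (rule summable_comparison_test'[of _ 0]) (rule norm_sqrt_iter_Suc_diff_le[OF assms])
  then show ?thesis
    using sum_lessThan_telescope[of ?Y] by (simp add: summable_iff_convergent del: sqrt_iter.simps(2))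
qed

text \<open>From 0 \<le> C \<le> 1 follows |1 - C| \<le> 1, so the iteration converges in norm. The
  iterates are polynomials in C, hence the limit commutes with everything that commutes with C; that
  last conclusion is what uniqueness of the root rests on.\<close>

lemma ex_positive_sqrt_contraction:
  assumes C: "positive_op C" and le: "\<And>\<psi>. Re (cinner \<psi> (C \<psi>)) \<le> (norm \<psi>)\<^sup>2"
  obtains S where "positive_op S" "S o\<^sub>L S = C" "\<And>D. D o\<^sub>L C = C o\<^sub>L D \<Longrightarrow> D o\<^sub>L S = S o\<^sub>L D"
proof -
  define X where "X = id_blinfun - C"
  have X: "positive_op X"
  proof (rule positive_opI)
    show "complex_linear X"
      unfolding X_def by (intro complex_linear_diff complex_linear_id positive_opD[OF C])
    fix \<psi>
    have "cinner \<psi> (X \<psi>) = of_real ((norm \<psi>)\<^sup>2 - Re (cinner \<psi> (C \<psi>)))"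
      using positive_opD(4)[OF C, of \<psi>] by (simp add: X_def blinfun.diff_left cinner.diff_right norm_sq_cinner)
    then show "\<exists>r\<ge>0. cinner \<psi> (X \<psi>) = of_real r"
      using le[of \<psi>] by (intro exI[of _ "(norm \<psi>)\<^sup>2 - Re (cinner \<psi> (C \<psi>))"]) auto
  qed
  have "norm (X \<psi>) \<le> 1 * norm \<psi>" for \<psi>
  proof (rule positive_op_norm_le[OF X])
    show "Re (cinner \<psi> (X \<psi>)) \<le> 1 * (norm \<psi>)\<^sup>2" for \<psi>
      using positive_opD(2)[OF C, of \<psi>] by (simp add: X_def blinfun.diff_left cinner.diff_right norm_sq_cinner)
  qed simp
  then have nX: "norm X \<le> 1"
    by (intro norm_blinfun_bound) auto
  obtain Y where Y: "sqrt_iter X \<longlonglongrightarrow> Y"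
    using convergent_sqrt_iter[OF nX] by (auto simp: convergent_def)
  have "(\<lambda>n. sqrt_iter X (Suc n)) \<longlonglongrightarrow> (1/2) *\<^sub>R (X + (Y o\<^sub>L Y))"
    unfolding sqrt_iter.simps
    by (intro tendsto_intros bounded_bilinear.tendsto[OF bounded_bilinear_blinfun_compose] Y)
  \<comment> \<open>With S = 1 - Y and C = 1 - X, the fixed-point equation 2 Y = X + Y^2 says S^2 =
    C.\<close>
  then have fix_eq: "Y = (1/2) *\<^sub>R (X + (Y o\<^sub>L Y))"
    using LIMSEQ_Suc[OF Y] LIMSEQ_unique by blast
  have lin: "complex_linear (sqrt_iter X n)" for n
    by (induction n) (auto intro!: complex_linear_zero complex_linear_scaleR complex_linear_add complex_linear_compose positive_opD[OF X])
  have herm: "cinner \<phi> (sqrt_iter X n \<psi>) = cinner (sqrt_iter X n \<phi>) \<psi>" for n \<phi> \<psi>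
    by (induction n arbitrary: \<phi> \<psi>)
      (simp_all add: cinner.zero_left cinner.zero_right blinfun.scaleR_left blinfun.add_left cinner.scaleR_left cinner.scaleR_right
        cinner_add_left cinner_add_right positive_op_hermitian[OF X])
  have nY: "norm Y \<le> 1"
    by (rule LIMSEQ_le_const2[OF tendsto_norm[OF Y]])
      (use norm_sqrt_iter_le[OF nX] scalar_sqrt_iter_bounds in \<open>auto intro: order_trans\<close>)
  have hY: "cinner \<phi> (Y \<psi>) = cinner (Y \<phi>) \<psi>" for \<phi> \<psi>
  proof (rule LIMSEQ_unique)
    show "(\<lambda>n. cinner \<phi> (sqrt_iter X n \<psi>)) \<longlonglongrightarrow> cinner \<phi> (Y \<psi>)"
      by (intro cinner.tendsto tendsto_intros Y)
    show "(\<lambda>n. cinner \<phi> (sqrt_iter X n \<psi>)) \<longlonglongrightarrow> cinner (Y \<phi>) \<psi>"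
      unfolding herm by (intro cinner.tendsto tendsto_intros Y)
  qed
  define S where "S = id_blinfun - Y"
  have S: "positive_op S"
  proof (rule positive_opI)
    show "complex_linear S"
      unfolding S_def by (intro complex_linear_diff complex_linear_id complex_linear_limit[OF lin Y])
    fix \<psi>
    have "Im (cinner \<psi> (Y \<psi>)) = 0"
      using hY[of \<psi> \<psi>] cinner_commute[of \<psi> "Y \<psi>"] by (simp add: complex_eq_iff)
    then have "cinner \<psi> (S \<psi>) = of_real ((norm \<psi>)\<^sup>2 - Re (cinner \<psi> (Y \<psi>)))"
      by (simp add: S_def blinfun.diff_left cinner.diff_right norm_sq_cinner complex_eq_iff)
    moreover have "Re (cinner \<psi> (Y \<psi>)) \<le> (norm \<psi>)\<^sup>2"
      using cinner_op_le_norm[of \<psi> Y] mult_right_mono[OF nY, of "(norm \<psi>)\<^sup>2"] by simp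
    ultimately show "\<exists>r\<ge>0. cinner \<psi> (S \<psi>) = of_real r"
      by (intro exI[of _ "(norm \<psi>)\<^sup>2 - Re (cinner \<psi> (Y \<psi>))"]) auto
  qed
  have SS: "S o\<^sub>L S = C"
  proof (rule blinfun_eqI)
    fix \<psi>
    have "2 *\<^sub>R Y = X + (Y o\<^sub>L Y)"
      by (subst fix_eq) simp
    then have "(2 *\<^sub>R Y) \<psi> = (X + (Y o\<^sub>L Y)) \<psi>"
      by simp
    then have "Y \<psi> + Y \<psi> = \<psi> - C \<psi> + Y (Y \<psi>)"
      by (simp add: blinfun.scaleR_left blinfun.add_left X_def blinfun.diff_left scaleR_2)
    then show "(S o\<^sub>L S) \<psi> = C \<psi>"
      by (simp add: S_def blinfun.diff_left blinfun.diff_right algebra_simps)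
  qed
  have comm: "D o\<^sub>L S = S o\<^sub>L D" if D: "D o\<^sub>L C = C o\<^sub>L D" for D
  proof -
    have DC: "D (C x) = C (D x)" for x
      using arg_cong[OF D, of "\<lambda>F. blinfun_apply F x"] by simp
    have DX: "D (X x) = X (D x)" for x
      by (simp add: X_def blinfun.diff_left blinfun.diff_right DC)
    have DY: "D (sqrt_iter X n x) = sqrt_iter X n (D x)" for n x
      by (induction n arbitrary: x) (simp_all add: blinfun.scaleR_left blinfun.add_left blinfun.scaleR_right blinfun.add_right DX)
    have "D (Y x) = Y (D x)" for x
    proof (rule LIMSEQ_unique)
      show "(\<lambda>n. D (sqrt_iter X n x)) \<longlonglongrightarrow> D (Y x)"
        by (intro tendsto_intros Y)
      show "(\<lambda>n. D (sqrt_iter X n x)) \<longlonglongrightarrow> Y (D x)"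
        unfolding DY by (intro tendsto_intros Y)
    qed
    then show ?thesis
      by (intro blinfun_eqI) (simp add: S_def blinfun.diff_left blinfun.diff_right)
  qed
  show ?thesis
    using that S SS comm by blast
qed

lemma ex_positive_sqrt:
  assumes C: "positive_op C"
  obtains S where "positive_op S" "S o\<^sub>L S = C" "\<And>D. D o\<^sub>L C = C o\<^sub>L D \<Longrightarrow> D o\<^sub>L S = S o\<^sub>L D"
proof -
  define c where "c = norm C + 1"
  have c: "c > 0" "norm C \<le> c"
    by (auto simp: c_def add_nonneg_pos)
  have scale: "positive_op (r *\<^sub>R A)" if "positive_op A" "r \<ge> 0" for A r
  proof (rule positive_opI)
    fix \<psi>
    show "\<exists>s\<ge>0. cinner \<psi> ((r *\<^sub>R A) \<psi>) = of_real s"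
      using positive_opD(2)[OF that(1), of \<psi>] positive_opD(4)[OF that(1), of \<psi>] that(2)
      by (intro exI[of _ "r * Re (cinner \<psi> (A \<psi>))"]) (simp add: blinfun.scaleR_left cinner.scaleR_right scaleR_conv_of_real)
  qed (intro complex_linear_scaleR positive_opD that)
  obtain S where S: "positive_op S" "S o\<^sub>L S = (1 / c) *\<^sub>R C"
    "\<And>D. D o\<^sub>L ((1 / c) *\<^sub>R C) = ((1 / c) *\<^sub>R C) o\<^sub>L D \<Longrightarrow> D o\<^sub>L S = S o\<^sub>L D"
  proof (rule ex_positive_sqrt_contraction)
    show "positive_op ((1 / c) *\<^sub>R C)"
      using c by (intro scale C) auto
    fix \<psi>
    have "Re (cinner \<psi> (C \<psi>)) \<le> c * (norm \<psi>)\<^sup>2"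
      using cinner_op_le_norm[of \<psi> C] mult_right_mono[OF c(2), of "(norm \<psi>)\<^sup>2"] by simp
    then show "Re (cinner \<psi> (((1 / c) *\<^sub>R C) \<psi>)) \<le> (norm \<psi>)\<^sup>2"
      using c by (simp add: blinfun.scaleR_left cinner.scaleR_right field_simps)
  qed blast
  show ?thesis
  proof (rule that[of "sqrt c *\<^sub>R S"])
    show "positive_op (sqrt c *\<^sub>R S)"
      using c by (intro scale S) auto
    have SS: "S (S x) = (1 / c) *\<^sub>R C x" for x
      using arg_cong[OF S(2), of "\<lambda>F. blinfun_apply F x"] by (simp add: blinfun.scaleR_left)
    show "(sqrt c *\<^sub>R S) o\<^sub>L (sqrt c *\<^sub>R S) = C"
      using c by (intro blinfun_eqI) (simp add: blinfun.scaleR_left blinfun.scaleR_right SS)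
    fix D assume D: "D o\<^sub>L C = C o\<^sub>L D"
    have DC: "D (C x) = C (D x)" for x
      using arg_cong[OF D, of "\<lambda>F. blinfun_apply F x"] by simp
    have DS: "D o\<^sub>L S = S o\<^sub>L D"
      by (rule S(3), rule blinfun_eqI) (simp add: blinfun.scaleR_left blinfun.scaleR_right DC)
    have "D (S x) = S (D x)" for x
      using arg_cong[OF DS, of "\<lambda>F. blinfun_apply F x"] by simp
    then show "D o\<^sub>L (sqrt c *\<^sub>R S) = (sqrt c *\<^sub>R S) o\<^sub>L D"
      by (intro blinfun_eqI) (simp add: blinfun.scaleR_left blinfun.scaleR_right)
  qed
qed

lemma positive_op_square: 
  assumes "positive_op P"
  shows "positive_op (P o\<^sub>L P)"
proof (rule positive_opI)
  fix \<psi>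
  show "\<exists>r\<ge>0. cinner \<psi> ((P o\<^sub>L P) \<psi>) = of_real r"
    by (intro exI[of _ "(norm (P \<psi>))\<^sup>2"]) (simp add: positive_op_hermitian[OF assms] norm_sq_cinner)
qed (intro complex_linear_compose positive_opD assms)

text \<open>Any root R commutes with R^2, hence with the root S just constructed, so (S + R)(S - R)
  = 0. For w = (S - R) x positivity then forces <w, S w> = <w, R w> = 0, so (S - R) w = 0, and |w|^2
  = <x, (S - R) w> = 0.\<close>

lemma positive_sqrt_unique:
  assumes P: "positive_op P" and Q: "positive_op Q" and PQ: "P o\<^sub>L P = Q o\<^sub>L Q"
  shows "P = Q"
proof -
  obtain S where S: "positive_op S" "S o\<^sub>L S = P o\<^sub>L P"
    and comm: "\<And>D. D o\<^sub>L (P o\<^sub>L P) = (P o\<^sub>L P) o\<^sub>L D \<Longrightarrow> D o\<^sub>L S = S o\<^sub>L D"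
    using ex_positive_sqrt[OF positive_op_square[OF P]] by blast
  have "R = S" if R: "positive_op R" "R o\<^sub>L R = P o\<^sub>L P" for R
  proof -
    have RR: "R (R x) = S (S x)" for x
      using arg_cong[OF trans[OF R(2) S(2)[symmetric]], of "\<lambda>F. blinfun_apply F x"] by simp
    have RS': "R o\<^sub>L S = S o\<^sub>L R"
      by (rule comm, unfold R(2)[symmetric]) (rule blinfun_eqI, simp)
    have RS: "R (S x) = S (R x)" for x
      using arg_cong[OF RS', of "\<lambda>F. blinfun_apply F x"] by simp
    define D where "D x = S x - R x" for x
    have hD: "cinner x (D y) = cinner (D x) y" for x y
      by (simp add: D_def cinner.diff_left cinner.diff_right positive_op_hermitian[OF S(1)] positive_op_hermitian[OF R(1)])
    have "D x = 0" for x
    proof -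
      define w where "w = D x"
      have "S w + R w = 0"
        by (simp add: w_def D_def blinfun.diff_right RR RS)
      then have "cinner w (S w) + cinner w (R w) = 0"
        by (metis cinner_add_right cinner.zero_right)
      then have "Re (cinner w (S w)) + Re (cinner w (R w)) = 0"
        by (metis plus_complex.sel(1) zero_complex.sel(1))
      then have "Re (cinner w (S w)) = 0" "Re (cinner w (R w)) = 0"
        using positive_opD(2)[OF S(1), of w] positive_opD(2)[OF R(1), of w] by auto
      then have "D w = 0"
        using positive_op_eq_0[OF S(1), of w] positive_op_eq_0[OF R(1), of w] by (simp add: D_def)
      then have "cinner (D x) (D x) = 0"
        using hD[of x "D x"] by (simp add: w_def cinner.zero_right)
      then show ?thesis
        by (simp add: norm_sq_cinner)
    qed
    then show ?thesis
      by (intro blinfun_eqI) (simp add: D_def)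
  qed
  from this[of P] this[of Q] show ?thesis
    using P Q PQ by simp
qed

lemma abs_op_unique:
  assumes "positive_op P" "positive_op Q" "\<And>\<phi> \<psi>. cinner (P \<phi>) (P \<psi>) = cinner (Q \<phi>) (Q \<psi>)"
  shows "P = Q"
proof (rule positive_sqrt_unique[OF assms(1,2)])
  show "P o\<^sub>L P = Q o\<^sub>L Q"
  proof (intro blinfun_eqI cinner_ext)
    fix \<psi> \<phi>
    show "cinner \<phi> ((P o\<^sub>L P) \<psi>) = cinner \<phi> ((Q o\<^sub>L Q) \<psi>)"
      using positive_op_hermitian[OF assms(1), of \<phi> "P \<psi>"] positive_op_hermitian[OF assms(2), of \<phi> "Q \<psi>"] assms(3)
      by simp
  qed
qed

text \<open>The square root of A' A is a candidate, A' being the adjoint; uniqueness of positive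
  roots makes the definite description in \<open>abs_op\<close> denote it.\<close>

lemma abs_op_spec:
  assumes A: "complex_linear A"
  shows "positive_op (abs_op A)" "\<And>\<phi> \<psi>. cinner (abs_op A \<phi>) (abs_op A \<psi>) = cinner (A \<phi>) (A \<psi>)"
proof -
  obtain A' where A': "complex_linear A'" "\<And>\<phi> \<psi>. cinner \<phi> (A \<psi>) = cinner (A' \<phi>) \<psi>"
    using ex_adjoint[OF A] by blast
  have aa: "cinner \<phi> (A' (A \<psi>)) = cinner (A \<phi>) (A \<psi>)" for \<phi> \<psi>
    using A'(2)[of "A \<psi>" \<phi>] by (metis cinner_commute)
  have "positive_op (A' o\<^sub>L A)"
  proof (rule positive_opI)
    fix \<psi>
    show "\<exists>r\<ge>0. cinner \<psi> ((A' o\<^sub>L A) \<psi>) = of_real r"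
      by (intro exI[of _ "(norm (A \<psi>))\<^sup>2"]) (simp add: aa norm_sq_cinner)
  qed (intro complex_linear_compose A A')
  then obtain S where S: "positive_op S" "S o\<^sub>L S = A' o\<^sub>L A"
    using ex_positive_sqrt by blast
  have "cinner (S \<phi>) (S \<psi>) = cinner (A \<phi>) (A \<psi>)" for \<phi> \<psi>
    using arg_cong[OF S(2), of "\<lambda>F. cinner \<phi> (blinfun_apply F \<psi>)"]
    by (simp add: aa positive_op_hermitian[OF S(1)])
  with S(1) have "\<exists>!P. positive_op P \<and> (\<forall>\<phi> \<psi>. cinner (P \<phi>) (P \<psi>) = cinner (A \<phi>) (A \<psi>))"
    by (intro ex1I[of _ S]) (auto intro: abs_op_unique)
  from theI'[OF this]
  show "positive_op (abs_op A)" "\<And>\<phi> \<psi>. cinner (abs_op A \<phi>) (abs_op A \<psi>) = cinner (A \<phi>) (A \<psi>)"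
    by (auto simp: abs_op_def)
qed

lemma norm_abs_op:
  assumes "complex_linear A"
  shows "norm (abs_op A \<psi>) = norm (A \<psi>)"
proof -
  have "complex_of_real ((norm (abs_op A \<psi>))\<^sup>2) = complex_of_real ((norm (A \<psi>))\<^sup>2)"
    by (simp only: norm_sq_cinner[symmetric] abs_op_spec(2)[OF assms])
  then show ?thesis
    by (simp only: of_real_eq_iff power2_eq_iff_nonneg[OF norm_ge_zero norm_ge_zero])
qed

lemma abs_op_positive: "positive_op A \<Longrightarrow> abs_op A = A"
  using abs_op_spec[OF positive_opD(1)] by (intro abs_op_unique) auto

section \<open>Resolvents, approximate polar decomposition, trace norm by duality\<close>

section \<open>Trace class operators\<close>

text \<open>In |P x + \<epsilon> x|^2 the cross term 2 \<epsilon> <P x, x> is nonnegative, so both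
  squares are dominated separately.\<close>

lemma positive_op_resolvent_bound:
  assumes P: "positive_op P" and "\<epsilon> > 0"
  shows "norm (P x) \<le> norm (P x + \<epsilon> *\<^sub>R x)" "\<epsilon> * norm x \<le> norm (P x + \<epsilon> *\<^sub>R x)"
proof -
  have "inner (P x) x \<ge> 0"
    using positive_opD(2)[OF P, of x] by (simp add: inner_l2r_def positive_op_hermitian[OF P])
  then have "inner (P x + \<epsilon> *\<^sub>R x) (P x + \<epsilon> *\<^sub>R x) \<ge> inner (P x) (P x) + inner (\<epsilon> *\<^sub>R x) (\<epsilon> *\<^sub>R x)"
    using assms(2) by (simp add: inner_add_left inner_add_right inner_commute)
  then have "(norm (P x + \<epsilon> *\<^sub>R x))\<^sup>2 \<ge> (norm (P x))\<^sup>2 + (norm (\<epsilon> *\<^sub>R x))\<^sup>2"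
    by (simp add: power2_norm_eq_inner del: norm_scaleR inner_scaleR_left inner_scaleR_right)
  then have "(norm (P x))\<^sup>2 \<le> (norm (P x + \<epsilon> *\<^sub>R x))\<^sup>2" "(norm (\<epsilon> *\<^sub>R x))\<^sup>2 \<le> (norm (P x + \<epsilon> *\<^sub>R x))\<^sup>2"
    using zero_le_power2[of "norm (P x)"] zero_le_power2[of "norm (\<epsilon> *\<^sub>R x)"] by linarith+
  then have "norm (P x) \<le> norm (P x + \<epsilon> *\<^sub>R x)" "norm (\<epsilon> *\<^sub>R x) \<le> norm (P x + \<epsilon> *\<^sub>R x)"
    by (simp_all only: abs_le_square_iff[symmetric] abs_norm_cancel)
  then show "norm (P x) \<le> norm (P x + \<epsilon> *\<^sub>R x)" "\<epsilon> * norm x \<le> norm (P x + \<epsilon> *\<^sub>R x)"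
    using assms(2) by simp_all
qed

text \<open>The equation P y + \<epsilon> y = \<phi> is the fixed-point equation y = (\<phi> + (|P|
  - P) y) / (|P| + \<epsilon>), |P| being the operator norm. Since 0 \<le> |P| - P \<le> |P|, its
  right side contracts with factor |P| / (|P| + \<epsilon>) < 1.\<close>

lemma ex_resolvent:
  assumes P: "positive_op P" and e: "\<epsilon> > 0"
  obtains J :: l2op where "complex_linear J" "\<And>\<phi>. P (J \<phi>) + \<epsilon> *\<^sub>R J \<phi> = \<phi>" "\<And>\<phi>. J (P \<phi> + \<epsilon> *\<^sub>R \<phi>) = \<phi>"
proof -
  define c where "c = norm P + \<epsilon>"
  have c: "c > 0" using e by (simp add: c_def add_nonneg_pos)
  define N where "N = norm P *\<^sub>R id_blinfun - P"
  have N_apply: "N x = norm P *\<^sub>R x - P x" for x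
    by (simp add: N_def blinfun.diff_left blinfun.scaleR_left)
  have N: "positive_op N"
  proof (rule positive_opI)
    fix \<psi>
    have "cinner \<psi> (N \<psi>) = of_real (norm P * (norm \<psi>)\<^sup>2 - Re (cinner \<psi> (P \<psi>)))"
      using positive_opD(4)[OF P, of \<psi>]
      by (simp add: N_apply cinner.diff_right cinner.scaleR_right norm_sq_cinner scaleR_conv_of_real)
    then show "\<exists>r\<ge>0. cinner \<psi> (N \<psi>) = of_real r"
      using cinner_op_le_norm[of \<psi> P] by (intro exI[of _ "norm P * (norm \<psi>)\<^sup>2 - Re (cinner \<psi> (P \<psi>))"]) auto
  qed (unfold N_def, intro complex_linear_diff complex_linear_scaleR complex_linear_id positive_opD P)
  have nN: "norm (N \<psi>) \<le> norm P * norm \<psi>" for \<psi>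
  proof (rule positive_op_norm_le[OF N])
    show "Re (cinner \<psi> (N \<psi>)) \<le> norm P * (norm \<psi>)\<^sup>2" for \<psi>
      using positive_opD(2)[OF P, of \<psi>]
      by (simp add: N_apply cinner.diff_right cinner.scaleR_right norm_sq_cinner scaleR_conv_of_real)
  qed simp
  have "\<exists>y. P y + \<epsilon> *\<^sub>R y = \<phi>" for \<phi>
  proof -
    have "\<exists>!y. (1 / c) *\<^sub>R (\<phi> + N y) = y"
    proof (rule banach_fix_type[of "norm P / c"])
      show "0 \<le> norm P / c" "norm P / c < 1"
        using c e by (auto simp: c_def field_simps)
      show "\<forall>x y. dist ((1 / c) *\<^sub>R (\<phi> + N x)) ((1 / c) *\<^sub>R (\<phi> + N y)) \<le> norm P / c * dist x y"
      proof (intro allI)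
        fix x y
        have "dist ((1 / c) *\<^sub>R (\<phi> + N x)) ((1 / c) *\<^sub>R (\<phi> + N y)) = norm ((1 / c) *\<^sub>R N (x - y))"
          by (simp add: dist_norm blinfun.diff_right flip: scaleR_diff_right)
        also have "\<dots> = norm (N (x - y)) / c"
          using c by simp
        also have "\<dots> \<le> (norm P * norm (x - y)) / c"
          using c by (intro divide_right_mono nN) simp
        finally show "dist ((1 / c) *\<^sub>R (\<phi> + N x)) ((1 / c) *\<^sub>R (\<phi> + N y)) \<le> norm P / c * dist x y"
          by (simp add: dist_norm)
      qed
    qed
    then obtain y where "(1 / c) *\<^sub>R (\<phi> + N y) = y" by blast
    then have "c *\<^sub>R ((1 / c) *\<^sub>R (\<phi> + N y)) = c *\<^sub>R y" by (simp only:)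
    then have "\<phi> + N y = c *\<^sub>R y"
      using c by simp
    then have "P y + \<epsilon> *\<^sub>R y = \<phi>"
      by (simp add: N_apply c_def scaleR_add_left algebra_simps)
    then show ?thesis by blast
  qed
  then obtain f where f: "\<And>\<phi>. P (f \<phi>) + \<epsilon> *\<^sub>R f \<phi> = \<phi>"
    by metis
  have inj: "x = y" if "P x + \<epsilon> *\<^sub>R x = P y + \<epsilon> *\<^sub>R y" for x y
  proof -
    have "P (x - y) + \<epsilon> *\<^sub>R (x - y) = 0"
      using that by (simp add: blinfun.diff_right scaleR_diff_right algebra_simps)
    then have "\<epsilon> * norm (x - y) \<le> 0"
      using positive_op_resolvent_bound(2)[OF P e, of "x - y"] by simp
    then show ?thesis
      using e by (simp add: mult_le_0_iff)
  qed
  obtain J :: l2op where J: "complex_linear J" "\<And>x. J x = f x"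
  proof (rule ex_complex_linear_op[of f "1 / \<epsilon>"])
    show "f (x + y) = f x + f y" for x y
    proof (rule inj)
      have "P (f x + f y) + \<epsilon> *\<^sub>R (f x + f y) = (P (f x) + \<epsilon> *\<^sub>R f x) + (P (f y) + \<epsilon> *\<^sub>R f y)"
        by (simp add: blinfun.add_right scaleR_add_right)
      then show "P (f (x + y)) + \<epsilon> *\<^sub>R f (x + y) = P (f x + f y) + \<epsilon> *\<^sub>R (f x + f y)"
        by (simp only: f)
    qed
    show "f (scaleC a x) = scaleC a (f x)" for a x
    proof (rule inj)
      have "P (scaleC a (f x)) + \<epsilon> *\<^sub>R scaleC a (f x) = scaleC a (P (f x) + \<epsilon> *\<^sub>R f x)"
        by (simp only: complex_linearD[OF positive_opD(1)[OF P]] scaleC_add_right scaleC.scaleR_right)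
      then show "P (f (scaleC a x)) + \<epsilon> *\<^sub>R f (scaleC a x) = P (scaleC a (f x)) + \<epsilon> *\<^sub>R scaleC a (f x)"
        by (simp only: f)
    qed
    show "norm (f x) \<le> norm x * (1 / \<epsilon>)" for x
      using positive_op_resolvent_bound(2)[OF P e, of "f x"] e by (simp add: f field_simps)
  qed blast
  show ?thesis
  proof (rule that[of J])
    show "P (J \<phi>) + \<epsilon> *\<^sub>R J \<phi> = \<phi>" for \<phi>
      by (simp only: J f)
    show "J (P \<phi> + \<epsilon> *\<^sub>R \<phi>) = \<phi>" for \<phi>
      by (rule inj) (simp only: J f)
  qed (rule J)
qed

text \<open>The contraction \<open>U = A (|A| + \<delta>)\<^sup>-\<^sup>1\<close> replaces the partial isometry of the polar decomposition.\<close>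

lemma ex_approx_polar:
  assumes A: "complex_linear A" and d: "\<delta> > 0"
  obtains U :: l2op where "complex_linear U" "\<And>\<phi>. norm (U \<phi>) \<le> norm \<phi>"
    "\<And>\<phi>. A \<phi> = U (abs_op A \<phi> + \<delta> *\<^sub>R \<phi>)"
    "\<And>\<phi>. cmod (cinner (U \<phi>) (A \<phi>) - cinner \<phi> (abs_op A \<phi>)) \<le> \<delta> * (norm \<phi>)\<^sup>2"
proof -
  define R where "R = abs_op A"
  have R: "positive_op R" "\<And>\<phi> \<psi>. cinner (R \<phi>) (R \<psi>) = cinner (A \<phi>) (A \<psi>)"
    using abs_op_spec[OF A] by (auto simp: R_def)
  obtain J :: l2op where J: "complex_linear J" "\<And>\<phi>. R (J \<phi>) + \<delta> *\<^sub>R J \<phi> = \<phi>" "\<And>\<phi>. J (R \<phi> + \<delta> *\<^sub>R \<phi>) = \<phi>"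
    using ex_resolvent[OF R(1) d] by blast
  have RJ: "norm (R (J \<phi>)) \<le> norm \<phi>" for \<phi>
    using positive_op_resolvent_bound(1)[OF R(1) d, of "J \<phi>"] by (simp only: J(2))
  show ?thesis
  proof (rule that[of "A o\<^sub>L J"])
    show "complex_linear (A o\<^sub>L J)"
      by (intro complex_linear_compose A J)
    show "norm ((A o\<^sub>L J) \<phi>) \<le> norm \<phi>" for \<phi>
      using RJ[of \<phi>] by (simp add: R_def norm_abs_op[OF A])
    show "A \<phi> = (A o\<^sub>L J) (abs_op A \<phi> + \<delta> *\<^sub>R \<phi>)" for \<phi>
      using J(3)[of \<phi>] by (simp add: R_def)
    show "cmod (cinner ((A o\<^sub>L J) \<phi>) (A \<phi>) - cinner \<phi> (abs_op A \<phi>)) \<le> \<delta> * (norm \<phi>)\<^sup>2" for \<phi>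
    proof -
      have "cinner ((A o\<^sub>L J) \<phi>) (A \<phi>) = cinner (R (J \<phi>)) (R \<phi>)"
        by (simp add: R(2))
      also have "\<dots> = cinner (\<phi> - \<delta> *\<^sub>R J \<phi>) (R \<phi>)"
        using J(2)[of \<phi>] by (metis add_diff_cancel_right')
      also have "\<dots> = cinner \<phi> (R \<phi>) - \<delta> *\<^sub>R cinner (R (J \<phi>)) \<phi>"
        by (simp add: positive_op_hermitian[OF R(1)] blinfun.diff_right blinfun.scaleR_right cinner.diff_left cinner.scaleR_left)
      finally have "cmod (cinner ((A o\<^sub>L J) \<phi>) (A \<phi>) - cinner \<phi> (abs_op A \<phi>)) = \<delta> * cmod (cinner (R (J \<phi>)) \<phi>)"
        using d by (simp add: R_def)
      also have "\<dots> \<le> \<delta> * (norm \<phi> * norm \<phi>)"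
        using d by (intro mult_left_mono order_trans[OF cmod_cinner_le] mult_right_mono RJ) auto
      finally show ?thesis
        by (simp add: power2_eq_square)
    qed
  qed
qed

text \<open>Expand in the Fock basis and exchange the sums: the entry <e_m, S M e_n> is the
  conjugate of <e_n, M' S e_m>, Bessel's inequality bounds the sum over n by |M' S e_m|^2, and the
  adjoint M' is again a contraction.\<close>

lemma hilbert_schmidt_compose_bound:
  assumes S: "positive_op S" and sm: "summable (\<lambda>n. (norm (S (fock n)))\<^sup>2)"
    and M: "complex_linear M" "\<And>\<phi>. norm (M \<phi>) \<le> norm \<phi>"
  shows "(\<Sum>n<N. (norm (S (M (fock n))))\<^sup>2) \<le> (\<Sum>n. (norm (S (fock n)))\<^sup>2)"
proof -
  obtain M' :: l2op where M': "complex_linear M'" "\<And>\<phi> \<psi>. cinner \<phi> (M \<psi>) = cinner (M' \<phi>) \<psi>"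
    using ex_adjoint[OF M(1)] by blast
  have nM': "norm (M' \<phi>) \<le> norm \<phi>" for \<phi>
    by (rule adjoint_contraction[OF M'(2) M(2)])
  have 1: "(\<lambda>m. \<Sum>n<N. (cmod (cinner (fock m) (S (M (fock n)))))\<^sup>2) sums (\<Sum>n<N. (norm (S (M (fock n))))\<^sup>2)"
    by (intro sums_sum parseval_norm)
  have 2: "(\<Sum>n<N. (cmod (cinner (fock m) (S (M (fock n)))))\<^sup>2) \<le> (norm (S (fock m)))\<^sup>2" for m
  proof -
    have "cmod (cinner (fock m) (S (M (fock n)))) = cmod (cinner (fock n) (M' (S (fock m))))" for n
      by (subst cinner_commute[of "fock n"]) (simp add: positive_op_hermitian[OF S] M'(2))
    then have "(\<Sum>n<N. (cmod (cinner (fock m) (S (M (fock n)))))\<^sup>2) \<le> (norm (M' (S (fock m))))\<^sup>2"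
      using bessel_fock[of "M' (S (fock m))" N] by simp
    also have "\<dots> \<le> (norm (S (fock m)))\<^sup>2"
      by (intro power_mono nM') simp
    finally show ?thesis .
  qed
  show ?thesis
    by (rule sums_le[OF 2 1 summable_sums[OF sm]])
qed

lemma trace_classD:
  assumes "trace_class A"
  shows "complex_linear A" "positive_op (abs_op A)"
    "(\<lambda>n. Re (cinner (fock n) (abs_op A (fock n)))) sums trace_norm A"
proof -
  show A: "complex_linear A" and P: "positive_op (abs_op A)"
    using assms by (auto simp: trace_class_def abs_op_spec)
  have "summable (\<lambda>n. cinner (fock n) (abs_op A (fock n)))"
    using assms by (simp add: trace_class_def)
  then have "(\<lambda>n. cinner (fock n) (abs_op A (fock n))) sums op_trace (abs_op A)"
    by (simp add: op_trace_def summable_sums)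
  then show "(\<lambda>n. Re (cinner (fock n) (abs_op A (fock n)))) sums trace_norm A"
    unfolding trace_norm_def by (rule sums_Re)
qed

lemma trace_class_positiveI:
  assumes P: "positive_op P" and "summable (\<lambda>n. Re (cinner (fock n) (P (fock n))))"
  shows "trace_class P"
proof -
  have "summable (\<lambda>n. complex_of_real (Re (cinner (fock n) (P (fock n)))))"
    using assms(2) by (simp only: summable_of_real_iff)
  then show ?thesis
    by (simp add: trace_class_def abs_op_positive[OF P] positive_opD(1)[OF P] flip: positive_opD(4)[OF P])
qed

lemma positive_op_sqrt_diag:
  assumes "positive_op S" "S o\<^sub>L S = P"
  shows "cinner \<phi> (P \<psi>) = cinner (S \<phi>) (S \<psi>)" "Re (cinner \<phi> (P \<phi>)) = (norm (S \<phi>))\<^sup>2"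
proof -
  show 1: "cinner \<phi> (P \<psi>) = cinner (S \<phi>) (S \<psi>)" for \<psi>
    using positive_op_hermitian[OF assms(1), of \<phi> "S \<psi>"] by (simp flip: assms(2))
  show "Re (cinner \<phi> (P \<phi>)) = (norm (S \<phi>))\<^sup>2"
    by (simp add: 1 norm_sq_cinner)
qed

lemma norm_fock [simp]: "norm (fock n) = 1"
proof -
  have "complex_of_real ((norm (fock n))\<^sup>2) = complex_of_real 1"
    by (simp only: norm_sq_cinner[symmetric] fock_orthonormal) simp
  then show ?thesis
    by (simp only: of_real_eq_iff power2_eq_1_iff) (use norm_ge_zero[of "fock n"] in linarith)
qed

text \<open>Up to \<delta> per term, A is U |A| with U a contraction and |A| = S^2, so <V e_n, A
  e_n> becomes <S M e_n, S e_n> with M = U' V. The inequality 2 x y \<le> x^2 + y^2 and the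
  Hilbert-Schmidt bound for S M give the trace of |A|; \<delta> is taken so small that N such errors
  stay below e.\<close>

lemma trace_norm_bound:
  assumes A: "trace_class A" and V: "complex_linear V" "\<And>\<phi>. norm (V \<phi>) \<le> norm \<phi>"
  shows "(\<Sum>n<N. cmod (cinner (V (fock n)) (A (fock n)))) \<le> trace_norm A"
proof (rule field_le_epsilon)
  fix e :: real assume e: "e > 0"
  define \<delta> where "\<delta> = e / (real N + 1)"
  have d: "\<delta> > 0" "real N * \<delta> \<le> e"
    using e by (auto simp: \<delta>_def field_simps)
  define R where "R = abs_op A"
  have R: "positive_op R" "(\<lambda>n. Re (cinner (fock n) (R (fock n)))) sums trace_norm A"
    using trace_classD[OF A] by (auto simp: R_def)
  obtain U :: l2op where U: "complex_linear U" "\<And>\<phi>. norm (U \<phi>) \<le> norm \<phi>" "\<And>\<phi>. A \<phi> = U (R \<phi> + \<delta> *\<^sub>R \<phi>)"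
    using ex_approx_polar[OF trace_classD(1)[OF A] d(1)] by (metis R_def)
  obtain U' :: l2op where U': "complex_linear U'" "\<And>\<phi> \<psi>. cinner \<phi> (U \<psi>) = cinner (U' \<phi>) \<psi>"
    using ex_adjoint[OF U(1)] by blast
  have nU': "norm (U' \<phi>) \<le> norm \<phi>" for \<phi>
    by (rule adjoint_contraction[OF U'(2) U(2)])
  define M where "M = U' o\<^sub>L V"
  have M: "complex_linear M" "\<And>\<phi>. norm (M \<phi>) \<le> norm \<phi>"
    using order_trans[OF nU' V(2)] by (auto simp: M_def intro: complex_linear_compose U' V)
  obtain S where S: "positive_op S" "S o\<^sub>L S = R"
    using ex_positive_sqrt[OF R(1)] by blast
  note SR = positive_op_sqrt_diag[OF S]
  have sS: "(\<lambda>n. (norm (S (fock n)))\<^sup>2) sums trace_norm A"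
    using R(2) by (simp only: SR(2))
  have t: "cmod (cinner (V (fock n)) (A (fock n))) \<le> norm (S (M (fock n))) * norm (S (fock n)) + \<delta>" for n
  proof -
    have "cinner (V (fock n)) (A (fock n)) = cinner (M (fock n)) (R (fock n)) + \<delta> *\<^sub>R cinner (M (fock n)) (fock n)"
      by (subst U(3)) (simp add: M_def U'(2) cinner_add_right cinner.scaleR_right)
    then have "cmod (cinner (V (fock n)) (A (fock n))) \<le> cmod (cinner (M (fock n)) (R (fock n))) + \<delta> * cmod (cinner (M (fock n)) (fock n))"
      using d norm_triangle_ineq[of "cinner (M (fock n)) (R (fock n))" "\<delta> *\<^sub>R cinner (M (fock n)) (fock n)"] by simp
    also have "cmod (cinner (M (fock n)) (R (fock n))) \<le> norm (S (M (fock n))) * norm (S (fock n))"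
      unfolding SR(1) by (rule cmod_cinner_le)
    also have "\<delta> * cmod (cinner (M (fock n)) (fock n)) \<le> \<delta> * 1"
      using d cmod_cinner_le[of "M (fock n)" "fock n"] M(2)[of "fock n"]
      by (intro mult_left_mono) auto
    finally show ?thesis by simp
  qed
  have "(\<Sum>n<N. cmod (cinner (V (fock n)) (A (fock n)))) \<le> (\<Sum>n<N. norm (S (M (fock n))) * norm (S (fock n)) + \<delta>)"
    by (intro sum_mono t)
  also have "\<dots> \<le> (\<Sum>n<N. ((norm (S (M (fock n))))\<^sup>2 + (norm (S (fock n)))\<^sup>2) / 2 + \<delta>)"
  proof (intro sum_mono add_right_mono)
    fix n
    show "norm (S (M (fock n))) * norm (S (fock n)) \<le> ((norm (S (M (fock n))))\<^sup>2 + (norm (S (fock n)))\<^sup>2) / 2"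
      using sum_squares_bound[of "norm (S (M (fock n)))" "norm (S (fock n))"] by simp
  qed
  also have "\<dots> = ((\<Sum>n<N. (norm (S (M (fock n))))\<^sup>2) + (\<Sum>n<N. (norm (S (fock n)))\<^sup>2)) / 2 + real N * \<delta>"
    by (simp add: sum.distrib flip: sum_divide_distrib)
  also have "\<dots> \<le> (trace_norm A + trace_norm A) / 2 + e"
  proof (intro add_mono divide_right_mono d)
    show "(\<Sum>n<N. (norm (S (M (fock n))))\<^sup>2) \<le> trace_norm A"
      using hilbert_schmidt_compose_bound[OF S(1) sums_summable[OF sS] M] sums_unique[OF sS] by simp
    show "(\<Sum>n<N. (norm (S (fock n)))\<^sup>2) \<le> trace_norm A"
      using sum_le_suminf[OF sums_summable[OF sS], of "{..<N}"] sums_unique[OF sS] by simp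
  qed simp
  finally show "(\<Sum>n<N. cmod (cinner (V (fock n)) (A (fock n)))) \<le> trace_norm A + e"
    by simp
qed

text \<open>Converse of \<open>trace_norm_bound\<close>: for V the approximate polar factor of A,
  the tested entries come within \<delta> of the diagonal of |A|. The two lemmas together give
  stability under differences without comparing |A - B| to |A| and |B|.\<close>

lemma trace_class_of_bound:
  assumes A: "complex_linear A"
    and b: "\<And>V N. complex_linear V \<Longrightarrow> (\<And>\<phi>. norm (V \<phi>) \<le> norm \<phi>) \<Longrightarrow> (\<Sum>n<N. cmod (cinner (V (fock n)) (A (fock n)))) \<le> K"
  shows "trace_class A" "trace_norm A \<le> K"
proof -
  define R where "R = abs_op A"
  have R: "positive_op R"
    using abs_op_spec[OF A] by (simp add: R_def)
  have le: "(\<Sum>n<N. Re (cinner (fock n) (R (fock n)))) \<le> K" for N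
  proof (rule field_le_epsilon)
    fix e :: real assume e: "e > 0"
    define \<delta> where "\<delta> = e / (real N + 1)"
    have d: "\<delta> > 0" "real N * \<delta> \<le> e"
      using e by (auto simp: \<delta>_def field_simps)
    obtain U :: l2op where U: "complex_linear U" "\<And>\<phi>. norm (U \<phi>) \<le> norm \<phi>"
      "\<And>\<phi>. cmod (cinner (U \<phi>) (A \<phi>) - cinner \<phi> (R \<phi>)) \<le> \<delta> * (norm \<phi>)\<^sup>2"
      using ex_approx_polar[OF A d(1)] by (metis R_def)
    have "(\<Sum>n<N. Re (cinner (fock n) (R (fock n)))) \<le> (\<Sum>n<N. cmod (cinner (U (fock n)) (A (fock n))) + \<delta>)"
    proof (rule sum_mono)
      fix n
      have "Re (cinner (fock n) (R (fock n))) \<le> cmod (cinner (fock n) (R (fock n)))"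
        by (rule complex_Re_le_cmod)
      also have "\<dots> \<le> cmod (cinner (U (fock n)) (A (fock n))) + cmod (cinner (U (fock n)) (A (fock n)) - cinner (fock n) (R (fock n)))"
        using norm_triangle_sub[of "cinner (fock n) (R (fock n))" "cinner (U (fock n)) (A (fock n))"]
        by (simp add: norm_minus_commute)
      finally show "Re (cinner (fock n) (R (fock n))) \<le> cmod (cinner (U (fock n)) (A (fock n))) + \<delta>"
        using U(3)[of "fock n"] by simp
    qed
    also have "\<dots> \<le> K + e"
      using b[OF U(1,2), of N] d(2) by (simp add: sum.distrib)
    finally show "(\<Sum>n<N. Re (cinner (fock n) (R (fock n)))) \<le> K + e" .
  qed
  have s: "summable (\<lambda>n. Re (cinner (fock n) (R (fock n))))"
    by (rule summableI_nonneg_bounded[OF _ le]) (rule positive_opD(2)[OF R])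
  have "summable (\<lambda>n. complex_of_real (Re (cinner (fock n) (R (fock n)))))"
    using s by (simp only: summable_of_real_iff)
  then have "summable (\<lambda>n. cinner (fock n) (R (fock n)))"
    by (simp flip: positive_opD(4)[OF R])
  then show t: "trace_class A"
    by (simp add: trace_class_def A R_def)
  show "trace_norm A \<le> K"
    using sums_unique[OF trace_classD(3)[OF t]] suminf_le_const[OF s, of K] le by (simp add: R_def)
qed

lemma trace_class_diff:
  assumes A: "trace_class A" and B: "trace_class B"
  shows "trace_class (A - B)"
proof (rule trace_class_of_bound(1)[where K = "trace_norm A + trace_norm B"])
  show "complex_linear (A - B)"
    by (intro complex_linear_diff trace_classD A B)
  fix V :: l2op and N assume V: "complex_linear V" "\<And>\<phi>. norm (V \<phi>) \<le> norm \<phi>"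
  have "(\<Sum>n<N. cmod (cinner (V (fock n)) ((A - B) (fock n))))
    \<le> (\<Sum>n<N. cmod (cinner (V (fock n)) (A (fock n))) + cmod (cinner (V (fock n)) (B (fock n))))"
    by (intro sum_mono) (simp add: blinfun.diff_left cinner.diff_right norm_triangle_ineq4)
  also have "\<dots> \<le> trace_norm A + trace_norm B"
    using trace_norm_bound[OF A V, of N] trace_norm_bound[OF B V, of N] by (simp add: sum.distrib)
  finally show "(\<Sum>n<N. cmod (cinner (V (fock n)) ((A - B) (fock n)))) \<le> trace_norm A + trace_norm B" .
qed

text \<open>With |A| = S^2, Parseval gives |S \<psi>|^2 as the sum of |<S e_n, \<psi>>|^2, which is
  at most |\<psi>|^2 times the trace of |A|. Convergence in trace norm therefore implies strong
  convergence.\<close>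

lemma norm_le_trace_norm:
  assumes A: "trace_class A"
  shows "norm (A \<phi>) \<le> trace_norm A * norm \<phi>"
proof -
  define R where "R = abs_op A"
  have R: "positive_op R" "(\<lambda>n. Re (cinner (fock n) (R (fock n)))) sums trace_norm A"
    using trace_classD[OF A] by (auto simp: R_def)
  obtain S where S: "positive_op S" "S o\<^sub>L S = R"
    using ex_positive_sqrt[OF R(1)] by blast
  note SR = positive_op_sqrt_diag[OF S]
  have sS: "(\<lambda>n. (norm (S (fock n)))\<^sup>2) sums trace_norm A"
    using R(2) by (simp only: SR(2))
  have t0: "trace_norm A \<ge> 0"
    using sums_le[OF _ sums_zero sS] by simp
  have "norm (R \<phi>) \<le> trace_norm A * norm \<phi>"
  proof (rule positive_op_norm_le[OF R(1) _ t0])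
    fix \<psi>
    have le: "(cmod (cinner (fock n) (S \<psi>)))\<^sup>2 \<le> (norm (S (fock n)))\<^sup>2 * (norm \<psi>)\<^sup>2" for n
      unfolding positive_op_hermitian[OF S(1)] power_mult_distrib[symmetric]
      by (intro power_mono cmod_cinner_le) simp
    have "(norm (S \<psi>))\<^sup>2 \<le> trace_norm A * (norm \<psi>)\<^sup>2"
      by (rule sums_le[OF le parseval_norm sums_mult2[OF sS]])
    then show "Re (cinner \<psi> (R \<psi>)) \<le> trace_norm A * (norm \<psi>)\<^sup>2"
      by (simp only: SR(2))
  qed
  then show ?thesis
    by (simp add: R_def norm_abs_op[OF trace_classD(1)[OF A]])
qed

lemma trace_norm_zero: "trace_norm 0 = 0"
proof -
  have "positive_op 0"
    by (rule positive_opI) (auto simp: complex_linear_zero cinner.zero_right intro: exI[of _ 0])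
  then show ?thesis
    by (simp add: trace_norm_def abs_op_positive op_trace_def cinner.zero_right)
qed

lemma rank_one_proj_apply: "rank_one_proj \<psi> \<phi> = scaleC (cinner \<psi> \<phi>) \<psi>"
  by (simp add: rank_one_proj.rep_eq)

lemma positive_op_rank_one_proj: "positive_op (rank_one_proj \<psi>)"
proof (rule positive_opI)
  fix \<phi>
  show "\<exists>r\<ge>0. cinner \<phi> (rank_one_proj \<psi> \<phi>) = of_real r"
  proof (intro exI[of _ "(cmod (cinner \<psi> \<phi>))\<^sup>2"] conjI)
    have "cinner \<phi> (rank_one_proj \<psi> \<phi>) = cinner \<psi> \<phi> * cnj (cinner \<psi> \<phi>)"
      by (simp add: rank_one_proj_apply cinner_scaleC_right flip: cinner_commute)
    then show "cinner \<phi> (rank_one_proj \<psi> \<phi>) = of_real ((cmod (cinner \<psi> \<phi>))\<^sup>2)"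
      by (simp only: complex_norm_square)
  qed simp
qed (simp add: complex_linear_def rank_one_proj_apply cinner_scaleC_right scaleC_scaleC)

section \<open>Trace and energy of states, and their decompositions into vectors\<close>

section \<open>Energy-bounded states\<close>

text \<open>What the proof uses of a member of \<open>energy_states E\<close>. Apart from positivity
  it only concerns diagonal entries in the Fock basis, and it survives convex combinations and
  strong limits.\<close>

definition bounded_state :: "real \<Rightarrow> l2op \<Rightarrow> bool" where
  "bounded_state E \<rho> \<longleftrightarrow> positive_op \<rho> \<and> (\<lambda>n. Re (cinner (fock n) (\<rho> (fock n)))) sums 1 \<and>
     (\<forall>N. (\<Sum>n<N. real n * Re (cinner (fock n) (\<rho> (fock n)))) \<le> E)"

lemma diag_rank_one_proj: "Re (cinner (fock n) (rank_one_proj \<psi> (fock n))) = (cmod (cinner (fock n) \<psi>))\<^sup>2"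
proof -
  have "cinner (fock n) (rank_one_proj \<psi> (fock n)) = cinner (fock n) \<psi> * cnj (cinner (fock n) \<psi>)"
    by (simp add: rank_one_proj_apply cinner_scaleC_right mult.commute flip: cinner_commute)
  also have "\<dots> = of_real ((cmod (cinner (fock n) \<psi>))\<^sup>2)"
    by (simp only: complex_norm_square)
  finally show ?thesis by simp
qed

lemma mean_photon_number_le_iff:
  assumes "0 \<le> E"
  shows "mean_photon_number \<psi> \<le> ennreal E \<longleftrightarrow> (\<forall>N. (\<Sum>n<N. real n * (cmod (cinner (fock n) \<psi>))\<^sup>2) \<le> E)"
proof -
  have s: "(\<Sum>n<N. ennreal (real n * (cmod (cinner (fock n) \<psi>))\<^sup>2)) = ennreal (\<Sum>n<N. real n * (cmod (cinner (fock n) \<psi>))\<^sup>2)" for N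
    by (rule sum_ennreal) simp
  show ?thesis
  proof
    assume le: "mean_photon_number \<psi> \<le> ennreal E"
    show "\<forall>N. (\<Sum>n<N. real n * (cmod (cinner (fock n) \<psi>))\<^sup>2) \<le> E"
    proof
      fix N
      have "(\<Sum>n<N. ennreal (real n * (cmod (cinner (fock n) \<psi>))\<^sup>2)) \<le> mean_photon_number \<psi>"
        unfolding mean_photon_number_def by (rule sum_le_suminf) auto
      then have "ennreal (\<Sum>n<N. real n * (cmod (cinner (fock n) \<psi>))\<^sup>2) \<le> ennreal E"
        using le s by (metis order_trans)
      then show "(\<Sum>n<N. real n * (cmod (cinner (fock n) \<psi>))\<^sup>2) \<le> E"
        using assms by (simp add: ennreal_le_iff)
    qed
  next
    assume "\<forall>N. (\<Sum>n<N. real n * (cmod (cinner (fock n) \<psi>))\<^sup>2) \<le> E"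
    then have "(\<Sum>n<N. ennreal (real n * (cmod (cinner (fock n) \<psi>))\<^sup>2)) \<le> ennreal E" for N
      unfolding s by (intro ennreal_leI) simp
    then show "mean_photon_number \<psi> \<le> ennreal E"
      unfolding mean_photon_number_def by (intro suminf_le_const) auto
  qed
qed

lemma bounded_state_rank_one_proj:
  assumes "norm \<psi> = 1" "mean_photon_number \<psi> \<le> ennreal E" "0 \<le> E"
  shows "bounded_state E (rank_one_proj \<psi>)"
  using parseval_norm[of \<psi>] assms
  by (simp add: bounded_state_def diag_rank_one_proj positive_op_rank_one_proj mean_photon_number_le_iff)

lemma positive_op_add: "positive_op A \<Longrightarrow> positive_op B \<Longrightarrow> positive_op (A + B)"
  by (auto simp: positive_op_def complex_linear_add blinfun.add_left cinner_add_right)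

lemma positive_op_scaleR: "positive_op A \<Longrightarrow> 0 \<le> r \<Longrightarrow> positive_op (r *\<^sub>R A)"
  by (auto simp: positive_op_def complex_linear_scaleR blinfun.scaleR_left cinner.scaleR_right complex_is_Real_iff)

lemma convex_bounded_states: "convex {\<sigma>. bounded_state E \<sigma>}"
proof (rule convexI)
  fix A B :: l2op and u v :: real
  assume A: "A \<in> {\<sigma>. bounded_state E \<sigma>}" and B: "B \<in> {\<sigma>. bounded_state E \<sigma>}" and uv: "0 \<le> u" "0 \<le> v" "u + v = 1"
  have d: "Re (cinner (fock n) ((u *\<^sub>R A + v *\<^sub>R B) (fock n))) = u * Re (cinner (fock n) (A (fock n))) + v * Re (cinner (fock n) (B (fock n)))" for n
    by (simp add: blinfun.add_left blinfun.scaleR_left cinner_add_right cinner.scaleR_right)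
  have "(\<lambda>n. u * Re (cinner (fock n) (A (fock n))) + v * Re (cinner (fock n) (B (fock n)))) sums (u * 1 + v * 1)"
    using A B by (intro sums_add sums_mult) (auto simp: bounded_state_def)
  moreover have "(\<Sum>n<N. real n * (u * Re (cinner (fock n) (A (fock n))) + v * Re (cinner (fock n) (B (fock n))))) \<le> E" for N
  proof -
    have "(\<Sum>n<N. real n * (u * Re (cinner (fock n) (A (fock n))) + v * Re (cinner (fock n) (B (fock n)))))
      = u * (\<Sum>n<N. real n * Re (cinner (fock n) (A (fock n)))) + v * (\<Sum>n<N. real n * Re (cinner (fock n) (B (fock n))))"
      by (simp add: sum_distrib_left sum.distrib algebra_simps)
    also have "\<dots> \<le> u * E + v * E"
      using A B uv by (intro add_mono mult_left_mono) (auto simp: bounded_state_def)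
    also have "\<dots> = E"
      using uv by (simp flip: distrib_right)
    finally show ?thesis .
  qed
  ultimately show "u *\<^sub>R A + v *\<^sub>R B \<in> {\<sigma>. bounded_state E \<sigma>}"
    using A B uv by (auto simp: bounded_state_def d intro!: positive_op_add positive_op_scaleR)
qed

lemma bounded_state_trace_class: "bounded_state E \<rho> \<Longrightarrow> trace_class \<rho>"
  unfolding bounded_state_def by (intro trace_class_positiveI) (auto intro: sums_summable)

text \<open>Markov's inequality for the photon number: the levels n \<ge> N carry weight at most E /
  N. The bound is uniform over all states of energy at most E and serves as tightness in
  limits.\<close>

lemma bounded_state_partial_trace:
  assumes "bounded_state E \<rho>"
  shows "(\<Sum>n<N. Re (cinner (fock n) (\<rho> (fock n)))) \<le> 1"
    and "0 < N \<Longrightarrow> 1 - E / real N \<le> (\<Sum>n<N. Re (cinner (fock n) (\<rho> (fock n))))"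
proof -
  define d where "d n = Re (cinner (fock n) (\<rho> (fock n)))" for n
  have d: "d sums 1" "\<And>n. 0 \<le> d n" "\<And>N. (\<Sum>n<N. real n * d n) \<le> E"
    using assms positive_opD(2)[of \<rho>] by (auto simp: bounded_state_def d_def[abs_def])
  show "(\<Sum>n<N. Re (cinner (fock n) (\<rho> (fock n)))) \<le> 1"
    using sum_le_suminf[OF sums_summable[OF d(1)], of "{..<N}"] d(2) sums_unique[OF d(1)] by (simp add: d_def)
  assume N: "0 < N"
  have "1 \<le> (\<Sum>n<N. d n) + E / real N"
  proof (rule LIMSEQ_le_const2)
    show "(\<lambda>M. \<Sum>n<M. d n) \<longlonglongrightarrow> 1"
      using d(1) by (simp add: sums_def)
    have "(\<Sum>n<M. d n) \<le> (\<Sum>n<N. d n) + E / real N" if "M \<ge> N" for M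
    proof -
      have "(\<Sum>n<M. d n) = (\<Sum>n<N. d n) + (\<Sum>n=N..<M. d n)"
        using that by (metis atLeast0LessThan le0 sum.atLeastLessThan_concat)
      also have "(\<Sum>n=N..<M. d n) \<le> (\<Sum>n=N..<M. real n * d n / real N)"
        using N d(2) by (intro sum_mono) (simp add: field_simps mult_right_mono)
      also have "\<dots> \<le> (\<Sum>n<M. real n * d n / real N)"
        using d(2) by (intro sum_mono2) auto
      also have "\<dots> \<le> E / real N"
        using d(3)[of M] N by (simp add: divide_right_mono flip: sum_divide_distrib)
      finally show ?thesis by simp
    qed
    then show "\<exists>M. \<forall>n\<ge>M. (\<Sum>n<n. d n) \<le> (\<Sum>n<N. d n) + E / real N"
      by blast
  qed
  then show "1 - E / real N \<le> (\<Sum>n<N. Re (cinner (fock n) (\<rho> (fock n))))"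
    by (simp add: d_def)
qed

text \<open>Positivity and energy are closed conditions, but a strong limit could lose trace to high
  levels; the uniform tail bound E / N excludes this.\<close>

lemma bounded_state_limit:
  fixes \<rho> :: l2op
  assumes \<sigma>: "\<And>k. bounded_state E (\<sigma> k)" and lim: "\<And>\<phi>. (\<lambda>k. \<sigma> k \<phi>) \<longlonglongrightarrow> \<rho> \<phi>" and \<rho>: "complex_linear \<rho>"
  shows "bounded_state E \<rho>"
proof -
  have l: "(\<lambda>k. cinner \<phi> (\<sigma> k \<psi>)) \<longlonglongrightarrow> cinner \<phi> (\<rho> \<psi>)" for \<phi> \<psi>
    by (intro cinner.tendsto tendsto_const lim)
  have d: "(\<lambda>k. Re (cinner (fock n) (\<sigma> k (fock n)))) \<longlonglongrightarrow> Re (cinner (fock n) (\<rho> (fock n)))" for n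
    by (intro tendsto_Re l)
  have pos: "positive_op \<rho>"
    unfolding positive_op_def
  proof (intro conjI allI)
    fix \<psi>
    have "(\<lambda>k. Im (cinner \<psi> (\<sigma> k \<psi>))) \<longlonglongrightarrow> Im (cinner \<psi> (\<rho> \<psi>))"
      by (intro tendsto_Im l)
    then show "cinner \<psi> (\<rho> \<psi>) \<in> \<real>"
      using positive_opD(3) \<sigma> by (simp add: bounded_state_def complex_is_Real_iff LIMSEQ_const_iff)
    show "0 \<le> Re (cinner \<psi> (\<rho> \<psi>))"
      by (rule LIMSEQ_le_const[OF tendsto_Re[OF l]]) (use positive_opD(2) \<sigma> in \<open>auto simp: bounded_state_def\<close>)
  qed (rule \<rho>)
  have le1: "(\<Sum>n<N. Re (cinner (fock n) (\<rho> (fock n)))) \<le> 1" for N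
    by (rule LIMSEQ_le_const2[OF tendsto_sum[OF d]]) (use bounded_state_partial_trace(1)[OF \<sigma>] in auto)
  have ge1: "1 - E / real N \<le> (\<Sum>n<N. Re (cinner (fock n) (\<rho> (fock n))))" if "0 < N" for N
    by (rule LIMSEQ_le_const[OF tendsto_sum[OF d]]) (use bounded_state_partial_trace(2)[OF \<sigma> that] in auto)
  have "(\<lambda>n. Re (cinner (fock n) (\<rho> (fock n)))) sums 1"
    unfolding sums_def
  proof (rule tendsto_sandwich[of "\<lambda>N. 1 - E / real N" _ _ "\<lambda>N. 1"])
    show "\<forall>\<^sub>F N in sequentially. 1 - E / real N \<le> (\<Sum>n<N. Re (cinner (fock n) (\<rho> (fock n))))"
      using eventually_gt_at_top[of 0] by eventually_elim (rule ge1)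
    have "(\<lambda>N. 1 - E / real N) \<longlonglongrightarrow> 1 - 0"
      by (intro tendsto_intros lim_const_over_n)
    then show "(\<lambda>N. 1 - E / real N) \<longlonglongrightarrow> 1" by simp
  qed (use le1 in auto)
  moreover have "(\<Sum>n<N. real n * Re (cinner (fock n) (\<rho> (fock n)))) \<le> E" for N
  proof (rule LIMSEQ_le_const2)
    show "(\<lambda>k. \<Sum>n<N. real n * Re (cinner (fock n) (\<sigma> k (fock n)))) \<longlonglongrightarrow> (\<Sum>n<N. real n * Re (cinner (fock n) (\<rho> (fock n))))"
      by (intro tendsto_sum tendsto_mult tendsto_const d)
  qed (use \<sigma> in \<open>auto simp: bounded_state_def\<close>)
  ultimately show ?thesis
    using pos by (simp add: bounded_state_def)
qed

text \<open>Approximants from the convex hull inherit \<open>bounded_state\<close> by convexity, and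
  they converge strongly because the trace norm dominates the operator norm.\<close>

lemma energy_states_bounded:
  assumes \<rho>: "\<rho> \<in> energy_states E" and E: "0 \<le> E"
  shows "bounded_state E \<rho>"
proof -
  let ?S = "{rank_one_proj \<psi> |\<psi>. norm \<psi> = 1 \<and> mean_photon_number \<psi> \<le> ennreal E}"
  have hull: "convex hull ?S \<subseteq> {\<sigma>. bounded_state E \<sigma>}"
    by (intro hull_minimal convex_bounded_states) (auto intro: bounded_state_rank_one_proj E)
  have tc: "trace_class \<rho>"
    using \<rho> by (simp add: energy_states_def closed_convex_hull_def)
  have "\<exists>\<sigma>. bounded_state E \<sigma> \<and> trace_norm (\<rho> - \<sigma>) < 1 / real (Suc k)" for k
    using \<rho> hull unfolding energy_states_def closed_convex_hull_def
    by (smt (verit, ccfv_SIG) mem_Collect_eq of_nat_0_less_iff subsetD zero_less_Suc zero_less_divide_1_iff)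
  then obtain \<sigma> where \<sigma>: "\<And>k. bounded_state E (\<sigma> k)" "\<And>k. trace_norm (\<rho> - \<sigma> k) < 1 / real (Suc k)"
    by metis
  show ?thesis
  proof (rule bounded_state_limit[OF \<sigma>(1)])
    fix \<phi>
    have b: "norm (\<sigma> k \<phi> - \<rho> \<phi>) \<le> 1 / real (Suc k) * norm \<phi>" for k
    proof -
      have "norm ((\<rho> - \<sigma> k) \<phi>) \<le> trace_norm (\<rho> - \<sigma> k) * norm \<phi>"
        by (intro norm_le_trace_norm trace_class_diff tc bounded_state_trace_class[OF \<sigma>(1)])
      also have "\<dots> \<le> 1 / real (Suc k) * norm \<phi>"
        by (rule mult_right_mono[OF less_imp_le[OF \<sigma>(2)] norm_ge_zero])
      finally show ?thesis
        by (simp add: blinfun.diff_left norm_minus_commute)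
    qed
    have "(\<lambda>k. \<sigma> k \<phi> - \<rho> \<phi>) \<longlonglongrightarrow> 0"
    proof (rule Lim_null_comparison)
      show "\<forall>\<^sub>F k in sequentially. norm (\<sigma> k \<phi> - \<rho> \<phi>) \<le> 1 / real (Suc k) * norm \<phi>"
        by (intro always_eventually allI b)
      show "(\<lambda>k. 1 / real (Suc k) * norm \<phi>) \<longlonglongrightarrow> 0"
        by (intro tendsto_mult_left_zero LIMSEQ_Suc[OF lim_1_over_n])
    qed
    then show "(\<lambda>k. \<sigma> k \<phi>) \<longlonglongrightarrow> \<rho> \<phi>"
      by (simp add: LIM_zero_iff)
  qed (rule trace_classD(1)[OF tc])
qed

lemma rank_one_proj_energy_states:
  assumes "norm \<psi> = 1" "mean_photon_number \<psi> \<le> ennreal E" "0 \<le> E"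
  shows "rank_one_proj \<psi> \<in> energy_states E"
proof -
  have "rank_one_proj \<psi> \<in> convex hull {rank_one_proj \<psi> |\<psi>. norm \<psi> = 1 \<and> mean_photon_number \<psi> \<le> ennreal E}"
    using assms by (intro hull_inc) blast
  then show ?thesis
    using bounded_state_trace_class[OF bounded_state_rank_one_proj[OF assms]]
    by (auto simp: energy_states_def closed_convex_hull_def trace_norm_zero intro!: bexI[of _ "rank_one_proj \<psi>"])
qed

text \<open>Weak form of \<rho> = sum of |v_i><v_i|, with the weights absorbed into unnormalized
  vectors. It covers mixtures with prescribed stellar rank as well as the decomposition that every
  state has through its square root.\<close>

definition decomposes :: "l2op \<Rightarrow> (nat \<Rightarrow> l2r) \<Rightarrow> bool" where
  "decomposes \<rho> v \<longleftrightarrow> summable (\<lambda>i. (norm (v i))\<^sup>2) \<and>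
     (\<forall>\<phi> \<psi>. (\<lambda>i. cinner \<phi> (v i) * cinner (v i) \<psi>) sums cinner \<phi> (\<rho> \<psi>))"

text \<open>Inserting the resolution of the identity into \<rho> = S S gives the vectors S e_i, so
  no diagonalization of \<rho> is involved.\<close>

lemma ex_decomposes:
  assumes "bounded_state E \<rho>"
  obtains v where "decomposes \<rho> v"
proof -
  have \<rho>: "positive_op \<rho>" "(\<lambda>n. Re (cinner (fock n) (\<rho> (fock n)))) sums 1"
    using assms by (auto simp: bounded_state_def)
  obtain S where S: "positive_op S" "S o\<^sub>L S = \<rho>"
    using ex_positive_sqrt[OF \<rho>(1)] by blast
  note SR = positive_op_sqrt_diag[OF S]
  have "decomposes \<rho> (\<lambda>i. S (fock i))"
    unfolding decomposes_def
  proof (intro conjI allI)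
    show "summable (\<lambda>i. (norm (S (fock i)))\<^sup>2)"
      using \<rho>(2) by (simp only: SR(2) sums_summable)
    fix \<phi> \<psi>
    have "(\<lambda>i. cnj (cinner (fock i) (S \<phi>)) * cinner (fock i) (S \<psi>)) sums cinner (S \<phi>) (S \<psi>)"
      by (rule parseval)
    then show "(\<lambda>i. cinner \<phi> (S (fock i)) * cinner (S (fock i)) \<psi>) sums cinner \<phi> (\<rho> \<psi>)"
      by (simp add: SR(1) positive_op_hermitian[OF S(1)] flip: cinner_commute)
  qed
  then show ?thesis by (rule that)
qed

lemma mixture_decomposes:
  assumes "is_mixture \<rho> p \<psi>"
  shows "decomposes \<rho> (\<lambda>i. sqrt (p i) *\<^sub>R \<psi> i)"
  unfolding decomposes_def
proof (intro conjI allI)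
  have p: "\<And>i. 0 \<le> p i" "p sums 1" "\<And>i. norm (\<psi> i) = 1" "(\<lambda>i. p i *\<^sub>R rank_one_proj (\<psi> i)) sums \<rho>"
    using assms by (auto simp: is_mixture_def)
  show "summable (\<lambda>i. (norm (sqrt (p i) *\<^sub>R \<psi> i))\<^sup>2)"
    using p sums_summable[OF p(2)] by (simp add: power_mult_distrib)
  fix \<phi> \<xi>
  have "(\<lambda>i. cinner \<phi> ((p i *\<^sub>R rank_one_proj (\<psi> i)) \<xi>)) sums cinner \<phi> (\<rho> \<xi>)"
    by (intro bounded_linear.sums[OF cinner.bounded_linear_right] bounded_linear.sums[OF blinfun.bounded_linear_left] p)
  also have "(\<lambda>i. cinner \<phi> ((p i *\<^sub>R rank_one_proj (\<psi> i)) \<xi>)) = (\<lambda>i. cinner \<phi> (sqrt (p i) *\<^sub>R \<psi> i) * cinner (sqrt (p i) *\<^sub>R \<psi> i) \<xi>)"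
  proof
    fix i
    have "cinner \<phi> (sqrt (p i) *\<^sub>R \<psi> i) * cinner (sqrt (p i) *\<^sub>R \<psi> i) \<xi>
      = (sqrt (p i) * sqrt (p i)) *\<^sub>R (cinner \<phi> (\<psi> i) * cinner (\<psi> i) \<xi>)"
      by (simp add: cinner.scaleR_left cinner.scaleR_right)
    then show "cinner \<phi> ((p i *\<^sub>R rank_one_proj (\<psi> i)) \<xi>) = cinner \<phi> (sqrt (p i) *\<^sub>R \<psi> i) * cinner (sqrt (p i) *\<^sub>R \<psi> i) \<xi>"
      using p(1)[of i] by (simp add: blinfun.scaleR_left rank_one_proj_apply cinner.scaleR_right cinner_scaleC_right)
  qed
  finally show "(\<lambda>i. cinner \<phi> (sqrt (p i) *\<^sub>R \<psi> i) * cinner (sqrt (p i) *\<^sub>R \<psi> i) \<xi>) sums cinner \<phi> (\<rho> \<xi>)" .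
qed

definition energy_summand :: "l2r \<Rightarrow> nat \<Rightarrow> real" where
  "energy_summand \<psi> n = real n * (cmod (cinner (fock n) \<psi>))\<^sup>2"

lemma energy_summand_nonneg [simp]: "0 \<le> energy_summand \<psi> n"
  by (simp add: energy_summand_def)

text \<open>All terms are nonnegative, so the sums over components and Fock levels may be exchanged:
  every decomposition of \<rho> has total squared norm 1 and total energy at most E. This is the
  only control on the components of a mixture.\<close>

lemma decomposes_energy:
  assumes v: "decomposes \<rho> v" and \<rho>: "bounded_state E \<rho>"
  shows "(\<lambda>i. (norm (v i))\<^sup>2) sums 1"
    and "summable (energy_summand (v i))"
    and "summable (\<lambda>i. \<Sum>n. energy_summand (v i) n)"
    and "(\<Sum>i. \<Sum>n. energy_summand (v i) n) \<le> E"
proof -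
  have d: "(\<lambda>i. (cmod (cinner (fock n) (v i)))\<^sup>2) sums Re (cinner (fock n) (\<rho> (fock n)))" for n
  proof -
    have "(\<lambda>i. Re (cinner (fock n) (v i) * cinner (v i) (fock n))) sums Re (cinner (fock n) (\<rho> (fock n)))"
      using v by (intro sums_Re) (auto simp: decomposes_def)
    moreover have "Re (cinner (fock n) (v i) * cinner (v i) (fock n)) = (cmod (cinner (fock n) (v i)))\<^sup>2" for i
    proof -
      have "cinner (fock n) (v i) * cinner (v i) (fock n) = of_real ((cmod (cinner (fock n) (v i)))\<^sup>2)"
        by (simp only: complex_norm_square cinner_commute[of "v i"])
      then show ?thesis by simp
    qed
    ultimately show ?thesis by simp
  qed
  have e: "(\<Sum>i<I. \<Sum>n<N. energy_summand (v i) n) \<le> E" for I N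
  proof -
    have "(\<Sum>i<I. \<Sum>n<N. energy_summand (v i) n) = (\<Sum>n<N. real n * (\<Sum>i<I. (cmod (cinner (fock n) (v i)))\<^sup>2))"
      by (subst sum.swap) (simp add: energy_summand_def sum_distrib_left)
    also have "\<dots> \<le> (\<Sum>n<N. real n * Re (cinner (fock n) (\<rho> (fock n))))"
      using sum_le_suminf[OF sums_summable[OF d], of "{..<I}"] sums_unique[OF d]
      by (intro sum_mono mult_left_mono) auto
    also have "\<dots> \<le> E"
      using \<rho> by (simp add: bounded_state_def)
    finally show ?thesis .
  qed
  have e1: "(\<Sum>n<N. energy_summand (v i) n) \<le> E" for i N
  proof -
    have "(\<Sum>n<N. energy_summand (v i) n) \<le> (\<Sum>j<Suc i. \<Sum>n<N. energy_summand (v j) n)"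
      by (rule member_le_sum) (auto simp: sum_nonneg)
    then show ?thesis using e[where I = "Suc i" and N = N] by (rule order_trans)
  qed
  show s: "summable (energy_summand (v i))" for i
    by (rule summableI_nonneg_bounded[OF _ e1]) simp
  have "(\<Sum>i<I. \<Sum>n. energy_summand (v i) n) \<le> E" for I
  proof (rule LIMSEQ_le_const2)
    show "(\<lambda>N. \<Sum>i<I. \<Sum>n<N. energy_summand (v i) n) \<longlonglongrightarrow> (\<Sum>i<I. \<Sum>n. energy_summand (v i) n)"
      by (intro tendsto_sum summable_LIMSEQ s)
  qed (use e in auto)
  then show ss: "summable (\<lambda>i. \<Sum>n. energy_summand (v i) n)" and "(\<Sum>i. \<Sum>n. energy_summand (v i) n) \<le> E"
    by (auto intro!: summableI_nonneg_bounded suminf_nonneg s suminf_le_const)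
  have n: "summable (\<lambda>i. (norm (v i))\<^sup>2)"
    using v by (simp add: decomposes_def)
  have N1: "(\<Sum>i. (norm (v i))\<^sup>2) = 1"
  proof (rule antisym)
    have "(\<Sum>i<I. \<Sum>n<N. (cmod (cinner (fock n) (v i)))\<^sup>2) \<le> 1" for I N
    proof -
      have "(\<Sum>i<I. \<Sum>n<N. (cmod (cinner (fock n) (v i)))\<^sup>2) = (\<Sum>n<N. \<Sum>i<I. (cmod (cinner (fock n) (v i)))\<^sup>2)"
        by (rule sum.swap)
      also have "\<dots> \<le> (\<Sum>n<N. Re (cinner (fock n) (\<rho> (fock n))))"
        using sum_le_suminf[OF sums_summable[OF d], of "{..<I}"] sums_unique[OF d] by (intro sum_mono) auto
      also have "\<dots> \<le> 1"
        by (rule bounded_state_partial_trace[OF \<rho>])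
      finally show ?thesis .
    qed
    then have "(\<Sum>i<I. (norm (v i))\<^sup>2) \<le> 1" for I
      using LIMSEQ_le_const2[of "\<lambda>N. \<Sum>i<I. \<Sum>n<N. (cmod (cinner (fock n) (v i)))\<^sup>2" "\<Sum>i<I. (norm (v i))\<^sup>2" 1]
        tendsto_sum[of "{..<I}" "\<lambda>i N. \<Sum>n<N. (cmod (cinner (fock n) (v i)))\<^sup>2" "\<lambda>i. (norm (v i))\<^sup>2" sequentially]
        parseval_norm unfolding sums_def by blast
    then show "(\<Sum>i. (norm (v i))\<^sup>2) \<le> 1"
      by (intro suminf_le_const n)
    have "(\<Sum>n<N. Re (cinner (fock n) (\<rho> (fock n)))) \<le> (\<Sum>i. (norm (v i))\<^sup>2)" for N
      by (rule sums_le[OF bessel_fock sums_sum[OF d] summable_sums[OF n]])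
    then show "1 \<le> (\<Sum>i. (norm (v i))\<^sup>2)"
      using \<rho> unfolding bounded_state_def sums_def by (intro LIMSEQ_le_const2) auto
  qed
  then show "(\<lambda>i. (norm (v i))\<^sup>2) sums 1"
    using summable_sums[OF n] by simp
qed

section \<open>Outcome probabilities of mixtures and the trace-distance bound\<close>

section \<open>Rotations and quadrature projections\<close>

lemma cinner_fock_rotation: "cinner (fock n) (rotation \<theta> \<psi>) = cis (\<theta> * real n) * cinner (fock n) \<psi>"
proof -
  have "summable (\<lambda>n. scaleC (cis (\<theta> * real n) * cinner (fock n) \<psi>) (fock n))"
    using summable_fock_coeff[of \<psi>] by (intro summable_fock) (simp add: norm_mult)
  then have "(\<lambda>n. scaleC (cis (\<theta> * real n) * cinner (fock n) \<psi>) (fock n)) sums rotation \<theta> \<psi>"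
    unfolding rotation_def by (rule summable_sums)
  then show ?thesis by (rule cinner_fock_sums)
qed

lemma cinner_rotation: "cinner \<phi> (rotation \<theta> \<psi>) = cinner (rotation (- \<theta>) \<phi>) \<psi>"
  using parseval[of \<phi> "rotation \<theta> \<psi>"] parseval[of "rotation (- \<theta>) \<phi>" \<psi>]
  by (simp add: cinner_fock_rotation cis_cnj mult_ac sums_unique2)

lemma rotation_minus: "rotation (- \<theta>) (rotation \<theta> \<psi>) = \<psi>"
  by (rule fock_ext) (simp add: cinner_fock_rotation mult.assoc[symmetric] cis_mult)

lemma norm_rotation [simp]: "norm (rotation \<theta> \<psi>) = norm \<psi>"
proof -
  have "(norm (rotation \<theta> \<psi>))\<^sup>2 = (norm \<psi>)\<^sup>2"
    using parseval_norm[of "rotation \<theta> \<psi>"] parseval_norm[of \<psi>]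
    by (simp add: cinner_fock_rotation norm_mult sums_unique2)
  then show ?thesis by simp
qed

lemma sq_integrable_indicator:
  assumes "B \<in> sets borel" "sq_integrable f"
  shows "sq_integrable (\<lambda>x. indicator B x * f x)"
proof -
  have [measurable]: "B \<in> sets borel" "f \<in> borel_measurable borel" and i: "integrable lborel (\<lambda>x. (cmod (f x))\<^sup>2)"
    using assms by (auto simp: sq_integrable_def)
  have "integrable lborel (\<lambda>x. (cmod (indicator B x * f x))\<^sup>2)"
    by (rule Bochner_Integration.integrable_bound[OF i]) (auto simp: indicator_def)
  then show ?thesis by (simp add: sq_integrable_def)
qed

lemma cinner_position_proj:
  assumes "B \<in> sets borel"
  shows "cinner \<phi> (position_proj B \<psi>) = (LINT x|lborel. cnj (rep_l2r \<phi> x) * (indicator B x * rep_l2r \<psi> x))"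
  using cinner_to_l2r[OF sq_integrable_rep[of \<phi>] sq_integrable_indicator[OF assms sq_integrable_rep[of \<psi>]]]
  by (simp add: position_proj_def)

lemma position_proj_to_l2r:
  assumes "B \<in> sets borel" "sq_integrable f"
  shows "position_proj B (to_l2r f) = to_l2r (\<lambda>x. indicator B x * f x)"
  unfolding position_proj_def
  using rep_to_l2r[OF assms(2)]
  by (subst to_l2r_eq_iff) (auto intro!: sq_integrable_indicator assms sq_integrable_rep)

lemma position_proj_hermitian:
  assumes "B \<in> sets borel"
  shows "cinner \<phi> (position_proj B \<psi>) = cinner (position_proj B \<phi>) \<psi>"
proof -
  have "cinner (position_proj B \<phi>) \<psi> = (LINT x|lborel. cnj (indicator B x * rep_l2r \<phi> x) * rep_l2r \<psi> x)"
    using cinner_to_l2r[OF sq_integrable_indicator[OF assms sq_integrable_rep[of \<phi>]] sq_integrable_rep[of \<psi>]]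
    by (simp add: position_proj_def)
  then show ?thesis
    unfolding cinner_position_proj[OF assms]
    by (simp only:) (intro Bochner_Integration.integral_cong, auto simp: indicator_def)
qed

lemma position_proj_idem:
  assumes "B \<in> sets borel"
  shows "position_proj B (position_proj B \<psi>) = position_proj B \<psi>"
  unfolding position_proj_def[of B \<psi>]
  by (subst position_proj_to_l2r[OF assms sq_integrable_indicator[OF assms sq_integrable_rep]])
    (rule arg_cong[of _ _ to_l2r], auto simp: indicator_def)

lemma quadrature_proj_hermitian:
  assumes "B \<in> sets borel"
  shows "cinner \<phi> (quadrature_proj \<theta> B \<psi>) = cinner (quadrature_proj \<theta> B \<phi>) \<psi>"
  unfolding quadrature_proj_def cinner_rotation[of \<phi>] position_proj_hermitian[OF assms]
  by (simp add: cinner_rotation)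

lemma quadrature_proj_idem:
  assumes "B \<in> sets borel"
  shows "quadrature_proj \<theta> B (quadrature_proj \<theta> B \<psi>) = quadrature_proj \<theta> B \<psi>"
  using rotation_minus[of "- \<theta>"] position_proj_idem[OF assms] by (simp add: quadrature_proj_def)

lemma norm_quadrature_proj:
  assumes "B \<in> sets borel"
  shows "(norm (quadrature_proj \<theta> B \<psi>))\<^sup>2 = (LINT x|lborel. indicator B x * (cmod (rep_l2r (rotation \<theta> \<psi>) x))\<^sup>2)"
proof -
  have "(norm (quadrature_proj \<theta> B \<psi>))\<^sup>2 = (norm (position_proj B (rotation \<theta> \<psi>)))\<^sup>2"
    by (simp add: quadrature_proj_def)
  also have "\<dots> = (LINT x|lborel. (cmod (indicator B x * rep_l2r (rotation \<theta> \<psi>) x))\<^sup>2)"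
    unfolding position_proj_def by (rule norm_to_l2r_sq) (intro sq_integrable_indicator assms sq_integrable_rep)
  also have "\<dots> = (LINT x|lborel. indicator B x * (cmod (rep_l2r (rotation \<theta> \<psi>) x))\<^sup>2)"
    by (intro Bochner_Integration.integral_cong) (auto simp: indicator_def)
  finally show ?thesis .
qed

lemma norm_quadrature_proj_le:
  assumes "B \<in> sets borel"
  shows "norm (quadrature_proj \<theta> B \<psi>) \<le> norm \<psi>"
proof -
  have "(norm (quadrature_proj \<theta> B \<psi>))\<^sup>2 = cmod (cinner (quadrature_proj \<theta> B \<psi>) \<psi>)"
    using quadrature_proj_hermitian[OF assms, of "quadrature_proj \<theta> B \<psi>" \<theta> \<psi>]
    by (simp add: quadrature_proj_idem[OF assms] norm_sq_cinner norm_power)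
      (metis norm_of_real norm_power norm_sq_cinner of_real_power abs_norm_cancel)
  also have "\<dots> \<le> norm (quadrature_proj \<theta> B \<psi>) * norm \<psi>"
    by (rule cmod_cinner_le)
  finally show ?thesis
    by (cases "norm (quadrature_proj \<theta> B \<psi>) = 0") (auto simp: power2_eq_square)
qed

lemma ex_quadrature_op:
  assumes "B \<in> sets borel"
  obtains Q :: l2op where "complex_linear Q" "\<And>\<psi>. Q \<psi> = quadrature_proj \<theta> B \<psi>"
proof (rule ex_complex_linear_op[of "quadrature_proj \<theta> B" 1])
  show "quadrature_proj \<theta> B (x + y) = quadrature_proj \<theta> B x + quadrature_proj \<theta> B y" for x y
    by (rule cinner_ext) (simp add: quadrature_proj_hermitian[OF assms] cinner_add_right)
  show "quadrature_proj \<theta> B (scaleC c x) = scaleC c (quadrature_proj \<theta> B x)" for c x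
    by (rule cinner_ext) (simp add: quadrature_proj_hermitian[OF assms] cinner_scaleC_right)
qed (use norm_quadrature_proj_le[OF assms] that in auto)

text \<open>Serves to exchange the sum over the Fock basis in a trace with the sum over the
  components of a decomposition; absolute summability of the double series justifies it.\<close>

lemma sums_swap:
  fixes f :: "nat \<Rightarrow> nat \<Rightarrow> complex"
  assumes b: "\<And>i. (\<lambda>n. cmod (f i n)) sums c i" and c: "summable c"
    and s: "\<And>i. f i sums s i" and t: "\<And>n. (\<lambda>i. f i n) sums t n"
  shows "t sums (\<Sum>i. s i)"
proof -
  have ci: "infsum (\<lambda>n. cmod (f i n)) UNIV = c i" for i
  proof -
    have "((\<lambda>n. cmod (f i n)) has_sum c i) UNIV"
      using b[of i] by (intro sums_nonneg_imp_has_sum) auto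
    then show ?thesis by (rule infsumI)
  qed
  have c0: "c i \<ge> 0" for i
    by (rule sums_le[OF _ sums_zero b]) simp
  have "(\<lambda>x. norm (case x of (i, n) \<Rightarrow> f i n)) summable_on (UNIV \<times> UNIV)"
  proof (subst Infinite_Sum.abs_summable_on_Sigma_iff, intro conjI ballI)
    show "(\<lambda>n. norm (case (i, n) of (i, n) \<Rightarrow> f i n)) summable_on UNIV" for i
      using sums_summable[OF b[of i]] by (simp add: summable_on_UNIV_nonneg_real_iff)
    have "(\<lambda>i. norm (c i)) summable_on UNIV"
      using c c0 by (simp add: summable_on_UNIV_nonneg_real_iff)
    then show "(\<lambda>i. norm (\<Sum>\<^sub>\<infinity>n. cmod (case (i, n) of (i, n) \<Rightarrow> f i n))) summable_on UNIV"
      by (simp add: ci)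
  qed
  then have as: "(\<lambda>(i, n). f i n) summable_on (UNIV \<times> UNIV)"
    by (rule Infinite_Sum.abs_summable_summable)
  have as': "(\<lambda>(n, i). f i n) summable_on (UNIV \<times> UNIV)"
    using as by (subst (asm) summable_on_swap) simp
  have fi: "(f i has_sum s i) UNIV" for i
    using norm_summable_imp_has_sum[OF sums_summable[OF b[of i]] s[of i]] .
  have si: "(\<lambda>i. infsum (f i) UNIV) = s"
    by (rule ext, rule infsumI, rule fi)
  have ti: "infsum (\<lambda>i. f i n) UNIV = t n" for n
  proof -
    have "(\<lambda>i. f i n) summable_on UNIV"
      using summable_on_SigmaD1[of "\<lambda>n i. f i n" UNIV "\<lambda>_. UNIV" n] as' by simp
    then have "(\<lambda>i. f i n) sums infsum (\<lambda>i. f i n) UNIV"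
      by (intro has_sum_imp_sums has_sum_infsum)
    then show ?thesis
      using t sums_unique2 by blast
  qed
  have "infsum (\<lambda>i. infsum (f i) UNIV) UNIV = infsum (\<lambda>n. infsum (\<lambda>i. f i n) UNIV) UNIV"
    by (rule infsum_swap_banach[OF as])
  then have eq: "infsum s UNIV = infsum t UNIV"
    by (simp only: ti si)
  have "s summable_on UNIV"
    using summable_on_Sigma_banach[OF as] by (simp only: si)
  then have 1: "s sums infsum s UNIV"
    by (intro has_sum_imp_sums has_sum_infsum)
  have "t summable_on UNIV"
    using summable_on_Sigma_banach[OF as'] by (simp add: ti)
  then have "t sums infsum t UNIV"
    by (intro has_sum_imp_sums has_sum_infsum)
  then show ?thesis
    using sums_unique[OF 1] eq by simp
qed

text \<open>For fixed i the terms sum by Parseval to <Q v_i, v_i> = |Q v_i|^2, as Q is a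
  self-adjoint idempotent, and their absolute values sum to at most |v_i|^2. The double series thus
  converges absolutely.\<close>

lemma decomposes_quadrature_trace:
  assumes v: "decomposes \<rho> v" and B: "B \<in> sets borel"
  shows "(\<lambda>n. cinner (fock n) (\<rho> (quadrature_proj \<theta> B (fock n)))) sums
    complex_of_real (\<Sum>i. (norm (quadrature_proj \<theta> B (v i)))\<^sup>2)"
proof -
  define Q where "Q = quadrature_proj \<theta> B"
  have Qh: "cinner \<phi> (Q \<psi>) = cinner (Q \<phi>) \<psi>" for \<phi> \<psi>
    unfolding Q_def by (rule quadrature_proj_hermitian[OF B])
  define f where "f i n = cinner (fock n) (v i) * cinner (v i) (Q (fock n))" for i n
  have f: "f i n = cnj (cinner (fock n) (Q (v i))) * cinner (fock n) (v i)" for i n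
    unfolding f_def by (subst (2) cinner_commute) (simp add: Qh[symmetric] flip: cinner_commute)
  have sv: "summable (\<lambda>i. (norm (v i))\<^sup>2)"
    using v by (simp add: decomposes_def)
  have nQ: "norm (Q \<psi>) \<le> norm \<psi>" for \<psi>
    unfolding Q_def by (rule norm_quadrature_proj_le[OF B])
  have b: "cmod (f i n) \<le> ((cmod (cinner (fock n) (Q (v i))))\<^sup>2 + (cmod (cinner (fock n) (v i)))\<^sup>2) / 2" for i n
    using sum_squares_bound[of "cmod (cinner (fock n) (Q (v i)))" "cmod (cinner (fock n) (v i))"]
    by (simp add: f norm_mult)
  have bs: "(\<lambda>n. ((cmod (cinner (fock n) (Q (v i))))\<^sup>2 + (cmod (cinner (fock n) (v i)))\<^sup>2) / 2) sums (((norm (Q (v i)))\<^sup>2 + (norm (v i))\<^sup>2) / 2)" for i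
    by (intro sums_divide sums_add parseval_norm)
  have s: "summable (\<lambda>n. cmod (f i n))" for i
    by (rule summable_comparison_test'[OF sums_summable[OF bs[of i]], of 0]) (use b in simp)
  have "t sums (\<Sum>i. of_real ((norm (Q (v i)))\<^sup>2))" if "\<And>n. (\<lambda>i. f i n) sums t n" for t
  proof (rule sums_swap[OF summable_sums[OF s] _ _ that])
    show "summable (\<lambda>i. \<Sum>n. cmod (f i n))"
    proof (rule summable_comparison_test'[OF sv, of 0])
      fix i
      have "(\<Sum>n. cmod (f i n)) \<le> ((norm (Q (v i)))\<^sup>2 + (norm (v i))\<^sup>2) / 2"
        by (rule sums_le[OF b summable_sums[OF s] bs])
      also have "\<dots> \<le> (norm (v i))\<^sup>2"
        using power_mono[OF nQ norm_ge_zero, of "v i" 2] by simp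
      finally show "norm (\<Sum>n. cmod (f i n)) \<le> (norm (v i))\<^sup>2"
        using suminf_nonneg[OF s[of i]] by simp
    qed
    show "f i sums of_real ((norm (Q (v i)))\<^sup>2)" for i
    proof -
      have "f i sums cinner (Q (v i)) (v i)"
        unfolding f by (rule parseval)
      also have "cinner (Q (v i)) (v i) = cinner (Q (v i)) (Q (v i))"
        using Qh[of "Q (v i)" "v i"] quadrature_proj_idem[OF B] by (simp add: Q_def)
      finally show ?thesis by (simp only: norm_sq_cinner)
    qed
  qed
  moreover have "(\<lambda>i. f i n) sums cinner (fock n) (\<rho> (Q (fock n)))" for n
    using v by (simp add: decomposes_def f_def)
  moreover have "summable (\<lambda>i. (norm (Q (v i)))\<^sup>2)"
    by (rule summable_comparison_test'[OF sv, of 0]) (simp add: power_mono nQ)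
  ultimately show ?thesis
    by (simp add: Q_def suminf_of_real)
qed

lemma quadrature_prob_decomposes:
  assumes "decomposes \<rho> v" "B \<in> sets borel"
  shows "quadrature_prob \<rho> \<theta> B = (\<Sum>i. (norm (quadrature_proj \<theta> B (v i)))\<^sup>2)"
  unfolding quadrature_prob_def op_trace_def sums_unique[OF decomposes_quadrature_trace[OF assms], symmetric] by simp

lemma quadrature_prob_nonneg:
  assumes "bounded_state E \<rho>" "B \<in> sets borel"
  shows "0 \<le> quadrature_prob \<rho> \<theta> B"
proof -
  obtain v where v: "decomposes \<rho> v"
    using ex_decomposes[OF assms(1)] by blast
  have "summable (\<lambda>i. (norm (quadrature_proj \<theta> B (v i)))\<^sup>2)"
    by (rule summable_comparison_test'[of "\<lambda>i. (norm (v i))\<^sup>2" 0])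
      (use v in \<open>auto simp: decomposes_def intro!: power_mono norm_quadrature_proj_le assms\<close>)
  then show ?thesis
    unfolding quadrature_prob_decomposes[OF v assms(2)] by (intro suminf_nonneg) auto
qed

lemma quadrature_prob_diff_le_trace_distance:
  assumes \<sigma>: "bounded_state E \<sigma>" and \<tau>: "bounded_state E \<tau>" and B: "B \<in> sets borel"
  shows "quadrature_prob \<sigma> \<theta> B - quadrature_prob \<tau> \<theta> B \<le> trace_distance \<tau> \<sigma>"
proof -
  obtain Q :: l2op where Q: "complex_linear Q" "\<And>\<psi>. Q \<psi> = quadrature_proj \<theta> B \<psi>"
    using ex_quadrature_op[OF B] by blast
  define U where "U = 2 *\<^sub>R Q - id_blinfun"
  have U: "U \<psi> = 2 *\<^sub>R quadrature_proj \<theta> B \<psi> - \<psi>" for \<psi>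
    by (simp add: U_def blinfun.diff_left blinfun.scaleR_left Q)
  have Ul: "complex_linear U"
    unfolding U_def by (intro complex_linear_diff complex_linear_scaleR complex_linear_id Q)
  have Un: "norm (U \<psi>) \<le> norm \<psi>" for \<psi>
  proof -
    have "cinner (quadrature_proj \<theta> B \<psi>) (quadrature_proj \<theta> B \<psi>) = cinner (quadrature_proj \<theta> B \<psi>) \<psi>"
      using quadrature_proj_hermitian[OF B, of "quadrature_proj \<theta> B \<psi>" \<theta> \<psi>] by (simp add: quadrature_proj_idem[OF B])
    then have "inner (quadrature_proj \<theta> B \<psi>) (quadrature_proj \<theta> B \<psi>) = inner (quadrature_proj \<theta> B \<psi>) \<psi>"
      by (simp add: inner_l2r_def)
    then have "inner (U \<psi>) (U \<psi>) = inner \<psi> \<psi>"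
      by (simp add: U inner_diff_left inner_diff_right inner_commute)
    then show ?thesis
      by (simp add: norm_eq_sqrt_inner)
  qed
  have tr: "(\<lambda>n. Re (cinner (fock n) (\<rho> (quadrature_proj \<theta> B (fock n))))) sums quadrature_prob \<rho> \<theta> B" if "bounded_state E \<rho>" for \<rho>
  proof -
    obtain v where v: "decomposes \<rho> v"
      using ex_decomposes[OF \<open>bounded_state E \<rho>\<close>] by blast
    show ?thesis
      using sums_Re[OF decomposes_quadrature_trace[OF v B, of \<theta>]] by (simp add: quadrature_prob_decomposes[OF v B])
  qed
  define f where "f n = 2 * (Re (cinner (fock n) (\<sigma> (quadrature_proj \<theta> B (fock n)))) - Re (cinner (fock n) (\<tau> (quadrature_proj \<theta> B (fock n)))))
     - (Re (cinner (fock n) (\<sigma> (fock n))) - Re (cinner (fock n) (\<tau> (fock n))))" for n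
  have fs: "f sums (2 * (quadrature_prob \<sigma> \<theta> B - quadrature_prob \<tau> \<theta> B) - (1 - 1))"
    unfolding f_def using \<sigma> \<tau> by (intro sums_diff sums_mult tr) (auto simp: bounded_state_def)
  have tc: "trace_class (\<tau> - \<sigma>)"
    by (intro trace_class_diff bounded_state_trace_class[OF \<sigma>] bounded_state_trace_class[OF \<tau>])
  \<comment> \<open>Because \<sigma> - \<tau> is self-adjoint, \<open>f n\<close> is the real part
    of the conjugate of <U e_n, (\<sigma> - \<tau>) e_n>, which is the kind of entry that
    \<open>trace_norm_bound\<close> controls.\<close>
  have f_le: "f n \<le> cmod (cinner (U (fock n)) ((\<tau> - \<sigma>) (fock n)))" for n
  proof -
    have p: "positive_op \<sigma>" "positive_op \<tau>"
      using \<sigma> \<tau> by (auto simp: bounded_state_def)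
    have "f n = Re (cinner (fock n) ((\<sigma> - \<tau>) (U (fock n))))"
      by (simp add: f_def U blinfun.diff_left blinfun.diff_right blinfun.scaleR_right cinner.diff_right cinner.scaleR_right)
    also have "cinner (fock n) ((\<sigma> - \<tau>) (U (fock n))) = cinner ((\<sigma> - \<tau>) (fock n)) (U (fock n))"
      by (simp add: blinfun.diff_left cinner.diff_left cinner.diff_right positive_op_hermitian[OF p(1)] positive_op_hermitian[OF p(2)])
    also have "\<dots> = cnj (cinner (U (fock n)) ((\<sigma> - \<tau>) (fock n)))"
      by (rule cinner_commute)
    also have "Re \<dots> \<le> cmod \<dots>"
      by (rule complex_Re_le_cmod)
    also have "\<dots> = cmod (cinner (U (fock n)) ((\<tau> - \<sigma>) (fock n)))"
      by (simp only: complex_mod_cnj) (simp add: blinfun.diff_left cinner.diff_right norm_minus_commute)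
    finally show ?thesis .
  qed
  have "2 * (quadrature_prob \<sigma> \<theta> B - quadrature_prob \<tau> \<theta> B) - (1 - 1) \<le> trace_norm (\<tau> - \<sigma>)"
  proof (rule LIMSEQ_le_const2)
    show "(\<lambda>N. \<Sum>n<N. f n) \<longlonglongrightarrow> 2 * (quadrature_prob \<sigma> \<theta> B - quadrature_prob \<tau> \<theta> B) - (1 - 1)"
      using fs by (simp add: sums_def)
    show "\<exists>N. \<forall>n\<ge>N. (\<Sum>n<n. f n) \<le> trace_norm (\<tau> - \<sigma>)"
      using order_trans[OF sum_mono[OF f_le] trace_norm_bound[OF tc Ul Un]] by blast
  qed
  then show ?thesis
    by (simp add: trace_distance_def)
qed

section \<open>Sobolev estimates and the continuous representative of a vector\<close>

section \<open>Pointwise wave functions\<close>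

text \<open>\<open>sobolev \<psi>\<close> is \<open>\<langle>\<psi>|n + 1|\<psi>\<rangle>\<close>, which is equivalent to the squared norm of \<open>\<psi>\<close> and \<open>\<psi>'\<close>, \<open>x\<psi>\<close> together.\<close>

definition sobolev_summand :: "l2r \<Rightarrow> nat \<Rightarrow> real" where
  "sobolev_summand \<psi> n = (real n + 1) * (cmod (cinner (fock n) \<psi>))\<^sup>2"

definition sobolev :: "l2r \<Rightarrow> real" where
  "sobolev \<psi> = (\<Sum>n. sobolev_summand \<psi> n)"

lemma sobolev_summand_nonneg [simp]: "0 \<le> sobolev_summand \<psi> n"
  by (simp add: sobolev_summand_def)

lemma sobolev_eq:
  assumes "summable (energy_summand \<psi>)"
  shows "sobolev_summand \<psi> sums ((norm \<psi>)\<^sup>2 + (\<Sum>n. energy_summand \<psi> n))"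
proof -
  have "(\<lambda>n. (cmod (cinner (fock n) \<psi>))\<^sup>2 + energy_summand \<psi> n) sums ((norm \<psi>)\<^sup>2 + (\<Sum>n. energy_summand \<psi> n))"
    by (intro sums_add parseval_norm summable_sums assms)
  then show ?thesis
    by (simp add: sobolev_summand_def[abs_def] energy_summand_def algebra_simps)
qed

text \<open>The derivative is (a - b) / sqrt 2 with a, b the lowered and the raised vector. In Fock
  coordinates |a|^2 \<le> \<open>sobolev \<psi>\<close> and |b|^2 = \<open>sobolev \<psi>\<close>,
  and |a - b|^2 / 2 \<le> |a|^2 + |b|^2.\<close>

lemma norm_gauss_vec_deriv_le:
  fixes P :: "complex poly"
  defines "\<psi> \<equiv> gauss_vec 1 0 P"
  assumes "summable (sobolev_summand \<psi>)"
  shows "(norm (gauss_vec 1 0 (cgauss_deriv 1 0 P)))\<^sup>2 \<le> 2 * sobolev \<psi>"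
proof -
  define a where "a = gauss_vec 1 0 (lower_poly 1 0 P)"
  define b where "b = gauss_vec 1 0 (raise_poly 1 0 P)"
  have s: "sobolev_summand \<psi> sums sobolev \<psi>"
    using assms by (simp add: sobolev_def summable_sums)
  have le: "(cmod (cinner (fock n) a))\<^sup>2 \<le> sobolev_summand \<psi> (Suc n)" for n
    unfolding a_def cinner_fock_lower[of 1, simplified] \<psi>_def
    by (simp add: sobolev_summand_def norm_mult power_mult_distrib mult_right_mono)
  have s': "(\<lambda>n. sobolev_summand \<psi> (Suc n)) sums (sobolev \<psi> - sobolev_summand \<psi> 0)"
    using s by (subst sums_Suc_iff) simp
  have "(norm a)\<^sup>2 \<le> sobolev \<psi> - sobolev_summand \<psi> 0"
    by (rule sums_le[OF le parseval_norm s'])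
  then have na: "(norm a)\<^sup>2 \<le> sobolev \<psi>"
    using sobolev_summand_nonneg[of \<psi> 0] by linarith
  have "(\<lambda>n. (cmod (cinner (fock (Suc n)) b))\<^sup>2) = sobolev_summand \<psi>"
    unfolding b_def cinner_fock_raise(2)[of 1, simplified] \<psi>_def
    by (auto simp: sobolev_summand_def norm_mult power_mult_distrib)
  then have "(\<lambda>n. (cmod (cinner (fock (Suc n)) b))\<^sup>2) sums sobolev \<psi>"
    using s by simp
  then have "(\<lambda>n. (cmod (cinner (fock n) b))\<^sup>2) sums (sobolev \<psi> + (cmod (cinner (fock 0) b))\<^sup>2)"
    by (rule sums_Suc)
  then have nb: "(norm b)\<^sup>2 = sobolev \<psi>"
    using sums_unique2[OF parseval_norm[of b]] cinner_fock_raise(1)[of 1 0 P] by (simp add: b_def)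
  have "gauss_vec 1 0 (cgauss_deriv 1 0 P) = (1 / sqrt 2) *\<^sub>R (a - b)"
  proof -
    define c where "c = complex_of_real (1 / sqrt 2)"
    have c2: "c * (c + c) = 1"
      by (simp add: c_def flip: of_real_mult of_real_add)
    have "lower_poly 1 0 P - raise_poly 1 0 P = smult c (cgauss_deriv 1 0 P) + smult c (cgauss_deriv 1 0 P)"
      by (simp add: lower_poly_def raise_poly_def c_def smult_add_right smult_diff_right)
    then have "lower_poly 1 0 P - raise_poly 1 0 P = smult (c + c) (cgauss_deriv 1 0 P)"
      by (simp only: smult_add_left)
    then have "smult c (lower_poly 1 0 P - raise_poly 1 0 P) = cgauss_deriv 1 0 P"
      by (simp only: smult_smult c2 smult_1_left)
    then have "gauss_vec 1 0 (cgauss_deriv 1 0 P) = scaleC c (a - b)"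
      by (metis a_def b_def gauss_vec_diff gauss_vec_smult one_complex.sel(1) zero_less_one)
    then show ?thesis
      by (simp only: c_def scaleC_of_real)
  qed
  then have "(norm (gauss_vec 1 0 (cgauss_deriv 1 0 P)))\<^sup>2 = (norm (a - b))\<^sup>2 / 2"
    by (simp add: power_divide)
  also have "(norm (a - b))\<^sup>2 \<le> (norm a + norm b)\<^sup>2"
    by (intro power_mono norm_triangle_ineq4) simp
  also have "(norm a + norm b)\<^sup>2 / 2 \<le> (norm a)\<^sup>2 + (norm b)\<^sup>2"
    using sum_squares_bound[of "norm a" "norm b"] by (simp add: power2_sum)
  finally show ?thesis
    using na nb by simp
qed

text \<open>Cauchy-Schwarz for the integral of the derivative against the indicator of [x, y]:
  Hoelder continuity of order 1/2.\<close>

lemma cgauss_diff_bound: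
  "(cmod (cgauss 1 0 P y - cgauss 1 0 P x))\<^sup>2 \<le> \<bar>y - x\<bar> * (norm (gauss_vec 1 0 (cgauss_deriv 1 0 P)))\<^sup>2"
proof (induction x y rule: linorder_wlog)
  case (sym a b)
  then show ?case by (simp add: norm_minus_commute abs_minus_commute)
next
  case (le x y)
  define I where "I t = complex_of_real (indicator {x..y} t)" for t
  have I2: "(cmod (I t))\<^sup>2 = indicator {x..y} t" for t
    by (simp add: I_def indicator_def)
  have I: "sq_integrable I"
    unfolding sq_integrable_def I2 using le by (auto simp: I_def[abs_def])
  have nI: "(norm (to_l2r I))\<^sup>2 = y - x"
    unfolding norm_to_l2r_sq[OF I] I2 using le by simp
  have "cinner (to_l2r I) (gauss_vec 1 0 (cgauss_deriv 1 0 P)) = (LINT t|lborel. cnj (I t) * cgauss 1 0 (cgauss_deriv 1 0 P) t)"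
    unfolding gauss_vec_def by (intro cinner_to_l2r I sq_integrable_cgauss) simp
  also have "\<dots> = (LINT t|lborel. indicator {x..y} t *\<^sub>R cgauss 1 0 (cgauss_deriv 1 0 P) t)"
    by (intro Bochner_Integration.integral_cong refl) (simp only: I_def scaleR_conv_of_real complex_cnj_complex_of_real)
  also have "\<dots> = cgauss 1 0 P y - cgauss 1 0 P x"
    by (rule integral_FTC_Icc[OF le has_vector_derivative_at_within[OF has_vector_derivative_cgauss] continuous_on_cgauss])
  finally have "cmod (cgauss 1 0 P y - cgauss 1 0 P x) \<le> norm (to_l2r I) * norm (gauss_vec 1 0 (cgauss_deriv 1 0 P))"
    using cmod_cinner_le[of "to_l2r I" "gauss_vec 1 0 (cgauss_deriv 1 0 P)"] by simp
  then have "(cmod (cgauss 1 0 P y - cgauss 1 0 P x))\<^sup>2 \<le> (norm (to_l2r I) * norm (gauss_vec 1 0 (cgauss_deriv 1 0 P)))\<^sup>2"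
    by (intro power_mono) auto
  then show ?case
    using le by (simp add: power_mult_distrib nI)
qed

text \<open>The value at x is compared with the values at y in [x, x + 1] and averaged over y. The
  constant is 6 = 2 + 4: twice the squared norm, plus 4 from twice the Hoelder bound.\<close>

lemma cgauss_sup_bound:
  fixes P :: "complex poly"
  defines "\<psi> \<equiv> gauss_vec 1 0 P"
  assumes s: "summable (sobolev_summand \<psi>)"
  shows "(cmod (cgauss 1 0 P x))\<^sup>2 \<le> 6 * sobolev \<psi>"
proof -
  define f where "f = cgauss 1 0 P"
  define W where "W = sobolev \<psi>"
  have fi: "sq_integrable f"
    by (simp add: f_def sq_integrable_cgauss)
  have W0: "0 \<le> W"
    unfolding W_def sobolev_def by (intro suminf_nonneg s) simp
  have "(norm \<psi>)\<^sup>2 \<le> W"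
    unfolding W_def sobolev_def
    by (rule sums_le[OF _ parseval_norm summable_sums[OF s]]) (simp add: sobolev_summand_def algebra_simps)
  moreover have nf: "(norm \<psi>)\<^sup>2 = (LINT y|lborel. (cmod (f y))\<^sup>2)"
    unfolding \<psi>_def gauss_vec_def f_def by (intro norm_to_l2r_sq sq_integrable_cgauss) simp
  ultimately have nW: "(LINT y|lborel. (cmod (f y))\<^sup>2) \<le> W"
    by simp
  have le: "(cmod (f x))\<^sup>2 \<le> 2 * (cmod (f y))\<^sup>2 + 4 * W" if "y \<in> {x..x+1}" for y
  proof -
    have "(cmod (f y - f x))\<^sup>2 \<le> \<bar>y - x\<bar> * (norm (gauss_vec 1 0 (cgauss_deriv 1 0 P)))\<^sup>2"
      unfolding f_def by (rule cgauss_diff_bound)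
    also have "\<dots> \<le> 1 * (2 * W)"
      using that norm_gauss_vec_deriv_le[OF s[unfolded \<psi>_def]]
      by (intro mult_mono) (auto simp: W_def \<psi>_def)
    finally have d: "(cmod (f y - f x))\<^sup>2 \<le> 2 * W" by simp
    have "(cmod (f x))\<^sup>2 \<le> (cmod (f y) + cmod (f y - f x))\<^sup>2"
      using norm_triangle_ineq4[of "f y" "f y - f x"] by (intro power_mono) auto
    also have "\<dots> \<le> 2 * (cmod (f y))\<^sup>2 + 2 * (cmod (f y - f x))\<^sup>2"
      using sum_squares_bound[of "cmod (f y)" "cmod (f y - f x)"] by (simp add: power2_sum)
    finally show ?thesis
      using d by simp
  qed
  have "(cmod (f x))\<^sup>2 = (LINT y|lborel. indicator {x..x+1} y * (cmod (f x))\<^sup>2)"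
    by simp
  also have "\<dots> \<le> (LINT y|lborel. 2 * (cmod (f y))\<^sup>2 + indicator {x..x+1} y * (4 * W))"
  proof (rule integral_mono)
    show "integrable lborel (\<lambda>y. indicator {x..x+1} y * (cmod (f x))\<^sup>2)"
      by (intro integrable_mult_left) simp
    show "integrable lborel (\<lambda>y. 2 * (cmod (f y))\<^sup>2 + indicator {x..x+1} y * (4 * W))"
      using fi by (intro Bochner_Integration.integrable_add integrable_mult_right integrable_mult_left) (auto simp: sq_integrable_def)
    show "indicator {x..x+1} y * (cmod (f x))\<^sup>2 \<le> 2 * (cmod (f y))\<^sup>2 + indicator {x..x+1} y * (4 * W)" for y
      using le[of y] by (auto simp: indicator_def)
  qed
  also have "\<dots> = 2 * (LINT y|lborel. (cmod (f y))\<^sup>2) + 4 * W"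
    using fi by (subst Bochner_Integration.integral_add) (auto simp: sq_integrable_def)
  also have "\<dots> \<le> 6 * W"
    using nW by simp
  finally show ?thesis
    by (simp add: f_def W_def)
qed

lemma fock_fun_eq_cgauss: "fock_fun n = cgauss 1 0 (fock_poly n)"
  by (simp add: fock_fun_eq_gauss_poly gauss_poly_eq_cgauss)

lemma borel_measurable_fock_fun [measurable]: "fock_fun n \<in> borel_measurable borel"
  unfolding fock_fun_eq_cgauss by measurable

text \<open>A finite Fock sum is a polynomial times the standard Gaussian, so the two preceding
  estimates apply; expressed by coefficients they pass to infinite series.\<close>

lemma fock_sum_bounds:
  fixes c :: "nat \<Rightarrow> complex"
  assumes "finite A"
  shows "(cmod (\<Sum>n\<in>A. c n * fock_fun n x))\<^sup>2 \<le> 6 * (\<Sum>n\<in>A. (real n + 1) * (cmod (c n))\<^sup>2)"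
    and "(cmod ((\<Sum>n\<in>A. c n * fock_fun n y) - (\<Sum>n\<in>A. c n * fock_fun n x)))\<^sup>2 \<le> 2 * \<bar>y - x\<bar> * (\<Sum>n\<in>A. (real n + 1) * (cmod (c n))\<^sup>2)"
proof -
  define P where "P = (\<Sum>n\<in>A. smult (c n) (fock_poly n))"
  have P: "cgauss 1 0 P x = (\<Sum>n\<in>A. c n * fock_fun n x)" for x
    by (simp add: P_def cgauss_def fock_fun_eq_cgauss poly_sum sum_distrib_right mult.assoc)
  have Pv: "gauss_vec 1 0 P = (\<Sum>n\<in>A. scaleC (c n) (fock n))"
    unfolding P_def using assms
  proof (induction A rule: finite_induct)
    case empty
    then show ?case
      by (simp add: gauss_vec_def cgauss_simps(1)[abs_def] flip: zero_l2r.abs_eq)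
  next
    case (insert n A)
    then show ?case
      by (simp add: gauss_vec_add gauss_vec_smult flip: fock_eq_gauss_vec)
  qed
  have Pc: "cinner (fock m) (gauss_vec 1 0 P) = (if m \<in> A then c m else 0)" for m
  proof -
    have "cinner (fock m) (gauss_vec 1 0 P) = (\<Sum>n\<in>A. if m = n then c n else 0)"
      unfolding Pv cinner.sum_right cinner_scaleC_right fock_orthonormal by (intro sum.cong) auto
    then show ?thesis using assms by simp
  qed
  have "sobolev_summand (gauss_vec 1 0 P) sums (\<Sum>n\<in>A. sobolev_summand (gauss_vec 1 0 P) n)"
    by (rule sums_finite[OF assms]) (simp add: sobolev_summand_def Pc)
  also have "(\<Sum>n\<in>A. sobolev_summand (gauss_vec 1 0 P) n) = (\<Sum>n\<in>A. (real n + 1) * (cmod (c n))\<^sup>2)"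
    by (intro sum.cong) (auto simp: sobolev_summand_def Pc)
  finally have s: "sobolev_summand (gauss_vec 1 0 P) sums (\<Sum>n\<in>A. (real n + 1) * (cmod (c n))\<^sup>2)" .
  have S: "summable (sobolev_summand (gauss_vec 1 0 P))" "sobolev (gauss_vec 1 0 P) = (\<Sum>n\<in>A. (real n + 1) * (cmod (c n))\<^sup>2)"
    using s by (simp_all add: sobolev_def sums_iff)
  show "(cmod (\<Sum>n\<in>A. c n * fock_fun n x))\<^sup>2 \<le> 6 * (\<Sum>n\<in>A. (real n + 1) * (cmod (c n))\<^sup>2)"
    using cgauss_sup_bound[OF S(1), of x] by (simp add: P S(2))
  have "(cmod ((\<Sum>n\<in>A. c n * fock_fun n y) - (\<Sum>n\<in>A. c n * fock_fun n x)))\<^sup>2 \<le> \<bar>y - x\<bar> * (norm (gauss_vec 1 0 (cgauss_deriv 1 0 P)))\<^sup>2"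
    using cgauss_diff_bound[of P y x] by (simp add: P)
  also have "\<dots> \<le> \<bar>y - x\<bar> * (2 * (\<Sum>n\<in>A. (real n + 1) * (cmod (c n))\<^sup>2))"
    using norm_gauss_vec_deriv_le[OF S(1)] by (intro mult_left_mono) (simp_all add: S(2))
  finally show "(cmod ((\<Sum>n\<in>A. c n * fock_fun n y) - (\<Sum>n\<in>A. c n * fock_fun n x)))\<^sup>2 \<le> 2 * \<bar>y - x\<bar> * (\<Sum>n\<in>A. (real n + 1) * (cmod (c n))\<^sup>2)"
    by (simp add: mult_ac)
qed

text \<open>By duality with \<open>fock_sum_bounds\<close>, testing against \<open>c\<^sub>n = cnj (h\<^sub>n x) / (n + 1)\<close>.\<close>

lemma summable_fock_fun_kernel: "summable (\<lambda>n. (cmod (fock_fun n x))\<^sup>2 / (real n + 1))"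
proof (rule summableI_nonneg_bounded)
  fix N
  define c where "c n = cnj (fock_fun n x) / (real n + 1)" for n
  define D where "D = (\<Sum>n<N. (cmod (fock_fun n x))\<^sup>2 / (real n + 1))"
  have D0: "D \<ge> 0"
    unfolding D_def by (intro sum_nonneg) simp
  have cf: "c n * fock_fun n x = complex_of_real ((cmod (fock_fun n x))\<^sup>2 / (real n + 1))" for n
    unfolding of_real_divide complex_norm_square by (simp add: c_def mult.commute)
  have 1: "(\<Sum>n<N. c n * fock_fun n x) = complex_of_real D"
    unfolding D_def cf by simp
  have 2: "(\<Sum>n<N. (real n + 1) * (cmod (c n))\<^sup>2) = D"
    unfolding D_def
  proof (rule sum.cong)
    fix n
    have "cmod (c n) = cmod (fock_fun n x) / (real n + 1)"
    proof -
      have "cmod (complex_of_real (real n) + 1) = real n + 1"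
        by (metis norm_of_real abs_of_nonneg of_real_1 of_real_add of_nat_0_le_iff add_nonneg_nonneg zero_le_one)
      then show ?thesis
        by (simp add: c_def norm_divide)
    qed
    then show "(real n + 1) * (cmod (c n))\<^sup>2 = (cmod (fock_fun n x))\<^sup>2 / (real n + 1)"
      by (simp add: power_divide power2_eq_square)
  qed simp
  have "(cmod (complex_of_real D))\<^sup>2 \<le> 6 * D"
    using fock_sum_bounds(1)[of "{..<N}" c x] unfolding 1 2 by simp
  then have "D * D \<le> 6 * D"
    by (simp add: power2_eq_square)
  then have "D \<le> 6"
    using D0 by (cases "D = 0") auto
  then show "(\<Sum>n<N. (cmod (fock_fun n x))\<^sup>2 / (real n + 1)) \<le> 6"
    by (simp add: D_def)
qed simp

lemma summable_cauchy_schwarz: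
  fixes a b :: "nat \<Rightarrow> real"
  assumes a: "summable (\<lambda>n. (a n)\<^sup>2)" and b: "summable (\<lambda>n. (b n)\<^sup>2)"
  shows "summable (\<lambda>n. \<bar>a n * b n\<bar>)" and "(\<Sum>n. \<bar>a n * b n\<bar>) \<le> sqrt (\<Sum>n. (a n)\<^sup>2) * sqrt (\<Sum>n. (b n)\<^sup>2)"
proof -
  have le: "(\<Sum>n<N. \<bar>a n * b n\<bar>) \<le> sqrt (\<Sum>n. (a n)\<^sup>2) * sqrt (\<Sum>n. (b n)\<^sup>2)" for N
  proof -
    have "(\<Sum>n<N. \<bar>a n * b n\<bar>) \<le> L2_set a {..<N} * L2_set b {..<N}"
      using L2_set_mult_ineq[of a b "{..<N}"] by (simp add: abs_mult)
    also have "\<dots> \<le> sqrt (\<Sum>n. (a n)\<^sup>2) * sqrt (\<Sum>n. (b n)\<^sup>2)"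
      unfolding L2_set_def by (intro mult_mono real_sqrt_le_mono sum_le_suminf a b suminf_nonneg real_sqrt_ge_zero sum_nonneg) auto
    finally show ?thesis .
  qed
  show s: "summable (\<lambda>n. \<bar>a n * b n\<bar>)"
    by (rule summableI_nonneg_bounded[OF _ le]) simp
  show "(\<Sum>n. \<bar>a n * b n\<bar>) \<le> sqrt (\<Sum>n. (a n)\<^sup>2) * sqrt (\<Sum>n. (b n)\<^sup>2)"
    by (rule suminf_le_const[OF s le])
qed

text \<open>Pointwise sum of the Fock series. For vectors of finite energy it converges and is the
  continuous representative of the class, which gives a meaning to values and zeros at single
  points.\<close>

definition wavefun :: "l2r \<Rightarrow> real \<Rightarrow> complex" where
  "wavefun \<psi> x = (\<Sum>n. cinner (fock n) \<psi> * fock_fun n x)"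

text \<open>Cauchy-Schwarz with the weights n + 1 and 1 / (n + 1). The last factor does not depend
  on \<psi>, so at a fixed point x the tails are uniformly small over vectors of bounded
  energy.\<close>

lemma wavefun_tail_bound:
  assumes s: "summable (sobolev_summand \<psi>)"
  shows "summable (\<lambda>n. cmod (cinner (fock n) \<psi> * fock_fun n x))"
    and "cmod (wavefun \<psi> x - (\<Sum>n<N. cinner (fock n) \<psi> * fock_fun n x))
      \<le> sqrt (sobolev \<psi>) * sqrt (\<Sum>n. (cmod (fock_fun (n + N) x))\<^sup>2 / (real (n + N) + 1))"
proof -
  define k where "k n = (cmod (fock_fun n x))\<^sup>2 / (real n + 1)" for n
  have k: "summable k" "\<And>n. 0 \<le> k n"
    using summable_fock_fun_kernel[of x] by (simp_all add: k_def[abs_def])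
  have t: "cmod (cinner (fock n) \<psi> * fock_fun n x) = \<bar>sqrt (sobolev_summand \<psi> n) * sqrt (k n)\<bar>" for n
    using k(2)[of n] by (simp add: sobolev_summand_def k_def norm_mult real_sqrt_mult real_sqrt_divide)
  have cs: "summable (\<lambda>n. \<bar>sqrt (sobolev_summand \<psi> (n + M)) * sqrt (k (n + M))\<bar>)"
    "(\<Sum>n. \<bar>sqrt (sobolev_summand \<psi> (n + M)) * sqrt (k (n + M))\<bar>)
      \<le> sqrt (\<Sum>n. sobolev_summand \<psi> (n + M)) * sqrt (\<Sum>n. k (n + M))" for M
    using summable_cauchy_schwarz[of "\<lambda>n. sqrt (sobolev_summand \<psi> (n + M))" "\<lambda>n. sqrt (k (n + M))"]
      summable_ignore_initial_segment[OF s, of M] summable_ignore_initial_segment[OF k(1), of M] k(2)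
    by simp_all
  show sm: "summable (\<lambda>n. cmod (cinner (fock n) \<psi> * fock_fun n x))"
    using cs(1)[of 0] by (simp add: t)
  have "wavefun \<psi> x - (\<Sum>n<N. cinner (fock n) \<psi> * fock_fun n x) = (\<Sum>n. cinner (fock (n + N)) \<psi> * fock_fun (n + N) x)"
    unfolding wavefun_def using suminf_split_initial_segment[OF summable_norm_cancel[OF sm], of N] by simp
  also have "cmod \<dots> \<le> (\<Sum>n. cmod (cinner (fock (n + N)) \<psi> * fock_fun (n + N) x))"
    using summable_ignore_initial_segment[OF sm, of N] by (rule summable_norm)
  also have "\<dots> \<le> sqrt (\<Sum>n. sobolev_summand \<psi> (n + N)) * sqrt (\<Sum>n. k (n + N))"
    unfolding t by (rule cs)
  also have "\<dots> \<le> sqrt (sobolev \<psi>) * sqrt (\<Sum>n. k (n + N))"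
  proof (intro mult_right_mono real_sqrt_le_mono real_sqrt_ge_zero)
    show "(\<Sum>n. sobolev_summand \<psi> (n + N)) \<le> sobolev \<psi>"
      using suminf_split_initial_segment[OF s, of N] sum_nonneg[of "{..<N}" "sobolev_summand \<psi>"]
      by (simp add: sobolev_def)
  qed (intro suminf_nonneg summable_ignore_initial_segment k)
  finally show "cmod (wavefun \<psi> x - (\<Sum>n<N. cinner (fock n) \<psi> * fock_fun n x))
      \<le> sqrt (sobolev \<psi>) * sqrt (\<Sum>n. (cmod (fock_fun (n + N) x))\<^sup>2 / (real (n + N) + 1))"
    by (simp add: k_def)
qed

lemma wavefun_LIMSEQ:
  assumes "summable (sobolev_summand \<psi>)"
  shows "(\<lambda>N. \<Sum>n<N. cinner (fock n) \<psi> * fock_fun n x) \<longlonglongrightarrow> wavefun \<psi> x"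
  unfolding wavefun_def
  by (rule summable_LIMSEQ[OF summable_norm_cancel[OF wavefun_tail_bound(1)[OF assms]]])

lemma wavefun_bounds:
  assumes s: "summable (sobolev_summand \<psi>)"
  shows "(cmod (wavefun \<psi> x))\<^sup>2 \<le> 6 * sobolev \<psi>"
    and "(cmod (wavefun \<psi> y - wavefun \<psi> x))\<^sup>2 \<le> 2 * \<bar>y - x\<bar> * sobolev \<psi>"
proof -
  have le: "(\<Sum>n<N. (real n + 1) * (cmod (cinner (fock n) \<psi>))\<^sup>2) \<le> sobolev \<psi>" for N
    using sum_le_suminf[OF s, of "{..<N}"] by (simp add: sobolev_def sobolev_summand_def[abs_def])
  show "(cmod (wavefun \<psi> x))\<^sup>2 \<le> 6 * sobolev \<psi>"
  proof (rule LIMSEQ_le_const2)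
    show "(\<lambda>N. (cmod (\<Sum>n<N. cinner (fock n) \<psi> * fock_fun n x))\<^sup>2) \<longlonglongrightarrow> (cmod (wavefun \<psi> x))\<^sup>2"
      by (intro tendsto_intros wavefun_LIMSEQ s)
    have "(cmod (\<Sum>n<N. cinner (fock n) \<psi> * fock_fun n x))\<^sup>2 \<le> 6 * sobolev \<psi>" for N
      using fock_sum_bounds(1)[of "{..<N}" "\<lambda>n. cinner (fock n) \<psi>" x] le[of N] by simp
    then show "\<exists>N. \<forall>n\<ge>N. (cmod (\<Sum>n<n. cinner (fock n) \<psi> * fock_fun n x))\<^sup>2 \<le> 6 * sobolev \<psi>"
      by blast
  qed
  show "(cmod (wavefun \<psi> y - wavefun \<psi> x))\<^sup>2 \<le> 2 * \<bar>y - x\<bar> * sobolev \<psi>"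
  proof (rule LIMSEQ_le_const2)
    show "(\<lambda>N. (cmod ((\<Sum>n<N. cinner (fock n) \<psi> * fock_fun n y) - (\<Sum>n<N. cinner (fock n) \<psi> * fock_fun n x)))\<^sup>2) \<longlonglongrightarrow> (cmod (wavefun \<psi> y - wavefun \<psi> x))\<^sup>2"
      by (intro tendsto_intros wavefun_LIMSEQ s)
    have "(cmod ((\<Sum>n<N. cinner (fock n) \<psi> * fock_fun n y) - (\<Sum>n<N. cinner (fock n) \<psi> * fock_fun n x)))\<^sup>2 \<le> 2 * \<bar>y - x\<bar> * sobolev \<psi>" for N
      using fock_sum_bounds(2)[of "{..<N}" "\<lambda>n. cinner (fock n) \<psi>" y x] mult_left_mono[OF le[of N], of "2 * \<bar>y - x\<bar>"] by simp
    then show "\<exists>N. \<forall>n\<ge>N. (cmod ((\<Sum>n<n. cinner (fock n) \<psi> * fock_fun n y) - (\<Sum>n<n. cinner (fock n) \<psi> * fock_fun n x)))\<^sup>2 \<le> 2 * \<bar>y - x\<bar> * sobolev \<psi>"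
      by blast
  qed
qed

lemma continuous_on_wavefun:
  assumes s: "summable (sobolev_summand \<psi>)"
  shows "continuous_on UNIV (wavefun \<psi>)"
proof -
  have "isCont (wavefun \<psi>) x" for x
  proof -
    have "((\<lambda>y. sqrt (2 * \<bar>y - x\<bar> * sobolev \<psi>)) \<longlongrightarrow> sqrt (2 * \<bar>x - x\<bar> * sobolev \<psi>)) (at x)"
      by (intro tendsto_intros)
    then have "((\<lambda>y. sqrt (2 * \<bar>y - x\<bar> * sobolev \<psi>)) \<longlongrightarrow> 0) (at x)"
      by simp
    then have "((\<lambda>y. wavefun \<psi> y - wavefun \<psi> x) \<longlongrightarrow> 0) (at x)"
      by (rule Lim_null_comparison[rotated]) (use wavefun_bounds(2)[OF s] in \<open>auto intro!: always_eventually real_le_rsqrt\<close>)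
    then show ?thesis
      by (simp add: isCont_def LIM_zero_iff)
  qed
  then show ?thesis
    by (simp add: continuous_on_eq_continuous_at)
qed

lemma fock_eq_to_l2r: "fock n = to_l2r (fock_fun n)"
  by (rule fock.abs_eq)

lemma sq_integrable_fock_fun: "sq_integrable (fock_fun n)"
  unfolding fock_fun_eq_cgauss by (intro sq_integrable_cgauss) simp

lemma sum_fock_to_l2r:
  "sq_integrable (\<lambda>x. \<Sum>n<N. c n * fock_fun n x) \<and> (\<Sum>n<N. scaleC (c n) (fock n)) = to_l2r (\<lambda>x. \<Sum>n<N. c n * fock_fun n x)"
proof (induction N)
  case 0
  then show ?case by (simp add: sq_integrable_zero zero_l2r.abs_eq)
next
  case (Suc N)
  then show ?case
    by (simp add: sq_integrable_add sq_integrable_scale sq_integrable_fock_fun fock_eq_to_l2r scaleC_to_l2r plus_to_l2r)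
qed

text \<open>The partial sums converge pointwise to \<open>wavefun \<psi>\<close> and in L^2 to
  \<psi>; by Fatou's lemma the two limits differ by a function of norm 0.\<close>

lemma rep_eq_wavefun:
  assumes s: "summable (sobolev_summand \<psi>)"
  shows "AE x in lborel. rep_l2r \<psi> x = wavefun \<psi> x"
proof -
  define S where "S N x = (\<Sum>n<N. cinner (fock n) \<psi> * fock_fun n x)" for N x
  have [measurable]: "S N \<in> borel_measurable borel" for N
    unfolding S_def by measurable
  have [measurable]: "rep_l2r \<psi> \<in> borel_measurable borel"
    using sq_integrable_rep[of \<psi>] by (simp add: sq_integrable_def)
  have [measurable]: "wavefun \<psi> \<in> borel_measurable borel"
    by (rule borel_measurable_continuous_onI[OF continuous_on_wavefun[OF s]])
  have "(\<integral>\<^sup>+x. ennreal ((cmod (wavefun \<psi> x - rep_l2r \<psi> x))\<^sup>2) \<partial>lborel)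
      = (\<integral>\<^sup>+x. liminf (\<lambda>N. ennreal ((cmod (S N x - rep_l2r \<psi> x))\<^sup>2)) \<partial>lborel)"
  proof (rule nn_integral_cong)
    fix x
    have "(\<lambda>N. ennreal ((cmod (S N x - rep_l2r \<psi> x))\<^sup>2)) \<longlonglongrightarrow> ennreal ((cmod (wavefun \<psi> x - rep_l2r \<psi> x))\<^sup>2)"
      unfolding S_def by (intro tendsto_intros wavefun_LIMSEQ s)
    then show "ennreal ((cmod (wavefun \<psi> x - rep_l2r \<psi> x))\<^sup>2) = liminf (\<lambda>N. ennreal ((cmod (S N x - rep_l2r \<psi> x))\<^sup>2))"
      by (rule lim_imp_Liminf[OF sequentially_bot, symmetric])
  qed
  also have "\<dots> \<le> liminf (\<lambda>N. \<integral>\<^sup>+x. ennreal ((cmod (S N x - rep_l2r \<psi> x))\<^sup>2) \<partial>lborel)"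
    by (rule nn_integral_liminf) measurable
  also have "(\<lambda>N. \<integral>\<^sup>+x. ennreal ((cmod (S N x - rep_l2r \<psi> x))\<^sup>2) \<partial>lborel)
      = (\<lambda>N. ennreal ((norm ((\<Sum>n<N. scaleC (cinner (fock n) \<psi>) (fock n)) - \<psi>))\<^sup>2))"
  proof
    fix N
    have "(\<Sum>n<N. scaleC (cinner (fock n) \<psi>) (fock n)) - \<psi> = to_l2r (S N) - to_l2r (rep_l2r \<psi>)"
      using sum_fock_to_l2r[of "\<lambda>n. cinner (fock n) \<psi>" N] by (simp add: S_def[abs_def])
    also have "\<dots> = to_l2r (\<lambda>x. S N x - rep_l2r \<psi> x)"
      using sum_fock_to_l2r[of "\<lambda>n. cinner (fock n) \<psi>" N] by (intro minus_to_l2r sq_integrable_rep) (simp add: S_def[abs_def])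
    finally show "(\<integral>\<^sup>+x. ennreal ((cmod (S N x - rep_l2r \<psi> x))\<^sup>2) \<partial>lborel)
      = ennreal ((norm ((\<Sum>n<N. scaleC (cinner (fock n) \<psi>) (fock n)) - \<psi>))\<^sup>2)"
      using sum_fock_to_l2r[of "\<lambda>n. cinner (fock n) \<psi>" N]
      by (simp add: nn_integral_norm_to_l2r sq_integrable_diff sq_integrable_rep S_def[abs_def])
  qed
  also have "liminf \<dots> = 0"
  proof (rule lim_imp_Liminf[OF sequentially_bot])
    have "(\<lambda>N. (\<Sum>n<N. scaleC (cinner (fock n) \<psi>) (fock n)) - \<psi>) \<longlonglongrightarrow> 0"
      using fock_expansion[of \<psi>] by (simp add: sums_def LIM_zero_iff)
    then have "(\<lambda>N. ennreal ((norm ((\<Sum>n<N. scaleC (cinner (fock n) \<psi>) (fock n)) - \<psi>))\<^sup>2)) \<longlonglongrightarrow> ennreal ((norm (0 :: l2r))\<^sup>2)"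
      by (intro tendsto_intros)
    then show "(\<lambda>N. ennreal ((norm ((\<Sum>n<N. scaleC (cinner (fock n) \<psi>) (fock n)) - \<psi>))\<^sup>2)) \<longlonglongrightarrow> 0"
      by simp
  qed
  finally have "(\<integral>\<^sup>+x. ennreal ((cmod (wavefun \<psi> x - rep_l2r \<psi> x))\<^sup>2) \<partial>lborel) = 0"
    by simp
  then have "AE x in lborel. ennreal ((cmod (wavefun \<psi> x - rep_l2r \<psi> x))\<^sup>2) = 0"
    by (subst (asm) nn_integral_0_iff_AE) auto
  then show ?thesis
    by eventually_elim (simp add: ennreal_eq_0_iff)
qed

text \<open>The set of disagreement is open, and a nonempty open set contains an interval of
  positive measure.\<close>

lemma continuous_AE_eq_imp_eq:
  fixes f g :: "real \<Rightarrow> 'a :: real_normed_vector"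
  assumes f: "continuous_on UNIV f" and g: "continuous_on UNIV g" and ae: "AE x in lborel. f x = g x"
  shows "f x = g x"
proof (rule ccontr)
  assume ne: "f x \<noteq> g x"
  define U where "U = {x. f x \<noteq> g x}"
  have "open U"
    unfolding U_def by (intro open_Collect_neq f g)
  moreover have "x \<in> U"
    using ne by (simp add: U_def)
  ultimately obtain e where e: "e > 0" "ball x e \<subseteq> U"
    by (rule openE)
  have "{x <..< x + e} \<subseteq> U"
    using e(2) by (auto simp: subset_iff dist_real_def)
  then have "emeasure lborel {x <..< x + e} \<le> emeasure lborel U"
    using \<open>open U\<close> by (intro emeasure_mono) auto
  moreover have "emeasure lborel U = 0"
  proof -
    have "U \<in> sets lborel"
      using \<open>open U\<close> by simp
    then show ?thesis
      using ae AE_iff_measurable[of U lborel "\<lambda>x. f x = g x"] by (simp add: U_def)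
  qed
  ultimately show False
    using e(1) by simp
qed

section \<open>Existence, uniqueness and continuity of the outcome density\<close>

section \<open>Quadrature densities\<close>

lemma energy_summand_rotation: "energy_summand (rotation \<theta> \<psi>) = energy_summand \<psi>"
  by (auto simp: energy_summand_def cinner_fock_rotation norm_mult)

lemma sobolev_summand_rotation: "sobolev_summand (rotation \<theta> \<psi>) = sobolev_summand \<psi>"
  by (auto simp: sobolev_summand_def cinner_fock_rotation norm_mult)

lemma sobolev_rotation: "sobolev (rotation \<theta> \<psi>) = sobolev \<psi>"
  by (simp add: sobolev_def sobolev_summand_rotation)

lemma norm_quadrature_proj_wavefun:
  assumes B: "B \<in> sets borel" and s: "summable (sobolev_summand \<psi>)"
  shows "(norm (quadrature_proj \<theta> B \<psi>))\<^sup>2 = (LINT x|lborel. indicator B x * (cmod (wavefun (rotation \<theta> \<psi>) x))\<^sup>2)"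
    and "integrable lborel (\<lambda>x. (cmod (wavefun (rotation \<theta> \<psi>) x))\<^sup>2)"
proof -
  have s': "summable (sobolev_summand (rotation \<theta> \<psi>))"
    using s by (simp add: sobolev_summand_rotation)
  note [measurable] = borel_measurable_continuous_onI[OF continuous_on_wavefun[OF s']] B
  have [measurable]: "rep_l2r (rotation \<theta> \<psi>) \<in> borel_measurable borel"
    using sq_integrable_rep by (simp add: sq_integrable_def)
  show "(norm (quadrature_proj \<theta> B \<psi>))\<^sup>2 = (LINT x|lborel. indicator B x * (cmod (wavefun (rotation \<theta> \<psi>) x))\<^sup>2)"
    unfolding norm_quadrature_proj[OF B]
    by (rule integral_cong_AE) (use rep_eq_wavefun[OF s'] in auto)
  have "integrable lborel (\<lambda>x. (cmod (rep_l2r (rotation \<theta> \<psi>) x))\<^sup>2)"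
    using sq_integrable_rep by (simp add: sq_integrable_def)
  then show "integrable lborel (\<lambda>x. (cmod (wavefun (rotation \<theta> \<psi>) x))\<^sup>2)"
    by (rule integrable_cong_AE_imp) (use rep_eq_wavefun[OF s'] in auto)
qed

text \<open>The density is the sum of |\<open>wavefun\<close> of the rotated v_i|^2 over a
  decomposition. The terms are bounded by 6 times \<open>sobolev (v i)\<close>, which is summable by
  \<open>decomposes_energy\<close>, so the sum is uniform and continuous. Densities of a measure
  agree almost everywhere, and continuity makes the definite description unique.\<close>

lemma quadrature_density_properties:
  assumes \<rho>: "bounded_state E \<rho>"
  shows "continuous_on UNIV (quadrature_density \<rho> \<theta>)" "0 \<le> quadrature_density \<rho> \<theta> x"
    "integrable lborel (quadrature_density \<rho> \<theta>)"
    "B \<in> sets borel \<Longrightarrow> quadrature_prob \<rho> \<theta> B = (LINT x:B|lborel. quadrature_density \<rho> \<theta> x)"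
proof -
  obtain v where v: "decomposes \<rho> v"
    using ex_decomposes[OF \<rho>] by blast
  note en = decomposes_energy[OF v \<rho>]
  have s: "summable (sobolev_summand (v i))" and S: "sobolev (v i) = (norm (v i))\<^sup>2 + (\<Sum>n. energy_summand (v i) n)" for i
    using sobolev_eq[OF en(2)] by (simp_all add: sobolev_def sums_iff)
  have sS: "summable (\<lambda>i. sobolev (v i))"
    unfolding S by (intro summable_add en sums_summable[OF en(1)])
  define f where "f i x = (cmod (wavefun (rotation \<theta> (v i)) x))\<^sup>2" for i x
  define p where "p x = (\<Sum>i. f i x)" for x
  have f_le: "norm (f i x) \<le> 6 * sobolev (v i)" for i x
    using wavefun_bounds(1)[of "rotation \<theta> (v i)" x] s[of i]
    by (simp add: f_def sobolev_summand_rotation sobolev_rotation)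
  have fs: "summable (\<lambda>i. f i x)" for x
    by (rule summable_comparison_test'[OF summable_mult[OF sS, of 6], of 0]) (rule f_le)
  have cf: "continuous_on UNIV (f i)" for i
    unfolding f_def[abs_def] by (intro continuous_intros continuous_on_wavefun) (simp add: sobolev_summand_rotation s)
  have fi: "integrable lborel (f i)" for i
    unfolding f_def[abs_def] by (rule norm_quadrature_proj_wavefun(2)[OF sets.empty_sets s])
  have prob: "quadrature_prob \<rho> \<theta> B = (\<Sum>i. LINT x|lborel. indicator B x * f i x)" "summable (\<lambda>i. LINT x|lborel. indicator B x * f i x)"
    if B: "B \<in> sets borel" for B
  proof -
    have e: "(norm (quadrature_proj \<theta> B (v i)))\<^sup>2 = (LINT x|lborel. indicator B x * f i x)" for i
      unfolding f_def by (rule norm_quadrature_proj_wavefun(1)[OF B s])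
    show "quadrature_prob \<rho> \<theta> B = (\<Sum>i. LINT x|lborel. indicator B x * f i x)"
      unfolding quadrature_prob_decomposes[OF v B] e ..
    show "summable (\<lambda>i. LINT x|lborel. indicator B x * f i x)"
      unfolding e[symmetric]
      by (rule summable_comparison_test'[OF sums_summable[OF en(1)], of 0]) (simp add: power_mono norm_quadrature_proj_le[OF B])
  qed
  have pc: "continuous_on UNIV p"
    unfolding p_def
  proof (rule uniform_limit_theorem[where F = sequentially and f = "\<lambda>N x. \<Sum>i<N. f i x"])
    show "uniform_limit UNIV (\<lambda>N x. \<Sum>i<N. f i x) (\<lambda>x. \<Sum>i. f i x) sequentially"
      by (rule Weierstrass_m_test[OF f_le summable_mult[OF sS]])
  qed (auto intro!: always_eventually continuous_on_sum cf)
  have p0: "0 \<le> p x" for x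
    unfolding p_def by (intro suminf_nonneg fs) (simp add: f_def)
  have If: "integrable lborel (\<lambda>x. indicator B x * f i x)" if "B \<in> sets borel" for B i
    using integrable_mult_indicator[of B lborel "f i"] that fi by simp
  have pB: "integrable lborel (\<lambda>x. indicator B x * p x)" "(LINT x|lborel. indicator B x * p x) = quadrature_prob \<rho> \<theta> B"
    if B: "B \<in> sets borel" for B
  proof -
    have n: "norm (indicator B x * f i x) = indicator B x * f i x" for i x
      by (simp add: f_def indicator_def)
    have eq: "(\<Sum>i. indicator B x * f i x) = indicator B x * p x" for x
      unfolding p_def by (rule suminf_mult[OF fs])
    have sm: "summable (\<lambda>i. norm (indicator B x * f i x))" for x
      unfolding n by (rule summable_mult[OF fs])
    have sm2: "summable (\<lambda>i. LINT x|lborel. norm (indicator B x * f i x))"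
      unfolding n by (rule prob(2)[OF B])
    show "integrable lborel (\<lambda>x. indicator B x * p x)"
      using integrable_suminf[OF If[OF B] AE_I2[OF sm] sm2] by (simp only: eq)
    show "(LINT x|lborel. indicator B x * p x) = quadrature_prob \<rho> \<theta> B"
      using integral_suminf[OF If[OF B] AE_I2[OF sm] sm2] by (simp only: eq prob(1)[OF B])
  qed
  have pint: "integrable lborel p"
    using pB(1)[of UNIV] by simp
  have "quadrature_density \<rho> \<theta> = p"
    unfolding quadrature_density_def
  proof (rule the_equality)
    show "continuous_on UNIV p \<and> (\<forall>x. 0 \<le> p x) \<and> integrable lborel p \<and>
      (\<forall>B\<in>sets borel. quadrature_prob \<rho> \<theta> B = (LINT x:B|lborel. p x))"
      using pc p0 pint pB(2) by (auto simp: set_lebesgue_integral_def)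
    fix q assume q: "continuous_on UNIV q \<and> (\<forall>x. 0 \<le> q x) \<and> integrable lborel q \<and>
      (\<forall>B\<in>sets borel. quadrature_prob \<rho> \<theta> B = (LINT x:B|lborel. q x))"
    have em: "emeasure (density lborel (\<lambda>x. ennreal (r x))) B = ennreal (LINT x|lborel. indicator B x * r x)"
      if "integrable lborel r" "\<And>x. 0 \<le> r x" "B \<in> sets borel" for r :: "real \<Rightarrow> real" and B
    proof -
      have [measurable]: "r \<in> borel_measurable borel" "B \<in> sets borel"
        using that by auto
      have "emeasure (density lborel (\<lambda>x. ennreal (r x))) B = (\<integral>\<^sup>+x. ennreal (r x) * indicator B x \<partial>lborel)"
        by (rule emeasure_density) auto
      also have "\<dots> = (\<integral>\<^sup>+x. ennreal (indicator B x * r x) \<partial>lborel)"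
        by (intro nn_integral_cong) (auto simp: indicator_def)
      also have "\<dots> = ennreal (LINT x|lborel. indicator B x * r x)"
        using that integrable_mult_indicator[of B lborel r] by (intro nn_integral_eq_integral) auto
      finally show ?thesis .
    qed
    have "density lborel (\<lambda>x. ennreal (q x)) = density lborel (\<lambda>x. ennreal (p x))"
    proof (rule measure_eqI)
      fix B assume "B \<in> sets (density lborel (\<lambda>x. ennreal (q x)))"
      then have B: "B \<in> sets borel" by simp
      show "emeasure (density lborel (\<lambda>x. ennreal (q x))) B = emeasure (density lborel (\<lambda>x. ennreal (p x))) B"
        using q B pB(2)[OF B] by (simp add: em pint p0 set_lebesgue_integral_def)
    qed simp
    then have "AE x in lborel. ennreal (q x) = ennreal (p x)"
      using q pint by (intro sigma_finite_measure.density_unique[OF sigma_finite_lborel]) auto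
    then have "AE x in lborel. q x = p x"
      by eventually_elim (use q p0 in \<open>simp add: ennreal_inj\<close>)
    then show "q = p"
      using q pc by (intro ext continuous_AE_eq_imp_eq) auto
  qed
  then show "continuous_on UNIV (quadrature_density \<rho> \<theta>)" "0 \<le> quadrature_density \<rho> \<theta> x"
    "integrable lborel (quadrature_density \<rho> \<theta>)"
    "B \<in> sets borel \<Longrightarrow> quadrature_prob \<rho> \<theta> B = (LINT x:B|lborel. quadrature_density \<rho> \<theta> x)"
    using pc p0 pint pB(2) by (auto simp: set_lebesgue_integral_def)
qed

section \<open>Factorization of entire functions with finitely many zeros, and limits\<close>

section \<open>Entire functions with few zeros\<close>

lemma field_differentiable_cong_open:
  assumes "f field_differentiable (at a)" "open S" "a \<in> S" "\<And>w. w \<in> S \<Longrightarrow> f w = g w"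
  shows "g field_differentiable (at a)"
  using assms unfolding field_differentiable_def by (meson has_field_derivative_transform_within_open)

text \<open>The zero count is encoded as a factorization into a polynomial and a zero-free entire
  function. This excludes the zero function, allows zeros to be divided out one at a time, and is
  the first half of Hadamard's factorization.\<close>

definition few_zeros :: "nat \<Rightarrow> (complex \<Rightarrow> complex) \<Rightarrow> bool" where
  "few_zeros r F \<longleftrightarrow> (\<exists>p G. p \<noteq> 0 \<and> degree p \<le> r \<and> G holomorphic_on UNIV \<and>
     (\<forall>w. G w \<noteq> 0) \<and> (\<forall>w. F w = poly p w * G w))"

lemma few_zeros_of_zorder_sum:
  assumes F: "F holomorphic_on UNIV" and fin: "finite {w. F w = 0}"
    and le: "(\<Sum>w\<in>{w. F w = 0}. nat (zorder F w)) \<le> r"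
  shows "few_zeros r F"
proof -
  define Z where "Z = {w. F w = 0}"
  have finZ: "finite Z"
    using fin by (simp add: Z_def)
  define n where "n w = nat (zorder F w)" for w
  define q where "q A = (\<Prod>a\<in>A. [:-a, 1:] ^ n a)" for A :: "complex set"
  have q0: "q A \<noteq> 0" for A
    by (cases "finite A") (auto simp: q_def)
  have q_poly: "poly (q A) w = (\<Prod>a\<in>A. (w - a) ^ n a)" for A w
    by (simp add: q_def poly_prod)
  have q_nz: "poly (q A) w \<noteq> 0" if "w \<notin> A" for A w
    using that by (cases "finite A") (auto simp: q_poly)
  \<comment> \<open>The plane is infinite, so a finite zero set excludes the zero function.\<close>
  have nz: "\<exists>w\<in>UNIV. F w \<noteq> 0"
  proof -
    have "infinite (UNIV :: complex set)"
      by (rule infinite_UNIV_char_0)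
    then show ?thesis
      using fin by (metis (mono_tags, lifting) UNIV_I UNIV_eq_I mem_Collect_eq)
  qed
  have ex: "\<exists>e. e > 0 \<and> zor_poly F a holomorphic_on cball a e \<and>
      (\<forall>w\<in>cball a e. F w = zor_poly F a w * (w - a) ^ n a \<and> zor_poly F a w \<noteq> 0) \<and> (F a = 0 \<longrightarrow> n a > 0)" for a
    using zorder_exist_zero[OF F open_UNIV connected_UNIV UNIV_I nz, of a] by (auto simp: n_def split: if_splits)
  \<comment> \<open>F divided by its zeros; at a zero w the singularity is removed with the value of
    the local zero-free factor \<open>zor_poly\<close>.\<close>
  define G where "G w = (if w \<in> Z then zor_poly F w w / poly (q (Z - {w})) w else F w / poly (q Z) w)" for w
  have split: "poly (q Z) w = (w - a) ^ n a * poly (q (Z - {a})) w" if "a \<in> Z" for a w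
    unfolding q_poly using finZ that by (subst prod.remove[of _ a]) auto
  have "G field_differentiable (at a)" for a
  proof (cases "a \<in> Z")
    case True
    obtain e where e: "e > 0" "zor_poly F a holomorphic_on cball a e"
      "\<And>w. w \<in> cball a e \<Longrightarrow> F w = zor_poly F a w * (w - a) ^ n a \<and> zor_poly F a w \<noteq> 0"
      using ex[of a] by blast
    have noZ: "w \<notin> Z" if "w \<in> ball a e" "w \<noteq> a" for w
      using e(3)[of w] that by (auto simp: Z_def)
    have "(\<lambda>w. zor_poly F a w / poly (q (Z - {a})) w) holomorphic_on ball a e"
      using e(2) noZ by (intro holomorphic_intros q_nz) (auto intro: holomorphic_on_subset)
    then have "(\<lambda>w. zor_poly F a w / poly (q (Z - {a})) w) field_differentiable (at a)"
      using e(1) by (auto intro: holomorphic_on_imp_differentiable_at)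
    then show ?thesis
    proof (rule field_differentiable_cong_open)
      show "open (ball a e)" "a \<in> ball a e"
        using e(1) by auto
      show "zor_poly F a w / poly (q (Z - {a})) w = G w" if "w \<in> ball a e" for w
      proof (cases "w = a")
        case False
        then show ?thesis
          using noZ[OF that False] e(3)[of w] that by (simp add: G_def split[OF True])
      qed (simp add: G_def True)
    qed
  next
    case False
    have op: "open (- Z)"
      using finZ by (simp add: finite_imp_closed open_Compl)
    have "(\<lambda>w. F w / poly (q Z) w) holomorphic_on - Z"
      using F by (intro holomorphic_intros q_nz) (auto intro: holomorphic_on_subset)
    then have "(\<lambda>w. F w / poly (q Z) w) field_differentiable (at a)"
      using False op by (auto intro: holomorphic_on_imp_differentiable_at)
    then show ?thesis
      by (rule field_differentiable_cong_open[OF _ op]) (use False in \<open>auto simp: G_def\<close>)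
  qed
  then have "G holomorphic_on UNIV"
    by (simp add: holomorphic_on_def)
  moreover have "G w \<noteq> 0" for w
  proof (cases "w \<in> Z")
    case True
    have "zor_poly F w w \<noteq> 0"
      using ex[of w] by force
    then show ?thesis
      using True q_nz[of w "Z - {w}"] by (simp add: G_def)
  next
    case False
    then show ?thesis
      using q_nz[OF False] by (simp add: G_def Z_def)
  qed
  moreover have "F w = poly (q Z) w * G w" for w
  proof (cases "w \<in> Z")
    case True
    then have "n w > 0" "F w = 0"
      using ex[of w] by (auto simp: Z_def)
    then show ?thesis
      using split[OF True, of w] by simp
  next
    case False
    then show ?thesis
      using q_nz[OF False] by (simp add: G_def)
  qed
  moreover have "degree (q Z) \<le> r"
  proof -
    have "degree (q Z) \<le> (\<Sum>a\<in>Z. degree ([:-a, 1:] ^ n a))"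
      unfolding q_def using degree_prod_sum_le[OF finZ, of "\<lambda>a. [:-a, 1:] ^ n a"] by (simp add: o_def)
    also have "\<dots> = (\<Sum>a\<in>Z. n a)"
      by (intro sum.cong) (auto simp: degree_linear_power)
    finally show ?thesis
      using le by (simp add: Z_def n_def)
  qed
  ultimately show ?thesis
    unfolding few_zeros_def using q0 by blast
qed

lemma few_zeros_nonzero_fun:
  assumes "F holomorphic_on UNIV" "\<And>w. F w \<noteq> 0"
  shows "few_zeros r F"
  unfolding few_zeros_def using assms by (intro exI[of _ 1] exI[of _ F]) auto

lemma few_zeros_holomorphic: "few_zeros r F \<Longrightarrow> F holomorphic_on UNIV"
proof -
  assume "few_zeros r F"
  then obtain p G where "G holomorphic_on UNIV" "\<And>w. F w = poly p w * G w"
    unfolding few_zeros_def by blast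
  then have "(\<lambda>w. poly p w * G w) holomorphic_on UNIV" "F = (\<lambda>w. poly p w * G w)"
    by (auto intro!: holomorphic_intros)
  then show ?thesis by simp
qed

lemma few_zeros_mult_linear:
  assumes "few_zeros r h"
  shows "few_zeros (Suc r) (\<lambda>w. (w - z) * h w)"
proof -
  obtain p G where pG: "p \<noteq> 0" "degree p \<le> r" "G holomorphic_on UNIV" "\<And>w. G w \<noteq> 0" "\<And>w. h w = poly p w * G w"
    using assms unfolding few_zeros_def by blast
  define P where "P = [:- z, 1:] * p"
  have "P \<noteq> 0" "degree P \<le> Suc r" "\<And>w. poly P w = (w - z) * poly p w"
    using pG(1,2) degree_mult_le[of "[:- z, 1:]" p] by (simp_all add: P_def del: mult_pCons_left)
  then have "P \<noteq> 0 \<and> degree P \<le> Suc r \<and> G holomorphic_on UNIV \<and> (\<forall>w. G w \<noteq> 0) \<and> (\<forall>w. (w - z) * h w = poly P w * G w)"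
    using pG by simp
  then show ?thesis
    unfolding few_zeros_def by blast
qed

lemma uniform_limit_compose_seq:
  "uniform_limit K F f sequentially \<Longrightarrow> filterlim k at_top sequentially \<Longrightarrow>
    uniform_limit K (\<lambda>j. F (k j)) f sequentially"
  by (auto simp: uniform_limit_iff intro: eventually_compose_filterlim)

text \<open>Hurwitz's theorem with multiplicities, by dividing out one convergent zero at a time.\<close>

lemma few_zeros_limit:
  assumes "\<And>m. few_zeros r (F m)" "\<And>R. uniform_limit (cball 0 R) F f sequentially"
    and "f holomorphic_on UNIV" "\<exists>w. f w \<noteq> 0"
  shows "few_zeros r f"
  using assms
proof (induction r arbitrary: F f)
  \<comment> \<open>A zero of the limit attracts zeros of the F m with arbitrarily large m. For r =
    0 this leaves f without zeros; in the induction step it supplies zeros z j that converge to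
    z0.\<close>
  have hurwitz: "\<exists>m\<ge>M. \<exists>z\<in>ball z0 e. F m z = 0"
    if F: "\<And>m. few_zeros r (F m)" "\<And>R. uniform_limit (cball 0 R) F f sequentially"
      and f: "f holomorphic_on UNIV" "\<exists>w. f w \<noteq> 0" "f z0 = 0" and e: "e > 0"
    for r F f z0 M and e :: real
  proof (rule ccontr)
    assume "\<not> (\<exists>m\<ge>M. \<exists>z\<in>ball z0 e. F m z = 0)"
    then have nz: "\<And>m z. z \<in> ball z0 e \<Longrightarrow> F (m + M) z \<noteq> 0"
      by auto
    have "f z0 \<noteq> 0"
    proof (rule Hurwitz_no_zeros[of "ball z0 e" "\<lambda>m. F (m + M)" f z0])
      show "F (m + M) holomorphic_on ball z0 e" for m
        using few_zeros_holomorphic[OF F(1)] by (rule holomorphic_on_subset) auto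
      show "f holomorphic_on ball z0 e"
        using f(1) by (rule holomorphic_on_subset) auto
      show "uniform_limit K (\<lambda>m. F (m + M)) f sequentially" if K: "compact K" "K \<subseteq> ball z0 e" for K
      proof -
        obtain R where "K \<subseteq> cball 0 R"
          using compact_imp_bounded[OF K(1)] by (auto simp: bounded_pos subset_iff)
        then have "uniform_limit K F f sequentially"
          using F(2) uniform_limit_on_subset by blast
        then show ?thesis
          by (rule uniform_limit_compose_seq[OF _ filterlim_add_const_nat_at_top])
      qed
      show "\<not> f constant_on ball z0 e"
      proof
        assume "f constant_on ball z0 e"
        then have z: "f w = 0" if "w \<in> ball z0 e" for w
          using f(3) e that unfolding constant_on_def by (metis centre_in_ball)
        have "f w = 0" for w
          by (rule analytic_continuation_open[of "ball z0 e" UNIV f "\<lambda>_. 0"]) (use z f e in auto)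
        then show False using f(2) by simp
      qed
    qed (use e nz in auto)
    then show False using f(3) by simp
  qed
  {
    case (0 F f)
    have "f z \<noteq> 0" for z
    proof
      assume "f z = 0"
      then obtain m w where "F m w = 0"
        using hurwitz[OF 0(1-4), of z 1 0] by auto
      moreover obtain p G where "p \<noteq> 0" "degree p \<le> 0" "\<And>w. G w \<noteq> 0" "\<And>w. F m w = poly p w * G w"
        using 0(1)[of m] unfolding few_zeros_def by blast
      moreover from this obtain a where "p = [:a:]"
        by (auto elim: degree_eq_zeroE)
      ultimately show False
        by auto
    qed
    with 0 show ?case
      by (intro few_zeros_nonzero_fun) auto
  next
    case (Suc r F f)
    show ?case
    proof (cases "\<exists>z. f z = 0")
      case False
      with Suc show ?thesis
        by (intro few_zeros_nonzero_fun) auto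
    next
      case True
      then obtain z0 where z0: "f z0 = 0" by blast
      have "\<exists>m z. m \<ge> j \<and> dist z0 z < 1 / real (Suc j) \<and> F m z = 0" for j
      proof -
        have "\<exists>m\<ge>j. \<exists>z\<in>ball z0 (1 / real (Suc j)). F m z = 0"
          by (rule hurwitz[OF Suc.prems z0]) simp
        then show ?thesis by (metis mem_ball)
      qed
      then obtain k z where k: "\<And>j. k j \<ge> j" and z: "\<And>j. dist z0 (z j) < 1 / real (Suc j)" "\<And>j. F (k j) (z j) = 0"
        by metis
      have kt: "filterlim k at_top sequentially"
        by (rule filterlim_at_top_mono[OF filterlim_ident]) (use k in auto)
      have zl: "(\<lambda>j. cmod (z j - z0)) \<longlonglongrightarrow> 0"
        by (rule tendsto_sandwich[OF _ _ tendsto_const LIMSEQ_Suc[OF lim_1_over_n]])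
          (use z(1) in \<open>auto simp: dist_norm norm_minus_commute intro!: always_eventually less_imp_le\<close>)
      have "\<exists>H. few_zeros r H \<and> (\<forall>w. F (k j) w = (w - z j) * H w)" for j
      proof -
        obtain p G where pG: "p \<noteq> 0" "degree p \<le> Suc r" "G holomorphic_on UNIV" "\<And>w. G w \<noteq> 0" "\<And>w. F (k j) w = poly p w * G w"
          using Suc.prems(1)[of "k j"] unfolding few_zeros_def by blast
        have "poly p (z j) = 0"
          using pG(4,5)[of "z j"] z(2)[of j] by simp
        then obtain q where q: "p = [:- z j, 1:] * q"
          by (auto simp: poly_eq_0_iff_dvd dvd_def)
        have q0: "q \<noteq> 0"
          using pG(1) q by auto
        have "degree p = degree [:- z j, 1:] + degree q"
          unfolding q by (rule degree_mult_eq) (use q0 in auto)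
        then have "degree q \<le> r"
          using pG(2) by simp
        with q0 have "few_zeros r (\<lambda>w. poly q w * G w)"
          unfolding few_zeros_def using pG by blast
        moreover have "F (k j) w = (w - z j) * (poly q w * G w)" for w
          by (simp add: pG(5) q algebra_simps)
        ultimately show ?thesis by blast
      qed
      then obtain H where H: "\<And>j. few_zeros r (H j)" "\<And>j w. F (k j) w = (w - z j) * H j w"
        by metis
      define h where "h w = (if w = z0 then deriv f z0 else f w / (w - z0))" for w
      have hol_h: "h holomorphic_on UNIV"
        by (rule pole_theorem_0[of f _ z0]) (use Suc.prems(3) z0 in \<open>auto simp: h_def\<close>)
      have fh: "f w = (w - z0) * h w" for w
        using z0 by (simp add: h_def)
      have "uniform_limit (cball 0 R) H h sequentially" for R
      proof (rule uniform_limitI)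
        fix e :: real assume e: "e > 0"
        \<comment> \<open>The quotients are compared on the circle of radius R' and the estimate is
          carried inside by the maximum modulus principle. The margin 2 keeps z0, and z j within
          distance 1 of it, at distance at least 1 from the circle, so the divisions do not enlarge
          anything.\<close>
        define R' where "R' = \<bar>R\<bar> + cmod z0 + 2"
        have dv: "x / d \<le> x" if "1 \<le> d" "0 \<le> x" for x d :: real
          using that mult_left_mono[of 1 d x] by (simp add: divide_le_eq)
        have R': "R' > 0" by (simp add: R'_def add_nonneg_pos)
        have "continuous_on (cball 0 R') f"
          using Suc.prems(3) by (intro holomorphic_on_imp_continuous_on) (auto intro: holomorphic_on_subset)
        then have "bounded (f ` cball 0 R')"
          by (intro compact_imp_bounded compact_continuous_image) auto
        then obtain B where B: "B > 0" "\<And>w. w \<in> cball 0 R' \<Longrightarrow> cmod (f w) \<le> B"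
          by (auto simp: bounded_pos)
        have "uniform_limit (cball 0 R') (\<lambda>j. F (k j)) f sequentially"
          by (rule uniform_limit_compose_seq[OF Suc.prems(2) kt])
        then have "\<forall>\<^sub>F j in sequentially. \<forall>w\<in>cball 0 R'. dist (F (k j) w) (f w) < e / 4"
          using e by (intro uniform_limitD) auto
        moreover have "\<forall>\<^sub>F j in sequentially. cmod (z j - z0) < min 1 (e / (4 * B))"
          using zl e B(1) by (intro order_tendstoD) auto
        ultimately show "\<forall>\<^sub>F j in sequentially. \<forall>w\<in>cball 0 R. dist (H j w) (h w) < e"
        proof eventually_elim
          case (elim j)
          have "cmod (H j w - h w) \<le> e / 2" if w: "w \<in> cball 0 R" for w
          proof (rule maximum_modulus_frontier[of "\<lambda>w. H j w - h w" "cball 0 R'"])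
            have hol: "(\<lambda>w. H j w - h w) holomorphic_on UNIV"
              by (intro holomorphic_intros hol_h few_zeros_holomorphic[OF H(1)])
            show "(\<lambda>w. H j w - h w) holomorphic_on interior (cball 0 R')"
              using hol by (rule holomorphic_on_subset) simp
            show "continuous_on (closure (cball 0 R')) (\<lambda>w. H j w - h w)"
              using hol by (intro holomorphic_on_imp_continuous_on) (auto intro: holomorphic_on_subset)
            show "w \<in> cball 0 R'"
            proof -
              have "cmod w \<le> R" using w by simp
              then have "cmod w \<le> R'"
                unfolding R'_def using norm_ge_zero[of z0] by linarith
              then show ?thesis by simp
            qed
            fix w assume "w \<in> frontier (cball (0::complex) R')"
            then have nw: "cmod w = R'"
              using R' by simp
            have d0: "cmod (w - z0) \<ge> 1"
              using norm_triangle_ineq2[of w z0] nw by (simp add: R'_def)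
            have "cmod (z j) \<le> cmod z0 + 1"
              using norm_triangle_sub[of "z j" z0] elim(2) by simp
            then have d1: "cmod (w - z j) \<ge> 1"
              using norm_triangle_ineq2[of w "z j"] nw by (simp add: R'_def)
            have "H j w - h w = ((F (k j) w - f w) + h w * (z j - z0)) / (w - z j)"
            proof -
              have "(H j w - h w) * (w - z j) = (F (k j) w - f w) + h w * (z j - z0)"
                by (simp add: H(2) fh algebra_simps)
              moreover have "w - z j \<noteq> 0" using d1 by auto
              ultimately show ?thesis by (simp add: nonzero_eq_divide_eq)
            qed
            then have "cmod (H j w - h w) = cmod ((F (k j) w - f w) + h w * (z j - z0)) / cmod (w - z j)"
              by (simp add: norm_divide)
            also have "\<dots> \<le> cmod ((F (k j) w - f w) + h w * (z j - z0))"
              using d1 by (rule dv) simp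
            also have "\<dots> \<le> e / 4 + B * (e / (4 * B))"
            proof (rule norm_triangle_le[OF add_mono])
              show "cmod (F (k j) w - f w) \<le> e / 4"
                using elim(1) nw by (auto simp: dist_norm intro: less_imp_le)
              have "cmod (h w) = cmod (f w) / cmod (w - z0)"
                using d0 by (auto simp: h_def norm_divide)
              also have "\<dots> \<le> cmod (f w)"
                using d0 by (rule dv) simp
              also have "\<dots> \<le> B"
                using B(2)[of w] nw by simp
              finally show "cmod (h w * (z j - z0)) \<le> B * (e / (4 * B))"
                using elim(2) B(1) unfolding norm_mult by (intro mult_mono) auto
            qed
            also have "\<dots> = e / 2"
              using B(1) by simp
            finally show "cmod (H j w - h w) \<le> e / 2" .
          qed auto
          then show ?case
            using e by (force simp: dist_norm)
        qed
      qed
      moreover have "\<exists>w. h w \<noteq> 0"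
        using Suc.prems(4) by (auto simp: fh)
      ultimately have "few_zeros r h"
        by (intro Suc.IH[OF H(1) _ hol_h])
      then have "few_zeros (Suc r) (\<lambda>w. (w - z0) * h w)"
        by (rule few_zeros_mult_linear)
      then show ?thesis
        by (simp add: fh[abs_def])
    qed
  }
qed

text \<open>Borel--Caratheodory: the Schwarz lemma is applied to \<open>h / (2M - h)\<close> with \<open>Re h < M\<close>.\<close>

lemma entire_Re_quadratic_bound:
  assumes g: "g holomorphic_on UNIV" and Re: "\<And>w. Re (g w) \<le> (cmod w)\<^sup>2 / 2 + K"
  shows "\<exists>c0 c1 c2. \<forall>w. g w = c0 + c1 * w + c2 * w\<^sup>2"
proof -
  define h where "h w = g w - g 0" for w
  have h: "h holomorphic_on UNIV"
    unfolding h_def by (intro holomorphic_intros g)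
  \<comment> \<open>The term \<open>cmod (g 0)\<close> pays for the normalization h 0 = 0, and the 1
    makes the bound on Re h strict, as the Schwarz lemma requires.\<close>
  define L where "L = \<bar>K\<bar> + cmod (g 0) + 1"
  have L: "L > 0" by (simp add: L_def add_nonneg_pos)
  have Reh: "Re (h w) < (cmod w)\<^sup>2 / 2 + L" for w
    using Re[of w] abs_Re_le_cmod[of "g 0"] by (simp add: h_def L_def)
  have bound: "cmod (h w) \<le> 4 * (cmod w)\<^sup>2 + 2 * L" for w
  proof (cases "w = 0")
    case True
    then show ?thesis using L by (simp add: h_def)
  next
    case False
    \<comment> \<open>Radius 2 |w| places w at modulus 1/2 after rescaling. The Schwarz lemma then
      gives 2 |h w| \<le> |2M - h w|, hence |h w| \<le> 2M, which is quadratic in |w|.\<close>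
    define \<rho> where "\<rho> = 2 * cmod w"
    have \<rho>: "\<rho> > 0" using False by (simp add: \<rho>_def)
    define M where "M = \<rho>\<^sup>2 / 2 + L"
    have M: "M > 0" using L by (simp add: M_def add_nonneg_pos)
    define \<phi> where "\<phi> z = h (of_real \<rho> * z) / (2 * of_real M - h (of_real \<rho> * z))" for z
    have ReM: "Re (h (of_real \<rho> * z)) < M" if "cmod z < 1" for z
    proof -
      have "(cmod (of_real \<rho> * z))\<^sup>2 \<le> \<rho>\<^sup>2"
        using that \<rho> by (intro power_mono) (auto simp: norm_mult mult_le_cancel_left1)
      then show ?thesis
        using Reh[of "of_real \<rho> * z"] by (simp add: M_def)
    qed
    have lt: "cmod u < cmod (2 * of_real M - u)" if "Re u < M" for u
    proof -
      have "(cmod (2 * of_real M - u))\<^sup>2 - (cmod u)\<^sup>2 = 4 * M * (M - Re u)"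
        unfolding cmod_power2 by (simp add: power2_eq_square algebra_simps)
      also have "\<dots> > 0"
        using M that by simp
      finally have "(cmod u)\<^sup>2 < (cmod (2 * of_real M - u))\<^sup>2" by simp
      then show ?thesis
        by (rule power2_less_imp_less) simp
    qed
    have nz: "2 * of_real M - h (of_real \<rho> * z) \<noteq> 0" if "cmod z < 1" for z
      using lt[OF ReM[OF that]] norm_ge_zero by (metis norm_zero not_less)
    have "cmod (\<phi> (w / of_real \<rho>)) \<le> cmod (w / of_real \<rho>)"
    proof (rule Schwarz_Lemma(1)[of \<phi>])
      have "(\<lambda>z. h (of_real \<rho> * z)) holomorphic_on ball 0 1"
        using holomorphic_on_compose_gen[of "\<lambda>z. of_real \<rho> * z" "ball 0 1" h UNIV] h
        by (auto simp: o_def intro!: holomorphic_intros)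
      then show "\<phi> holomorphic_on ball 0 1"
        unfolding \<phi>_def using nz by (intro holomorphic_intros) auto
      show "\<phi> 0 = 0"
        by (simp add: \<phi>_def h_def)
      show "cmod (\<phi> z) < 1" if "cmod z < 1" for z
        using lt[OF ReM[OF that]] nz[OF that] by (simp add: \<phi>_def norm_divide)
      show "cmod (w / of_real \<rho>) < 1"
        using False by (simp add: \<rho>_def norm_divide)
    qed
    moreover have "of_real \<rho> * (w / of_real \<rho>) = w" "cmod (w / of_real \<rho>) = 1 / 2"
      using \<rho> False by (simp_all add: norm_divide) (simp add: \<rho>_def)
    ultimately have "cmod (h w / (2 * of_real M - h w)) \<le> 1 / 2"
      by (simp add: \<phi>_def)
    moreover have "cmod (2 * of_real M - h w) > 0"
      using nz[of "w / of_real \<rho>"] \<rho> \<open>cmod (w / of_real \<rho>) = 1 / 2\<close> by simp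
    ultimately have "2 * cmod (h w) \<le> cmod (2 * of_real M - h w)"
      by (simp add: norm_divide divide_le_eq)
    also have "\<dots> \<le> 2 * M + cmod (h w)"
      using norm_triangle_ineq4[of "2 * complex_of_real M" "h w"] M by (simp add: norm_mult)
    finally have "cmod (h w) \<le> 2 * M" by simp
    then show ?thesis
      by (simp add: M_def \<rho>_def power_mult_distrib)
  qed
  have "h w = (\<Sum>k\<le>2. (deriv ^^ k) h 0 / fact k * w ^ k)" for w
  proof (rule Liouville_polynomial[OF h, where A = 1 and B = "4 + 2 * L"])
    fix z :: complex assume "1 \<le> cmod z"
    then have "2 * L * 1 \<le> 2 * L * (cmod z)\<^sup>2"
      using L by (intro mult_left_mono) auto
    then show "cmod (h z) \<le> (4 + 2 * L) * (cmod z)\<^sup>2"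
      using bound[of z] by (simp add: algebra_simps)
  qed
  moreover define c where "c k = (deriv ^^ k) h 0 / fact k" for k
  ultimately have "h w = (\<Sum>k\<le>2. c k * w ^ k)" for w
    by simp
  then have "g w = (g 0 + c 0) + c 1 * w + c 2 * w\<^sup>2" for w
    using h_def[of w] by (simp add: numeral_2_eq_2 algebra_simps)
  then show ?thesis by blast
qed

lemma poly_lower_bound_at_infinity:
  fixes p :: "complex poly"
  assumes "p \<noteq> 0"
  obtains c R where "c > 0" "R > 0" "\<And>z. cmod z \<ge> R \<Longrightarrow> cmod (poly p z) \<ge> c"
proof (cases p rule: pCons_cases)
  case (pCons a q)
  show ?thesis
  proof (cases "q = 0")
    case True
    then show ?thesis
      using that[of "cmod a" 1] assms pCons by auto
  next
    case False
    obtain r where "\<And>z. r \<le> cmod z \<Longrightarrow> 1 \<le> cmod (poly (pCons a q) z)"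
      using poly_infinity[OF False, of 1 a] by blast
    then show ?thesis
      using that[of 1 "max r 1"] pCons by auto
  qed
qed

text \<open>The zero-free factor is exp g, and \<open>growth\<close> bounds Re g by |w|^2 / 2 plus a
  constant, so g is quadratic. If |a| \<ge> 1/2, there is a ray along which |F w| is at least a
  constant times exp (|w|^2 / 2), which the extra factor |w| in \<open>decay\<close>
  forbids.\<close>

lemma few_zeros_gaussian:
  assumes F: "few_zeros r F" and growth: "\<And>w. cmod (F w) \<le> C * exp ((cmod w)\<^sup>2 / 2)"
    and decay: "\<And>w. cmod w * cmod (F w) \<le> C * exp ((cmod w)\<^sup>2 / 2)"
  obtains p a b where "p \<noteq> 0" "degree p \<le> r" "\<And>w. F w = poly p w * exp (a * w\<^sup>2 + b * w)" "cmod a < 1 / 2"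
proof -
  obtain p G where pG: "p \<noteq> 0" "degree p \<le> r" "G holomorphic_on UNIV" "\<And>w. G w \<noteq> 0" "\<And>w. F w = poly p w * G w"
    using F unfolding few_zeros_def by blast
  obtain g where g: "g holomorphic_on UNIV" "\<And>w. G w = exp (g w)"
    using contractible_imp_holomorphic_log[OF pG(3) contractible_UNIV] pG(4) by (metis UNIV_I)
  obtain c R where cR: "c > 0" "R > 0" "\<And>z. cmod z \<ge> R \<Longrightarrow> cmod (poly p z) \<ge> c"
    using poly_lower_bound_at_infinity[OF pG(1)] by blast
  have C0: "C \<ge> 0"
    using order_trans[OF norm_ge_zero growth[of 0]] by simp
  have "continuous_on (cball 0 R) (\<lambda>w. Re (g w))"
    using g(1) by (intro continuous_intros holomorphic_on_imp_continuous_on) (auto intro: holomorphic_on_subset)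
  then have "bounded ((\<lambda>w. Re (g w)) ` cball 0 R)"
    by (intro compact_imp_bounded compact_continuous_image) auto
  then obtain B where B: "B > 0" "\<And>w. w \<in> cball 0 R \<Longrightarrow> \<bar>Re (g w)\<bar> \<le> B"
    by (auto simp: bounded_pos)
  define K where "K = B + \<bar>ln ((C + 1) / c)\<bar>"
  have "Re (g w) \<le> (cmod w)\<^sup>2 / 2 + K" for w
  proof (cases "cmod w \<le> R")
    case True
    then have "Re (g w) \<le> B"
      using B(2)[of w] by simp
    then show ?thesis
      by (simp add: K_def add_nonneg_nonneg add_increasing add_increasing2)
  next
    case False
    then have p: "cmod (poly p w) \<ge> c"
      by (intro cR) simp
    have "c * exp (Re (g w)) \<le> cmod (poly p w) * cmod (G w)"
      using p by (simp add: g(2) mult_right_mono)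
    also have "\<dots> = cmod (F w)"
      by (simp add: pG(5) norm_mult)
    also have "\<dots> \<le> C * exp ((cmod w)\<^sup>2 / 2)"
      by (rule growth)
    also have "\<dots> \<le> (C + 1) * exp ((cmod w)\<^sup>2 / 2)"
      by (intro mult_right_mono) auto
    finally have "exp (Re (g w)) \<le> (C + 1) / c * exp ((cmod w)\<^sup>2 / 2)"
      using cR(1) by (simp add: field_simps)
    also have "(C + 1) / c = exp (ln ((C + 1) / c))"
      using C0 cR(1) by simp
    finally have "Re (g w) \<le> ln ((C + 1) / c) + (cmod w)\<^sup>2 / 2"
      by (simp flip: exp_add)
    then show ?thesis
      using B(1) by (simp add: K_def)
  qed
  then obtain c0 b a where q: "\<And>w. g w = c0 + b * w + a * w\<^sup>2"
    using entire_Re_quadratic_bound[OF g(1)] by blast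
  define P where "P = smult (exp c0) p"
  have P: "P \<noteq> 0" "degree P \<le> r" "F w = poly P w * exp (a * w\<^sup>2 + b * w)" for w
    using pG by (auto simp: P_def g(2) q exp_add algebra_simps)
  have "cmod a < 1 / 2"
  proof (rule ccontr)
    assume "\<not> cmod a < 1 / 2"
    then have a: "cmod a \<ge> 1 / 2" by simp
    then have "a \<noteq> 0" by auto
    \<comment> \<open>A unit square root of cnj a / |a| makes a (t u)^2 = |a| t^2 real and
      nonnegative. Both u0 and - u0 qualify, and the sign is chosen so that the linear term does not
      decrease the modulus.\<close>
    define u0 where "u0 = csqrt (cnj a / of_real (cmod a))"
    have u0: "u0\<^sup>2 = cnj a / of_real (cmod a)"
      by (simp add: u0_def)
    define u where "u = (if Re (b * u0) \<ge> 0 then u0 else - u0)"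
    have u2: "u\<^sup>2 = cnj a / of_real (cmod a)" and ub: "Re (b * u) \<ge> 0"
      using u0 by (auto simp: u_def)
    have "(cmod u)\<^sup>2 = 1"
      using \<open>a \<noteq> 0\<close> by (simp add: u2 norm_divide flip: norm_power)
    then have nu: "cmod u = 1"
      using norm_ge_zero[of u] by (simp add: power2_eq_1_iff)
    have au: "a * u\<^sup>2 = of_real (cmod a)"
    proof -
      have "a * cnj a = of_real (cmod a) * of_real (cmod a)"
        by (simp add: complex_norm_square[symmetric] power2_eq_square)
      then show ?thesis
        using \<open>a \<noteq> 0\<close> by (simp add: u2)
    qed
    obtain c' R' where cR': "c' > 0" "R' > 0" "\<And>z. cmod z \<ge> R' \<Longrightarrow> cmod (poly P z) \<ge> c'"
      using poly_lower_bound_at_infinity[OF P(1)] by blast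
    \<comment> \<open>Beyond R' the polynomial has modulus at least c', and t c' > C contradicts
      \<open>decay\<close>.\<close>
    define t where "t = max R' (C / c' + 1)"
    have t: "t \<ge> R'" "t > 0" "t > C / c'"
      using cR' by (auto simp: t_def)
    define w where "w = of_real t * u"
    have nw: "cmod w = t"
      using t nu by (simp add: w_def norm_mult)
    define \<beta> where "\<beta> = Re (b * u)"
    have "Re (a * w\<^sup>2 + b * w) = cmod a * t\<^sup>2 + t * \<beta>"
    proof -
      have "a * w\<^sup>2 = of_real (cmod a * t\<^sup>2)"
        using au by (simp add: w_def power_mult_distrib algebra_simps)
      moreover have "b * w = of_real t * (b * u)"
        by (simp add: w_def algebra_simps)
      moreover have "Re (of_real t * z) = t * Re z" for z
        by simp
      ultimately show ?thesis
        by (simp only: plus_complex.sel Re_complex_of_real \<beta>_def)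
    qed
    moreover have "t\<^sup>2 / 2 \<le> cmod a * t\<^sup>2 + t * \<beta>"
    proof -
      have "1 / 2 * t\<^sup>2 \<le> cmod a * t\<^sup>2"
        by (rule mult_right_mono[OF a]) simp
      moreover have "0 \<le> t * \<beta>"
        using t ub by (simp add: \<beta>_def)
      ultimately show ?thesis by simp
    qed
    ultimately have "exp (t\<^sup>2 / 2) \<le> cmod (exp (a * w\<^sup>2 + b * w))"
      by simp
    then have "c' * exp (t\<^sup>2 / 2) \<le> cmod (F w)"
      unfolding P(3) norm_mult using cR' t nw by (intro mult_mono) auto
    then have "t * (c' * exp (t\<^sup>2 / 2)) \<le> cmod w * cmod (F w)"
      using t nw cR'(1) by (intro mult_mono) auto
    also have "\<dots> \<le> C * exp (t\<^sup>2 / 2)"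
      using decay[of w] nw by simp
    finally have "t * c' \<le> C"
      by (simp add: mult.assoc[symmetric])
    then show False
      using t(3) cR'(1) by (simp add: field_simps)
  qed
  with P show ?thesis
    using that by blast
qed

section \<open>The Bargmann transform: growth, injectivity, rotations\<close>

section \<open>Stellar functions\<close>

definition stellar_coeff :: "l2r \<Rightarrow> nat \<Rightarrow> complex" where
  "stellar_coeff \<psi> n = cinner (fock n) \<psi> / complex_of_real (sqrt (fact n))"

lemma stellar_fun_eq: "stellar_fun \<psi> \<alpha> = (\<Sum>n. stellar_coeff \<psi> n * \<alpha> ^ n)"
  by (simp add: stellar_fun_def stellar_coeff_def)

lemma norm_stellar_term: "cmod (stellar_coeff \<psi> n * \<alpha> ^ n) = \<bar>cmod (cinner (fock n) \<psi>) * (cmod \<alpha> ^ n / sqrt (fact n))\<bar>"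
  by (simp add: stellar_coeff_def norm_mult norm_divide norm_power)

lemma sums_exp_norm_sq: "(\<lambda>n. (cmod \<alpha> ^ n / sqrt (fact n))\<^sup>2) sums exp ((cmod \<alpha>)\<^sup>2)"
proof -
  have "(cmod \<alpha> ^ n / sqrt (fact n))\<^sup>2 = ((cmod \<alpha>)\<^sup>2) ^ n /\<^sub>R fact n" for n
  proof -
    have "(cmod \<alpha> ^ n / sqrt (fact n))\<^sup>2 = (cmod \<alpha> ^ n)\<^sup>2 / fact n"
      by (simp add: power_divide)
    also have "(cmod \<alpha> ^ n)\<^sup>2 = ((cmod \<alpha>)\<^sup>2) ^ n"
      by (simp only: power_mult[symmetric] mult.commute)
    finally show ?thesis
      by (simp only: real_scaleR_def divide_inverse mult.commute)
  qed
  then show ?thesis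
    using exp_converges[of "(cmod \<alpha>)\<^sup>2"] by simp
qed

text \<open>Cauchy-Schwarz against the sequence |\<alpha>|^n / sqrt (n!), whose squares sum to exp
  (|\<alpha>|^2).\<close>

lemma stellar_fun_growth:
  shows "summable (\<lambda>n. cmod (stellar_coeff \<psi> n * \<alpha> ^ n))"
    and "cmod (stellar_fun \<psi> \<alpha>) \<le> norm \<psi> * exp ((cmod \<alpha>)\<^sup>2 / 2)"
proof -
  note cs = summable_cauchy_schwarz[OF summable_fock_coeff[of \<psi>] sums_summable[OF sums_exp_norm_sq[of \<alpha>]]]
  show s: "summable (\<lambda>n. cmod (stellar_coeff \<psi> n * \<alpha> ^ n))"
    unfolding norm_stellar_term by (rule cs)
  have "sqrt (exp ((cmod \<alpha>)\<^sup>2)) = exp ((cmod \<alpha>)\<^sup>2 / 2)"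
    by (rule real_sqrt_unique) (simp_all add: power2_eq_square flip: exp_add)
  moreover have "sqrt (\<Sum>n. (cmod (cinner (fock n) \<psi>))\<^sup>2) = norm \<psi>"
    unfolding sums_unique[OF parseval_norm[of \<psi>], symmetric] by simp
  moreover have "(\<Sum>n. (cmod \<alpha> ^ n / sqrt (fact n))\<^sup>2) = exp ((cmod \<alpha>)\<^sup>2)"
    using sums_unique[OF sums_exp_norm_sq[of \<alpha>]] by simp
  ultimately have "(\<Sum>n. cmod (stellar_coeff \<psi> n * \<alpha> ^ n)) \<le> norm \<psi> * exp ((cmod \<alpha>)\<^sup>2 / 2)"
    unfolding norm_stellar_term using cs(2) by simp
  then show "cmod (stellar_fun \<psi> \<alpha>) \<le> norm \<psi> * exp ((cmod \<alpha>)\<^sup>2 / 2)"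
    unfolding stellar_fun_eq using summable_norm[OF s] by linarith
qed

lemma stellar_fun_sums: "(\<lambda>n. stellar_coeff \<psi> n * \<alpha> ^ n) sums stellar_fun \<psi> \<alpha>"
  unfolding stellar_fun_eq by (rule summable_sums[OF summable_norm_cancel[OF stellar_fun_growth(1)]])

text \<open>Finite energy gains one power of |\<alpha>|: the weight sqrt (n + 1) on the Fock
  coefficients turns |\<alpha>| |\<alpha>|^n / sqrt (n!) into the next term |\<alpha>|^(n+1) / sqrt
  ((n + 1)!) of the exponential sequence. It supplies the \<open>decay\<close> hypothesis of
  \<open>few_zeros_gaussian\<close>.\<close>

lemma stellar_fun_decay:
  assumes s: "summable (sobolev_summand \<psi>)"
  shows "cmod \<alpha> * cmod (stellar_fun \<psi> \<alpha>) \<le> sqrt (sobolev \<psi>) * exp ((cmod \<alpha>)\<^sup>2 / 2)"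
proof -
  define x where "x = (cmod \<alpha>)\<^sup>2"
  define a where "a n = sqrt (sobolev_summand \<psi> n)" for n
  define b where "b n = cmod \<alpha> ^ Suc n / sqrt (fact (Suc n))" for n
  have a2: "(a n)\<^sup>2 = sobolev_summand \<psi> n" for n
    by (simp add: a_def)
  have "(\<lambda>n. (b n)\<^sup>2) sums (exp x - (cmod \<alpha> ^ 0 / sqrt (fact 0))\<^sup>2)"
    unfolding b_def x_def by (subst sums_Suc_iff) (simp add: sums_exp_norm_sq)
  then have b2: "(\<lambda>n. (b n)\<^sup>2) sums (exp x - 1)" by simp
  have ab: "cmod \<alpha> * cmod (stellar_coeff \<psi> n * \<alpha> ^ n) = \<bar>a n * b n\<bar>" for n
  proof -
    have f: "sqrt (fact (Suc n)) = sqrt (real n + 1) * sqrt (fact n)"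
      by (simp add: real_sqrt_mult add.commute)
    have "sqrt (real n + 1) \<noteq> 0" by simp
    then have "sqrt (real n + 1) * cmod (cinner (fock n) \<psi>) * (cmod \<alpha> ^ Suc n / (sqrt (real n + 1) * sqrt (fact n)))
      = cmod \<alpha> * (cmod (cinner (fock n) \<psi>) * (cmod \<alpha> ^ n / sqrt (fact n)))"
      by (simp add: field_simps)
    moreover have "a n = sqrt (real n + 1) * cmod (cinner (fock n) \<psi>)"
      by (simp add: a_def sobolev_summand_def real_sqrt_mult)
    ultimately show ?thesis
      unfolding norm_stellar_term b_def f by (simp add: abs_mult)
  qed
  note cs = summable_cauchy_schwarz[of a b, unfolded a2, OF s sums_summable[OF b2]]
  have "cmod \<alpha> * cmod (stellar_fun \<psi> \<alpha>) \<le> cmod \<alpha> * (\<Sum>n. cmod (stellar_coeff \<psi> n * \<alpha> ^ n))"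
    unfolding stellar_fun_eq by (intro mult_left_mono summable_norm stellar_fun_growth) simp
  also have "\<dots> = (\<Sum>n. \<bar>a n * b n\<bar>)"
    unfolding ab[symmetric] by (rule suminf_mult[symmetric, OF stellar_fun_growth(1)])
  also have "\<dots> \<le> sqrt (sobolev \<psi>) * sqrt (exp x - 1)"
    using cs(2) sums_unique[OF b2] by (simp add: sobolev_def)
  also have "\<dots> \<le> sqrt (sobolev \<psi>) * sqrt (exp x)"
    using s by (intro mult_left_mono real_sqrt_le_mono) (auto simp: sobolev_def suminf_nonneg)
  also have "sqrt (exp x) = exp (x / 2)"
    by (rule real_sqrt_unique) (simp_all add: power2_eq_square flip: exp_add)
  finally show ?thesis
    by (simp add: x_def)
qed

lemma stellar_fun_has_derivative:
  "(stellar_fun \<psi> has_field_derivative (\<Sum>n. diffs (stellar_coeff \<psi>) n * \<alpha> ^ n)) (at \<alpha>)"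
  using termdiffs_strong_converges_everywhere[of "stellar_coeff \<psi>" \<alpha>]
    summable_norm_cancel[OF stellar_fun_growth(1)[of \<psi>]]
  by (simp add: stellar_fun_eq[abs_def])

lemma stellar_fun_holomorphic: "stellar_fun \<psi> holomorphic_on UNIV"
  using stellar_fun_has_derivative by (auto simp: holomorphic_on_def field_differentiable_def)

lemma stellar_fun_add: "stellar_fun (\<psi> + \<phi>) \<alpha> = stellar_fun \<psi> \<alpha> + stellar_fun \<phi> \<alpha>"
proof (rule sums_unique2[OF stellar_fun_sums])
  have "(\<lambda>n. stellar_coeff \<psi> n * \<alpha> ^ n + stellar_coeff \<phi> n * \<alpha> ^ n) sums (stellar_fun \<psi> \<alpha> + stellar_fun \<phi> \<alpha>)"
    by (intro sums_add stellar_fun_sums)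
  then show "(\<lambda>n. stellar_coeff (\<psi> + \<phi>) n * \<alpha> ^ n) sums (stellar_fun \<psi> \<alpha> + stellar_fun \<phi> \<alpha>)"
    by (simp add: stellar_coeff_def cinner_add_right add_divide_distrib distrib_right)
qed

lemma stellar_fun_scaleC: "stellar_fun (scaleC c \<psi>) \<alpha> = c * stellar_fun \<psi> \<alpha>"
proof (rule sums_unique2[OF stellar_fun_sums])
  have "(\<lambda>n. c * (stellar_coeff \<psi> n * \<alpha> ^ n)) sums (c * stellar_fun \<psi> \<alpha>)"
    by (intro sums_mult stellar_fun_sums)
  then show "(\<lambda>n. stellar_coeff (scaleC c \<psi>) n * \<alpha> ^ n) sums (c * stellar_fun \<psi> \<alpha>)"
    by (simp add: stellar_coeff_def cinner_scaleC_right mult.assoc)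
qed

text \<open>A power series with a nonzero coefficient has no zeros in some punctured disc, so all
  coefficients vanish, and the Fock basis is complete.\<close>

lemma stellar_fun_eq_0_imp:
  assumes "\<And>\<alpha>. stellar_fun \<psi> \<alpha> = 0"
  shows "\<psi> = 0"
proof (rule fock_complete)
  have "stellar_coeff \<psi> n = 0" for n
  proof (rule ccontr)
    assume n: "stellar_coeff \<psi> n \<noteq> 0"
    have "stellar_coeff \<psi> 0 = 0"
      using assms[of 0] by (simp add: stellar_fun_eq)
    then have "n > 0"
      using n by (cases n) auto
    have "\<exists>s>0. \<forall>z\<in>cball 0 s - {0}. stellar_fun \<psi> z \<noteq> 0"
    proof (rule powser_0_nonzero[of 1 0 "stellar_coeff \<psi>" "stellar_fun \<psi>" n])
      show "(\<lambda>n. stellar_coeff \<psi> n * (x - 0) ^ n) sums stellar_fun \<psi> x" for x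
        using stellar_fun_sums by simp
      show "stellar_fun \<psi> 0 = 0"
        by (rule assms)
    qed (insert n \<open>n > 0\<close>, auto)
    then obtain s where "0 < s" "\<And>z. z \<in> cball 0 s - {0} \<Longrightarrow> stellar_fun \<psi> z \<noteq> 0"
      by blast
    then have "stellar_fun \<psi> (of_real s) \<noteq> 0" by auto
    then show False using assms by simp
  qed
  then show "cinner (fock n) \<psi> = 0" for n
    by (simp add: stellar_coeff_def)
qed

lemma stellar_fun_inject:
  assumes "\<And>\<alpha>. stellar_fun \<psi> \<alpha> = stellar_fun \<phi> \<alpha>"
  shows "\<psi> = \<phi>"
proof -
  have "\<psi> + scaleC (-1) \<phi> = 0"
    by (rule stellar_fun_eq_0_imp) (simp add: stellar_fun_add stellar_fun_scaleC assms)
  moreover have "scaleC (-1) \<phi> = - \<phi>"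
    using scaleC_of_real[of "-1" \<phi>] by simp
  ultimately show ?thesis by simp
qed

lemma stellar_fun_rotation: "stellar_fun (rotation \<theta> \<psi>) \<alpha> = stellar_fun \<psi> (cis \<theta> * \<alpha>)"
proof -
  have "cis (\<theta> * real n) = cis \<theta> ^ n" for n
    by (subst Complex.DeMoivre) (simp only: mult.commute)
  then show ?thesis
    by (simp add: stellar_fun_eq stellar_coeff_def cinner_fock_rotation power_mult_distrib mult_ac)
qed

lemma pure_stellar_rank_le_imp_few_zeros:
  assumes "pure_stellar_rank \<psi> \<le> enat r"
  shows "few_zeros r (stellar_fun \<psi>)"
proof (rule few_zeros_of_zorder_sum[OF stellar_fun_holomorphic])
  show "finite {w. stellar_fun \<psi> w = 0}"
    using assms by (auto simp: pure_stellar_rank_def Let_def split: if_splits)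
  then show "(\<Sum>w\<in>{w. stellar_fun \<psi> w = 0}. nat (zorder (stellar_fun \<psi>) w)) \<le> r"
    using assms by (simp add: pure_stellar_rank_def Let_def)
qed

lemma few_zeros_compose_mult:
  assumes "few_zeros r F" "c \<noteq> 0"
  shows "few_zeros r (\<lambda>w. F (c * w))"
proof -
  obtain p G where pG: "p \<noteq> 0" "degree p \<le> r" "G holomorphic_on UNIV" "\<And>w. G w \<noteq> 0" "\<And>w. F w = poly p w * G w"
    using assms(1) unfolding few_zeros_def by blast
  have "(\<lambda>w. G (c * w)) holomorphic_on UNIV"
    using holomorphic_on_compose_gen[of "\<lambda>w. c * w" UNIV G UNIV] pG(3) by (auto simp: o_def intro!: holomorphic_intros)
  moreover have "pcompose p [:0, c:] \<noteq> 0"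
    using pG(1) assms(2) by (simp add: pcompose_eq_0_iff)
  moreover have "degree (pcompose p [:0, c:]) \<le> r"
    using pG(2) assms(2) by (simp add: degree_pcompose)
  ultimately show ?thesis
    unfolding few_zeros_def using pG by (intro exI[of _ "pcompose p [:0, c:]"] exI[of _ "\<lambda>w. G (c * w)"]) (simp add: poly_pcompose mult.commute)
qed

section \<open>Inverting the Bargmann transform on polynomials times Gaussians\<close>

section \<open>States of finite stellar rank are Gaussians times polynomials\<close>

lemma sqrt_fact_Suc: "complex_of_real (sqrt (fact (Suc n))) = of_real (sqrt (real (Suc n))) * of_real (sqrt (fact n))"
  by (simp add: real_sqrt_mult flip: of_real_mult)

lemma stellar_coeff_raise:
  assumes "Re s > 0"
  shows "stellar_coeff (gauss_vec s t (raise_poly s t q)) 0 = 0"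
    "stellar_coeff (gauss_vec s t (raise_poly s t q)) (Suc n) = stellar_coeff (gauss_vec s t q) n"
  using sqrt_Suc_complex(1)[of n]
  by (simp_all only: stellar_coeff_def cinner_fock_raise[OF assms] sqrt_fact_Suc) (simp_all del: of_nat_Suc)

text \<open>In the Bargmann representation the creation operator is multiplication by \<alpha> and,
  in \<open>stellar_fun_lower\<close>, the annihilation operator is d/d\<alpha>. Both hold
  coefficient by coefficient.\<close>

lemma stellar_fun_raise:
  assumes "Re s > 0"
  shows "stellar_fun (gauss_vec s t (raise_poly s t q)) \<alpha> = \<alpha> * stellar_fun (gauss_vec s t q) \<alpha>"
proof (rule sums_unique2[OF stellar_fun_sums])
  let ?e = "\<lambda>n. stellar_coeff (gauss_vec s t (raise_poly s t q)) n * \<alpha> ^ n"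
  have "(\<lambda>n. \<alpha> * (stellar_coeff (gauss_vec s t q) n * \<alpha> ^ n)) sums (\<alpha> * stellar_fun (gauss_vec s t q) \<alpha>)"
    by (intro sums_mult stellar_fun_sums)
  then have "(\<lambda>n. ?e (Suc n)) sums (\<alpha> * stellar_fun (gauss_vec s t q) \<alpha>)"
    by (simp add: stellar_coeff_raise[OF assms] mult_ac)
  from sums_Suc[OF this] show "?e sums (\<alpha> * stellar_fun (gauss_vec s t q) \<alpha>)"
    by (simp add: stellar_coeff_raise[OF assms])
qed

lemma stellar_fun_lower:
  assumes "Re s > 0"
  shows "(stellar_fun (gauss_vec s t q) has_field_derivative stellar_fun (gauss_vec s t (lower_poly s t q)) \<alpha>) (at \<alpha>)"
proof -
  have "diffs (stellar_coeff (gauss_vec s t q)) n = stellar_coeff (gauss_vec s t (lower_poly s t q)) n" for n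
  proof -
    have "of_nat (Suc n) * cinner (fock (Suc n)) (gauss_vec s t q) / (of_real (sqrt (real (Suc n))) * of_real (sqrt (fact n)))
      = of_real (sqrt (real (Suc n))) * cinner (fock (Suc n)) (gauss_vec s t q) / complex_of_real (sqrt (fact n))"
      unfolding sqrt_Suc_complex(2)[of n, symmetric] using sqrt_Suc_complex(1)[of n] by (simp del: of_nat_Suc)
    then show ?thesis
      unfolding diffs_def stellar_coeff_def cinner_fock_lower[OF assms] sqrt_fact_Suc
      by (simp del: of_nat_Suc)
  qed
  then show ?thesis
    using stellar_fun_has_derivative[of "gauss_vec s t q" \<alpha>] by (simp add: stellar_fun_eq)
qed

text \<open>On a pure Gaussian, lowering equals \<kappa> times raising plus b times the identity, as
  comparing the linear and constant terms shows. Under the Bargmann transform this is the equation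
  F' = (\<kappa> \<alpha> + b) F, which determines F up to a factor.\<close>

lemma stellar_fun_gaussian:
  fixes s t :: complex
  assumes s: "Re s > 0"
  defines "\<kappa> \<equiv> (1 - s) / (1 + s)"
  defines "b \<equiv> t * (1 + \<kappa>) / of_real (sqrt 2)"
  obtains c where "c \<noteq> 0" "\<And>\<alpha>. stellar_fun (gauss_vec s t 1) \<alpha> = c * exp (\<kappa> / 2 * \<alpha>\<^sup>2 + b * \<alpha>)"
proof -
  define F where "F = stellar_fun (gauss_vec s t 1)"
  have s1: "1 + s \<noteq> 0"
    using s by (auto simp: complex_eq_iff)
  have lower: "lower_poly s t 1 = smult \<kappa> (raise_poly s t 1) + smult b 1"
  proof -
    have k: "\<kappa> * (1 + s) = 1 - s"
      using s1 by (simp add: \<kappa>_def)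
    define c where "c = 1 / complex_of_real (sqrt 2)"
    have l: "lower_poly s t 1 = smult c [:t, 1 - s:]" and r: "raise_poly s t 1 = smult c [:- t, 1 + s:]"
      by (simp_all add: lower_poly_def raise_poly_def cgauss_deriv_def one_pCons pderiv_pCons c_def)
    have "\<kappa> * (c * (1 + s)) = c * (1 - s)"
      by (simp only: k[symmetric] mult.left_commute)
    moreover have "b = c * t + \<kappa> * (c * t)"
      by (simp add: b_def c_def algebra_simps add_divide_distrib)
    ultimately show ?thesis
      unfolding l r by (simp add: one_pCons k)
  qed
  have gb: "gauss_vec s t [:d:] = scaleC d (gauss_vec s t 1)" for d
    using gauss_vec_smult[OF s, of t d 1] by simp
  have F': "(F has_field_derivative (\<kappa> * \<alpha> + b) * F \<alpha>) (at \<alpha>)" for \<alpha>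
    using stellar_fun_lower[OF s, of t 1 \<alpha>]
    by (simp add: lower gb gauss_vec_add[OF s] gauss_vec_smult[OF s] stellar_fun_add stellar_fun_scaleC stellar_fun_raise[OF s] F_def algebra_simps)
  define H where "H \<alpha> = F \<alpha> * exp (- (\<kappa> / 2 * \<alpha>\<^sup>2 + b * \<alpha>))" for \<alpha>
  have "(H has_field_derivative 0) (at \<alpha>)" for \<alpha>
    unfolding H_def by (auto intro!: derivative_eq_intros F' simp: algebra_simps)
  then obtain c where c: "\<And>\<alpha>. H \<alpha> = c"
    using has_field_derivative_zero_constant[of UNIV H] by auto
  have e: "F \<alpha> = c * exp (\<kappa> / 2 * \<alpha>\<^sup>2 + b * \<alpha>)" for \<alpha>
    using c[of \<alpha>] by (simp add: H_def exp_minus field_simps)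
  have "c \<noteq> 0"
  proof
    assume "c = 0"
    then have "gauss_vec s t 1 = 0"
      by (intro stellar_fun_eq_0_imp) (use e in \<open>simp add: F_def\<close>)
    then have "AE x in lborel. cgauss s t 1 x = 0"
      using to_l2r_eq_iff[OF sq_integrable_cgauss[OF s] sq_integrable_zero, of t 1]
      by (simp add: gauss_vec_def zero_l2r.abs_eq)
    then have "cgauss s t 1 0 = 0"
      by (intro continuous_AE_eq_imp_eq[of "cgauss s t 1" "\<lambda>x. 0"] continuous_on_cgauss continuous_on_const)
    then show False
      by (simp add: cgauss_def)
  qed
  with e show ?thesis
    using that by (simp add: F_def)
qed

lemma degree_raise_poly_le: "degree (raise_poly s t q) \<le> Suc (degree q)"
proof -
  have "degree ([:0, 1:] * q) \<le> Suc (degree q)" "degree ([:t, - s:] * q) \<le> Suc (degree q)"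
    using degree_mult_le[of "[:0, 1:]" q] degree_mult_le[of "[:t, - s:]" q] degree_pCons_le[of t "[:- s:]"]
    by (auto intro: order_trans)
  moreover have "degree (pderiv q) \<le> Suc (degree q)"
    by (simp add: degree_pderiv)
  ultimately show ?thesis
    unfolding raise_poly_def cgauss_deriv_def
    by (intro order_trans[OF degree_smult_le] degree_diff_le degree_add_le)
qed

text \<open>The Cayley transform s = (1 - \<kappa>) / (1 + \<kappa>) with \<kappa> = 2a sends the
  disc |\<kappa>| < 1 to Re s > 0, so the Gaussian of parameter s is normalizable. The polynomial is
  built by Horner's scheme, each multiplication by \<alpha> being one application of
  \<open>raise_poly\<close>.\<close>

lemma ex_gauss_vec_stellar_fun:
  assumes a: "cmod a < 1 / 2"
  obtains s t where "Re s > 0"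
    "\<And>P. \<exists>q. (q = 0 \<or> degree q \<le> degree P) \<and> (\<forall>\<alpha>. stellar_fun (gauss_vec s t q) \<alpha> = poly P \<alpha> * exp (a * \<alpha>\<^sup>2 + b * \<alpha>))"
proof -
  define \<kappa> where "\<kappa> = 2 * a"
  have n\<kappa>: "cmod \<kappa> < 1"
    using a by (simp add: \<kappa>_def norm_mult)
  have k1: "1 + \<kappa> \<noteq> 0"
  proof
    assume "1 + \<kappa> = 0"
    then have "\<kappa> = -1" by (simp add: add_eq_0_iff)
    then show False using n\<kappa> by simp
  qed
  define s where "s = (1 - \<kappa>) / (1 + \<kappa>)"
  define t where "t = b * of_real (sqrt 2) / (1 + \<kappa>)"
  have s: "Re s > 0"
  proof -
    have "(cmod \<kappa>)\<^sup>2 < 1"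
      using n\<kappa> by (simp add: power_less_one_iff abs_square_less_1)
    then have "(Re \<kappa>)\<^sup>2 + (Im \<kappa>)\<^sup>2 < 1"
      by (simp only: cmod_power2)
    then have "Re (1 - \<kappa>) * Re (1 + \<kappa>) + Im (1 - \<kappa>) * Im (1 + \<kappa>) > 0"
      by (simp add: algebra_simps power2_eq_square)
    moreover have "(Re (1 + \<kappa>))\<^sup>2 + (Im (1 + \<kappa>))\<^sup>2 > 0"
      using k1 by (simp only: complex_eq_0 not_sum_power2_lt_zero order_less_le sum_power2_ge_zero) auto
    ultimately show ?thesis
      unfolding s_def Re_divide by (rule divide_pos_pos)
  qed
  have "(1 - s) / (1 + s) = \<kappa>"
  proof -
    have "1 - s = 2 * \<kappa> / (1 + \<kappa>)" "1 + s = 2 / (1 + \<kappa>)"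
      using k1 by (simp_all add: s_def field_simps)
    then show ?thesis using k1 by simp
  qed
  moreover have "t * (1 + \<kappa>) / of_real (sqrt 2) = b"
    using k1 by (simp add: t_def)
  ultimately obtain c where c: "c \<noteq> 0" "\<And>\<alpha>. stellar_fun (gauss_vec s t 1) \<alpha> = c * exp (\<kappa> / 2 * \<alpha>\<^sup>2 + b * \<alpha>)"
    using stellar_fun_gaussian[OF s, of t] by metis
  have gb: "gauss_vec s t [:d:] = scaleC d (gauss_vec s t 1)" for d
    using gauss_vec_smult[OF s, of t d 1] by simp
  have "\<exists>q. (q = 0 \<or> degree q \<le> degree P) \<and> (\<forall>\<alpha>. stellar_fun (gauss_vec s t q) \<alpha> = poly P \<alpha> * exp (a * \<alpha>\<^sup>2 + b * \<alpha>))" for P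
  proof (induction P)
    case 0
    have "gauss_vec s t 0 = scaleC 0 (gauss_vec s t 1)"
      using gauss_vec_smult[OF s, of t 0 1] by simp
    then have "stellar_fun (gauss_vec s t 0) \<alpha> = 0" for \<alpha>
      by (simp add: stellar_fun_scaleC)
    then show ?case
      by (intro exI[of _ 0]) simp
  next
    case (pCons p0 P)
    then obtain q where q: "q = 0 \<or> degree q \<le> degree P" "\<And>\<alpha>. stellar_fun (gauss_vec s t q) \<alpha> = poly P \<alpha> * exp (a * \<alpha>\<^sup>2 + b * \<alpha>)"
      by blast
    define q' where "q' = smult (p0 / c) 1 + raise_poly s t q"
    have e: "stellar_fun (gauss_vec s t q') \<alpha> = poly (pCons p0 P) \<alpha> * exp (a * \<alpha>\<^sup>2 + b * \<alpha>)" for \<alpha>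
      using c(1) by (simp add: q'_def gb gauss_vec_add[OF s] gauss_vec_smult[OF s] stellar_fun_add stellar_fun_scaleC
          stellar_fun_raise[OF s] c(2) q(2) \<kappa>_def algebra_simps)
    \<comment> \<open>Raising may increase the degree by 1, and so does \<open>pCons\<close>, except
      for P = 0. In that case q has to be shown to be the zero polynomial: its wave function is 0
      everywhere, while a nonzero q has finitely many roots.\<close>
    have "degree q' \<le> degree (pCons p0 P)"
    proof (cases "P = 0")
      case True
      have "gauss_vec s t q = 0"
        by (rule stellar_fun_eq_0_imp) (simp add: q(2) True)
      show ?thesis
      proof (cases "q = 0")
        case True
        then show ?thesis
          by (simp add: q'_def raise_poly_def cgauss_deriv_def)
      next
        case False
        obtain x :: real where "cgauss s t q x \<noteq> 0"
        proof -
          have "finite {z. poly q z = 0}"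
            using False by (rule poly_roots_finite)
          then have "finite ((of_real :: real \<Rightarrow> complex) -` {z. poly q z = 0})"
            by (rule finite_vimageI) (simp add: inj_def)
          then have "\<exists>x :: real. x \<notin> (of_real :: real \<Rightarrow> complex) -` {z. poly q z = 0}"
            using infinite_UNIV_char_0[where 'a = real] ex_new_if_finite by blast
          then show ?thesis
            using that by (auto simp: cgauss_def)
        qed
        moreover have "AE x in lborel. cgauss s t q x = 0"
          using \<open>gauss_vec s t q = 0\<close> to_l2r_eq_iff[OF sq_integrable_cgauss[OF s] sq_integrable_zero, of t q]
          by (simp add: gauss_vec_def zero_l2r.abs_eq)
        ultimately show ?thesis
          using continuous_AE_eq_imp_eq[of "cgauss s t q" "\<lambda>x. 0" x] continuous_on_cgauss by auto
      qed
    next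
      case False
      have "degree q' \<le> max 0 (Suc (degree q))"
        unfolding q'_def by (intro degree_add_le_max[THEN order_trans] max.mono degree_raise_poly_le) simp
      also have "\<dots> \<le> degree (pCons p0 P)"
        using q(1) False by auto
      finally show ?thesis .
    qed
    with e show ?case by blast
  qed
  with s show ?thesis using that by blast
qed

lemma wavefun_gauss_vec:
  assumes s: "Re s > 0" and sm: "summable (sobolev_summand (gauss_vec s t q))"
  shows "wavefun (gauss_vec s t q) x = cgauss s t q x"
proof (rule continuous_AE_eq_imp_eq[OF continuous_on_wavefun[OF sm] continuous_on_cgauss])
  show "AE x in lborel. wavefun (gauss_vec s t q) x = cgauss s t q x"
    using rep_eq_wavefun[OF sm] rep_to_l2r[OF sq_integrable_cgauss[OF s, of t q]]
    by eventually_elim (simp add: gauss_vec_def)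
qed

text \<open>Injectivity of the stellar function identifies \<psi> with the Gaussian vector
  constructed for the same data; its zeros are then the real roots of q, whose degree is at most
  that of the polynomial in the stellar function.\<close>

lemma few_zeros_imp_wavefun_roots:
  assumes sm: "summable (sobolev_summand \<psi>)" and F: "few_zeros r (stellar_fun \<psi>)"
  shows "finite {x. wavefun \<psi> x = 0} \<and> card {x. wavefun \<psi> x = 0} \<le> r"
proof -
  define C where "C = norm \<psi> + sqrt (sobolev \<psi>)"
  have S0: "sobolev \<psi> \<ge> 0"
    unfolding sobolev_def by (intro suminf_nonneg sm) simp
  have g1: "cmod (stellar_fun \<psi> w) \<le> C * exp ((cmod w)\<^sup>2 / 2)" for w
    by (rule order_trans[OF stellar_fun_growth(2)]) (use S0 in \<open>simp add: C_def\<close>)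
  have g2: "cmod w * cmod (stellar_fun \<psi> w) \<le> C * exp ((cmod w)\<^sup>2 / 2)" for w
    by (rule order_trans[OF stellar_fun_decay[OF sm]]) (simp add: C_def)
  obtain p a b where p: "p \<noteq> 0" "degree p \<le> r" "\<And>w. stellar_fun \<psi> w = poly p w * exp (a * w\<^sup>2 + b * w)" "cmod a < 1 / 2"
    using few_zeros_gaussian[OF F g1 g2] by blast
  obtain s t where st: "Re s > 0"
    "\<And>P. \<exists>q. (q = 0 \<or> degree q \<le> degree P) \<and> (\<forall>\<alpha>. stellar_fun (gauss_vec s t q) \<alpha> = poly P \<alpha> * exp (a * \<alpha>\<^sup>2 + b * \<alpha>))"
    using ex_gauss_vec_stellar_fun[OF p(4), of b] by blast
  obtain q where q: "q = 0 \<or> degree q \<le> degree p" "\<And>\<alpha>. stellar_fun (gauss_vec s t q) \<alpha> = poly p \<alpha> * exp (a * \<alpha>\<^sup>2 + b * \<alpha>)"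
    using st(2)[of p] by blast
  have eq: "\<psi> = gauss_vec s t q"
    by (rule stellar_fun_inject) (simp add: p(3) q(2))
  have q0: "q \<noteq> 0"
  proof
    assume "q = 0"
    then have "gauss_vec s t q = scaleC 0 (gauss_vec s t 1)"
      using gauss_vec_smult[OF st(1), of t 0 1] by simp
    then have "stellar_fun (gauss_vec s t q) w = 0" for w
      by (simp add: stellar_fun_scaleC)
    then have "poly p w = 0" for w
      using q(2)[of w] by simp
    then show False
      using p(1) poly_all_0_iff_0[of p] by blast
  qed
  have z: "wavefun \<psi> x = 0 \<longleftrightarrow> poly q (of_real x) = 0" for x
    using wavefun_gauss_vec[OF st(1) sm[unfolded eq]] by (simp add: eq cgauss_def)
  have "inj_on complex_of_real {x. wavefun \<psi> x = 0}" "complex_of_real ` {x. wavefun \<psi> x = 0} \<subseteq> {w. poly q w = 0}"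
    by (auto simp: inj_on_def z)
  then have "finite {x. wavefun \<psi> x = 0}" "card {x. wavefun \<psi> x = 0} \<le> card {w. poly q w = 0}"
    using inj_on_finite[OF _ _ poly_roots_finite[OF q0]] card_inj_on_le[OF _ _ poly_roots_finite[OF q0]] by auto
  then show ?thesis
    using card_poly_roots_bound[OF q0] q q0 p(2) by simp
qed

section \<open>Weak limits of vectors of bounded energy and bounded stellar rank\<close>

section \<open>A uniform lower bound by compactness\<close>

lemma bounded_state_of_energy:
  assumes "norm \<psi> = 1" "\<And>N. (\<Sum>n<N. energy_summand \<psi> n) \<le> E"
  shows "bounded_state E (rank_one_proj \<psi>)"
  using parseval_norm[of \<psi>] assms
  by (simp add: bounded_state_def diag_rank_one_proj positive_op_rank_one_proj energy_summand_def)

lemma sobolev_of_energy: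
  assumes "\<And>N. (\<Sum>n<N. energy_summand \<psi> n) \<le> E"
  shows "summable (energy_summand \<psi>)" "summable (sobolev_summand \<psi>)" "sobolev \<psi> \<le> (norm \<psi>)\<^sup>2 + E"
proof -
  show s: "summable (energy_summand \<psi>)"
    by (rule summableI_nonneg_bounded[OF _ assms]) simp
  show "summable (sobolev_summand \<psi>)" "sobolev \<psi> \<le> (norm \<psi>)\<^sup>2 + E"
    using sobolev_eq[OF s] suminf_le_const[OF s assms] by (auto simp: sobolev_def sums_iff)
qed

text \<open>Convergence of each Fock coefficient suffices: on the disc of radius R the n-th term is
  dominated by 2 |R|^n / sqrt (n!), and Tannery's theorem exchanges limit and sum.\<close>

lemma stellar_fun_uniform_limit:
  assumes n: "\<And>j. norm (\<phi> j) \<le> 1" "norm \<psi> \<le> 1"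
    and lim: "\<And>n. (\<lambda>j. cinner (fock n) (\<phi> j)) \<longlonglongrightarrow> cinner (fock n) \<psi>"
  shows "uniform_limit (cball 0 R) (\<lambda>j. stellar_fun (\<phi> j)) (stellar_fun \<psi>) sequentially"
proof -
  define M where "M n = \<bar>R\<bar> ^ n / sqrt (fact n)" for n
  have M0: "M n \<ge> 0" for n
    by (simp add: M_def)
  \<comment> \<open>|R|^n / sqrt (n!) is 2^-n times (2 |R|)^n / sqrt (n!), a product of two
    square-summable sequences.\<close>
  have sM: "summable M"
  proof -
    have "((1 / 2 :: real) ^ n)\<^sup>2 = (1 / 4) ^ n" for n
      by (simp add: power2_eq_square flip: power_mult_distrib)
    then have half: "summable (\<lambda>n. ((1 / 2 :: real) ^ n)\<^sup>2)"
      by (simp add: summable_geometric)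
    have "summable (\<lambda>n. \<bar>(1 / 2) ^ n * (cmod (of_real (2 * \<bar>R\<bar>)) ^ n / sqrt (fact n))\<bar>)"
      by (rule summable_cauchy_schwarz(1)[OF half sums_summable[OF sums_exp_norm_sq]])
    also have "(\<lambda>n. \<bar>(1 / 2) ^ n * (cmod (of_real (2 * \<bar>R\<bar>)) ^ n / sqrt (fact n))\<bar>) = M"
      by (auto simp: M_def abs_mult power_mult_distrib power_divide)
    finally show ?thesis .
  qed
  have c1: "cmod (cinner (fock n) \<xi>) \<le> 1" if "norm \<xi> \<le> 1" for n \<xi>
    using cmod_cinner_le[of "fock n" \<xi>] that by simp
  define a where "a n j = cmod (cinner (fock n) (\<phi> j) - cinner (fock n) \<psi>) * M n" for n j
  have a_le: "norm (a n j) \<le> 2 * M n" for n j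
  proof -
    have "cmod (cinner (fock n) (\<phi> j) - cinner (fock n) \<psi>) \<le> 1 + 1"
      by (rule order_trans[OF norm_triangle_ineq4 add_mono[OF c1[OF n(1)] c1[OF n(2)]]])
    then show ?thesis
      using M0[of n] by (simp add: a_def abs_mult mult_right_mono)
  qed
  have sa: "summable (\<lambda>n. a n j)" for j
    by (rule summable_comparison_test'[OF summable_mult[OF sM], of 0]) (rule a_le)
  have "(\<lambda>j. \<Sum>n. a n j) \<longlonglongrightarrow> (\<Sum>n::nat. 0)"
  proof (rule tannerys_theorem[THEN conjunct2, THEN conjunct2])
    show "(\<lambda>j. a n j) \<longlonglongrightarrow> 0" for n
    proof -
      have "(\<lambda>j. cmod (cinner (fock n) (\<phi> j) - cinner (fock n) \<psi>) * M n) \<longlonglongrightarrow> cmod (cinner (fock n) \<psi> - cinner (fock n) \<psi>) * M n"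
        by (intro tendsto_intros lim)
      then show ?thesis by (simp add: a_def)
    qed
    show "\<forall>\<^sub>F (k, j) in sequentially \<times>\<^sub>F sequentially. norm (a k j) \<le> 2 * M k"
      using a_le by (intro always_eventually) auto
  qed (auto intro: summable_mult sM)
  then have l0: "(\<lambda>j. \<Sum>n. a n j) \<longlonglongrightarrow> 0" by simp
  have le: "dist (stellar_fun (\<phi> j) w) (stellar_fun \<psi> w) \<le> (\<Sum>n. a n j)" if w: "w \<in> cball 0 R" for j w
  proof -
    have t: "cmod (stellar_coeff (\<phi> j) n * w ^ n - stellar_coeff \<psi> n * w ^ n) \<le> a n j" for n
    proof -
      have "stellar_coeff (\<phi> j) n * w ^ n - stellar_coeff \<psi> n * w ^ n
        = (cinner (fock n) (\<phi> j) - cinner (fock n) \<psi>) * (w ^ n / complex_of_real (sqrt (fact n)))"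
        by (simp add: stellar_coeff_def field_simps)
      then have "cmod (stellar_coeff (\<phi> j) n * w ^ n - stellar_coeff \<psi> n * w ^ n)
        = cmod (cinner (fock n) (\<phi> j) - cinner (fock n) \<psi>) * (cmod w ^ n / sqrt (fact n))"
        by (simp add: norm_mult norm_divide norm_power)
      also have "\<dots> \<le> cmod (cinner (fock n) (\<phi> j) - cinner (fock n) \<psi>) * M n"
        unfolding M_def using w by (intro mult_left_mono divide_right_mono power_mono) auto
      finally show ?thesis by (simp add: a_def)
    qed
    have s: "(\<lambda>n. stellar_coeff (\<phi> j) n * w ^ n - stellar_coeff \<psi> n * w ^ n) sums (stellar_fun (\<phi> j) w - stellar_fun \<psi> w)"
      by (intro sums_diff stellar_fun_sums)
    have sn: "summable (\<lambda>n. cmod (stellar_coeff (\<phi> j) n * w ^ n - stellar_coeff \<psi> n * w ^ n))"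
      by (rule summable_comparison_test'[OF sa[of j], of 0]) (use t in simp)
    have "cmod (stellar_fun (\<phi> j) w - stellar_fun \<psi> w) \<le> (\<Sum>n. cmod (stellar_coeff (\<phi> j) n * w ^ n - stellar_coeff \<psi> n * w ^ n))"
      using summable_norm[OF sn] sums_unique[OF s] by simp
    also have "\<dots> \<le> (\<Sum>n. a n j)"
      by (rule suminf_le[OF t sn sa])
    finally show ?thesis by (simp add: dist_norm)
  qed
  show ?thesis
  proof (rule uniform_limitI)
    fix e :: real assume "e > 0"
    with l0 have "\<forall>\<^sub>F j in sequentially. (\<Sum>n. a n j) < e"
      by (rule order_tendstoD)
    then show "\<forall>\<^sub>F j in sequentially. \<forall>w\<in>cball 0 R. dist (stellar_fun (\<phi> j) w) (stellar_fun \<psi> w) < e"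
      by eventually_elim (use le le_less_trans in blast)
  qed
qed

text \<open>The Fock tails beyond N are at most \<open>T N\<close> for all vectors with
  \<open>sobolev\<close> at most K. For fixed N only a finite sum has to converge in j; afterwards N
  tends to infinity.\<close>

lemma wavefun_limit_zero:
  assumes s: "\<And>j. summable (sobolev_summand (\<phi> j))" "\<And>j. sobolev (\<phi> j) \<le> K"
    and s': "summable (sobolev_summand \<psi>)" "sobolev \<psi> \<le> K"
    and lim: "\<And>n. (\<lambda>j. cinner (fock n) (\<phi> j)) \<longlonglongrightarrow> cinner (fock n) \<psi>"
    and z: "(\<lambda>j. wavefun (\<phi> j) x) \<longlonglongrightarrow> 0"
  shows "wavefun \<psi> x = 0"
proof -
  define T where "T N = sqrt K * sqrt (\<Sum>n. (cmod (fock_fun (n + N) x))\<^sup>2 / (real (n + N) + 1))" for N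
  define S where "S N \<xi> = (\<Sum>n<N. cinner (fock n) \<xi> * fock_fun n x)" for N \<xi>
  have t0: "(\<Sum>n. (cmod (fock_fun (n + N) x))\<^sup>2 / (real (n + N) + 1)) \<ge> 0" for N
    by (intro suminf_nonneg summable_ignore_initial_segment[OF summable_fock_fun_kernel]) simp
  have tail: "cmod (wavefun \<xi> x - S N \<xi>) \<le> T N" if "summable (sobolev_summand \<xi>)" "sobolev \<xi> \<le> K" for N \<xi>
  proof -
    have "cmod (wavefun \<xi> x - S N \<xi>) \<le> sqrt (sobolev \<xi>) * sqrt (\<Sum>n. (cmod (fock_fun (n + N) x))\<^sup>2 / (real (n + N) + 1))"
      unfolding S_def by (rule wavefun_tail_bound(2)[OF that(1)])
    also have "\<dots> \<le> T N"
      unfolding T_def using t0 that(2) by (intro mult_right_mono real_sqrt_le_mono real_sqrt_ge_zero) auto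
    finally show ?thesis .
  qed
  have "cmod (wavefun \<psi> x) \<le> 2 * T N" for N
  proof (rule LIMSEQ_le_const)
    have "(\<lambda>j. 2 * T N + cmod (S N \<psi> - S N (\<phi> j)) + cmod (wavefun (\<phi> j) x)) \<longlonglongrightarrow> 2 * T N + cmod (S N \<psi> - S N \<psi>) + cmod (0 :: complex)"
      unfolding S_def by (intro tendsto_intros lim z)
    then show "(\<lambda>j. 2 * T N + cmod (S N \<psi> - S N (\<phi> j)) + cmod (wavefun (\<phi> j) x)) \<longlonglongrightarrow> 2 * T N"
      by simp
    have "cmod (wavefun \<psi> x) \<le> 2 * T N + cmod (S N \<psi> - S N (\<phi> j)) + cmod (wavefun (\<phi> j) x)" for j
    proof -
      have tri: "cmod (a + b - c + d) \<le> cmod a + cmod b + cmod c + cmod d" for a b c d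
        using norm_triangle_ineq[of "a + b - c" d] norm_triangle_ineq4[of "a + b" c] norm_triangle_ineq[of a b] by linarith
      have "wavefun \<psi> x = (wavefun \<psi> x - S N \<psi>) + (S N \<psi> - S N (\<phi> j)) - (wavefun (\<phi> j) x - S N (\<phi> j)) + wavefun (\<phi> j) x"
        by simp
      then have "cmod (wavefun \<psi> x) \<le> cmod (wavefun \<psi> x - S N \<psi>) + cmod (S N \<psi> - S N (\<phi> j)) + cmod (wavefun (\<phi> j) x - S N (\<phi> j)) + cmod (wavefun (\<phi> j) x)"
        using tri[of "wavefun \<psi> x - S N \<psi>" "S N \<psi> - S N (\<phi> j)" "wavefun (\<phi> j) x - S N (\<phi> j)" "wavefun (\<phi> j) x"]
        by (simp only:)
      then show ?thesis
        using tail[OF s', of N] tail[OF s, of j N] by simp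
    qed
    then show "\<exists>M. \<forall>j\<ge>M. cmod (wavefun \<psi> x) \<le> 2 * T N + cmod (S N \<psi> - S N (\<phi> j)) + cmod (wavefun (\<phi> j) x)"
      by blast
  qed
  moreover have "(\<lambda>N. 2 * T N) \<longlonglongrightarrow> 2 * (sqrt K * sqrt 0)"
    unfolding T_def
    by (intro tendsto_intros suminf_exist_split2[OF summable_fock_fun_kernel[of x]])
  ultimately have "cmod (wavefun \<psi> x) \<le> 2 * (sqrt K * sqrt 0)"
    by (intro LIMSEQ_le_const[of "\<lambda>N. 2 * T N"]) auto
  then show ?thesis by simp
qed

text \<open>If no c works, unit vectors with sums below 1 / (m + 1) have a subsequence converging in
  each Fock coefficient. The limit is not 0, has stellar function with at most k - 1 zeros, and its
  wave function vanishes at k distinct points.\<close>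

lemma finite_rank_wavefun_lower_bound:
  assumes k: "1 \<le> k" and inj: "inj_on x {1..k}"
  obtains c where "c > 0"
    "\<And>\<psi>. norm \<psi> = 1 \<Longrightarrow> (\<And>N. (\<Sum>n<N. energy_summand \<psi> n) \<le> E) \<Longrightarrow> pure_stellar_rank \<psi> \<le> enat (k - 1) \<Longrightarrow>
      c \<le> (\<Sum>i=1..k. (cmod (wavefun (rotation \<theta> \<psi>) (x i)))\<^sup>2)"
proof (rule ccontr)
  assume no: "\<not> thesis"
  have "\<exists>\<psi>. norm \<psi> = 1 \<and> (\<forall>N. (\<Sum>n<N. energy_summand \<psi> n) \<le> E) \<and> pure_stellar_rank \<psi> \<le> enat (k - 1) \<and>
      (\<Sum>i=1..k. (cmod (wavefun (rotation \<theta> \<psi>) (x i)))\<^sup>2) < 1 / real (Suc m)" for m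
  proof (rule ccontr)
    assume "\<not> ?thesis"
    then have "1 / real (Suc m) \<le> (\<Sum>i=1..k. (cmod (wavefun (rotation \<theta> \<psi>) (x i)))\<^sup>2)"
      if "norm \<psi> = 1" "\<And>N. (\<Sum>n<N. energy_summand \<psi> n) \<le> E" "pure_stellar_rank \<psi> \<le> enat (k - 1)" for \<psi>
      using that by (meson not_less)
    then show False
      using no that[of "1 / real (Suc m)"] by simp
  qed
  then obtain \<psi> where \<psi>: "\<And>m. norm (\<psi> m) = 1" "\<And>m N. (\<Sum>n<N. energy_summand (\<psi> m) n) \<le> E"
    "\<And>m. pure_stellar_rank (\<psi> m) \<le> enat (k - 1)"
    "\<And>m. (\<Sum>i=1..k. (cmod (wavefun (rotation \<theta> (\<psi> m)) (x i)))\<^sup>2) < 1 / real (Suc m)"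
    by metis
  define \<chi>' where "\<chi>' m = rotation \<theta> (\<psi> m)" for m
  have n1: "norm (\<chi>' m) = 1" for m
    by (simp add: \<chi>'_def \<psi>)
  have en: "(\<Sum>n<N. energy_summand (\<chi>' m) n) \<le> E" for m N
    by (simp add: \<chi>'_def energy_summand_rotation \<psi>)
  \<comment> \<open>Rotation only multiplies the argument of the stellar function by a unit complex
    number, so it preserves the zero count.\<close>
  have fz: "few_zeros (k - 1) (stellar_fun (\<chi>' m))" for m
    unfolding \<chi>'_def stellar_fun_rotation[abs_def]
    by (intro few_zeros_compose_mult pure_stellar_rank_le_imp_few_zeros \<psi>) simp
  obtain r where r: "strict_mono (r :: nat \<Rightarrow> nat)" "\<And>n. n \<in> UNIV \<Longrightarrow> \<exists>l. (\<lambda>j. cinner (fock n) (\<chi>' (r j))) \<longlonglongrightarrow> l"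
  proof (rule function_convergent_subsequence[of UNIV "\<lambda>m n. cinner (fock n) (\<chi>' m)" 1])
    show "norm (cinner (fock n) (\<chi>' m)) \<le> 1" for m n
      using cmod_cinner_le[of "fock n" "\<chi>' m"] by (simp add: n1)
  qed auto
  define \<phi> where "\<phi> j = \<chi>' (r j)" for j
  obtain b where b: "\<And>n. (\<lambda>j. cinner (fock n) (\<phi> j)) \<longlonglongrightarrow> b n"
    using r(2) unfolding \<phi>_def by (metis UNIV_I)
  have b1: "(\<Sum>n<N. (cmod (b n))\<^sup>2) \<le> 1" for N
  proof (rule LIMSEQ_le_const2)
    show "(\<lambda>j. \<Sum>n<N. (cmod (cinner (fock n) (\<phi> j)))\<^sup>2) \<longlonglongrightarrow> (\<Sum>n<N. (cmod (b n))\<^sup>2)"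
      by (intro tendsto_intros b)
    show "\<exists>M. \<forall>j\<ge>M. (\<Sum>n<N. (cmod (cinner (fock n) (\<phi> j)))\<^sup>2) \<le> 1"
    proof -
      have "(\<Sum>n<N. (cmod (cinner (fock n) (\<phi> j)))\<^sup>2) \<le> 1" for j
        using bessel_fock[where \<psi> = "\<phi> j" and N = N] by (simp add: \<phi>_def n1)
      then show ?thesis by blast
    qed
  qed
  have "summable (\<lambda>n. (cmod (b n))\<^sup>2)"
    by (rule summableI_nonneg_bounded[OF _ b1]) simp
  from ex_l2r_fock_coeff[OF this] obtain \<xi> where \<xi>: "\<And>n. cinner (fock n) \<xi> = b n"
    by blast
  have lim: "(\<lambda>j. cinner (fock n) (\<phi> j)) \<longlonglongrightarrow> cinner (fock n) \<xi>" for n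
    using b by (simp add: \<xi>)
  have n\<xi>: "norm \<xi> \<le> 1"
  proof -
    have "(norm \<xi>)\<^sup>2 \<le> 1"
      using parseval_norm[of \<xi>] b1 unfolding sums_def by (intro LIMSEQ_le_const2) (auto simp: \<xi>)
    then show ?thesis by (simp add: power_le_one_iff abs_square_le_1)
  qed
  have e\<xi>: "(\<Sum>n<N. energy_summand \<xi> n) \<le> E" for N
  proof (rule LIMSEQ_le_const2)
    show "(\<lambda>j. \<Sum>n<N. energy_summand (\<phi> j) n) \<longlonglongrightarrow> (\<Sum>n<N. energy_summand \<xi> n)"
      unfolding energy_summand_def by (intro tendsto_intros lim)
    show "\<exists>M. \<forall>j\<ge>M. (\<Sum>n<N. energy_summand (\<phi> j) n) \<le> E"
      using en by (simp add: \<phi>_def)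
  qed
  have "\<xi> \<noteq> 0"
  proof
    assume "\<xi> = 0"
    \<comment> \<open>N \<ge> 2E keeps at least half of the squared norm of every \<phi> j in the
      first N levels. This finite sum passes to the limit, so \<xi> = 0 is impossible; the added 1
      makes N positive.\<close>
    define N where "N = nat \<lceil>2 * E\<rceil> + 1"
    have N: "N > 0" "E / real N \<le> 1 / 2"
    proof -
      have "2 * E \<le> real N"
        unfolding N_def by linarith
      then show "E / real N \<le> 1 / 2"
        by (simp add: N_def divide_le_eq)
    qed (simp add: N_def)
    have "1 - E / real N \<le> (\<Sum>n<N. (cmod (cinner (fock n) \<xi>))\<^sup>2)"
    proof (rule LIMSEQ_le_const)
      show "(\<lambda>j. \<Sum>n<N. (cmod (cinner (fock n) (\<phi> j)))\<^sup>2) \<longlonglongrightarrow> (\<Sum>n<N. (cmod (cinner (fock n) \<xi>))\<^sup>2)"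
        by (intro tendsto_intros lim)
      have "1 - E / real N \<le> (\<Sum>n<N. (cmod (cinner (fock n) (\<phi> j)))\<^sup>2)" for j
        using bounded_state_partial_trace(2)[OF bounded_state_of_energy[OF n1 en] N(1), of "r j"]
        by (simp add: diag_rank_one_proj \<phi>_def)
      then show "\<exists>M. \<forall>j\<ge>M. 1 - E / real N \<le> (\<Sum>n<N. (cmod (cinner (fock n) (\<phi> j)))\<^sup>2)"
        by blast
    qed
    then show False
      using N(2) \<open>\<xi> = 0\<close> by (simp add: cinner.zero_right)
  qed
  have "few_zeros (k - 1) (stellar_fun \<xi>)"
  proof (rule few_zeros_limit)
    show "few_zeros (k - 1) (stellar_fun (\<phi> j))" for j
      using fz by (simp add: \<phi>_def)
    show "uniform_limit (cball 0 R) (\<lambda>j. stellar_fun (\<phi> j)) (stellar_fun \<xi>) sequentially" for R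
      by (intro stellar_fun_uniform_limit n\<xi> lim) (simp add: \<phi>_def n1)
    show "\<exists>w. stellar_fun \<xi> w \<noteq> 0"
      using stellar_fun_eq_0_imp[of \<xi>] \<open>\<xi> \<noteq> 0\<close> by blast
  qed (rule stellar_fun_holomorphic)
  moreover have s\<xi>: "summable (sobolev_summand \<xi>)" "sobolev \<xi> \<le> 1 + E"
    using sobolev_of_energy(2,3)[OF e\<xi>] power_le_one[OF norm_ge_zero n\<xi>, of 2] by auto
  ultimately have roots: "finite {y. wavefun \<xi> y = 0}" "card {y. wavefun \<xi> y = 0} \<le> k - 1"
    using few_zeros_imp_wavefun_roots by blast+
  have "wavefun \<xi> (x i) = 0" if i: "i \<in> {1..k}" for i
  proof (rule wavefun_limit_zero[of \<phi> "1 + E" \<xi>])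
    show "summable (sobolev_summand (\<phi> j))" "sobolev (\<phi> j) \<le> 1 + E" for j
      using sobolev_of_energy(2,3)[OF en, of "r j"] by (auto simp: \<phi>_def n1)
    have le: "cmod (wavefun (\<phi> j) (x i)) \<le> sqrt (1 / real (Suc j))" for j
    proof (rule real_le_rsqrt)
      have "(cmod (wavefun (\<phi> j) (x i)))\<^sup>2 \<le> (\<Sum>i=1..k. (cmod (wavefun (\<phi> j) (x i)))\<^sup>2)"
        using i by (intro member_le_sum[of i]) auto
      also have "\<dots> \<le> 1 / real (Suc (r j))"
        using \<psi>(4)[of "r j"] by (simp add: \<phi>_def \<chi>'_def)
      also have "\<dots> \<le> 1 / real (Suc j)"
        using strict_mono_imp_increasing[OF r(1), of j] by (intro divide_left_mono) auto
      finally show "(cmod (wavefun (\<phi> j) (x i)))\<^sup>2 \<le> 1 / real (Suc j)" .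
    qed
    have "(\<lambda>j. sqrt (1 / real (Suc j))) \<longlonglongrightarrow> sqrt 0"
      by (intro tendsto_real_sqrt LIMSEQ_Suc[OF lim_1_over_n])
    then show "(\<lambda>j. wavefun (\<phi> j) (x i)) \<longlonglongrightarrow> 0"
      by (intro Lim_null_comparison[OF always_eventually[OF allI[OF le]]]) simp
  qed (use s\<xi> lim in auto)
  then have "x ` {1..k} \<subseteq> {y. wavefun \<xi> y = 0}"
    by auto
  then have "card (x ` {1..k}) \<le> card {y. wavefun \<xi> y = 0}"
    by (intro card_mono roots)
  then show False
    using roots(2) k card_image[OF inj] by simp
qed

section \<open>Soundness, completeness and the trace-distance estimate\<close>

section \<open>The witness threshold\<close>

lemma windows_borel [measurable]: "windows k x \<eta> \<in> sets borel"
  unfolding windows_def by (intro sets.finite_UN) auto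

text \<open>The vacuum has constant stellar function 1. It shows that the sets over which the infima
  are taken are nonempty.\<close>

lemma vacuum_stellar_states:
  assumes "0 \<le> E"
  shows "rank_one_proj (fock 0) \<in> stellar_states r E"
proof -
  have c: "cinner (fock n) (fock 0) = (if n = 0 then 1 else 0)" for n
    by (simp add: fock_orthonormal)
  have F: "stellar_fun (fock 0) \<alpha> = 1" for \<alpha>
  proof -
    have "(\<lambda>n. stellar_coeff (fock 0) n * \<alpha> ^ n) sums (\<Sum>n\<in>{0}. stellar_coeff (fock 0) n * \<alpha> ^ n)"
      by (rule sums_finite) (auto simp: stellar_coeff_def c)
    then show ?thesis
      using sums_unique2[OF stellar_fun_sums] by (simp add: stellar_coeff_def c)
  qed
  have "pure_stellar_rank (fock 0) = 0"
    by (simp add: pure_stellar_rank_def F zero_enat_def)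
  moreover have "is_mixture (rank_one_proj (fock 0)) (\<lambda>i. if i = 0 then 1 else 0) (\<lambda>_. fock 0)"
  proof -
    have "(\<lambda>i. (if i = (0 :: nat) then 1 else 0) *\<^sub>R rank_one_proj (fock 0)) sums (\<Sum>i\<in>{0}. (if i = (0 :: nat) then 1 else 0) *\<^sub>R rank_one_proj (fock 0))"
      by (rule sums_finite) auto
    moreover have "(\<lambda>i. if i = (0 :: nat) then 1 else 0 :: real) sums (\<Sum>i\<in>{0}. if i = (0 :: nat) then 1 else 0)"
      by (rule sums_finite) auto
    ultimately show ?thesis
      by (simp add: is_mixture_def)
  qed
  ultimately have "stellar_rank (rank_one_proj (fock 0)) \<le> enat 0"
    unfolding stellar_rank_def
    by (intro Inf_lower2[of "SUP i\<in>{i. 0 < (if i = (0 :: nat) then 1 else 0 :: real)}. pure_stellar_rank (fock 0)"])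
      (auto simp: zero_enat_def intro!: exI[of _ "\<lambda>i. if i = (0 :: nat) then 1 else 0 :: real"] exI[of _ "\<lambda>_ :: nat. fock 0"] SUP_least)
  then have "stellar_rank (rank_one_proj (fock 0)) \<le> enat r"
    by (rule order_trans) simp
  moreover have "mean_photon_number (fock 0) \<le> ennreal E"
    unfolding mean_photon_number_le_iff[OF assms] using assms by (auto simp: c intro!: sum_nonpos order_trans[OF _ assms])
  ultimately show ?thesis
    by (simp add: stellar_states_def rank_one_proj_energy_states assms)
qed

text \<open>A nonempty set of extended naturals contains its infimum, so some mixture attains the
  stellar rank; the empty set would have infimum \<infinity>.\<close>

lemma stellar_rank_le_imp_mixture:
  assumes "stellar_rank \<sigma> \<le> enat r"
  obtains p \<psi> where "is_mixture \<sigma> p \<psi>" "\<And>i. 0 < p i \<Longrightarrow> pure_stellar_rank (\<psi> i) \<le> enat r"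
proof -
  let ?S = "{(SUP i\<in>{i. 0 < p i}. pure_stellar_rank (\<psi> i)) | p \<psi>. is_mixture \<sigma> p \<psi>}"
  have "?S \<noteq> {}"
  proof
    assume "?S = {}"
    then have "stellar_rank \<sigma> = \<infinity>"
      unfolding stellar_rank_def by (simp only: Inf_empty top_enat_def)
    then show False using assms by simp
  qed
  then have "Inf ?S \<in> ?S"
    by (metis (no_types, lifting) LeastI_ex Inf_enat_def ex_in_conv)
  then obtain p \<psi> where p: "is_mixture \<sigma> p \<psi>" "stellar_rank \<sigma> = (SUP i\<in>{i. 0 < p i}. pure_stellar_rank (\<psi> i))"
    unfolding stellar_rank_def by blast
  show ?thesis
  proof (rule that[OF p(1)])
    fix i assume "0 < p i"
    then have "pure_stellar_rank (\<psi> i) \<le> (SUP i\<in>{i. 0 < p i}. pure_stellar_rank (\<psi> i))"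
      by (intro SUP_upper) simp
    then show "pure_stellar_rank (\<psi> i) \<le> enat r"
      using p(2) assms by simp
  qed
qed

lemma sum_ge_exists_ge:
  fixes f :: "nat \<Rightarrow> real"
  assumes "1 \<le> k" "c \<le> (\<Sum>i=1..k. f i)"
  obtains i where "i \<in> {1..k}" "c / real k \<le> f i"
proof (rule ccontr)
  assume "\<not> thesis"
  then have "\<And>i. i \<in> {1..k} \<Longrightarrow> f i < c / real k"
    using that by (meson not_less)
  then have "(\<Sum>i=1..k. f i) < (\<Sum>i=1..k. c / real k)"
    using assms(1) by (intro sum_strict_mono) auto
  then show False
    using assms by simp
qed

text \<open>At some x_i the squared modulus is at least c / k. The bound on \<eta> makes the Hoelder
  estimate at most c / (4k) across that window, so the modulus keeps at least half of sqrt (c / k)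
  there, and its square at least c / (4k).\<close>

lemma pure_window_lower_bound:
  assumes k: "1 \<le> k" and n: "norm \<psi> = 1" and en: "\<And>N. (\<Sum>n<N. energy_summand \<psi> n) \<le> E"
    and c: "c > 0" "c \<le> (\<Sum>i=1..k. (cmod (wavefun (rotation \<theta> \<psi>) (x i)))\<^sup>2)"
    and \<eta>: "\<eta> > 0" "4 * real k * (1 + E) * \<eta> \<le> c"
  shows "\<eta> * c / (4 * real k) \<le> (norm (quadrature_proj \<theta> (windows k x \<eta>) \<psi>))\<^sup>2"
proof -
  define u where "u = wavefun (rotation \<theta> \<psi>)"
  have s: "summable (sobolev_summand \<psi>)" "sobolev \<psi> \<le> 1 + E"
    using sobolev_of_energy[OF en] n by auto
  obtain i where i: "i \<in> {1..k}" "c / real k \<le> (cmod (u (x i)))\<^sup>2"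
    using sum_ge_exists_ge[OF k c(2)] unfolding u_def by blast
  have low: "c / (4 * real k) \<le> (cmod (u y))\<^sup>2" if y: "y \<in> {x i - \<eta> / 2 .. x i + \<eta> / 2}" for y
  proof -
    have "(cmod (u y - u (x i)))\<^sup>2 \<le> 2 * \<bar>y - x i\<bar> * sobolev (rotation \<theta> \<psi>)"
      unfolding u_def by (intro wavefun_bounds) (simp add: sobolev_summand_rotation s)
    also have "\<dots> \<le> 2 * (\<eta> / 2) * (1 + E)"
    proof (intro mult_mono)
      show "\<bar>y - x i\<bar> \<le> \<eta> / 2"
        using y unfolding atLeastAtMost_iff by linarith
      show "sobolev (rotation \<theta> \<psi>) \<le> 1 + E"
        using s by (simp add: sobolev_rotation)
      show "0 \<le> sobolev (rotation \<theta> \<psi>)"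
        unfolding sobolev_rotation unfolding sobolev_def by (intro suminf_nonneg s) simp
    qed (use \<eta> in auto)
    also have "\<dots> \<le> c / (4 * real k)"
      using \<eta> k by (simp add: field_simps)
    finally have d: "(cmod (u y - u (x i)))\<^sup>2 \<le> c / (4 * real k)" .
    define g where "g = sqrt (c / (4 * real k))"
    have g: "g \<ge> 0" "g\<^sup>2 = c / (4 * real k)"
      using c k by (simp_all add: g_def)
    have "cmod (u y - u (x i)) \<le> g"
      by (rule power2_le_imp_le[OF _ g(1)]) (simp only: g(2) d)
    moreover have "2 * g \<le> cmod (u (x i))"
    proof (rule power2_le_imp_le)
      have "(2 * g)\<^sup>2 = c / real k"
        using g k by (simp add: power_mult_distrib)
      then show "(2 * g)\<^sup>2 \<le> (cmod (u (x i)))\<^sup>2"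
        using i(2) by simp
    qed simp
    moreover have "cmod (u (x i)) \<le> cmod (u y) + cmod (u y - u (x i))"
      using norm_triangle_ineq4[of "u y" "u y - u (x i)"] by simp
    ultimately have "g \<le> cmod (u y)" by linarith
    then have "g\<^sup>2 \<le> (cmod (u y))\<^sup>2"
      using g by (intro power_mono)
    then show ?thesis by (simp add: g)
  qed
  have ui: "integrable lborel (\<lambda>y. (cmod (u y))\<^sup>2)"
    unfolding u_def by (rule norm_quadrature_proj_wavefun(2)[OF windows_borel s(1)])
  have "\<eta> * c / (4 * real k) = (LINT y|lborel. indicator {x i - \<eta> / 2 .. x i + \<eta> / 2} y * (c / (4 * real k)))"
    using \<eta>(1) by simp
  also have "\<dots> \<le> (LINT y|lborel. indicator (windows k x \<eta>) y * (cmod (u y))\<^sup>2)"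
  proof (rule integral_mono)
    show "integrable lborel (\<lambda>y. indicator {x i - \<eta> / 2 .. x i + \<eta> / 2} y * (c / (4 * real k)))"
      by (intro integrable_mult_left integrable_real_indicator) (use \<eta> in auto)
    show "integrable lborel (\<lambda>y. indicator (windows k x \<eta>) y * (cmod (u y))\<^sup>2)"
      using integrable_mult_indicator[OF _ ui, of "windows k x \<eta>"] by (simp add: windows_borel)
    show "indicator {x i - \<eta> / 2 .. x i + \<eta> / 2} y * (c / (4 * real k)) \<le> indicator (windows k x \<eta>) y * (cmod (u y))\<^sup>2" for y
      using low[of y] i(1) by (auto simp: indicator_def windows_def)
  qed
  also have "\<dots> = (norm (quadrature_proj \<theta> (windows k x \<eta>) \<psi>))\<^sup>2"
    unfolding u_def by (rule norm_quadrature_proj_wavefun(1)[OF windows_borel s(1), symmetric])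
  finally show ?thesis .
qed

text \<open>The cutoff 2E + 1 is positive also for E = 0 and satisfies E / (2E + 1) \<le> 1/2. This
  loses a factor 2 against the pure-state bound, whence 8 in place of 4.\<close>

lemma stellar_states_window_lower_bound:
  assumes k: "1 \<le> k" and E: "0 \<le> E" and \<sigma>: "\<sigma> \<in> stellar_states (k - 1) E"
    and c: "c > 0" "\<And>\<psi>. norm \<psi> = 1 \<Longrightarrow> (\<And>N. (\<Sum>n<N. energy_summand \<psi> n) \<le> 2 * E + 1) \<Longrightarrow> pure_stellar_rank \<psi> \<le> enat (k - 1) \<Longrightarrow>
      c \<le> (\<Sum>i=1..k. (cmod (wavefun (rotation \<theta> \<psi>) (x i)))\<^sup>2)"
    and \<eta>: "\<eta> > 0" "4 * real k * (2 * E + 2) * \<eta> \<le> c"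
  shows "\<eta> * c / (8 * real k) \<le> quadrature_prob \<sigma> \<theta> (windows k x \<eta>)"
proof -
  define W where "W = windows k x \<eta>"
  have W: "W \<in> sets borel"
    by (simp add: W_def windows_borel)
  have \<sigma>b: "bounded_state E \<sigma>"
    using \<sigma> E by (auto simp: stellar_states_def intro: energy_states_bounded)
  have "stellar_rank \<sigma> \<le> enat (k - 1)"
    using \<sigma> by (simp add: stellar_states_def)
  from stellar_rank_le_imp_mixture[OF this]
  obtain p \<psi> where p: "is_mixture \<sigma> p \<psi>" "\<And>i. 0 < p i \<Longrightarrow> pure_stellar_rank (\<psi> i) \<le> enat (k - 1)"
    by blast
  have p0: "0 \<le> p i" "norm (\<psi> i) = 1" for i
    using p(1) by (auto simp: is_mixture_def)
  define v where "v i = sqrt (p i) *\<^sub>R \<psi> i" for i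
  have v: "decomposes \<sigma> v"
    unfolding v_def[abs_def] by (rule mixture_decomposes[OF p(1)])
  note en = decomposes_energy[OF v \<sigma>b]
  have ev: "energy_summand (v i) n = p i * energy_summand (\<psi> i) n" for i n
    using p0[of i] by (simp add: v_def energy_summand_def cinner.scaleR_right power_mult_distrib)
  define C where "C = \<eta> * c / (4 * real k)"
  have C: "C > 0"
    using \<eta> c k by (simp add: C_def)
  \<comment> \<open>Markov's inequality in a form that can be summed over i. Above the cutoff the
    left side is nonpositive; below it the pure-state bound holds, and the energy term only lowers
    the left side.\<close>
  have low: "C * ((norm (v i))\<^sup>2 - (\<Sum>n. energy_summand (v i) n) / (2 * E + 1)) \<le> (norm (quadrature_proj \<theta> W (v i)))\<^sup>2" for i
  proof (cases "p i = 0")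
    case True
    then show ?thesis
      by (simp add: v_def ev True energy_summand_def[abs_def] cinner.zero_right)
  next
    case False
    then have pi: "p i > 0" using p0[of i] by simp
    have sm: "summable (energy_summand (\<psi> i))"
      using en(2)[of i] pi by (simp add: ev[abs_def])
    define e where "e = (\<Sum>n. energy_summand (\<psi> i) n)"
    have e0: "e \<ge> 0"
      unfolding e_def by (intro suminf_nonneg sm) simp
    have ee: "(\<Sum>n. energy_summand (v i) n) = p i * e"
      unfolding e_def ev by (rule suminf_mult[OF sm])
    obtain Q :: l2op where Q: "\<And>\<psi>. Q \<psi> = quadrature_proj \<theta> W \<psi>"
      using ex_quadrature_op[OF W] by blast
    have nQ: "(norm (quadrature_proj \<theta> W (v i)))\<^sup>2 = p i * (norm (quadrature_proj \<theta> W (\<psi> i)))\<^sup>2"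
      unfolding Q[symmetric] v_def using p0[of i] by (simp add: blinfun.scaleR_right power_mult_distrib)
    have "C * (1 - e / (2 * E + 1)) \<le> (norm (quadrature_proj \<theta> W (\<psi> i)))\<^sup>2"
    proof (cases "e \<le> 2 * E + 1")
      case True
      have b: "(\<Sum>n<N. energy_summand (\<psi> i) n) \<le> 2 * E + 1" for N
        using sum_le_suminf[OF sm, of "{..<N}"] True by (simp add: e_def)
      have "C \<le> (norm (quadrature_proj \<theta> W (\<psi> i)))\<^sup>2"
        unfolding C_def W_def
        by (rule pure_window_lower_bound[OF k p0(2) b c(1) c(2)[OF p0(2) b p(2)[OF pi]] \<eta>(1)]) (use \<eta>(2) in \<open>simp add: algebra_simps\<close>)
      moreover have "C * (1 - e / (2 * E + 1)) \<le> C * 1"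
        using C e0 E by (intro mult_left_mono) auto
      ultimately show ?thesis by simp
    next
      case False
      then have "1 - e / (2 * E + 1) \<le> 0"
        using E by (simp add: field_simps)
      then have "C * (1 - e / (2 * E + 1)) \<le> 0"
        using C by (simp add: mult_le_0_iff)
      then show ?thesis
        by (rule order_trans) simp
    qed
    then have "p i * (C * (1 - e / (2 * E + 1))) \<le> p i * (norm (quadrature_proj \<theta> W (\<psi> i)))\<^sup>2"
      using pi by (intro mult_left_mono) auto
    moreover have "(norm (v i))\<^sup>2 = p i"
      using p0[of i] by (simp add: v_def power_mult_distrib)
    ultimately show ?thesis
      unfolding nQ ee by (simp add: algebra_simps)
  qed
  have sQ: "summable (\<lambda>i. (norm (quadrature_proj \<theta> W (v i)))\<^sup>2)"
    by (rule summable_comparison_test'[OF sums_summable[OF en(1)], of 0]) (simp add: power_mono norm_quadrature_proj_le[OF W])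
  have "(\<lambda>i. C * ((norm (v i))\<^sup>2 - (\<Sum>n. energy_summand (v i) n) / (2 * E + 1))) sums (C * (1 - (\<Sum>i. \<Sum>n. energy_summand (v i) n) / (2 * E + 1)))"
    by (intro sums_mult sums_diff sums_divide en summable_sums)
  then have h1: "C * (1 - (\<Sum>i. \<Sum>n. energy_summand (v i) n) / (2 * E + 1)) \<le> quadrature_prob \<sigma> \<theta> W"
    unfolding quadrature_prob_decomposes[OF v W] by (rule sums_le[OF low _ summable_sums[OF sQ]])
  have h2: "C * (1 / 2) \<le> C * (1 - (\<Sum>i. \<Sum>n. energy_summand (v i) n) / (2 * E + 1))"
  proof (rule mult_left_mono)
    have "(\<Sum>i. \<Sum>n. energy_summand (v i) n) / (2 * E + 1) \<le> E / (2 * E + 1)"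
      using en(4) E by (intro divide_right_mono) auto
    also have "\<dots> \<le> 1 / 2"
      using E by (simp add: field_simps)
    finally show "1 / 2 \<le> 1 - (\<Sum>i. \<Sum>n. energy_summand (v i) n) / (2 * E + 1)"
      by simp
  qed (use C in simp)
  have "\<eta> * c / (8 * real k) = C * (1 / 2)"
    by (simp add: C_def)
  then show ?thesis
    using order_trans[OF h2 h1] by (simp only: W_def)
qed

text \<open>The windows may overlap, so the indicator of their union is dominated by the sum of k
  indicators, each of integral \<eta>.\<close>

lemma window_prob_upper_bound:
  assumes \<rho>: "bounded_state E \<rho>" and \<eta>: "\<eta> > 0"
    and b: "\<And>i y. i \<in> {1..k} \<Longrightarrow> \<bar>y - x i\<bar> \<le> \<eta> / 2 \<Longrightarrow> quadrature_density \<rho> \<theta> y \<le> \<epsilon>"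
  shows "quadrature_prob \<rho> \<theta> (windows k x \<eta>) \<le> real k * \<eta> * \<epsilon>"
proof -
  note q = quadrature_density_properties[OF \<rho>, where \<theta> = \<theta>]
  have "quadrature_prob \<rho> \<theta> (windows k x \<eta>) = (LINT y|lborel. indicator (windows k x \<eta>) y * quadrature_density \<rho> \<theta> y)"
    using q(4)[OF windows_borel] by (simp add: set_lebesgue_integral_def)
  also have "\<dots> \<le> (LINT y|lborel. (\<Sum>i=1..k. indicator {x i - \<eta> / 2 .. x i + \<eta> / 2} y * \<epsilon>))"
  proof (rule integral_mono)
    show "integrable lborel (\<lambda>y. indicator (windows k x \<eta>) y * quadrature_density \<rho> \<theta> y)"
      using integrable_mult_indicator[OF _ q(3), of "windows k x \<eta>"] by (simp add: windows_borel)
    show "integrable lborel (\<lambda>y. \<Sum>i=1..k. indicator {x i - \<eta> / 2 .. x i + \<eta> / 2} y * \<epsilon>)"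
      by (intro Bochner_Integration.integrable_sum integrable_mult_left integrable_real_indicator) (use \<eta> in auto)
    fix y
    show "indicator (windows k x \<eta>) y * quadrature_density \<rho> \<theta> y \<le> (\<Sum>i=1..k. indicator {x i - \<eta> / 2 .. x i + \<eta> / 2} y * \<epsilon>)"
    proof (cases "y \<in> windows k x \<eta>")
      case True
      then obtain i where i: "i \<in> {1..k}" "y \<in> {x i - \<eta> / 2 .. x i + \<eta> / 2}"
        by (auto simp: windows_def)
      have "quadrature_density \<rho> \<theta> y \<le> \<epsilon>"
        by (rule b[OF i(1)]) (use i(2) in \<open>unfold atLeastAtMost_iff, linarith\<close>)
      moreover have "0 \<le> \<epsilon>"
        using calculation q(2)[of y] by linarith
      moreover have "indicator {x i - \<eta> / 2 .. x i + \<eta> / 2} y * \<epsilon> \<le> (\<Sum>i=1..k. indicator {x i - \<eta> / 2 .. x i + \<eta> / 2} y * \<epsilon>)"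
        using i(1) \<open>0 \<le> \<epsilon>\<close> by (intro member_le_sum) auto
      ultimately show ?thesis
        using True i(2) by simp
    next
      case False
      have "indicator {x i - \<eta> / 2 .. x i + \<eta> / 2} y = (0 :: real)" if "i \<in> {1..k}" for i
        using False that by (auto simp: windows_def indicator_def)
      then have s0: "(\<Sum>i=1..k. indicator {x i - \<eta> / 2 .. x i + \<eta> / 2} y * \<epsilon>) = 0"
        by (intro sum.neutral) auto
      show ?thesis
        unfolding s0 using False by simp
    qed
  qed
  also have "\<dots> = (\<Sum>i=1..k. LINT y|lborel. indicator {x i - \<eta> / 2 .. x i + \<eta> / 2} y * \<epsilon>)"
    by (intro Bochner_Integration.integral_sum integrable_mult_left integrable_real_indicator) (use \<eta> in auto)
  also have "\<dots> = real k * \<eta> * \<epsilon>"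
    using \<eta> by simp
  finally show ?thesis .
qed

theorem mainTheorem5:
  fixes k :: nat and E \<theta> :: real and \<rho> :: l2op and x :: "nat \<Rightarrow> real"
  assumes "1 \<le> k" and "0 \<le> E" and "0 \<le> \<theta>" and "\<theta> < 2 * pi"
    and "\<rho> \<in> energy_states E"
    and "inj_on x {1..k}"
    and "\<forall>i\<in>{1..k}. quadrature_density \<rho> \<theta> (x i) = 0"
  shows "(\<exists>\<eta>>0. 0 < threshold k E \<theta> x \<eta> \<and>
            quadrature_prob \<rho> \<theta> (windows k x \<eta>) < threshold k E \<theta> x \<eta>) \<and>
         (\<forall>\<eta>>0. \<forall>\<tau>\<in>stellar_states k E.
            threshold k E \<theta> x \<eta> - quadrature_prob \<tau> \<theta> (windows k x \<eta>)
              \<le> (INF \<sigma>\<in>stellar_states (k - 1) E. trace_distance \<tau> \<sigma>))"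
proof (intro conjI allI impI ballI)
  \<comment> \<open>Infima of real sets are only meaningful for nonempty sets; the vacuum belongs to
    this one.\<close>
  have ne: "stellar_states (k - 1) E \<noteq> {}"
    using vacuum_stellar_states[OF assms(2)] by blast
  have bs: "bounded_state E \<sigma>" if "\<sigma> \<in> stellar_states r E" for \<sigma> r
    using that assms(2) by (auto simp: stellar_states_def intro: energy_states_bounded)
  show "\<exists>\<eta>>0. 0 < threshold k E \<theta> x \<eta> \<and> quadrature_prob \<rho> \<theta> (windows k x \<eta>) < threshold k E \<theta> x \<eta>"
  proof -
    have \<rho>: "bounded_state E \<rho>"
      by (rule energy_states_bounded[OF assms(5,2)])
    obtain c where c: "c > 0"
      "\<And>\<psi>. norm \<psi> = 1 \<Longrightarrow> (\<And>N. (\<Sum>n<N. energy_summand \<psi> n) \<le> 2 * E + 1) \<Longrightarrow> pure_stellar_rank \<psi> \<le> enat (k - 1) \<Longrightarrow>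
        c \<le> (\<Sum>i=1..k. (cmod (wavefun (rotation \<theta> \<psi>) (x i)))\<^sup>2)"
      using finite_rank_wavefun_lower_bound[OF assms(1,6), of "2 * E + 1" \<theta>] by metis
    \<comment> \<open>Chosen so that the upper bound k \<eta> \<epsilon> for \<rho> equals \<eta> c
      / (16 k), half of the lower bound for the threshold.\<close>
    define \<epsilon> where "\<epsilon> = c / (16 * (real k)\<^sup>2)"
    have \<epsilon>: "\<epsilon> > 0"
      using c(1) assms(1) by (simp add: \<epsilon>_def)
    have "\<exists>d>0. \<forall>y. \<bar>y - x i\<bar> < d \<longrightarrow> quadrature_density \<rho> \<theta> y < \<epsilon>" if "i \<in> {1..k}" for i
    proof -
      have "isCont (quadrature_density \<rho> \<theta>) (x i)"
        using quadrature_density_properties(1)[OF \<rho>, of \<theta>] by (simp add: continuous_on_eq_continuous_at)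
      then obtain d where "d > 0" "\<And>y. \<bar>y - x i\<bar> < d \<Longrightarrow> \<bar>quadrature_density \<rho> \<theta> y - quadrature_density \<rho> \<theta> (x i)\<bar> < \<epsilon>"
        using \<epsilon> unfolding continuous_at_eps_delta dist_real_def by metis
      then show ?thesis
        using assms(7) that by (intro exI[of _ d]) force
    qed
    then obtain d where d: "\<And>i. i \<in> {1..k} \<Longrightarrow> d i > 0"
      "\<And>i y. i \<in> {1..k} \<Longrightarrow> \<bar>y - x i\<bar> < d i \<Longrightarrow> quadrature_density \<rho> \<theta> y < \<epsilon>"
      by metis
    define \<delta> where "\<delta> = Min (d ` {1..k})"
    have \<delta>: "\<delta> > 0" "\<And>i. i \<in> {1..k} \<Longrightarrow> \<delta> \<le> d i"
      using d(1) assms(1) by (auto simp: \<delta>_def)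
    \<comment> \<open>The first bound keeps every window inside the neighbourhood where the density
      of \<rho> is below \<epsilon>. The second is what the soundness estimate asks for: 2E + 2
      bounds \<open>sobolev\<close> of a unit vector of energy at most 2E + 1.\<close>
    define \<eta> where "\<eta> = min \<delta> (c / (4 * real k * (2 * E + 2)))"
    have \<eta>: "\<eta> > 0" "4 * real k * (2 * E + 2) * \<eta> \<le> c"
    proof -
      have pos: "4 * real k * (2 * E + 2) > 0"
        using assms(1,2) by simp
      then show "\<eta> > 0"
        using \<delta>(1) c(1) by (simp add: \<eta>_def)
      have "4 * real k * (2 * E + 2) * \<eta> \<le> 4 * real k * (2 * E + 2) * (c / (4 * real k * (2 * E + 2)))"
        using pos by (intro mult_left_mono) (auto simp: \<eta>_def)
      also have "\<dots> = c"
        using pos by (simp only: times_divide_eq_right nonzero_mult_div_cancel_left[OF less_imp_neq[OF pos, symmetric]])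
      finally show "4 * real k * (2 * E + 2) * \<eta> \<le> c" .
    qed
    have thr: "\<eta> * c / (8 * real k) \<le> threshold k E \<theta> x \<eta>"
      unfolding threshold_def
      by (rule cINF_greatest[OF ne], rule stellar_states_window_lower_bound[OF assms(1,2) _ c \<eta>])
    have "quadrature_prob \<rho> \<theta> (windows k x \<eta>) \<le> real k * \<eta> * \<epsilon>"
    proof (rule window_prob_upper_bound[OF \<rho> \<eta>(1)])
      fix i y assume i: "i \<in> {1..k}" "\<bar>y - x i\<bar> \<le> \<eta> / 2"
      have "\<eta> \<le> \<delta>"
        by (simp add: \<eta>_def)
      then have "\<eta> / 2 < d i"
        using \<eta>(1) \<delta>(2)[OF i(1)] by linarith
      then show "quadrature_density \<rho> \<theta> y \<le> \<epsilon>"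
        using d(2)[OF i(1), of y] i(2) by simp
    qed
    also have "\<dots> = \<eta> * c / (16 * real k)"
      using assms(1) by (simp add: \<epsilon>_def power2_eq_square)
    also have "\<dots> < \<eta> * c / (8 * real k)"
      using \<eta>(1) c(1) assms(1) by (simp add: field_simps)
    finally have "quadrature_prob \<rho> \<theta> (windows k x \<eta>) < threshold k E \<theta> x \<eta>"
      using thr by linarith
    moreover have "0 < \<eta> * c / (8 * real k)"
      using \<eta>(1) c(1) assms(1) by simp
    ultimately show ?thesis
      using \<eta>(1) thr by (intro exI[of _ \<eta>]) auto
  qed
  fix \<eta> :: real and \<tau>
  assume \<eta>: "0 < \<eta>" and \<tau>: "\<tau> \<in> stellar_states k E"
  show "threshold k E \<theta> x \<eta> - quadrature_prob \<tau> \<theta> (windows k x \<eta>) \<le> (INF \<sigma>\<in>stellar_states (k - 1) E. trace_distance \<tau> \<sigma>)"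
  proof (rule cINF_greatest[OF ne])
    fix \<sigma> assume \<sigma>: "\<sigma> \<in> stellar_states (k - 1) E"
    have "threshold k E \<theta> x \<eta> \<le> quadrature_prob \<sigma> \<theta> (windows k x \<eta>)"
      unfolding threshold_def
    proof (rule cINF_lower[OF _ \<sigma>])
      show "bdd_below ((\<lambda>\<sigma>. quadrature_prob \<sigma> \<theta> (windows k x \<eta>)) ` stellar_states (k - 1) E)"
        by (rule bdd_belowI2[of _ 0]) (rule quadrature_prob_nonneg[OF bs windows_borel])
    qed
    then show "threshold k E \<theta> x \<eta> - quadrature_prob \<tau> \<theta> (windows k x \<eta>) \<le> trace_distance \<tau> \<sigma>"
      using quadrature_prob_diff_le_trace_distance[OF bs[OF \<sigma>] bs[OF \<tau>] windows_borel, of \<theta> k x \<eta>] by linarith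
  qed
qed

end
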